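(* Let $d \geq 3$ be an integer. Then for all sufficiently large $N$, the number of combinatorially distinct $2$-LC $d$-quasimanifolds with $N$ facets is smaller than $2^{\frac{d^3}{2}N}$.
   Context: A simplicial regular CW-complex is a finite regular CW-complex such that for every proper face $F$ the interval $[\emptyset,F]$ in its face poset is Boolean. A $d$-pseudomanifold is a finite simplicial regular CW-complex that is pure $d$-dimensional and in which each $(d-1)$-cell lies in at most two $d$-cells; boundary $(d-1)$-faces are those in exactly one $d$-cell. A tree of $d$-simplices is a simplicial complex triangulating the $d$-ball whose dual graph is a tree. A $2$-LC gluing in a $d$-pseudomanifold identifies (via a simplicial homeomorphism) two boundary $(d-1)$-faces whose intersection has dimension at least $d-3$; the glued faces become interior. For a $(d-3)$-face $\sigma$ of a pseudomanifold $K$, the link $\mathrm{link}(\sigma,K)$ is a $2$-dimensional complex whose boundary edges correspond to the boundary $(d-1)$-faces of $K$ containing $\sigma$, and a $2$-LC gluing of two boundary faces containing $\sigma$ corresponds to identifying two boundary edges of $\mathrm{link}(\sigma,K)$. A $2$-LC $d$-quasimanifold is any $d$-pseudomanifold obtainable from a tree of $d$-simplices by a sequence of $2$-LC gluings each of which is: (1) orientable with respect to the involved links of $(d-3)$-faces (the edge identification in these links preserves their orientability); (2) planar with respect to the involved links of $(d-3)$-faces (the identifications of boundary edges in each such link are non-crossing, i.e. compatible with the link eventually being a $2$-sphere); (3) impacting only the boundaries of the links of $(d-3)$-faces (no identification is forced among interior edges or interior vertices of such links); and (4) not forcing any identification between two distinct connected components of the boundary of the link of a $(d-3)$-face; moreover,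 any two $(d-1)$-faces that share an interior edge of the link of a $(d-3)$-face are required to be glued together. Facets are the $d$-faces; combinatorially distinct means having non-isomorphic face posets. *)

theory Defs
  imports "HOL-Analysis.Analysis"
begin

section \<open>Regular CW-complexes\<close>

definition disk :: "nat \<Rightarrow> (nat \<Rightarrow> real) topology" where
  "disk n = subtopology (Euclidean_space n) {x. (\<Sum>i<n. (x i)\<^sup>2) \<le> 1}"

definition disk_boundary :: "nat \<Rightarrow> (nat \<Rightarrow> real) set" where
  "disk_boundary n = {x \<in> topspace (disk n). (\<Sum>i<n. (x i)\<^sup>2) = 1}"

text \<open>
  A finite regular CW-complex is given by a Hausdorff space together with its finite family of
  \<^emph>\<open>closed\<close> cells: closed balls whose interiors partition the space and whose boundary spheres are
  unions of cells. As the interiors are disjoint, the cells lying in the boundary of \<open>\<sigma>\<close> are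
  exactly the cells properly contained in \<open>\<sigma>\<close>. The empty face is not listed among the cells.
\<close>

record 'a cell_complex =
  cspace :: "'a topology"
  cells :: "'a set set"

definition cell_boundary :: "'a cell_complex \<Rightarrow> 'a set \<Rightarrow> 'a set" where
  "cell_boundary K \<sigma> = \<Union>{\<tau> \<in> cells K. \<tau> \<subset> \<sigma>}"

definition regular_cw :: "'a cell_complex \<Rightarrow> bool" where
  "regular_cw K \<longleftrightarrow>
     Hausdorff_space (cspace K) \<and> finite (cells K) \<and> topspace (cspace K) = \<Union>(cells K) \<and>
     (\<forall>\<sigma>\<in>cells K. \<exists>n h. homeomorphic_map (disk n) (subtopology (cspace K) \<sigma>) h \<and>
                         h ` disk_boundary n = cell_boundary K \<sigma>) \<and>
     (\<forall>\<sigma>\<in>cells K. \<forall>\<tau>\<in>cells K. \<sigma> \<noteq> \<tau> \<longrightarrow>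
         (\<sigma> - cell_boundary K \<sigma>) \<inter> (\<tau> - cell_boundary K \<tau>) = {})"

definition dim_cells :: "'a cell_complex \<Rightarrow> nat \<Rightarrow> 'a set set" where
  "dim_cells K n = {\<sigma> \<in> cells K. subtopology (cspace K) \<sigma> homeomorphic_space disk n}"

text \<open>Face posets are families of sets ordered by inclusion, the empty face being \<open>{}\<close>.\<close>

definition face_poset :: "'a cell_complex \<Rightarrow> 'a set set" where
  "face_poset K = insert {} (cells K)"

definition poset_iso :: "'a set set \<Rightarrow> 'b set set \<Rightarrow> bool" where
  "poset_iso A B \<longleftrightarrow>
     (\<exists>f. bij_betw f A B \<and> (\<forall>x\<in>A. \<forall>y\<in>A. x \<subseteq> y \<longleftrightarrow> f x \<subseteq> f y))"

definition comb_equiv :: "('a cell_complex \<times> 'a cell_complex) set" where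
  "comb_equiv = {(K, L). poset_iso (face_poset K) (face_poset L)}"

definition simplicial_cw :: "'a cell_complex \<Rightarrow> bool" where
  "simplicial_cw K \<longleftrightarrow> regular_cw K \<and>
     (\<forall>\<sigma>\<in>cells K. \<exists>V :: nat set. finite V \<and> poset_iso {\<tau> \<in> face_poset K. \<tau> \<subseteq> \<sigma>} (Pow V))"


section \<open>Pseudomanifolds and trees of simplices\<close>

definition pure_dim :: "nat \<Rightarrow> 'a cell_complex \<Rightarrow> bool" where
  "pure_dim d K \<longleftrightarrow> cells K \<noteq> {} \<and> (\<forall>\<sigma>\<in>cells K. \<exists>D\<in>dim_cells K d. \<sigma> \<subseteq> D)"

definition pseudomanifold :: "nat \<Rightarrow> 'a cell_complex \<Rightarrow> bool" where
  "pseudomanifold d K \<longleftrightarrow> simplicial_cw K \<and> pure_dim d K \<and>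
     (\<forall>F\<in>dim_cells K (d - 1). card {D \<in> dim_cells K d. F \<subseteq> D} \<le> 2)"

definition boundary_faces :: "nat \<Rightarrow> 'a cell_complex \<Rightarrow> 'a set set" where
  "boundary_faces d K = {F \<in> dim_cells K (d - 1). card {D \<in> dim_cells K d. F \<subseteq> D} = 1}"

definition tree_graph :: "'v set \<Rightarrow> ('v \<times> 'v) set \<Rightarrow> bool" where
  "tree_graph V E \<longleftrightarrow> V \<noteq> {} \<and>
     (\<forall>u\<in>V. \<forall>v\<in>V. (u, v) \<in> (Restr E V)\<^sup>*) \<and>
     \<not> (\<exists>vs. 3 \<le> length vs \<and> distinct vs \<and> set vs \<subseteq> V \<and>
             (\<forall>i<length vs. (vs ! i, vs ! (Suc i mod length vs)) \<in> E))"

definition dual_edges :: "nat \<Rightarrow> 'a cell_complex \<Rightarrow> ('a set \<times> 'a set) set" where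
  "dual_edges d K = {(D, D'). D \<in> dim_cells K d \<and> D' \<in> dim_cells K d \<and> D \<noteq> D' \<and>
                              (\<exists>F\<in>dim_cells K (d - 1). F \<subseteq> D \<and> F \<subseteq> D')}"

text \<open>
  A simplicial CW-complex is a simplicial complex iff any two faces meet in a single (possibly
  empty) face.
\<close>

definition simplicial_complex :: "'a cell_complex \<Rightarrow> bool" where
  "simplicial_complex K \<longleftrightarrow> simplicial_cw K \<and>
     (\<forall>\<sigma>\<in>cells K. \<forall>\<tau>\<in>cells K. \<sigma> \<inter> \<tau> \<in> face_poset K)"

definition tree_of_simplices :: "nat \<Rightarrow> 'a cell_complex \<Rightarrow> bool" where
  "tree_of_simplices d K \<longleftrightarrow> simplicial_complex K \<and> cspace K homeomorphic_space disk d \<and>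
     tree_graph (dim_cells K d) (dual_edges d K)"


section \<open>Links of codimension-three faces\<close>

text \<open>
  The link of \<open>\<sigma>\<close> is the complex whose face poset consists of the faces containing \<open>\<sigma>\<close>, with
  \<open>\<sigma>\<close> itself as the empty face. If \<open>dim \<sigma> = d - 3\<close>, its vertices, edges and triangles are the
  faces of dimension \<open>d - 2\<close>, \<open>d - 1\<close> and \<open>d\<close> that contain \<open>\<sigma>\<close>.
\<close>

definition link_poset :: "'a cell_complex \<Rightarrow> 'a set \<Rightarrow> 'a set set" where
  "link_poset K \<sigma> = {\<rho> \<in> cells K. \<sigma> \<subseteq> \<rho>}"

text \<open>
  A face \<open>\<rho>\<close> of the link stands for the face of \<open>\<rho>\<close> opposite to \<open>\<sigma>\<close>, that is the largest face of
  \<open>\<rho>\<close> disjoint from \<open>\<sigma>\<close>. For simplicial complexes this is an isomorphism onto the usual link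
  \<open>{\<tau>. \<tau> \<inter> \<sigma> = {} \<and> \<tau> \<union> \<sigma> \<in> K}\<close>; in a simplicial CW-complex several faces containing \<open>\<sigma>\<close> may
  have the same opposite face.
\<close>

definition opposite :: "'a cell_complex \<Rightarrow> 'a set \<Rightarrow> 'a set \<Rightarrow> 'a set" where
  "opposite K \<sigma> \<rho> = \<Union>{\<tau> \<in> cells K. \<tau> \<subseteq> \<rho> \<and> \<tau> \<inter> \<sigma> = {}}"

definition link_vertices :: "nat \<Rightarrow> 'a cell_complex \<Rightarrow> 'a set \<Rightarrow> 'a set set" where
  "link_vertices d K \<sigma> = link_poset K \<sigma> \<inter> dim_cells K (d - 2)"

definition link_edges :: "nat \<Rightarrow> 'a cell_complex \<Rightarrow> 'a set \<Rightarrow> 'a set set" where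
  "link_edges d K \<sigma> = link_poset K \<sigma> \<inter> dim_cells K (d - 1)"

definition link_triangles :: "nat \<Rightarrow> 'a cell_complex \<Rightarrow> 'a set \<Rightarrow> 'a set set" where
  "link_triangles d K \<sigma> = link_poset K \<sigma> \<inter> dim_cells K d"

definition link_boundary :: "nat \<Rightarrow> 'a cell_complex \<Rightarrow> 'a set \<Rightarrow> 'a set set" where
  "link_boundary d K \<sigma> =
     {\<rho> \<in> link_vertices d K \<sigma> \<union> link_edges d K \<sigma>. \<exists>G\<in>boundary_faces d K. \<rho> \<subseteq> G}"

definition same_boundary_component ::
  "nat \<Rightarrow> 'a cell_complex \<Rightarrow> 'a set \<Rightarrow> 'a set \<Rightarrow> 'a set \<Rightarrow> bool" where
  "same_boundary_component d K \<sigma> \<rho> \<rho>' \<longleftrightarrow>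
     (\<rho>, \<rho>') \<in> {(\<alpha>, \<beta>). \<alpha> \<in> link_boundary d K \<sigma> \<and> \<beta> \<in> link_boundary d K \<sigma> \<and>
                        (\<alpha> \<subseteq> \<beta> \<or> \<beta> \<subseteq> \<alpha>)}\<^sup>*"

text \<open>
  An orientation assigns to each triangle of the link one of the two cyclic orders of its
  vertices, recorded as a set of directed edges; it is coherent if two triangles with a common
  edge induce opposite directions on that edge.
\<close>

definition orientable_link :: "nat \<Rightarrow> 'a cell_complex \<Rightarrow> 'a set \<Rightarrow> bool" where
  "orientable_link d K \<sigma> \<longleftrightarrow> (\<exists>ori :: 'a set \<Rightarrow> ('a set \<times> 'a set) set.
     (\<forall>D\<in>link_triangles d K \<sigma>. \<exists>a b c.
         distinct [a, b, c] \<and> {\<rho> \<in> link_vertices d K \<sigma>. \<rho> \<subseteq> D} = {a, b, c} \<and>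
         ori D = {(a, b), (b, c), (c, a)}) \<and>
     (\<forall>G\<in>link_edges d K \<sigma>. \<forall>D\<in>link_triangles d K \<sigma>. \<forall>D'\<in>link_triangles d K \<sigma>.
         D \<noteq> D' \<and> G \<subseteq> D \<and> G \<subseteq> D' \<longrightarrow>
         (\<forall>a\<in>link_vertices d K \<sigma>. \<forall>b\<in>link_vertices d K \<sigma>.
             a \<noteq> b \<and> a \<subseteq> G \<and> b \<subseteq> G \<longrightarrow> ((a, b) \<in> ori D \<longleftrightarrow> (b, a) \<in> ori D'))))"

text \<open>
  Planar: the link is realised by a cell complex lying in the 2-sphere. Starting from a disk, an
  orientable identification of two boundary edges keeps the link planar exactly if it does not
  cross the previous ones.
\<close>

definition planar_link :: "'a cell_complex \<Rightarrow> 'a set \<Rightarrow> bool" where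
  "planar_link K \<sigma> \<longleftrightarrow> (\<exists>L :: (nat \<Rightarrow> real) cell_complex.
     regular_cw L \<and> cspace L = subtopology (nsphere 2) (\<Union>(cells L)) \<and>
     poset_iso (face_poset L) (link_poset K \<sigma>))"


section \<open>2-LC gluings and 2-LC quasimanifolds\<close>

definition simplicial_homeo ::
  "'a cell_complex \<Rightarrow> 'a set \<Rightarrow> 'a set \<Rightarrow> ('a \<Rightarrow> 'a) \<Rightarrow> bool" where
  "simplicial_homeo K F F' h \<longleftrightarrow>
     homeomorphic_map (subtopology (cspace K) F) (subtopology (cspace K) F') h \<and>
     (\<lambda>\<tau>. h ` \<tau>) ` {\<tau> \<in> cells K. \<tau> \<subseteq> F} = {\<tau> \<in> cells K. \<tau> \<subseteq> F'}"

text \<open>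
  \<open>K'\<close> arises from \<open>K\<close> by identifying each point \<open>x\<close> of \<open>F\<close> with \<open>h x\<close> in \<open>F'\<close>; \<open>q\<close> is the
  quotient map.
\<close>

definition gluing ::
  "'a cell_complex \<Rightarrow> 'a cell_complex \<Rightarrow> 'a set \<Rightarrow> 'a set \<Rightarrow> ('a \<Rightarrow> 'a) \<Rightarrow> ('a \<Rightarrow> 'a) \<Rightarrow> bool" where
  "gluing K K' F F' h q \<longleftrightarrow> simplicial_homeo K F F' h \<and>
     quotient_map (cspace K) (cspace K') q \<and>
     (\<forall>x\<in>topspace (cspace K). \<forall>y\<in>topspace (cspace K).
         q x = q y \<longleftrightarrow> (x, y) \<in> ({(x, h x) |x. x \<in> F} \<union> {(h x, x) |x. x \<in> F})\<^sup>*) \<and>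
     cells K' = (\<lambda>\<sigma>. q ` \<sigma>) ` cells K"

definition two_LC_gluing :: "nat \<Rightarrow> 'a cell_complex \<Rightarrow> 'a cell_complex \<Rightarrow> ('a \<Rightarrow> 'a) \<Rightarrow> bool" where
  "two_LC_gluing d K K' q \<longleftrightarrow> (\<exists>F\<in>boundary_faces d K. \<exists>F'\<in>boundary_faces d K. \<exists>h.
     F \<noteq> F' \<and> (\<exists>k\<ge>d - 3. \<exists>\<sigma>\<in>dim_cells K k. \<sigma> \<subseteq> F \<inter> F') \<and> gluing K K' F F' h q)"

text \<open>
  Two distinct faces of the link of \<open>\<sigma>\<close> are identified by \<open>q\<close> if they become the same face of the
  new complex, or if this is forced on the faces opposite to \<open>\<sigma>\<close> they stand for (possibly by a
  gluing of two faces that do not contain \<open>\<sigma>\<close>).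
\<close>

definition link_identified ::
  "'a cell_complex \<Rightarrow> ('a \<Rightarrow> 'a) \<Rightarrow> 'a set \<Rightarrow> 'a set \<Rightarrow> 'a set \<Rightarrow> bool" where
  "link_identified K q \<sigma> \<rho> \<rho>' \<longleftrightarrow> \<rho> \<noteq> \<rho>' \<and>
     (q ` \<rho> = q ` \<rho>' \<or>
      opposite K \<sigma> \<rho> \<noteq> opposite K \<sigma> \<rho>' \<and> q ` opposite K \<sigma> \<rho> = q ` opposite K \<sigma> \<rho>')"

definition orientable_gluing :: "nat \<Rightarrow> 'a cell_complex \<Rightarrow> bool" where
  "orientable_gluing d K' \<longleftrightarrow> (\<forall>\<sigma>\<in>dim_cells K' (d - 3). orientable_link d K' \<sigma>)"

definition planar_gluing :: "nat \<Rightarrow> 'a cell_complex \<Rightarrow> bool" where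
  "planar_gluing d K' \<longleftrightarrow> (\<forall>\<sigma>\<in>dim_cells K' (d - 3). planar_link K' \<sigma>)"

definition impacts_only_link_boundaries :: "nat \<Rightarrow> 'a cell_complex \<Rightarrow> ('a \<Rightarrow> 'a) \<Rightarrow> bool" where
  "impacts_only_link_boundaries d K q \<longleftrightarrow>
     (\<forall>\<sigma>\<in>dim_cells K (d - 3).
      \<forall>\<rho>\<in>link_vertices d K \<sigma> \<union> link_edges d K \<sigma>. \<forall>\<rho>'\<in>link_vertices d K \<sigma> \<union> link_edges d K \<sigma>.
        link_identified K q \<sigma> \<rho> \<rho>' \<longrightarrow> \<rho> \<in> link_boundary d K \<sigma> \<and> \<rho>' \<in> link_boundary d K \<sigma>)"

definition respects_boundary_components :: "nat \<Rightarrow> 'a cell_complex \<Rightarrow> ('a \<Rightarrow> 'a) \<Rightarrow> bool" where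
  "respects_boundary_components d K q \<longleftrightarrow>
     (\<forall>\<sigma>\<in>dim_cells K (d - 3). \<forall>\<rho>\<in>link_boundary d K \<sigma>. \<forall>\<rho>'\<in>link_boundary d K \<sigma>.
        link_identified K q \<sigma> \<rho> \<rho>' \<longrightarrow> same_boundary_component d K \<sigma> \<rho> \<rho>')"

text \<open>
  Two \<open>(d - 1)\<close>-faces share an edge \<open>e\<close> of the link of \<open>\<sigma>\<close> if \<open>e\<close> is opposite to \<open>\<sigma>\<close> in both, and
  \<open>e\<close> is interior if it lies in two triangles opposite to \<open>\<sigma>\<close>. In the final complex, having been
  glued together means being equal.
\<close>

definition shared_interior_edges_glued :: "nat \<Rightarrow> 'a cell_complex \<Rightarrow> bool" where
  "shared_interior_edges_glued d K \<longleftrightarrow>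
     (\<forall>\<sigma>\<in>dim_cells K (d - 3). \<forall>G\<in>link_edges d K \<sigma>. \<forall>G'\<in>link_edges d K \<sigma>.
        opposite K \<sigma> G = opposite K \<sigma> G' \<and>
        (\<exists>D\<in>link_triangles d K \<sigma>. \<exists>D'\<in>link_triangles d K \<sigma>.
            opposite K \<sigma> D \<noteq> opposite K \<sigma> D' \<and>
            opposite K \<sigma> G \<subseteq> opposite K \<sigma> D \<and> opposite K \<sigma> G \<subseteq> opposite K \<sigma> D')
        \<longrightarrow> G = G')"

inductive obtainable :: "nat \<Rightarrow> 'a cell_complex \<Rightarrow> bool" for d where
  tree: "tree_of_simplices d K \<Longrightarrow> obtainable d K"
| glue: "\<lbrakk>obtainable d K; pseudomanifold d K; two_LC_gluing d K K' q; pseudomanifold d K';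
          orientable_gluing d K'; planar_gluing d K';
          impacts_only_link_boundaries d K q; respects_boundary_components d K q\<rbrakk>
         \<Longrightarrow> obtainable d K'"

definition two_LC_quasimanifold :: "nat \<Rightarrow> 'a cell_complex \<Rightarrow> bool" where
  "two_LC_quasimanifold d K \<longleftrightarrow>
     pseudomanifold d K \<and> obtainable d K \<and> shared_interior_edges_glued d K"

text \<open>
  The points of the complexes are taken from a type \<open>'a\<close>. Up to homeomorphism every finite regular
  CW-complex occurs as soon as \<open>'a\<close> has at least the cardinality of the continuum, for example
  for \<open>nat \<Rightarrow> real\<close>.
\<close>

definition quasimanifold_classes :: "nat \<Rightarrow> nat \<Rightarrow> 'a cell_complex set set" where
  "quasimanifold_classes d N =
     {K. two_LC_quasimanifold d K \<and> card (dim_cells K d) = N} // comb_equiv"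

end

theory Submission
  imports Defs "HOL-Homology.Homology" "HOL-Combinatorics.Permutations"
begin

text \<open>
  The facets of the tree of simplices are named by words over \<open>{0..d}\<close>: the letter \<open>c\<close> crosses the
  ridge opposite to the vertex of colour \<open>c\<close>. A \<^emph>\<open>flag\<close> is a facet together with an ordering of its
  vertices; its last \<open>d - 2\<close> entries span a face of codimension three, its first three entries a
  triangle in the link of that face. All these triangles form one system of polygons, a gluing of
  two ridges pairs their edges, and the number of boundary cycles of the system measures the
  defect from being planar. Orientability and the condition on boundary components say that a
  gluing only pairs edges of the same boundary cycle, so the pairing stays planar. Planarity does
  not depend on the order of the gluings. The edge pairs can therefore be rediscovered one at a
  time, and for a given set of glued edges there are exponentially few noncrossing pairings, as
  for Catalan numbers. The gluing of two ridges sharing a face of codimension three is known as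
  soon as one of its edge pairs is, so it suffices to name for every boundary ridge of the tree at
  most one of \<open>d!/2\<close> flags and to pair the named flags. This yields at most
  \<open>(1 + 12 \<cdot> d!/2)\<close> to the power \<open>(d - 1)N + 2\<close> outcomes for each of the at most \<open>3 \<cdot> 2\<^sup>d\<^sup>N\<close> trees.
\<close>

section \<open>Cycles of permutations and planar pairings\<close>

text \<open>One gluing pairs edges in many polygons at once and may merge boundary systems that were
  unrelated before, so noncrossing pairings cannot be counted polygon by polygon. Instead the
  outcomes are explored: forced pairs, those of the tree included, are inserted singly, and a gluing
  is revealed only once its named edges lie in one component. Just after a merger the revealable
  chords run between the two arcs of the merged cycle. Each state is bounded by a potential, the
  product of \<open>phi\<close> over boundary cycles and of \<open>theta\<close> over components:
  \<open>phi\<close> is supermultiplicative and survives splits, \<open>theta\<close> pays for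
  mergers. Initially a polygon is both a cycle and a component, and \<open>phi n * theta n\<close>
  is at most \<open>12 ^ n\<close>. The 12 is critical: for d = 3 the final comparison is 37 ^ 4 * 2
  ^ 6 < 2 ^ 27 with 37 = 1 + 12 * 3, and no larger integer would pass. Topology is needed for two
  facts: the dimension of a cell can be read off its Boolean interval, and in a ball the facets
  around a face are linked through ridges containing it, so a tree of simplices has no
  identifications beyond those of its tree edges.\<close>

definition cyc :: "('h => 'h) => 'h list => bool" where
  "cyc \<pi> l \<longleftrightarrow> l ~= [] & distinct l & map \<pi> l = rotate1 l"

lemma cyc_rotate: "cyc \<pi> l ==> cyc \<pi> (rotate n l)"
  unfolding cyc_def
  by (metis distinct_rotate rotate1_rotate_swap rotate_is_Nil_conv rotate_map)

lemma cyc_start: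
  assumes "cyc \<pi> l" "h \<in> set l"
  obtains A where "cyc \<pi> (h # A)" "set (h # A) = set l" "length (h # A) = length l"
proof -
  obtain n where n: "n < length l" "l ! n = h" using assms(2) by (auto simp: in_set_conv_nth)
  have "rotate n l ~= []" "hd (rotate n l) = h"
    using n hd_rotate_conv_nth[of l n] by (cases l; auto)+
  then obtain A where A: "rotate n l = h # A" by (cases "rotate n l") auto
  have "set (h # A) = set l" "length (h # A) = length l"
    by (metis A set_rotate, metis A length_rotate)
  with cyc_rotate[OF assms(1), of n] A that show ?thesis by simp
qed

lemma cyc_Cons_iff: "cyc \<pi> (h # A) \<longleftrightarrow> distinct (h # A) & map \<pi> (h # A) = A @ [h]"
  by (simp add: cyc_def)

lemma cyc_image: "cyc \<pi> l ==> \<pi> ` set l = set l"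
  unfolding cyc_def by (metis set_map set_rotate1)

lemma cyc_disjoint:
  assumes "cyc \<pi> l" "cyc \<pi> m" "h \<in> set l" "h \<in> set m"
  shows "set l = set m"
proof -
  have *: "set m \<subseteq> set l" if l: "cyc \<pi> l" and m: "cyc \<pi> m" and hl: "h \<in> set l" and hm: "h \<in> set m" for l m
  proof -
    from cyc_start[OF m hm] obtain A where A: "cyc \<pi> (h # A)" "set (h # A) = set m" by metis
    have "(h # A) ! n \<in> set l" if "n < length (h # A)" for n
      using that
    proof (induction n)
      case (Suc n)
      have "\<pi> ((h # A) ! n) = map \<pi> (h # A) ! n" using Suc by (metis Suc_lessD nth_map)
      also have "\<dots> = (A @ [h]) ! n" using A(1) cyc_Cons_iff by metis
      also have "\<dots> = (h # A) ! Suc n" using Suc.prems by (simp add: nth_append)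
      finally show ?case using Suc cyc_image[OF l] by (metis Suc_lessD imageI)
    qed (use hl in simp)
    then show ?thesis using A(2) by (metis in_set_conv_nth subsetI)
  qed
  show ?thesis using * assms by blast
qed

lemma cyc_exists:
  assumes fin: "finite H" and bij: "bij_betw \<pi> H H" and h: "h \<in> H"
  obtains A where "cyc \<pi> (h # A)" "set (h # A) \<subseteq> H"
proof -
  have inH: "(\<pi> ^^ n) h \<in> H" for n
    by (induction n) (use h bij in \<open>auto simp: bij_betw_def\<close>)
  have "\<not> inj_on (%n. (\<pi> ^^ n) h) (UNIV :: nat set)"
    by (metis finite_imageD fin finite_subset image_subsetI inH infinite_UNIV_nat)
  then obtain a b where ab: "a ~= b" "(\<pi> ^^ a) h = (\<pi> ^^ b) h"
    by (auto simp: inj_on_def)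
  obtain i j :: nat where "i < j" "(\<pi> ^^ i) h = (\<pi> ^^ j) h"
  proof (cases "a < b")
    case True then show ?thesis using that ab(2) by blast
  next
    case False then show ?thesis using that[of b a] ab by simp
  qed
  then have "\<exists>k>0. (\<pi> ^^ k) h = h"
  proof (induction i arbitrary: j)
    case (Suc i)
    then obtain j' where j: "j = Suc j'" by (metis not0_implies_Suc not_less_zero)
    have "\<pi> ((\<pi> ^^ i) h) = \<pi> ((\<pi> ^^ j') h)" using Suc.prems(2) j by simp
    then have "(\<pi> ^^ i) h = (\<pi> ^^ j') h" using inH bij by (meson bij_betw_def inj_on_def)
    then show ?case using Suc.IH[of j'] Suc.prems(1) j by simp
  qed auto
  then obtain k0 where "k0 > 0 & (\<pi> ^^ k0) h = h" by blast
  define k where "k = (LEAST k. k > 0 & (\<pi> ^^ k) h = h)"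
  have k: "k > 0" "(\<pi> ^^ k) h = h"
    using LeastI[of "%k. k > 0 & (\<pi> ^^ k) h = h", OF \<open>k0 > 0 & _\<close>] unfolding k_def by auto
  have kmin: "(\<pi> ^^ m) h ~= h" if "0 < m" "m < k" for m
    using not_less_Least[of m "%k. k > 0 & (\<pi> ^^ k) h = h"] that unfolding k_def by auto
  have inj: "(\<pi> ^^ i) h ~= (\<pi> ^^ j) h" if "i < j" "j < k" for i j
    using that
  proof (induction i arbitrary: j)
    case 0 then show ?case using kmin[of j] by (metis funpow_0)
  next
    case (Suc i)
    then obtain j' where j: "j = Suc j'" by (metis not0_implies_Suc not_less_zero)
    have "(\<pi> ^^ i) h ~= (\<pi> ^^ j') h" using Suc j by simp
    then have "\<pi> ((\<pi> ^^ i) h) ~= \<pi> ((\<pi> ^^ j') h)"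
      using inj_onD[of \<pi> H "(\<pi> ^^ i) h" "(\<pi> ^^ j') h"] inH bij unfolding bij_betw_def by blast
    then show ?case using j by simp
  qed
  define l where "l = map (%n. (\<pi> ^^ n) h) [0..<k]"
  have "l ~= []" using k by (simp add: l_def)
  moreover have "distinct l"
  proof -
    have "inj_on (%n. (\<pi> ^^ n) h) {0..<k}"
    proof (rule inj_onI)
      fix i j assume "i \<in> {0..<k}" "j \<in> {0..<k}" "(\<pi> ^^ i) h = (\<pi> ^^ j) h"
      then show "i = j" using inj[of i j] inj[of j i] by (cases i j rule: linorder_cases) auto
    qed
    then show ?thesis by (simp add: l_def distinct_map)
  qed
  moreover have "map \<pi> l = rotate1 l"
  proof (rule nth_equalityI)
    fix i assume "i < length (map \<pi> l)"
    then have i: "i < k" by (simp add: l_def)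
    show "map \<pi> l ! i = rotate1 l ! i"
    proof (cases "Suc i < k")
      case True
      then show ?thesis using i by (simp add: l_def nth_rotate1)
    next
      case False
      then have "Suc i = k" using i by simp
      then show ?thesis using i k by (simp add: l_def nth_rotate1) (metis funpow.simps(2) o_apply)
    qed
  qed simp
  ultimately have "cyc \<pi> l" by (simp add: cyc_def)
  moreover have "h \<in> set l" using k by (force simp: l_def intro!: image_eqI[of _ _ 0])
  moreover have "set l \<subseteq> H" using inH by (auto simp: l_def)
  ultimately show ?thesis using cyc_start that by metis
qed

text \<open>Composing a permutation with the transposition of two points fuses their cycles if these
  differ; \<open>cyc_split\<close> is the opposite case. This is the effect of pairing two edges on
  the boundary components.\<close>

lemma cyc_join:
  assumes "cyc \<pi> (u # A)" "cyc \<pi> (v # B)" "set (u # A) \<inter> set (v # B) = {}"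
  shows "cyc (\<pi>(u := \<pi> v, v := \<pi> u)) (u # B @ v # A)"
proof -
  have 1: "map (\<pi>(u := \<pi> v, v := \<pi> u)) A = map \<pi> A" "map (\<pi>(u := \<pi> v, v := \<pi> u)) B = map \<pi> B"
    using assms by (auto simp: cyc_Cons_iff)
  have "u ~= v" using assms by auto
  show ?thesis
    using assms 1 \<open>u ~= v\<close> unfolding cyc_Cons_iff
    by (cases A; cases B) auto
qed

lemma cyc_split:
  assumes "cyc \<pi> (u # A @ v # B)"
  shows "cyc (\<pi>(u := \<pi> v, v := \<pi> u)) (u # B)" "cyc (\<pi>(u := \<pi> v, v := \<pi> u)) (v # A)"
proof -
  have 1: "map (\<pi>(u := \<pi> v, v := \<pi> u)) A = map \<pi> A" "map (\<pi>(u := \<pi> v, v := \<pi> u)) B = map \<pi> B"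
    using assms by (auto simp: cyc_Cons_iff)
  have "u ~= v" using assms by (auto simp: cyc_Cons_iff)
  have 2: "map \<pi> (u # A @ v # B) = (A @ v # B) @ [u]" "distinct (u # A @ v # B)"
    using assms by (simp_all only: cyc_Cons_iff)
  have 3: "map \<pi> (u # A) = A @ [v]"
  proof -
    have "map \<pi> (u # A) = take (Suc (length A)) (map \<pi> (u # A @ v # B))" by simp
    also have "\<dots> = A @ [v]" unfolding 2 by simp
    finally show ?thesis .
  qed
  have 4: "map \<pi> (v # B) = B @ [u]"
  proof -
    have "map \<pi> (v # B) = drop (Suc (length A)) (map \<pi> (u # A @ v # B))" by simp
    also have "\<dots> = B @ [u]" unfolding 2 by simp
    finally show ?thesis .
  qed
  show "cyc (\<pi>(u := \<pi> v, v := \<pi> u)) (u # B)" "cyc (\<pi>(u := \<pi> v, v := \<pi> u)) (v # A)"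
    using 1 2(2) 3 4 \<open>u ~= v\<close> unfolding cyc_Cons_iff by (cases A; cases B; auto)+
qed

definition cycles_on :: "'h set => ('h => 'h) => 'h set set" where
  "cycles_on H \<pi> = {set l |l. cyc \<pi> l & set l \<subseteq> H}"

lemma cycles_on_disjoint: "c \<in> cycles_on H \<pi> ==> c' \<in> cycles_on H \<pi> ==> h \<in> c ==> h \<in> c' ==> c = c'"
  unfolding cycles_on_def using cyc_disjoint by fast

lemma finite_cycles_on: "finite H ==> finite (cycles_on H \<pi>)"
  unfolding cycles_on_def by (rule finite_subset[of _ "Pow H"]) auto

lemma cycles_on_nonempty: "c \<in> cycles_on H \<pi> ==> c ~= {}"
  by (auto simp: cycles_on_def cyc_def)

lemma cycles_on_cover:
  "finite H ==> bij_betw \<pi> H H ==> h \<in> H ==> \<exists>c\<in>cycles_on H \<pi>. h \<in> c"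
  unfolding cycles_on_def using cyc_exists by (metis (mono_tags, lifting) list.set_intros(1) mem_Collect_eq)

lemma cyc_cong: "cyc \<pi> l ==> (!!x. x \<in> set l ==> \<pi>' x = \<pi> x) ==> cyc \<pi>' l"
  unfolding cyc_def by (metis map_eq_conv)

text \<open>Distinct cycles are disjoint and nonempty, so a family of cycles covering
  \<open>H\<close> leaves no room for a further one.\<close>

lemma cycles_on_partition_eq:
  assumes "C \<subseteq> cycles_on H \<pi>" "\<Union>C = H"
  shows "cycles_on H \<pi> = C"
proof (rule ccontr)
  assume "cycles_on H \<pi> ~= C"
  then obtain c where c: "c \<in> cycles_on H \<pi>" "c ~: C" using assms by blast
  obtain h where "h \<in> c" using cycles_on_nonempty[OF c(1)] by blast
  moreover have "c \<subseteq> H" using c(1) by (auto simp: cycles_on_def)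
  ultimately obtain c' where "c' \<in> C" "h \<in> c'" using assms(2) by blast
  then have "c = c'" using cycles_on_disjoint[OF c(1) _ \<open>h \<in> c\<close>, of c'] assms(1) by blast
  then show False using c \<open>c' \<in> C\<close> by blast
qed

lemma cycles_on_Union: "finite H ==> bij_betw \<pi> H H ==> \<Union>(cycles_on H \<pi>) = H"
  using cycles_on_cover by (fastforce simp: cycles_on_def)

lemma cycles_on_join:
  assumes H: "finite H" "bij_betw \<pi> H H"
    and l: "cyc \<pi> (u # A)" "cyc \<pi> (v # B)" "set (u # A) ~= set (v # B)"
    and sub: "set (u # A) \<subseteq> H" "set (v # B) \<subseteq> H"
  shows "cycles_on H (\<pi>(u := \<pi> v, v := \<pi> u)) =
           insert (set (u # B @ v # A)) (cycles_on H \<pi> - {set (u # A), set (v # B)})"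
proof (rule cycles_on_partition_eq)
  have dis: "set (u # A) \<inter> set (v # B) = {}"
    using cyc_disjoint[OF l(1,2)] l(3) by blast
  have "c \<in> cycles_on H (\<pi>(u := \<pi> v, v := \<pi> u))"
    if c: "c \<in> cycles_on H \<pi> - {set (u # A), set (v # B)}" for c
  proof -
    obtain m where m: "c = set m" "cyc \<pi> m" "set m \<subseteq> H" using c by (auto simp: cycles_on_def)
    have "u ~: set m" "v ~: set m"
      using c m cyc_disjoint[OF m(2) l(1), of u] cyc_disjoint[OF m(2) l(2), of v] by auto
    then have "cyc (\<pi>(u := \<pi> v, v := \<pi> u)) m" by (intro cyc_cong[OF m(2)]) auto
    then show ?thesis using m unfolding cycles_on_def by blast
  qed
  moreover have "set (u # B @ v # A) \<in> cycles_on H (\<pi>(u := \<pi> v, v := \<pi> u))"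
    using cyc_join[OF l(1,2) dis] sub unfolding cycles_on_def by (intro CollectI exI conjI) auto
  ultimately show "insert (set (u # B @ v # A)) (cycles_on H \<pi> - {set (u # A), set (v # B)})
      \<subseteq> cycles_on H (\<pi>(u := \<pi> v, v := \<pi> u))" by blast
  show "\<Union>(insert (set (u # B @ v # A)) (cycles_on H \<pi> - {set (u # A), set (v # B)})) = H"
    using cycles_on_Union[OF H] sub by auto
qed

lemma cycles_on_split:
  assumes H: "finite H" "bij_betw \<pi> H H"
    and l: "cyc \<pi> (u # A @ v # B)" and sub: "set (u # A @ v # B) \<subseteq> H"
  shows "cycles_on H (\<pi>(u := \<pi> v, v := \<pi> u)) =
           {set (u # B), set (v # A)} \<union> (cycles_on H \<pi> - {set (u # A @ v # B)})"
proof (rule cycles_on_partition_eq)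
  have "c \<in> cycles_on H (\<pi>(u := \<pi> v, v := \<pi> u))"
    if c: "c \<in> cycles_on H \<pi> - {set (u # A @ v # B)}" for c
  proof -
    obtain m where m: "c = set m" "cyc \<pi> m" "set m \<subseteq> H" using c by (auto simp: cycles_on_def)
    have "u ~: set m" "v ~: set m"
      using c m l cyc_disjoint[OF m(2) l] by auto
    then have "cyc (\<pi>(u := \<pi> v, v := \<pi> u)) m" by (intro cyc_cong[OF m(2)]) auto
    then show ?thesis using m unfolding cycles_on_def by blast
  qed
  moreover have "set (u # B) \<in> cycles_on H (\<pi>(u := \<pi> v, v := \<pi> u))"
      "set (v # A) \<in> cycles_on H (\<pi>(u := \<pi> v, v := \<pi> u))"
    using cyc_split[OF l] sub unfolding cycles_on_def
    by (intro CollectI exI[of _ "u # B"], simp) (intro CollectI exI[of _ "v # A"], use cyc_split[OF l] sub in simp)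
  ultimately show "{set (u # B), set (v # A)} \<union> (cycles_on H \<pi> - {set (u # A @ v # B)})
      \<subseteq> cycles_on H (\<pi>(u := \<pi> v, v := \<pi> u))" by blast
  show "\<Union>({set (u # B), set (v # A)} \<union> (cycles_on H \<pi> - {set (u # A @ v # B)})) = H"
    using cycles_on_Union[OF H] sub by auto
qed

section \<open>Edge pairings, boundary cycles and genus\<close>

definition matching :: "'h set => ('h \<times> 'h) set => bool" where
  "matching H E \<longleftrightarrow> E \<subseteq> H \<times> H & sym E & single_valued E & (\<forall>h. (h, h) ~: E)"

lemma matching_subset: "matching H E ==> E' \<subseteq> E ==> sym E' ==> matching H E'"
  unfolding matching_def by (meson single_valued_subset subset_eq)

definition mate :: "('h \<times> 'h) set => 'h => 'h" where
  "mate E h = (if h \<in> Domain E then THE k. (h, k) \<in> E else h)"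

lemma mate_eq: "single_valued E ==> (h, k) \<in> E ==> mate E h = k"
  unfolding mate_def by (auto intro!: the_equality dest: single_valuedD)

lemma mate_notin: "h ~: Domain E ==> mate E h = h"
  by (simp add: mate_def)

definition pair :: "'h => 'h => ('h \<times> 'h) set" where
  "pair u v = {(u, v), (v, u)}"

lemma sym_pair: "sym (pair u v)" by (auto simp: pair_def sym_def)

lemma matching_new:
  assumes "matching H F" "E \<subseteq> F" "sym E" "(u, v) \<in> F" "(u, v) ~: E"
  shows "u ~= v" "u ~: Domain E" "v ~: Domain E" "u \<in> H" "v \<in> H"
    "matching H (E \<union> pair u v)" "E \<union> pair u v \<subseteq> F" "sym (E \<union> pair u v)"
proof -
  have sv: "single_valued F" "sym F" "F \<subseteq> H \<times> H" "!!h. (h, h) ~: F"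
    using assms(1) by (auto simp: matching_def)
  have vu: "(v, u) \<in> F" using sv(2) assms(4) by (auto dest: symD)
  show "u ~= v" using sv(4) assms(4) by auto
  show "u ~: Domain E"
    using single_valuedD[OF sv(1) assms(4)] assms(2,5) by blast
  show "v ~: Domain E"
    using single_valuedD[OF sv(1) vu] assms(2,3,5) by (blast dest: symD)
  show "u \<in> H" "v \<in> H" using sv(3) assms(4) by auto
  show *: "E \<union> pair u v \<subseteq> F" using assms(2,4) vu by (auto simp: pair_def)
  show s: "sym (E \<union> pair u v)" using assms(3) sym_pair by (rule sym_Un)
  show "matching H (E \<union> pair u v)" using assms(1) * s by (rule matching_subset)
qed

locale half_edges =
  fixes H :: "'h set" and nxt :: "'h => 'h"
  assumes finite_H: "finite H" and bij_nxt: "bij_betw nxt H H"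
begin

text \<open>
  Glueing polygons along pairs of edges: \<open>nxt\<close> runs around the polygons, and the cycles of
  \<open>perm E\<close> are the boundary components after the pairs in \<open>E\<close> have been identified, with the glued
  edges still listed.
\<close>

definition perm :: "('h \<times> 'h) set => 'h => 'h" where
  "perm E h = nxt (mate E h)"

definition nx :: "('h \<times> 'h) set" where "nx = {(h, nxt h) |h. h \<in> H}"

definition conn :: "('h \<times> 'h) set => ('h \<times> 'h) set" where
  "conn E = (nx \<union> nx\<inverse> \<union> E)\<^sup>*"

definition comps :: "('h \<times> 'h) set => 'h set set" where
  "comps E = (%h. conn E `` {h}) ` H"

definition cycles :: "('h \<times> 'h) set => 'h set set" where
  "cycles E = cycles_on H (perm E)"

definition same_cycle :: "('h \<times> 'h) set => 'h => 'h => bool" where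
  "same_cycle E u v \<longleftrightarrow> (\<exists>c\<in>cycles E. u \<in> c & v \<in> c)"

lemma nx_sub: "nx \<subseteq> H \<times> H"
  using bij_nxt by (auto simp: nx_def bij_betw_def)

lemma conn_refl [simp]: "(h, h) \<in> conn E" by (simp add: conn_def)

lemma conn_trans: "(a, b) \<in> conn E ==> (b, c) \<in> conn E ==> (a, c) \<in> conn E"
  unfolding conn_def by (rule rtrancl_trans)

lemma conn_sym: "sym E ==> (a, b) \<in> conn E ==> (b, a) \<in> conn E"
  unfolding conn_def
  by (meson symD sym_Un sym_Un_converse sym_rtrancl)

lemma conn_mono: "E \<subseteq> E' ==> conn E \<subseteq> conn E'"
  unfolding conn_def by (intro rtrancl_mono) auto

lemma conn_edge: "(a, b) \<in> E ==> (a, b) \<in> conn E"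
  by (auto simp: conn_def)

lemma conn_nxt: "h \<in> H ==> (h, nxt h) \<in> conn E"
  by (auto simp: conn_def nx_def)

lemma conn_in_H: "(a, b) \<in> conn E ==> E \<subseteq> H \<times> H ==> a \<in> H ==> b \<in> H"
  unfolding conn_def by (induction rule: rtrancl_induct) (use nx_sub in auto)

lemma mate_in: "matching H E ==> h \<in> H ==> mate E h \<in> H"
proof (cases "h \<in> Domain E")
  case True
  assume m: "matching H E" and "h \<in> H"
  from True obtain k where k: "(h, k) \<in> E" by auto
  then have "mate E h = k" using m by (intro mate_eq) (auto simp: matching_def)
  then show ?thesis using k m by (auto simp: matching_def)
qed (simp add: mate_notin)

lemma mate_mate: "matching H E ==> mate E (mate E h) = h"
proof (cases "h \<in> Domain E")
  case True
  assume m: "matching H E"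
  from True obtain k where k: "(h, k) \<in> E" by auto
  then have "mate E h = k" "(k, h) \<in> E" using m mate_eq by (auto simp: matching_def dest: symD)
  then show ?thesis using m mate_eq by (metis matching_def)
qed (simp add: mate_notin)

lemma bij_perm: "matching H E ==> bij_betw (perm E) H H"
proof -
  assume m: "matching H E"
  have "bij_betw (mate E) H H"
    by (rule bij_betw_byWitness[of _ "mate E"]) (use mate_mate[OF m] mate_in[OF m] in auto)
  then have "bij_betw (nxt \<circ> mate E) H H" using bij_nxt by (rule bij_betw_trans)
  moreover have "perm E = nxt \<circ> mate E" by (auto simp: perm_def)
  ultimately show ?thesis by simp
qed

lemma perm_insert:
  assumes "matching H (E \<union> pair u v)" "u ~= v" "u ~: Domain E" "v ~: Domain E"
  shows "perm (E \<union> pair u v) = (perm E)(u := perm E v, v := perm E u)"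
proof -
  have sv: "single_valued (E \<union> pair u v)" using assms(1) by (simp add: matching_def)
  have "mate (E \<union> pair u v) h = (if h = u then v else if h = v then u else mate E h)" for h
  proof -
    have "mate (E \<union> pair u v) h = mate E h" if "h ~= u" "h ~= v"
      unfolding mate_def using that by (auto simp: pair_def)
    moreover have "mate (E \<union> pair u v) u = v" "mate (E \<union> pair u v) v = u"
      by (rule mate_eq[OF sv], simp add: pair_def)+
    ultimately show ?thesis by simp
  qed
  then show ?thesis using assms by (auto simp: perm_def fun_eq_iff mate_notin)
qed

lemma conn_perm: "matching H E ==> h \<in> H ==> (h, perm E h) \<in> conn E"
proof -
  assume m: "matching H E" and h: "h \<in> H"
  have "(h, mate E h) \<in> conn E"
  proof (cases "h \<in> Domain E")
    case True
    then obtain k where "(h, k) \<in> E" by auto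
    then show ?thesis using m mate_eq conn_edge by (metis matching_def)
  qed (simp add: mate_notin)
  then show ?thesis using conn_nxt[OF mate_in[OF m h]] conn_trans unfolding perm_def by blast
qed

lemma cycle_conn:
  assumes m: "matching H E" and c: "c \<in> cycles E" and ab: "a \<in> c" "b \<in> c"
  shows "(a, b) \<in> conn E"
proof -
  obtain l where l: "c = set l" "cyc (perm E) l" "set l \<subseteq> H"
    using c by (auto simp: cycles_def cycles_on_def)
  obtain A where A: "cyc (perm E) (a # A)" "set (a # A) = set l"
    using cyc_start[OF l(2), of a] ab(1) l(1) by auto
  have mp: "map (perm E) (a # A) = A @ [a]" using A(1) by (simp only: cyc_Cons_iff)
  have "(a, (a # A) ! n) \<in> conn E" if "n < length (a # A)" for n
    using that
  proof (induction n)
    case (Suc n)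
    have "perm E ((a # A) ! n) = map (perm E) (a # A) ! n" using Suc.prems by (simp del: list.map)
    also have "\<dots> = (A @ [a]) ! n" by (simp only: mp)
    also have "\<dots> = (a # A) ! Suc n" using Suc.prems by (simp add: nth_append)
    finally have 1: "perm E ((a # A) ! n) = (a # A) ! Suc n" .
    have "(a # A) ! n \<in> set (a # A)" using Suc.prems by (intro nth_mem) simp
    then have "(a # A) ! n \<in> H" using A(2) l(3) by blast
    then show ?case using conn_perm[OF m] 1 conn_trans Suc by (metis Suc_lessD)
  qed simp
  moreover have "b \<in> set (a # A)" using ab(2) l(1) A(2) by simp
  ultimately show ?thesis by (metis in_set_conv_nth)
qed

lemma same_cycle_conn: "matching H E ==> same_cycle E u v ==> (u, v) \<in> conn E"
  unfolding same_cycle_def using cycle_conn by blast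

lemma comps_disjoint:
  assumes "sym E" "C \<in> comps E" "D \<in> comps E" "h \<in> C" "h \<in> D"
  shows "C = D"
proof -
  obtain a b where ab: "C = conn E `` {a}" "D = conn E `` {b}" using assms(2,3) by (auto simp: comps_def)
  then have "(a, h) \<in> conn E" "(b, h) \<in> conn E" using assms(4,5) by auto
  then have "(a, b) \<in> conn E" "(b, a) \<in> conn E" using conn_sym[OF assms(1)] conn_trans by blast+
  then show ?thesis using ab conn_trans by auto
qed

lemma finite_comps: "finite (comps E)" by (simp add: comps_def finite_H)

lemma conn_insert_conn:
  assumes "sym E" "(u, v) \<in> conn E"
  shows "conn (E \<union> pair u v) = conn E"
proof
  have "(nx \<union> nx\<inverse> \<union> (E \<union> pair u v)) \<subseteq> conn E"
    using assms conn_sym[OF assms] by (auto simp: conn_def pair_def)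
  then show "conn (E \<union> pair u v) \<subseteq> conn E"
    by (metis conn_def rtrancl_idemp rtrancl_mono)
qed (rule conn_mono, simp)

text \<open>A path can be shortened until it crosses the new pair at most once.\<close>

lemma conn_insert_iff:
  assumes E: "sym E"
  shows "(a, b) \<in> conn (E \<union> pair u v) \<longleftrightarrow>
    (a, b) \<in> conn E \<or> (a, u) \<in> conn E & (v, b) \<in> conn E \<or> (a, v) \<in> conn E & (u, b) \<in> conn E"
    (is "_ \<longleftrightarrow> ?R a b")
proof
  assume "(a, b) \<in> conn (E \<union> pair u v)"
  then show "?R a b"
    unfolding conn_def[of "E \<union> _"]
  proof (induction rule: rtrancl_induct)
    case (step y z)
    have "(y, z) \<in> conn E \<or> (y = u & z = v) \<or> (y = v & z = u)"
      using step(2) by (auto simp: conn_def pair_def)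
    then show ?case
    proof (elim disjE conjE)
      assume "(y, z) \<in> conn E"
      then show ?thesis using step.IH conn_trans by blast
    next
      assume "y = u" "z = v"
      then show ?thesis using step.IH by auto
    next
      assume "y = v" "z = u"
      then show ?thesis using step.IH by auto
    qed
  qed simp
next
  have m: "conn E \<subseteq> conn (E \<union> pair u v)" by (rule conn_mono) simp
  have "(u, v) \<in> conn (E \<union> pair u v)" "(v, u) \<in> conn (E \<union> pair u v)"
    by (rule conn_edge, simp add: pair_def)+
  then have "(x, y) \<in> conn E ==> (y, z) \<in> conn (E \<union> pair u v) ==> (x, z) \<in> conn (E \<union> pair u v)"
      "(v, z) \<in> conn E ==> (u, z) \<in> conn (E \<union> pair u v)"
      "(u, z) \<in> conn E ==> (v, z) \<in> conn (E \<union> pair u v)" for x y z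
    using subsetD[OF m] conn_trans[of _ _ "E \<union> pair u v"] by blast+
  then show "?R a b ==> (a, b) \<in> conn (E \<union> pair u v)" using subsetD[OF m] by (elim disjE conjE) simp_all
qed

lemma conn_class:
  assumes "sym E" "(a, b) \<in> conn E"
  shows "conn E `` {a} = conn E `` {b}"
proof -
  have "(b, a) \<in> conn E" using conn_sym[OF assms] .
  then show ?thesis using assms(2) by (auto intro: conn_trans)
qed

lemma comps_join:
  assumes E: "sym E" and uv: "u \<in> H" "v \<in> H" "(u, v) ~: conn E"
  defines "C \<equiv> conn E `` {u}" and "D \<equiv> conn E `` {v}"
  shows "comps (E \<union> pair u v) = insert (C \<union> D) (comps E - {C, D})" "C ~= D" "C \<inter> D = {}"
    "C \<in> comps E" "D \<in> comps E" "C \<union> D ~: comps E"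
proof -
  show CD: "C \<in> comps E" "D \<in> comps E" using uv by (auto simp: C_def D_def comps_def)
  have in_CD: "u \<in> C" "v \<in> D" by (auto simp: C_def D_def)
  show ne: "C ~= D"
  proof
    assume "C = D"
    then have "v \<in> conn E `` {u}" using in_CD(2) by (simp only: C_def)
    then show False using uv(3) by simp
  qed
  show dis: "C \<inter> D = {}"
  proof (rule ccontr)
    assume "C \<inter> D ~= {}"
    then obtain h where h: "h \<in> C" "h \<in> D" by auto
    show False using comps_disjoint[OF E CD h] ne by simp
  qed
  show "C \<union> D ~: comps E"
  proof
    assume CDc: "C \<union> D \<in> comps E"
    have "C \<union> D = C" by (rule comps_disjoint[OF E CDc CD(1), of u]) (use in_CD in auto)
    moreover have "C \<union> D = D" by (rule comps_disjoint[OF E CDc CD(2), of v]) (use in_CD in auto)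
    ultimately show False using ne by blast
  qed
  have iff: "(h, u) \<in> conn E \<longleftrightarrow> h \<in> C" "(h, v) \<in> conn E \<longleftrightarrow> h \<in> D" for h
    using conn_sym[OF E] by (auto simp: C_def D_def)
  have 1: "conn (E \<union> pair u v) `` {h} = (if h \<in> C \<union> D then C \<union> D else conn E `` {h})" for h
  proof -
    have "conn (E \<union> pair u v) `` {h} =
        conn E `` {h} \<union> (if h \<in> C then D else {}) \<union> (if h \<in> D then C else {})"
      using conn_insert_iff[OF E, of h _ u v] iff[of h] by (auto simp: C_def D_def)
    moreover have "h \<in> C ==> conn E `` {h} = C"
      using conn_class[OF E, of u h] by (simp add: C_def)
    moreover have "h \<in> D ==> conn E `` {h} = D"
      using conn_class[OF E, of v h] by (simp add: D_def)
    ultimately show ?thesis using dis by auto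
  qed
  have cl: "conn E `` {h} = conn E `` {a} \<longleftrightarrow> h \<in> conn E `` {a}" for h a
  proof
    assume "conn E `` {h} = conn E `` {a}"
    moreover have "h \<in> conn E `` {h}" by simp
    ultimately show "h \<in> conn E `` {a}" by simp
  next
    assume "h \<in> conn E `` {a}"
    then show "conn E `` {h} = conn E `` {a}" using conn_class[OF E, of a h] by simp
  qed
  have "comps (E \<union> pair u v) = (%h. if h \<in> C \<union> D then C \<union> D else conn E `` {h}) ` H"
    unfolding comps_def 1 ..
  also have "\<dots> = insert (C \<union> D) ((%h. conn E `` {h}) ` {h \<in> H. h ~: C \<union> D})"
    using uv(1) in_CD(1) by (auto simp: image_iff)
  also have "(%h. conn E `` {h}) ` {h \<in> H. h ~: C \<union> D} = comps E - {C, D}"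
    unfolding comps_def using cl[of _ u, folded C_def] cl[of _ v, folded D_def] by blast
  finally show "comps (E \<union> pair u v) = insert (C \<union> D) (comps E - {C, D})" .
qed

text \<open>A genus in disguise. Take the polygons as vertices, the \<open>card E / 2\<close> pairs
  as edges and the cycles of \<open>perm E\<close> as faces of an oriented ribbon graph. For a
  matching \<open>E\<close>, Euler's formula yields \<open>defect E = - 2 * p - 4 * g\<close> with
  \<open>p\<close> polygons and total genus \<open>g\<close>.\<close>

definition defect :: "('h \<times> 'h) set => int" where
  "defect E = 2 * int (card (cycles E)) - 4 * int (card (comps E)) - int (card E)"

lemma same_cycle_split:
  assumes m: "matching H (E \<union> pair u v)" "matching H E" and uv: "u ~= v" "u ~: Domain E" "v ~: Domain E"
    and sc: "same_cycle E u v"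
  obtains A B where "set (u # A @ v # B) \<in> cycles E" "cyc (perm E) (u # A @ v # B)"
    "set (u # A @ v # B) \<subseteq> H"
    "cycles (E \<union> pair u v) = {set (u # B), set (v # A)} \<union> (cycles E - {set (u # A @ v # B)})"
    "set (u # B) \<inter> set (v # A) = {}"
    "set (u # B) ~: cycles E - {set (u # A @ v # B)}" "set (v # A) ~: cycles E - {set (u # A @ v # B)}"
proof -
  obtain c where c: "c \<in> cycles E" "u \<in> c" "v \<in> c" using sc by (auto simp: same_cycle_def)
  then obtain l where l: "c = set l" "cyc (perm E) l" "set l \<subseteq> H"
    by (auto simp: cycles_def cycles_on_def)
  obtain R where R: "cyc (perm E) (u # R)" "set (u # R) = set l" using cyc_start[OF l(2)] c l by metis
  have "v \<in> set R" using R(2) c(3) l(1) uv(1) by auto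
  then obtain A B where AB: "R = A @ v # B" by (meson split_list)
  have cy: "cyc (perm E) (u # A @ v # B)" "set (u # A @ v # B) \<subseteq> H" "set (u # A @ v # B) \<in> cycles E"
    using R AB l c by auto
  have d: "distinct (u # A @ v # B)" using cy(1) by (simp only: cyc_Cons_iff)
  have "cycles (E \<union> pair u v) = {set (u # B), set (v # A)} \<union> (cycles E - {set (u # A @ v # B)})"
    unfolding cycles_def perm_insert[OF m(1) uv]
    by (rule cycles_on_split[OF finite_H bij_perm[OF m(2)] cy(1,2)])
  moreover have "x ~: cycles E - {set (u # A @ v # B)}" if "u \<in> x \<or> v \<in> x" for x
    using cycles_on_disjoint[of _ H "perm E" "set (u # A @ v # B)"] cy(3) that unfolding cycles_def by auto
  moreover have "set (u # B) \<inter> set (v # A) = {}" using d by auto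
  ultimately show ?thesis using cy by (intro that[of A B]) (assumption | simp)+
qed

lemma diff_cycle_join:
  assumes m: "matching H (E \<union> pair u v)" "matching H E" and uv: "u ~= v" "u ~: Domain E" "v ~: Domain E"
    and H: "u \<in> H" "v \<in> H" and sc: "\<not> same_cycle E u v"
  obtains A B where "set (u # A) \<in> cycles E" "set (v # B) \<in> cycles E" "set (u # A) \<inter> set (v # B) = {}"
    "cyc (perm (E \<union> pair u v)) (u # B @ v # A)" "distinct (u # A)" "distinct (v # B)"
    "cycles (E \<union> pair u v) = insert (set (u # B @ v # A)) (cycles E - {set (u # A), set (v # B)})"
    "set (u # B @ v # A) ~: cycles E - {set (u # A), set (v # B)}"
proof -
  obtain A where A: "cyc (perm E) (u # A)" "set (u # A) \<subseteq> H"
    using cyc_exists[OF finite_H bij_perm[OF m(2)] H(1)] .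
  obtain B where B: "cyc (perm E) (v # B)" "set (v # B) \<subseteq> H"
    using cyc_exists[OF finite_H bij_perm[OF m(2)] H(2)] .
  have cy: "set (u # A) \<in> cycles E" "set (v # B) \<in> cycles E"
    using A B unfolding cycles_def cycles_on_def by blast+
  then have ne: "set (u # A) ~= set (v # B)" using sc unfolding same_cycle_def by auto
  then have dis: "set (u # A) \<inter> set (v # B) = {}" using cyc_disjoint[OF A(1) B(1)] by blast
  have "cycles (E \<union> pair u v) = insert (set (u # B @ v # A)) (cycles E - {set (u # A), set (v # B)})"
    unfolding cycles_def perm_insert[OF m(1) uv]
    by (rule cycles_on_join[OF finite_H bij_perm[OF m(2)] A(1) B(1) ne A(2) B(2)])
  moreover have "cyc (perm (E \<union> pair u v)) (u # B @ v # A)"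
    unfolding perm_insert[OF m(1) uv] by (rule cyc_join[OF A(1) B(1) dis])
  moreover have "x ~: cycles E - {set (u # A), set (v # B)}" if "u \<in> x" for x
    using cycles_on_disjoint[of _ H "perm E" "set (u # A)"] cy that unfolding cycles_def by auto
  moreover have "distinct (u # A)" "distinct (v # B)" using A B by (simp_all only: cyc_Cons_iff)
  ultimately show ?thesis using cy dis by (intro that[of A B]) (assumption | simp)+
qed

lemma finite_cycles: "finite (cycles E)" by (simp add: cycles_def finite_cycles_on finite_H)

lemma matching_finite: "matching H E ==> finite E"
  unfolding matching_def using finite_H by (meson finite_SigmaI finite_subset)

text \<open>A pair inside one cycle splits it; a pair between two components merges two cycles and
  two components. Both changes are balanced by the two new elements of \<open>E\<close>. Only a pair
  between different cycles of one component adds a handle.\<close>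

lemma defect_step:
  assumes m: "matching H F" "E \<subseteq> F" "sym E" "(u, v) \<in> F" "(u, v) ~: E"
  shows "defect (E \<union> pair u v) =
    (if (u, v) \<in> conn E --> same_cycle E u v then defect E else defect E - 4)"
proof -
  note new = matching_new[OF m]
  have mE: "matching H E" using m(1,2,3) by (rule matching_subset)
  have cardE: "int (card (E \<union> pair u v)) = int (card E) + 2"
  proof -
    have "E \<inter> pair u v = {}" using new by (auto simp: pair_def)
    then have "card (E \<union> pair u v) = card E + card (pair u v)"
      using matching_finite[OF mE] by (intro card_Un_disjoint) (auto simp: pair_def)
    then show ?thesis using new(1) by (simp add: pair_def)
  qed
  show ?thesis
  proof (cases "same_cycle E u v")
    case True
    then have c: "(u, v) \<in> conn E" by (rule same_cycle_conn[OF mE])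
    obtain A B where AB: "set (u # A @ v # B) \<in> cycles E"
      "cycles (E \<union> pair u v) = {set (u # B), set (v # A)} \<union> (cycles E - {set (u # A @ v # B)})"
      "set (u # B) \<inter> set (v # A) = {}"
      "set (u # B) ~: cycles E - {set (u # A @ v # B)}" "set (v # A) ~: cycles E - {set (u # A @ v # B)}"
      using same_cycle_split[OF new(6) mE new(1-3) True] by metis
    have "set (u # B) ~= set (v # A)" using AB(3) by auto
    have "card (cycles (E \<union> pair u v)) = Suc (Suc (card (cycles E - {set (u # A @ v # B)})))"
      unfolding AB(2) using AB(4,5) \<open>set (u # B) ~= set (v # A)\<close> finite_cycles[of E] by (simp only: Un_insert_left Un_empty_left) (subst card_insert_disjoint; simp)+
    moreover have "Suc (card (cycles E - {set (u # A @ v # B)})) = card (cycles E)"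
      by (rule card_Suc_Diff1[OF finite_cycles AB(1)])
    moreover have "comps (E \<union> pair u v) = comps E"
      unfolding comps_def conn_insert_conn[OF m(3) c] ..
    ultimately show ?thesis using True cardE by (simp add: defect_def)
  next
    case False
    obtain A B where AB: "set (u # A) \<in> cycles E" "set (v # B) \<in> cycles E" "set (u # A) \<inter> set (v # B) = {}"
      "cycles (E \<union> pair u v) = insert (set (u # B @ v # A)) (cycles E - {set (u # A), set (v # B)})"
      "set (u # B @ v # A) ~: cycles E - {set (u # A), set (v # B)}"
      using diff_cycle_join[OF new(6) mE new(1-5) False] by metis
    have ne: "set (u # A) ~= set (v # B)" using AB(3) by auto
    have "card (cycles (E \<union> pair u v)) = Suc (card (cycles E - {set (u # A), set (v # B)}))"
      unfolding AB(4) using AB(5) finite_cycles[of E] by (intro card_insert_disjoint) auto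
    moreover have "card (cycles E - {set (u # A), set (v # B)}) = card (cycles E) - 2"
      using AB(1,2) ne finite_cycles[of E] by (subst card_Diff_subset) auto
    moreover have "card {set (u # A), set (v # B)} <= card (cycles E)"
      using AB(1,2) finite_cycles[of E] by (intro card_mono) auto
    ultimately have cyc: "int (card (cycles (E \<union> pair u v))) = int (card (cycles E)) - 1"
      using ne by (simp del: set_simps)
    show ?thesis
    proof (cases "(u, v) \<in> conn E")
      case True
      have "comps (E \<union> pair u v) = comps E"
        unfolding comps_def conn_insert_conn[OF m(3) True] ..
      then show ?thesis using True False cardE cyc by (simp add: defect_def)
    next
      case nc: False
      note j = comps_join[OF m(3) new(4,5) nc]
      have "card (comps (E \<union> pair u v)) = Suc (card (comps E - {conn E `` {u}, conn E `` {v}}))"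
        unfolding j(1) using j(6) finite_comps[of E] by (intro card_insert_disjoint) auto
      moreover have "card (comps E - {conn E `` {u}, conn E `` {v}}) = card (comps E) - 2"
        using j finite_comps[of E] by (subst card_Diff_subset) auto
      moreover have "card {conn E `` {u}, conn E `` {v}} <= card (comps E)"
        using j finite_comps[of E] by (intro card_mono) auto
      ultimately have "int (card (comps (E \<union> pair u v))) = int (card (comps E)) - 1"
        using j(2) by simp
      then show ?thesis using nc False cardE cyc by (simp add: defect_def)
    qed
  qed
qed

definition planar :: "('h \<times> 'h) set => bool" where
  "planar E \<longleftrightarrow> defect E = defect {}"

lemma defect_antimono:
  assumes F: "matching H F" and "E \<subseteq> F" "sym E"
  shows "defect F <= defect E"
  using assms(2,3)
proof (induction "card (F - E)" arbitrary: E rule: less_induct)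
  case less
  show ?case
  proof (cases "E = F")
    case False
    then obtain u v where uv: "(u, v) \<in> F" "(u, v) ~: E" using less.prems by auto
    note new = matching_new[OF F less.prems uv]
    have "card (F - (E \<union> pair u v)) < card (F - E)"
      using uv matching_finite[OF F] by (intro psubset_card_mono) (auto simp: pair_def)
    then have "defect F <= defect (E \<union> pair u v)" using less.hyps new by blast
    also have "\<dots> <= defect E" unfolding defect_step[OF F less.prems uv] by simp
    finally show ?thesis .
  qed simp
qed

text \<open>
  Every gluing preserves the defect or lowers it by 4, so if some order of the gluings preserves it
  then every order does.
\<close>

lemma planar_same_cycle:
  assumes F: "matching H F" "planar F" and E: "E \<subseteq> F" "sym E"
    and uv: "(u, v) \<in> F" "(u, v) ~: E" "(u, v) \<in> conn E"
  shows "same_cycle E u v"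
proof (rule ccontr)
  assume "\<not> ?thesis"
  then have "defect (E \<union> pair u v) < defect E"
    using defect_step[OF F(1) E uv(1,2)] uv(3) by simp
  moreover have "defect F <= defect (E \<union> pair u v)"
    using defect_antimono[OF F(1)] matching_new[OF F(1) E uv(1,2)] by blast
  moreover have "defect E <= defect {}"
  proof -
    have "matching H E" using F(1) E by (rule matching_subset)
    then show ?thesis by (rule defect_antimono) (auto simp: sym_def)
  qed
  ultimately show False using F(2) by (simp add: planar_def)
qed

text \<open>By \<open>indep\<close> a class of \<open>conn E\<close> contains no flags of
  \<open>P\<close> other than the two ends of one pair. Inserting some of the pairs therefore
  changes neither the classes nor the cycles that contain the ends of the others, and the test
  \<open>same\<close>, made for \<open>E\<close> only, stays valid during the whole batch.\<close>

lemma planar_batch: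
  assumes m: "matching H (E \<union> P)" "planar E" "sym E" "sym P"
    and same: "!!u v. (u, v) \<in> P ==> (u, v) \<in> conn E ==> same_cycle E u v"
    and indep: "!!u v a b. (u, v) \<in> P ==> (a, b) \<in> P ==> (u, a) \<in> conn E ==> a = u \<or> a = v"
  shows "planar (E \<union> P)"
proof -
  have mE: "matching H E" using m(1) by (rule matching_subset) (use m in auto)
  have "planar (E \<union> P)" if "E \<subseteq> E'" "E' \<subseteq> E \<union> P" "sym E'" "planar E'" for E'
    using that
  proof (induction "card (E \<union> P - E')" arbitrary: E' rule: less_induct)
    case less
    show ?case
    proof (cases "E' = E \<union> P")
      case False
      then obtain u v where uv: "(u, v) \<in> E \<union> P" "(u, v) ~: E'" using less.prems by auto
      then have uvP: "(u, v) \<in> P" using less.prems by auto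
      note new = matching_new[OF m(1) less.prems(2,3) uv]
      \<comment> \<open>A path of \<open>E'\<close> from \<open>u\<close> cannot use a new pair: the
        first one would start at \<open>u\<close> or \<open>v\<close>, and both are still unpaired
        in \<open>E'\<close>.\<close>
      have clos: "(u, b) \<in> conn E" if "(u, b) \<in> conn E'" for b
        using that unfolding conn_def[of E']
      proof (induction rule: rtrancl_induct)
        case (step y z)
        show ?case
        proof (cases "(y, z) \<in> nx \<union> nx\<inverse> \<union> E")
          case True
          then have "(y, z) \<in> conn E" by (auto simp: conn_def)
          then show ?thesis using step.IH conn_trans by blast
        next
          case False
          then have yz: "(y, z) \<in> E'" "(y, z) \<in> P" using step(2) less.prems(2) by auto
          then have "y = u \<or> y = v" using indep[OF uvP yz(2) step.IH] by blast
          then have "y \<in> {u, v}" "y \<in> Domain E'" using yz by auto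
          then show ?thesis using new(2,3) by auto
        qed
      qed simp
      have "same_cycle E' u v" if uvE': "(u, v) \<in> conn E'"
      proof -
        obtain c where c: "c \<in> cycles E" "u \<in> c" "v \<in> c"
          using same[OF uvP clos[OF uvE']] by (auto simp: same_cycle_def)
        then obtain l where l: "c = set l" "cyc (perm E) l" "set l \<subseteq> H"
          by (auto simp: cycles_def cycles_on_def)
        have "perm E' x = perm E x" if x: "x \<in> set l" for x
        proof -
          have ux: "(u, x) \<in> conn E" using cycle_conn[OF mE c(1,2)] x l(1) by blast
          have "(x, z) \<in> E' \<longleftrightarrow> (x, z) \<in> E" for z
          proof
            assume "(x, z) \<in> E'"
            show "(x, z) \<in> E"
            proof (rule ccontr)
              assume "(x, z) ~: E"
              then have xz: "(x, z) \<in> P" using \<open>(x, z) \<in> E'\<close> less.prems(2) by auto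
              have "x = u \<or> x = v" using indep[OF uvP xz ux] .
              then show False using new(2,3) \<open>(x, z) \<in> E'\<close> by auto
            qed
          qed (use less.prems in auto)
          then show ?thesis by (auto simp: perm_def mate_def)
        qed
        then have "cyc (perm E') l" by (rule cyc_cong[OF l(2)])
        then have "set l \<in> cycles E'" using l(3) unfolding cycles_def cycles_on_def by blast
        then show ?thesis using c l(1) by (auto simp: same_cycle_def)
      qed
      then have "defect (E' \<union> pair u v) = defect E'"
        using defect_step[OF m(1) less.prems(2,3) uv] by simp
      then have "planar (E' \<union> pair u v)" using less.prems(4) by (simp add: planar_def)
      moreover have "card (E \<union> P - (E' \<union> pair u v)) < card (E \<union> P - E')"
        using uv matching_finite[OF m(1)] by (intro psubset_card_mono) (auto simp: pair_def)
      ultimately show ?thesis using less.hyps new less.prems(1) by blast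
    qed (use less.prems in simp)
  qed
  then show ?thesis using m(2,3) by blast
qed

end

section \<open>Numerical weights\<close>

text \<open>The Catalan numbers as reals, defined by the ratio of consecutive terms.\<close>

fun cat :: "nat => real" where
  "cat 0 = 1"
| "cat (Suc n) = cat n * (2 * (2 * real n + 1) / (real n + 2))"

lemma cat_pos: "cat n > 0"
  by (induction n) auto

lemma cat_Suc: "(real n + 2) * cat (Suc n) = (4 * real n + 2) * cat n"
proof -
  have "cat (Suc n) = (4 * real n + 2) * cat n / (real n + 2)" by (simp add: algebra_simps)
  then show ?thesis by (simp only: nonzero_mult_div_cancel_left nonzero_eq_divide_eq) simp
qed

declare cat.simps(2) [simp del]

text \<open>Under the symmetry of i and m - i, weighting the terms of the convolution
  \<open>S m\<close> by i multiplies it by m / 2. Together with \<open>cat_Suc\<close> this gives (n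
  + 3) S(n + 1) = (4n + 6) cat(n + 1), the first-order recurrence that \<open>cat\<close> itself
  satisfies.\<close>

lemma cat_convolution: "(\<Sum>i\<le>n. cat i * cat (n - i)) = cat (Suc n)"
proof (induction n)
  case (Suc n)
  define S where "S = (%n. \<Sum>i\<le>n. cat i * cat (n - i))"
  have sym: "(\<Sum>i\<le>m. real i * (cat i * cat (m - i))) = real m / 2 * S m" for m
  proof -
    have "(\<Sum>i\<le>m. real i * (cat i * cat (m - i))) = (\<Sum>i\<le>m. real (m - i) * (cat (m - i) * cat i))"
      by (rule sum.reindex_bij_witness[of _ "%i. m - i" "%i. m - i"]) auto
    then have "2 * (\<Sum>i\<le>m. real i * (cat i * cat (m - i)))
        = (\<Sum>i\<le>m. real i * (cat i * cat (m - i))) + (\<Sum>i\<le>m. real (m - i) * (cat (m - i) * cat i))"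
      by simp
    also have "\<dots> = (\<Sum>i\<le>m. real m * (cat i * cat (m - i)))"
      unfolding sum.distrib[symmetric]
      by (intro sum.cong) (auto simp: of_nat_diff algebra_simps)
    also have "\<dots> = real m * S m" by (simp only: S_def sum_distrib_left)
    finally show ?thesis by linarith
  qed
  have "(\<Sum>i\<le>n. (real i + 2) * cat (Suc i) * cat (n - i)) = (\<Sum>i\<le>n. (4 * real i + 2) * cat i * cat (n - i))"
    by (simp only: cat_Suc)
  also have "\<dots> = 4 * (\<Sum>i\<le>n. real i * (cat i * cat (n - i))) + 2 * S n"
    unfolding S_def sum_distrib_left sum.distrib[symmetric] by (intro sum.cong) (auto simp: algebra_simps)
  also have "\<dots> = (2 * real n + 2) * S n" using sym[of n] by (simp add: algebra_simps)
  finally have 1: "(\<Sum>i\<le>n. (real i + 2) * cat (Suc i) * cat (n - i)) = (2 * real n + 2) * S n" .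
  have "(\<Sum>j\<le>Suc n. (real j + 1) * cat j * cat (Suc n - j))
      = cat (Suc n) + (\<Sum>i\<le>n. (real i + 2) * cat (Suc i) * cat (n - i))"
    by (subst sum.atMost_Suc_shift) (simp add: algebra_simps)
  moreover have "(\<Sum>j\<le>Suc n. (real j + 1) * cat j * cat (Suc n - j))
      = (\<Sum>i\<le>Suc n. real i * (cat i * cat (Suc n - i))) + S (Suc n)"
    unfolding S_def sum.distrib[symmetric] by (intro sum.cong) (auto simp: algebra_simps)
  ultimately have "(real (Suc n) / 2 + 1) * S (Suc n) = cat (Suc n) + (2 * real n + 2) * S n"
    using 1 sym[of "Suc n"] by (simp only: distrib_right mult_1)
  moreover have "S n = cat (Suc n)" using Suc.IH by (simp add: S_def)
  ultimately have "(real n + 3) * S (Suc n) = (4 * real n + 6) * cat (Suc n)"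
    by (simp add: field_simps)
  moreover have "(real n + 3) * cat (Suc (Suc n)) = (4 * real n + 6) * cat (Suc n)"
    using cat_Suc[of "Suc n"] by (simp add: algebra_simps)
  ultimately have "S (Suc n) = cat (Suc (Suc n))"
    by (metis add_nonneg_pos mult_left_cancel of_nat_0_le_iff order_less_irrefl zero_less_numeral)
  then show ?case by (simp add: S_def)
qed (simp add: cat.simps(2))

lemma cat_le: "cat n <= 4 ^ n"
proof (induction n)
  case (Suc n)
  have "cat n * (2 * (2 * real n + 1) / (real n + 2)) <= 4 ^ n * 4"
    using cat_pos[of n] by (intro mult_mono Suc) (auto simp: field_simps)
  then show ?case by (simp add: cat.simps(2))
qed simp

text \<open>The denominator is chosen so that the weighted convolution in \<open>sum_psi_le\<close>
  collapses to the Catalan convolution while log-convexity is kept.\<close>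

definition psi :: "nat => real" where "psi n = cat n / (real n + 1)"

lemma psi_pos: "psi n > 0" by (simp add: psi_def cat_pos add_nonneg_pos)

lemma psi_0: "psi 0 = 1" by (simp add: psi_def)

lemma psi_Suc: "psi (Suc n) = psi n * (2 * (2 * real n + 1) * (real n + 1) / (real n + 2)\<^sup>2)"
proof -
  have 1: "real (Suc n) + 1 = real n + 2" by simp
  have 2: "real n + 1 ~= 0" by simp
  have 3: "c * (2 * q / y) / y = c / x * (2 * q * x / (y * y))" if "x ~= 0" for c q x y :: real
    using that by simp
  show ?thesis unfolding psi_def cat.simps(2) 1 power2_eq_square by (rule 3[OF 2])
qed

text \<open>The ratio of consecutive terms increases: with denominators cleared, the difference is
  \<open>y\<close> times a polynomial with nonnegative coefficients.\<close>

lemma psi_log_convex: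
  assumes "m <= n"
  shows "psi (Suc m) * psi n <= psi m * psi (Suc n)"
proof -
  obtain k where n: "n = m + k" using assms le_Suc_ex by blast
  define x y where "x = real m" and "y = real k"
  have nn: "real n = x + y" "real m = x" by (simp_all add: n x_def y_def)
  have "(2 * (x + y) + 1) * (x + y + 1) * ((x + 2) * (x + 2)) - (2 * x + 1) * (x + 1) * ((x + y + 2) * (x + y + 2))
      = y * (5 * (x * x) + 5 * (x * y) + 14 * x + 7 * y + 8)"
    by (simp add: algebra_simps)
  moreover have "\<dots> \<ge> 0" by (intro mult_nonneg_nonneg add_nonneg_nonneg) (auto simp: x_def y_def)
  ultimately have le: "2 * (2 * x + 1) * (x + 1) * (x + y + 2)\<^sup>2 <= 2 * (2 * (x + y) + 1) * (x + y + 1) * (x + 2)\<^sup>2"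
    unfolding power2_eq_square by linarith
  have frac: "a / b <= c / e" if "a * e <= c * b" "b > 0" "e > 0" for a b c e :: real
    using that by (simp add: pos_divide_le_eq pos_le_divide_eq mult.commute)
  have "2 * (2 * x + 1) * (x + 1) / (x + 2)\<^sup>2 <= 2 * (2 * (x + y) + 1) * (x + y + 1) / (x + y + 2)\<^sup>2"
    by (rule frac[OF le]) (auto simp: x_def y_def)
  then have "psi m * psi n * (2 * (2 * x + 1) * (x + 1) / (x + 2)\<^sup>2)
     <= psi m * psi n * (2 * (2 * (x + y) + 1) * (x + y + 1) / (x + y + 2)\<^sup>2)"
    using psi_pos[of m] psi_pos[of n] by (intro mult_left_mono) auto
  then show ?thesis unfolding psi_Suc nn by (simp only: mult_ac)
qed

lemma psi_ratio_mono_left: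
  "a <= m ==> psi (a + b) * psi m <= psi a * psi (m + b)"
proof (induction b)
  case (Suc b)
  have "psi (Suc (a + b)) * psi m * psi (m + b) <= psi (a + b) * psi (Suc (m + b)) * psi m"
    using psi_log_convex[of "a + b" "m + b"] Suc.prems psi_pos[of m] by (simp add: mult.commute mult.left_commute)
  also have "\<dots> <= psi a * psi (m + b) * psi (Suc (m + b))"
    using Suc psi_pos[of "Suc (m + b)"] by (simp add: mult.commute mult.left_commute)
  finally show ?case using psi_pos[of "m + b"] by (simp add: mult.commute mult.left_commute)
qed (simp add: mult.commute)

text \<open>By log-convexity the gain psi(a + b) / (psi a * psi b) grows with both arguments. It is
  used with \<open>a\<close>, \<open>b\<close> the free letters of two cycles and \<open>m\<close>,
  \<open>m'\<close> all letters of their components.\<close>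

lemma psi_ratio_mono:
  assumes "a <= m" "b <= m'"
  shows "psi (a + b) * psi m * psi m' <= psi a * psi b * psi (m + m')"
proof -
  have "psi (a + b) * psi m * psi m' <= psi a * psi (m + b) * psi m'"
    using psi_ratio_mono_left[OF assms(1)] psi_pos[of m'] by simp
  also have "\<dots> <= psi a * (psi b * psi (m + m'))"
    using psi_ratio_mono_left[OF assms(2), of m] psi_pos[of a] by (simp add: add.commute mult.commute mult.left_commute)
  finally show ?thesis by (simp add: mult.assoc)
qed

lemma psi_supermult: "psi a * psi b <= psi (a + b)"
  using psi_ratio_mono[of 0 a 0 b] by (simp add: psi_0)

text \<open>Weight of a boundary cycle with \<open>n\<close> free letters. A discovered chord uses
  up two letters, which saves a factor 1/4; base 2 is where the recursion of
  \<open>arc_weight\<close> closes, as 1 + 3/2 * 1/4 * 4/3 = 3/2.\<close>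

definition phi :: "nat => real" where "phi n = 2 ^ n * psi n"

text \<open>Weight of a component with \<open>n\<close> letters. Dividing by \<open>psi\<close>
  compensates for the larger weight of a merged cycle, 3/2 absorbs the factor of
  \<open>arc_weight_le\<close>, and the power of 4 keeps the weight at least 1. A component without
  letters must cost nothing, hence the value 1 at 0.\<close>

definition theta :: "nat => real" where "theta n = (if n = 0 then 1 else 3 / 2 * 4 ^ n / psi n)"

lemma phi_pos: "phi n > 0" by (simp add: phi_def psi_pos)

lemma phi_0: "phi 0 = 1" by (simp add: phi_def psi_0)

lemma phi_ge_1: "phi n \<ge> 1"
proof (induction n)
  case (Suc n)
  have "1 <= 2 * (2 * (2 * real n + 1) * (real n + 1) / (real n + 2)\<^sup>2)"
    by (simp add: power2_eq_square divide_simps) (simp add: algebra_simps)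
  then have "1 * 1 <= phi n * (2 * (2 * (2 * real n + 1) * (real n + 1) / (real n + 2)\<^sup>2))"
    using Suc by (intro mult_mono) auto
  then show ?case by (simp add: phi_def psi_Suc algebra_simps)
qed (simp add: phi_0)

lemma phi_supermult: "phi a * phi b <= phi (a + b)"
  using psi_supermult[of a b] by (simp add: phi_def power_add)

lemma theta_ge_1: "theta n \<ge> 1"
proof -
  have "psi n <= cat n" using cat_pos[of n] by (simp add: psi_def divide_simps)
  moreover have "(0 :: real) < 4 ^ n" by simp
  ultimately have "1 * psi n <= 3 / 2 * 4 ^ n" using cat_le[of n] by linarith
  then have "1 <= 3 / 2 * 4 ^ n / psi n" by (simp only: pos_le_divide_eq[OF psi_pos])
  then show ?thesis by (cases "n = 0") (simp_all only: theta_def if_True if_False order_refl simp_thms)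
qed

lemma theta_0: "theta 0 = 1" by (simp add: theta_def)

text \<open>Here \<open>psi\<close> cancels and 3/2 * 8 ^ n remains for positive \<open>n\<close>;
  replacing 3/2 by (3/2) ^ n produces the base 12.\<close>

lemma phi_theta_le: "phi n * theta n <= 12 ^ n"
proof (cases n)
  case (Suc m)
  have "(3 / 2) * (8 :: real) ^ n <= 12 ^ n"
  proof -
    have "(3 / 2 :: real) ^ 1 <= (3 / 2) ^ n" using Suc by (intro power_increasing) auto
    then have "(3 / 2) * (8 :: real) ^ n <= (3 / 2) ^ n * 8 ^ n" by simp
    also have "\<dots> = 12 ^ n" by (simp flip: power_mult_distrib)
    finally show ?thesis .
  qed
  moreover have "phi n * theta n = (3 / 2) * 8 ^ n"
    using Suc psi_pos[of n] by (simp add: phi_def theta_def flip: power_mult_distrib)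
  ultimately show ?thesis by simp
qed (simp add: phi_0 theta_0)

text \<open>
  \<open>arc_weight a b\<close> bounds the number of ways to complete a cycle that consists of two arcs with
  \<open>a\<close> and \<open>b\<close> letters when only chords between the arcs are still to be found: either there is
  none, or the chord closest to the end of the first arc cuts off \<open>g\<close> and \<open>h\<close> letters.
\<close>

fun arc_weight :: "nat => nat => real" where
  "arc_weight a b = phi (a + b) +
     (\<Sum>g<a. \<Sum>h<b. phi (g + h) * arc_weight (a - 1 - g) (b - 1 - h))"

declare arc_weight.simps [simp del]

lemma arc_weight_nonneg: "arc_weight a b \<ge> 0"
proof (induction a b rule: arc_weight.induct)
  case (1 a b)
  have phi: "phi n \<ge> 0" for n using phi_pos[of n] by simp
  have "(\<Sum>g<a. \<Sum>h<b. phi (g + h) * arc_weight (a - 1 - g) (b - 1 - h)) \<ge> 0"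
    by (intro sum_nonneg mult_nonneg_nonneg phi 1)
  then show ?case using phi[of "a + b"] by (subst arc_weight.simps) (rule add_nonneg_nonneg)
qed

lemma arc_weight_0 [simp]: "arc_weight 0 b = phi b" "arc_weight a 0 = phi a"
  by (subst arc_weight.simps, simp)+

text \<open>Grouped by s = g + h, the pairs are counted twice: by the first coordinate there are at
  most s + 1 of them, and by the distance from the upper corner at most a + b - 1 - s.\<close>

lemma sum_arcs_le:
  fixes f :: "nat => real"
  assumes f: "!!s. f s \<ge> 0" and ab: "a > 0" "b > 0"
  shows "(\<Sum>g<a. \<Sum>h<b. f (g + h)) <= (\<Sum>s\<le>a + b - 2. (real (min s (a + b - 2 - s)) + 1) * f s)"
proof -
  have "(\<Sum>g<a. \<Sum>h<b. f (g + h)) = (\<Sum>p\<in>{..<a} \<times> {..<b}. f (fst p + snd p))"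
    by (simp add: sum.cartesian_product case_prod_beta)
  also have "\<dots> = (\<Sum>s\<le>a + b - 2. \<Sum>p\<in>{p \<in> {..<a} \<times> {..<b}. fst p + snd p = s}. f (fst p + snd p))"
    by (intro sum.group[symmetric] image_subsetI) (use ab in auto)
  also have "\<dots> <= (\<Sum>s\<le>a + b - 2. (real (min s (a + b - 2 - s)) + 1) * f s)"
  proof (rule sum_mono)
    fix s assume "s \<in> {..a + b - 2}"
    let ?P = "{p \<in> {..<a} \<times> {..<b}. fst p + snd p = s}"
    have "(\<Sum>p\<in>?P. f (fst p + snd p)) = real (card ?P) * f s"
      by (subst sum.cong[of ?P ?P _ "%_. f s"]) auto
    moreover have "card ?P <= card {..s}"
      by (rule card_inj_on_le[of fst]) (auto simp: inj_on_def)
    moreover have "card ?P <= card {..a + b - 2 - s}"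
      by (rule card_inj_on_le[of "%p. a - 1 - fst p"]) (auto simp: inj_on_def)
    ultimately show "(\<Sum>p\<in>?P. f (fst p + snd p)) <= (real (min s (a + b - 2 - s)) + 1) * f s"
      using f[of s] by (auto intro!: mult_right_mono)
  qed
  finally show ?thesis .
qed

text \<open>Because (min s r + 1)(s + r + 2) <= 2 (s + 1)(r + 1), the multiplicity cancels the
  denominators of \<open>psi s * psi r\<close>, and a Catalan convolution is left.\<close>

lemma sum_psi_le:
  assumes "n \<ge> 2"
  shows "(\<Sum>s\<le>n - 2. (real (min s (n - 2 - s)) + 1) * (psi s * psi (n - 2 - s)))
           <= (real n + 1)\<^sup>2 / (real n * (2 * real n - 1)) * psi n"
proof -
  have "(\<Sum>s\<le>n - 2. (real (min s (n - 2 - s)) + 1) * (psi s * psi (n - 2 - s)))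
      <= (\<Sum>s\<le>n - 2. 2 / real n * (cat s * cat (n - 2 - s)))"
  proof (rule sum_mono)
    fix s assume "s \<in> {..n - 2}"
    define r where "r = n - 2 - s"
    have n: "real n = real s + real r + 2" using \<open>s \<in> _\<close> assms by (simp add: r_def of_nat_diff)
    have "(real (min s r) + 1) * real n <= 2 * ((real s + 1) * (real r + 1))"
    proof (cases "s <= r")
      case True
      have "(real s + 1) * (real s + real r + 2) <= (real s + 1) * (2 * (real r + 1))"
        using True by (intro mult_left_mono) auto
      then show ?thesis using True n by (simp add: min_def algebra_simps)
    next
      case False
      have "(real r + 1) * (real s + real r + 2) <= (real r + 1) * (2 * (real s + 1))"
        using False by (intro mult_left_mono) auto
      then show ?thesis using False n by (simp add: min_def algebra_simps)
    qed
    then have "(real (min s r) + 1) * real n * (psi s * psi r) <= 2 * ((real s + 1) * (real r + 1)) * (psi s * psi r)"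
      using psi_pos[of s] psi_pos[of r] by (intro mult_right_mono) auto
    also have "\<dots> = 2 * (cat s * cat r)" by (simp add: psi_def divide_simps)
    finally show "(real (min s (n - 2 - s)) + 1) * (psi s * psi (n - 2 - s)) <= 2 / real n * (cat s * cat (n - 2 - s))"
      using assms unfolding r_def by (simp add: field_simps)
  qed
  also have "\<dots> = 2 / real n * cat (n - 1)"
  proof -
    have "Suc (n - 2) = n - 1" using assms by simp
    then show ?thesis using cat_convolution[of "n - 2"] by (simp only: sum_distrib_left[symmetric])
  qed
  also have "\<dots> = (real n + 1)\<^sup>2 / (real n * (2 * real n - 1)) * psi n"
  proof -
    obtain m where m: "n = Suc m" using assms by (cases n) auto
    have "cat n = cat m * (2 * (2 * real m + 1) / (real m + 2))" using m by (simp add: cat.simps(2))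
    then show ?thesis using m assms by (simp add: psi_def power2_eq_square divide_simps) (simp add: algebra_simps)
  qed
  finally show ?thesis .
qed

text \<open>The factor 3/2 is a fixed point: the sum contributes at most 3/2 * 1/4 * 4/3 = 1/2 times
  \<open>phi (a + b)\<close>. The quotient in \<open>sum_psi_le\<close> stays below 4/3 from a + b =
  3 on but equals 3/2 at 2, so a = b = 1 is computed directly.\<close>

lemma arc_weight_le: "arc_weight a b <= 3 / 2 * phi (a + b)"
proof (induction a b rule: arc_weight.induct)
  case (1 a b)
  show ?case
  proof (cases "a = 0 \<or> b = 0")
    case True
    then show ?thesis using phi_pos[of a] phi_pos[of b] by auto
  next
    case False
    define n where "n = a + b"
    show ?thesis
    proof (cases "a = 1 & b = 1")
      case True
      then have "arc_weight a b = phi 2 + 1" by (subst arc_weight.simps) (simp add: phi_0 numeral_2_eq_2)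
      moreover have "phi 2 = 8 / 3" by (simp add: phi_def psi_def cat.simps(2) numeral_2_eq_2)
      ultimately show ?thesis using True by (simp add: numeral_2_eq_2)
    next
      case not11: False
      then have n3: "n \<ge> 3" using False by (auto simp: n_def)
      have ab: "a > 0" "b > 0" using False by auto
      have "arc_weight a b <= phi n + (\<Sum>g<a. \<Sum>h<b. phi (g + h) * (3 / 2 * phi (n - 2 - (g + h))))"
      proof -
        have "(\<Sum>g<a. \<Sum>h<b. phi (g + h) * arc_weight (a - 1 - g) (b - 1 - h))
            <= (\<Sum>g<a. \<Sum>h<b. phi (g + h) * (3 / 2 * phi (n - 2 - (g + h))))"
        proof (intro sum_mono mult_left_mono)
          fix g h assume gh: "g \<in> {..<a}" "h \<in> {..<b}"
          have "a - 1 - g + (b - 1 - h) = n - 2 - (g + h)" using gh by (auto simp: n_def)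
          then show "arc_weight (a - 1 - g) (b - 1 - h) <= 3 / 2 * phi (n - 2 - (g + h))"
            using 1[OF gh] by simp
        qed (simp add: less_imp_le[OF phi_pos])
        then show ?thesis by (subst arc_weight.simps) (simp add: n_def)
      qed
      also have "(\<Sum>g<a. \<Sum>h<b. phi (g + h) * (3 / 2 * phi (n - 2 - (g + h))))
          <= (\<Sum>s\<le>n - 2. (real (min s (n - 2 - s)) + 1) * (phi s * (3 / 2 * phi (n - 2 - s))))"
        unfolding n_def
        by (rule sum_arcs_le[OF _ ab, of "%s. phi s * (3 / 2 * phi (a + b - 2 - s))"])
          (simp add: less_imp_le[OF phi_pos])
      also have "\<dots> = 3 / 8 * 2 ^ n * (\<Sum>s\<le>n - 2. (real (min s (n - 2 - s)) + 1) * (psi s * psi (n - 2 - s)))"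
        unfolding sum_distrib_left
      proof (rule sum.cong)
        fix s assume s: "s \<in> {..n - 2}"
        have "(2 :: real) ^ n = 4 * (2 ^ s * 2 ^ (n - 2 - s))"
        proof -
          have "n = 2 + s + (n - 2 - s)" using s n3 by simp
          then have "(2 :: real) ^ n = 2 ^ (2 + s + (n - 2 - s))" by presburger
          then show ?thesis by (simp add: power_add)
        qed
        then show "(real (min s (n - 2 - s)) + 1) * (phi s * (3 / 2 * phi (n - 2 - s)))
            = 3 / 8 * 2 ^ n * ((real (min s (n - 2 - s)) + 1) * (psi s * psi (n - 2 - s)))"
          by (simp add: phi_def)
      qed simp
      also have "\<dots> <= 3 / 8 * 2 ^ n * ((real n + 1)\<^sup>2 / (real n * (2 * real n - 1)) * psi n)"
        using sum_psi_le[of n] n3 by (intro mult_left_mono) auto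
      also have "\<dots> <= 3 / 8 * 2 ^ n * (4 / 3 * psi n)"
      proof -
        obtain k where k: "n = k + 3" using n3 by (metis add.commute le_Suc_ex)
        have "(real n + 1)\<^sup>2 / (real n * (2 * real n - 1)) <= 4 / 3"
          unfolding k by (simp add: power2_eq_square divide_simps) (simp add: algebra_simps)
        then show ?thesis using psi_pos[of n] by (intro mult_left_mono mult_right_mono) auto
      qed
      finally have "arc_weight a b <= phi n + 3 / 8 * 2 ^ n * (4 / 3 * psi n)" by simp
      also have "\<dots> = 3 / 2 * phi n" by (simp add: phi_def)
      finally show ?thesis by (simp add: n_def)
    qed
  qed
qed

text \<open>The inequality behind mergers: \<open>m\<close> and \<open>m'\<close> count the letters
  of the two components, \<open>a\<close> and \<open>b\<close> the free letters of the two cycles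
  that fuse. If one side has no letters, \<open>arc_weight\<close> equals \<open>phi\<close>, no
  factor 3/2 arises, and \<open>theta 0 = 1\<close> suffices.\<close>

lemma arc_weight_join:
  assumes "a <= m" "b <= m'"
  shows "arc_weight a b * theta (m + m') <= phi a * phi b * (theta m * theta m')"
proof (cases "m = 0 \<or> m' = 0")
  case True
  then show ?thesis using assms by (auto simp: theta_0 phi_0)
next
  case False
  have "psi (a + b) / psi (m + m') <= psi a * psi b / (psi m * psi m')"
    using psi_ratio_mono[OF assms] psi_pos by (simp add: frac_le_eq divide_simps mult.commute mult.left_commute)
  have t: "theta (m + m') = 3 / 2 * 4 ^ (m + m') / psi (m + m')" using False by (simp add: theta_def)
  have "arc_weight a b * theta (m + m') <= 3 / 2 * phi (a + b) * theta (m + m')"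
    using arc_weight_le[of a b] theta_ge_1[of "m + m'"] by (intro mult_right_mono) auto
  also have "\<dots> = 9 / 4 * 2 ^ (a + b) * 4 ^ (m + m') * (psi (a + b) / psi (m + m'))"
    unfolding t by (simp add: phi_def)
  also have "\<dots> <= 9 / 4 * 2 ^ (a + b) * 4 ^ (m + m') * (psi a * psi b / (psi m * psi m'))"
    by (intro mult_left_mono) (fact, simp)
  also have "\<dots> = phi a * phi b * (theta m * theta m')"
    using False by (simp add: phi_def theta_def power_add)
  finally show ?thesis .
qed

section \<open>Counting planar pairings\<close>

text \<open>Turns a choice of a free letter in an arc into the number of free letters that it cuts
  off, the form used in \<open>arc_weight\<close>.\<close>

lemma sum_over_letters:
  fixes f :: "nat => nat => 'b::comm_monoid_add"
  assumes "distinct l"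
  shows "(\<Sum>x\<in>{x \<in> set l. P x}. f (card {y \<in> set (takeWhile (%y. y ~= x) l). P y})
                                  (card {y \<in> set (tl (dropWhile (%y. y ~= x) l)). P y}))
       = (\<Sum>g<card {x \<in> set l. P x}. f (card {x \<in> set l. P x} - 1 - g) g)"
  using assms
proof (induction l arbitrary: f)
  case (Cons z l)
  let ?L = "{x \<in> set l. P x}"
  have z: "z ~: set l" using Cons.prems by simp
  have step: "(\<Sum>x\<in>?L. f (card {y \<in> set (takeWhile (%y. y ~= x) (z # l)). P y})
        (card {y \<in> set (tl (dropWhile (%y. y ~= x) (z # l))). P y}))
      = (\<Sum>x\<in>?L. f (card {y \<in> set (takeWhile (%y. y ~= x) l). P y} + (if P z then 1 else 0))
        (card {y \<in> set (tl (dropWhile (%y. y ~= x) l)). P y}))"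
  proof (rule sum.cong)
    fix x assume x: "x \<in> ?L"
    then have "x ~= z" using z by auto
    have "{y \<in> set (takeWhile (%y. y ~= x) (z # l)). P y} =
        (if P z then insert z {y \<in> set (takeWhile (%y. y ~= x) l). P y} else {y \<in> set (takeWhile (%y. y ~= x) l). P y})"
      using \<open>x ~= z\<close> by auto
    moreover have "z ~: set (takeWhile (%y. y ~= x) l)" using z by (auto dest: set_takeWhileD)
    ultimately have "card {y \<in> set (takeWhile (%y. y ~= x) (z # l)). P y}
      = card {y \<in> set (takeWhile (%y. y ~= x) l). P y} + (if P z then 1 else 0)" by simp
    moreover have "dropWhile (%y. y ~= x) (z # l) = dropWhile (%y. y ~= x) l" using \<open>x ~= z\<close> by simp
    ultimately show "f (card {y \<in> set (takeWhile (%y. y ~= x) (z # l)). P y})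
        (card {y \<in> set (tl (dropWhile (%y. y ~= x) (z # l))). P y}) =
      f (card {y \<in> set (takeWhile (%y. y ~= x) l). P y} + (if P z then 1 else 0))
        (card {y \<in> set (tl (dropWhile (%y. y ~= x) l)). P y})"
      by (simp only:)
  qed simp
  show ?case
  proof (cases "P z")
    case True
    have 1: "{x \<in> set (z # l). P x} = insert z ?L" using True by auto
    have finite_L: "finite ?L" and z_notin: "z ~: ?L" using z by simp_all
    have c: "card (insert z ?L) = Suc (card ?L)" using z by simp
    have "takeWhile (%y. y ~= z) (z # l) = []" "dropWhile (%y. y ~= z) (z # l) = z # l" by simp_all
    then have z_term: "card {y \<in> set (takeWhile (%y. y ~= z) (z # l)). P y} = 0"
      "card {y \<in> set (tl (dropWhile (%y. y ~= z) (z # l))). P y} = card ?L" by (simp_all only: list.sel list.set) simp_all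
    have "(\<Sum>x\<in>insert z ?L. f (card {y \<in> set (takeWhile (%y. y ~= x) (z # l)). P y})
        (card {y \<in> set (tl (dropWhile (%y. y ~= x) (z # l))). P y}))
      = f 0 (card ?L) + (\<Sum>x\<in>?L. f (card {y \<in> set (takeWhile (%y. y ~= x) l). P y} + 1)
        (card {y \<in> set (tl (dropWhile (%y. y ~= x) l)). P y}))"
      unfolding step[unfolded if_P[OF True]] sum.insert[OF finite_L z_notin] z_term ..
    also have "\<dots> = f 0 (card ?L) + (\<Sum>g<card ?L. f (card ?L - 1 - g + 1) g)"
      using Cons.IH[of "%a b. f (a + 1) b"] Cons.prems by simp
    also have "(\<Sum>g<card ?L. f (card ?L - 1 - g + 1) g) = (\<Sum>g<card ?L. f (Suc (card ?L) - 1 - g) g)"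
      by (intro sum.cong) (auto simp: Suc_diff_Suc)
    finally show ?thesis unfolding 1 c by (simp add: add.commute)
  next
    case False
    then have "{x \<in> set (z # l). P x} = ?L" by auto
    then show ?thesis using step Cons False by simp
  qed
qed simp

text \<open>\<open>E0\<close> holds the pairs of the tree, \<open>G x y\<close> all pairs forced by
  the chord from x to y, and an outcome is a symmetric set of chords. \<open>Out_closed\<close> is
  what is retained of the order of the gluings: any incomplete part of an outcome already connects
  the ends of a missing chord. \<open>Out_start\<close> says that no chord lies inside one polygon,
  so nothing can be discovered at the beginning.\<close>

locale chord_outcomes = half_edges H nxt
  for H :: "'h set" and nxt :: "'h => 'h" +
  fixes L :: "'h set" and G :: "'h => 'h => ('h \<times> 'h) set" and E0 :: "('h \<times> 'h) set"
    and Out :: "('h \<times> 'h) set set"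
  assumes L_sub: "L \<subseteq> H"
    and E0_sym: "sym E0"
    and G_sym: "G y x = (G x y)\<inverse>" and G_in: "(x, y) \<in> G x y"
    and Out_sub: "M \<in> Out ==> M \<subseteq> L \<times> L" and Out_sym: "M \<in> Out ==> sym M"
    and Out_matching: "M \<in> Out ==> matching H (E0 \<union> (\<Union>(x, y)\<in>M. G x y))"
    and Out_planar: "M \<in> Out ==> planar (E0 \<union> (\<Union>(x, y)\<in>M. G x y))"
    and Out_closed: "M \<in> Out ==> K \<subset> M ==> sym K ==>
        \<exists>(x, y)\<in>M - K. (x, y) \<in> conn (E0 \<union> (\<Union>(x, y)\<in>K. G x y))"
    and Out_fresh: "M \<in> Out ==> K \<subseteq> M ==> sym K ==> (x, y) \<in> M - K ==>
        (x, y) ~: E0 \<union> (\<Union>(x, y)\<in>K. G x y)"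
    and Out_start: "M \<in> Out ==> (x, y) \<in> M ==> (x, y) ~: conn {}"
begin

definition glued :: "('h \<times> 'h) set => ('h \<times> 'h) set" where
  "glued K = E0 \<union> (\<Union>(x, y)\<in>K. G x y)"

lemma glued_mono: "K \<subseteq> K' ==> glued K \<subseteq> glued K'"
  unfolding glued_def by blast

lemma glued_sym: "sym K ==> sym (glued K)"
proof (rule symI)
  fix a b assume K: "sym K" "(a, b) \<in> glued K"
  then consider "(a, b) \<in> E0" | x y where "(x, y) \<in> K" "(a, b) \<in> G x y" by (auto simp: glued_def)
  then show "(b, a) \<in> glued K"
  proof cases
    case 1
    then show ?thesis using E0_sym by (auto simp: glued_def dest: symD)
  next
    case 2
    then have "(y, x) \<in> K" "(b, a) \<in> G y x" using K(1) G_sym[of y x] by (auto dest: symD)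
    then show ?thesis by (auto simp: glued_def)
  qed
qed

lemma glued_pair: "(x, y) \<in> K ==> sym K ==> pair x y \<subseteq> glued K"
  using G_in[of x y] G_in[of y x] by (auto simp: pair_def glued_def dest: symD)

lemma finite_Out: "finite Out"
proof -
  have "Out \<subseteq> Pow (L \<times> L)" using Out_sub by auto
  then show ?thesis using finite_subset finite_H L_sub by (metis finite_Pow_iff finite_SigmaI)
qed

section \<open>States of the exploration and their weights\<close>

definition free :: "('h \<times> 'h) set => 'h => bool" where
  "free K h \<longleftrightarrow> h \<in> L & h ~: Domain K"

definition fcard :: "('h \<times> 'h) set => 'h set => nat" where
  "fcard K c = card {h \<in> c. free K h}"

text \<open>All letters are counted, free or used, so this factor is unaffected by the discovery of
  a chord and changes only at mergers.\<close>

definition comp_weight :: "('h \<times> 'h) set => real" where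
  "comp_weight E = (\<Prod>C\<in>comps E. theta (card (C \<inter> L)))"

definition wt :: "('h \<times> 'h) set => ('h \<times> 'h) set => real" where
  "wt E K = (\<Prod>c\<in>cycles E. phi (fcard K c)) * comp_weight E"

lemma comp_weight_ge_1: "comp_weight E \<ge> 1"
  unfolding comp_weight_def by (intro prod_ge_1 theta_ge_1)

lemma wt_ge_1: "wt E K \<ge> 1"
proof -
  have "1 <= (\<Prod>c\<in>cycles E. phi (fcard K c))" by (intro prod_ge_1 phi_ge_1)
  then have "1 * 1 <= (\<Prod>c\<in>cycles E. phi (fcard K c)) * comp_weight E"
    using comp_weight_ge_1[of E] by (intro mult_mono) auto
  then show ?thesis by (simp add: wt_def)
qed

lemma fcard_Un: "c \<inter> c' = {} ==> finite c ==> finite c' ==> fcard K (c \<union> c') = fcard K c + fcard K c'"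
  unfolding fcard_def by (subst card_Un_disjoint[symmetric]) (auto intro!: arg_cong[where f = card])

text \<open>In a state, \<open>E\<close> contains the pairs processed so far and \<open>K\<close>
  the chords known so far; \<open>E\<close> lags behind \<open>glued K\<close>. The state is
  resolved if every unknown chord joins different components, so that processing can go on.\<close>

definition resolved :: "('h \<times> 'h) set => ('h \<times> 'h) set => ('h \<times> 'h) set set" where
  "resolved E K = {M \<in> Out. K \<subseteq> M & (\<forall>(x, y)\<in>M - K. (x, y) ~: conn E)}"

text \<open>The state just after a merger: \<open>A @ B\<close> is the current cycle, and a chord
  that has become discoverable runs between its two arcs.\<close>

definition exploring ::
  "('h \<times> 'h) set => ('h \<times> 'h) set => 'h list => 'h list => ('h \<times> 'h) set set" where
  "exploring E K A B = {M \<in> Out. K \<subseteq> M &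
     (\<forall>(x, y)\<in>M - K. (x, y) \<in> conn E --> x \<in> set A & y \<in> set B \<or> x \<in> set B & y \<in> set A)}"

definition rest :: "('h \<times> 'h) set => ('h \<times> 'h) set => 'h set => real" where
  "rest E K c = (\<Prod>c\<in>cycles E - {c}. phi (fcard K c)) * comp_weight E"

lemma rest_ge_1: "rest E K c \<ge> 1"
proof -
  have "1 <= (\<Prod>c\<in>cycles E - {c}. phi (fcard K c))" by (intro prod_ge_1 phi_ge_1)
  then have "1 * 1 <= (\<Prod>c\<in>cycles E - {c}. phi (fcard K c)) * comp_weight E"
    using comp_weight_ge_1[of E] by (intro mult_mono) auto
  then show ?thesis by (simp add: rest_def)
qed

lemma wt_rest: "c \<in> cycles E ==> wt E K = phi (fcard K c) * rest E K c"
  unfolding wt_def rest_def by (simp add: prod.remove[OF finite_cycles] mult.assoc)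

text \<open>Some pair of \<open>glued K\<close> outside \<open>E\<close> is processed. Inside a
  component planarity makes it split a cycle, which \<open>phi_supermult\<close> pays for. Between
  components two cycles fuse; a chord that becomes connected must join the two old components, hence
  the two arcs, and \<open>exploring\<close> takes over. If no pair is left,
  \<open>Out_closed\<close> makes \<open>K\<close> the whole outcome.\<close>

lemma resolved_step:
  assumes IH: "!!E' K'. E \<subset> E' ==> E' \<subseteq> glued K' ==> sym E' ==> E' \<subseteq> H \<times> H ==> sym K' ==>
        real (card (resolved E' K')) <= wt E' K'"
    and IHx: "!!E' K' A B. E \<subset> E' ==> E' \<subseteq> glued K' ==> sym E' ==> E' \<subseteq> H \<times> H ==> sym K' ==>
        cyc (perm E') (A @ B) ==> set (A @ B) \<subseteq> H ==>
        real (card (exploring E' K' A B)) <= arc_weight (fcard K' (set A)) (fcard K' (set B)) * rest E' K' (set (A @ B))"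
    and E: "E \<subseteq> glued K" "sym E" and K: "sym K"
  shows "real (card (resolved E K)) <= wt E K"
proof (cases "resolved E K = {}")
  case True
  then show ?thesis using wt_ge_1[of E K] by simp
next
  case False
  then obtain M where M: "M \<in> Out" "K \<subseteq> M" by (auto simp: resolved_def)
  have mg: "matching H (glued M)" using Out_matching[OF M(1)] by (simp add: glued_def)
  have mK: "matching H (glued K)" using mg glued_mono[OF M(2)] glued_sym[OF K] by (rule matching_subset)
  have mE: "matching H E" using mK E by (rule matching_subset)
  show ?thesis
  proof (cases "E = glued K")
    case True
    have "resolved E K \<subseteq> {K}"
    proof
      fix N assume N: "N \<in> resolved E K"
      show "N \<in> {K}"
      proof (rule ccontr)
        assume "N ~: {K}"
        then have "K \<subset> N" using N by (auto simp: resolved_def)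
        moreover have "N \<in> Out" using N by (simp add: resolved_def)
        ultimately obtain x y where "(x, y) \<in> N - K" "(x, y) \<in> conn E"
          using Out_closed[of N K] K True unfolding glued_def by auto
        then show False using N by (auto simp: resolved_def)
      qed
    qed
    then have "card (resolved E K) <= 1" by (metis card.empty card.insert card_mono empty_iff finite.simps One_nat_def)
    then show ?thesis using wt_ge_1[of E K] by linarith
  next
    case False
    then obtain u v where uv: "(u, v) \<in> glued K" "(u, v) ~: E" using E by auto
    note new = matching_new[OF mK E uv]
    have pl: "same_cycle E u v" if "(u, v) \<in> conn E"
    proof (rule planar_same_cycle[OF mg _ _ E(2) _ uv(2) that])
      show "planar (glued M)" using Out_planar[OF M(1)] by (simp add: glued_def)
      show "E \<subseteq> glued M" "(u, v) \<in> glued M" using E(1) uv(1) glued_mono[OF M(2)] by auto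
    qed
    let ?E = "E \<union> pair u v"
    have E': "E \<subset> ?E" "?E \<subseteq> glued K" "sym ?E" "?E \<subseteq> H \<times> H"
      using uv new by (auto simp: pair_def matching_def)
    show ?thesis
    proof (cases "(u, v) \<in> conn E")
      case True
      obtain A B where AB: "set (u # A @ v # B) \<in> cycles E" 
        "cycles ?E = {set (u # B), set (v # A)} \<union> (cycles E - {set (u # A @ v # B)})"
        "set (u # B) \<inter> set (v # A) = {}"
        "set (u # B) ~: cycles E - {set (u # A @ v # B)}" "set (v # A) ~: cycles E - {set (u # A @ v # B)}"
        using same_cycle_split[OF new(6) mE new(1-3) pl[OF True]] by metis
      have ce: "conn ?E = conn E" by (rule conn_insert_conn[OF E(2) True])
      have "resolved E K = resolved ?E K" by (simp add: resolved_def ce)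
      then have "real (card (resolved E K)) <= wt ?E K" using IH[OF E' K] by simp
      also have "\<dots> = (phi (fcard K (set (u # B))) * phi (fcard K (set (v # A)))) * rest E K (set (u # A @ v # B))"
      proof -
        have ne: "set (u # B) ~= set (v # A)" using AB(3) by auto
        have "(\<Prod>c\<in>cycles ?E. phi (fcard K c)) = phi (fcard K (set (u # B))) * phi (fcard K (set (v # A))) *
            (\<Prod>c\<in>cycles E - {set (u # A @ v # B)}. phi (fcard K c))"
        proof -
          let ?R = "cycles E - {set (u # A @ v # B)}"
          have "(\<Prod>c\<in>cycles ?E. phi (fcard K c)) = (\<Prod>c\<in>insert (set (u # B)) (insert (set (v # A)) ?R). phi (fcard K c))"
            unfolding AB(2) by (rule prod.cong) auto
          also have "\<dots> = phi (fcard K (set (u # B))) * (phi (fcard K (set (v # A))) * (\<Prod>c\<in>?R. phi (fcard K c)))"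
            using AB(4,5) ne finite_cycles[of E] by (subst prod.insert, simp, blast, subst prod.insert) auto
          finally show ?thesis by (simp only: mult.assoc)
        qed
        moreover have "comp_weight ?E = comp_weight E" by (simp add: comp_weight_def comps_def ce)
        ultimately show ?thesis by (simp only: wt_def rest_def mult.assoc)
      qed
      also have "\<dots> <= phi (fcard K (set (u # A @ v # B))) * rest E K (set (u # A @ v # B))"
      proof (rule mult_right_mono)
        have "set (u # A @ v # B) = set (u # B) \<union> set (v # A)" by auto
        then have "fcard K (set (u # A @ v # B)) = fcard K (set (u # B)) + fcard K (set (v # A))"
          using fcard_Un[OF AB(3)] by simp
        then show "phi (fcard K (set (u # B))) * phi (fcard K (set (v # A))) <= phi (fcard K (set (u # A @ v # B)))"
          by (simp only: phi_supermult)
        show "0 <= rest E K (set (u # A @ v # B))" using rest_ge_1[of E K "set (u # A @ v # B)"] by linarith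
      qed
      also have "\<dots> = wt E K" using wt_rest[OF AB(1)] by simp
      finally show ?thesis .
    next
      case nc: False
      then have nsc: "\<not> same_cycle E u v" using same_cycle_conn[OF mE] by blast
      obtain A B where AB: "set (u # A) \<in> cycles E" "set (v # B) \<in> cycles E" "set (u # A) \<inter> set (v # B) = {}"
        "cyc (perm ?E) (u # B @ v # A)" "distinct (u # A)" "distinct (v # B)"
        "cycles ?E = insert (set (u # B @ v # A)) (cycles E - {set (u # A), set (v # B)})"
        "set (u # B @ v # A) ~: cycles E - {set (u # A), set (v # B)}"
        using diff_cycle_join[OF new(6) mE new(1-5) nsc] by metis
      \<comment> \<open>The fused cycle is rotated by one letter so that each of the old cycles
        becomes a contiguous arc.\<close>
      define A' B' where "A' = A @ [u]" and "B' = B @ [v]"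
      have sets: "set A' = set (u # A)" "set B' = set (v # B)" by (auto simp: A'_def B'_def)
      have cyc': "cyc (perm ?E) (B' @ A')"
        using cyc_rotate[OF AB(4), of 1] by (simp add: A'_def B'_def)
      have setBA: "set (B' @ A') = set (u # B @ v # A)" by (auto simp: A'_def B'_def)
      have cH: "c \<subseteq> H" if "c \<in> cycles E" for c using that by (auto simp: cycles_def cycles_on_def)
      have sub: "set (B' @ A') \<subseteq> H" using cH[OF AB(1)] cH[OF AB(2)] sets by auto
      have "resolved E K \<subseteq> exploring ?E K B' A'"
      proof
        fix N assume N: "N \<in> resolved E K"
        then have NO: "N \<in> Out" "K \<subseteq> N" by (auto simp: resolved_def)
        have "x \<in> set B' & y \<in> set A' \<or> x \<in> set A' & y \<in> set B'"
          if xy: "(x, y) \<in> N - K" "(x, y) \<in> conn ?E" for x y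
        proof -
          have ncxy: "(x, y) ~: conn E" using N xy(1) by (auto simp: resolved_def)
          have "(x, y) ~: ?E" using Out_fresh[OF NO K xy(1)] E'(2) by (auto simp: glued_def)
          moreover have "(x, y) \<in> glued N" using glued_pair[of x y N] xy(1) Out_sym[OF NO(1)] by (auto simp: pair_def)
          moreover have "matching H (glued N)" "planar (glued N)"
            using Out_matching[OF NO(1)] Out_planar[OF NO(1)] by (auto simp: glued_def)
          ultimately have "same_cycle ?E x y"
            using planar_same_cycle[of "glued N" ?E x y] E'(2,3) xy(2) glued_mono[OF NO(2)] by blast
          then obtain c where c: "c \<in> cycles ?E" "x \<in> c" "y \<in> c" by (auto simp: same_cycle_def)
          have "c ~: cycles E"
          proof
            assume "c \<in> cycles E"
            then show False using cycle_conn[OF mE _ c(2,3)] ncxy by simp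
          qed
          then have "c = set (u # B @ v # A)" using c(1) unfolding AB(7) by blast
          also have "\<dots> = set A' \<union> set B'" by (auto simp: A'_def B'_def)
          finally have "c = set A' \<union> set B'" .
          moreover have "\<not> (x \<in> set A' & y \<in> set A')" "\<not> (x \<in> set B' & y \<in> set B')"
            using cycle_conn[OF mE AB(1), of x y] cycle_conn[OF mE AB(2), of x y] ncxy unfolding sets by blast+
          ultimately show ?thesis using c(2,3) by blast
        qed
        then show "N \<in> exploring ?E K B' A'" using NO by (auto simp: exploring_def)
      qed
      then have "card (resolved E K) <= card (exploring ?E K B' A')"
        by (intro card_mono) (use finite_Out in \<open>auto simp: exploring_def\<close>)
      also have "real \<dots> <= arc_weight (fcard K (set B')) (fcard K (set A')) * rest ?E K (set (B' @ A'))"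
        by (rule IHx[OF E' K cyc' sub])
      also have "\<dots> <= wt E K"
      proof -
        define Cu Cv where "Cu = conn E `` {u}" and "Cv = conn E `` {v}"
        note j = comps_join[OF E(2) new(4,5) nc, folded Cu_def Cv_def]
        let ?R = "cycles E - {set (u # A), set (v # B)}"
        let ?P = "\<Prod>c\<in>?R. phi (fcard K c)"
        let ?Q = "\<Prod>C\<in>comps E - {Cu, Cv}. theta (card (C \<inter> L))"
        have CH: "C \<subseteq> H" if "C \<in> comps E" for C
          using that conn_in_H[of _ _ E] mE by (auto simp: comps_def matching_def)
        have finC: "finite Cu" "finite Cv" using CH[OF j(4)] CH[OF j(5)] finite_H finite_subset by blast+
        have "cycles ?E - {set (B' @ A')} = ?R" unfolding AB(7) setBA using AB(8) by blast
        then have r: "rest ?E K (set (B' @ A')) = ?P * comp_weight ?E" by (simp only: rest_def)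
        have "comp_weight ?E = theta (card ((Cu \<union> Cv) \<inter> L)) * ?Q"
          unfolding comp_weight_def j(1) using finite_comps[of E] j(6) by (subst prod.insert) auto
        moreover have "card ((Cu \<union> Cv) \<inter> L) = card (Cv \<inter> L) + card (Cu \<inter> L)"
          using j(3) finC by (subst card_Un_disjoint[symmetric]) (auto intro!: arg_cong[where f = card])
        ultimately have cw': "comp_weight ?E = theta (card (Cv \<inter> L) + card (Cu \<inter> L)) * ?Q" by simp
        have cw: "comp_weight E = theta (card (Cv \<inter> L)) * theta (card (Cu \<inter> L)) * ?Q"
        proof -
          have "comp_weight E = (\<Prod>C\<in>insert Cv (insert Cu (comps E - {Cu, Cv})). theta (card (C \<inter> L)))"
            unfolding comp_weight_def by (rule prod.cong) (use j in auto)
          also have "\<dots> = theta (card (Cv \<inter> L)) * (theta (card (Cu \<inter> L)) * ?Q)"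
            using finite_comps[of E] j(2) by (subst prod.insert, simp, simp, subst prod.insert) auto
          finally show ?thesis by simp
        qed
        have ne: "set (u # A) ~= set (v # B)" using AB(3) by auto
        have "wt E K = phi (fcard K (set B')) * phi (fcard K (set A')) * ?P * comp_weight E"
        proof -
          have "(\<Prod>c\<in>cycles E. phi (fcard K c)) = (\<Prod>c\<in>insert (set (v # B)) (insert (set (u # A)) ?R). phi (fcard K c))"
            by (rule prod.cong) (use AB(1,2) in blast)+
          also have "\<dots> = phi (fcard K (set (v # B))) * (phi (fcard K (set (u # A))) * ?P)"
            using finite_cycles[of E] ne by (subst prod.insert, simp, blast, subst prod.insert) auto
          finally show ?thesis by (simp only: wt_def sets mult.assoc)
        qed
        then have w: "wt E K = (phi (fcard K (set B')) * phi (fcard K (set A')) *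
            (theta (card (Cv \<inter> L)) * theta (card (Cu \<inter> L)))) * (?P * ?Q)"
          unfolding cw by (simp only: mult_ac)
        have "set (u # A) \<subseteq> Cu" "set (v # B) \<subseteq> Cv"
          using cycle_conn[OF mE AB(1), of u] cycle_conn[OF mE AB(2), of v] by (auto simp: Cu_def Cv_def)
        then have "fcard K (set B') <= card (Cv \<inter> L)" "fcard K (set A') <= card (Cu \<inter> L)"
          unfolding fcard_def sets free_def using finC by (auto intro!: card_mono)
        then have "arc_weight (fcard K (set B')) (fcard K (set A')) * theta (card (Cv \<inter> L) + card (Cu \<inter> L))
           <= phi (fcard K (set B')) * phi (fcard K (set A')) * (theta (card (Cv \<inter> L)) * theta (card (Cu \<inter> L)))"
          by (rule arc_weight_join)
        moreover have "0 <= ?P * ?Q"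
          using phi_pos theta_ge_1 by (intro mult_nonneg_nonneg prod_nonneg) (auto intro: less_imp_le order_trans[of 0 1])
        ultimately have "arc_weight (fcard K (set B')) (fcard K (set A')) * theta (card (Cv \<inter> L) + card (Cu \<inter> L)) * (?P * ?Q)
          <= wt E K" unfolding w by (rule mult_right_mono)
        then show ?thesis unfolding r cw' by (simp only: mult_ac)
      qed
      finally show ?thesis by simp
    qed
  qed
qed

text \<open>Either nothing is discoverable, or let \<open>x\<close> be the last letter of
  \<open>A\<close> that carries a discoverable chord, with mate \<open>y\<close> in
  \<open>B\<close>. The chord cuts off a cycle with the letters of \<open>A2 x\<close> and
  \<open>B1 y\<close>. No discoverable chord is left there: by the choice of \<open>x\<close> none
  ends in \<open>A2 x\<close>, and a chord ending in \<open>B1 y\<close> would need its other end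
  there. The arcs \<open>A1 x\<close> and \<open>B2 y\<close> remain to be explored, and the sum
  over \<open>x\<close> and \<open>y\<close> is the recursion of \<open>arc_weight\<close>.\<close>

lemma exploring_step:
  assumes res: "real (card (resolved E K)) <= wt E K"
    and IHx: "!!E' K' A B. E \<subset> E' ==> E' \<subseteq> glued K' ==> sym E' ==> E' \<subseteq> H \<times> H ==> sym K' ==>
        cyc (perm E') (A @ B) ==> set (A @ B) \<subseteq> H ==>
        real (card (exploring E' K' A B)) <= arc_weight (fcard K' (set A)) (fcard K' (set B)) * rest E' K' (set (A @ B))"
    and E: "E \<subseteq> glued K" "sym E" and K: "sym K"
    and cy: "cyc (perm E) (A @ B)" and sub: "set (A @ B) \<subseteq> H"
  shows "real (card (exploring E K A B)) <= arc_weight (fcard K (set A)) (fcard K (set B)) * rest E K (set (A @ B))"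
proof -
  define A1 where "A1 x = takeWhile (%y. y ~= x) A" for x
  define A2 where "A2 x = tl (dropWhile (%y. y ~= x) A)" for x
  define B1 where "B1 x = takeWhile (%y. y ~= x) B" for x
  define B2 where "B2 x = tl (dropWhile (%y. y ~= x) B)" for x
  have split: "l = takeWhile (%y. y ~= x) l @ x # tl (dropWhile (%y. y ~= x) l)" if "x \<in> set l" for x and l :: "'h list"
    using that by (induction l) auto
  have dist: "distinct (A @ B)" using cy by (simp add: cyc_def)
  define FA FB where "FA = {x \<in> set A. free K x}" and "FB = {y \<in> set B. free K y}"
  let ?c = "set (A @ B)"
  define Q where "Q x y = {M \<in> exploring E K A B. (x, y) \<in> M - K &
      (\<forall>x'\<in>set (A2 x). \<forall>y'. (x', y') \<in> M - K --> (x', y') ~: conn E)}" for x y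
  have cin: "?c \<in> cycles E" using cy sub unfolding cycles_def cycles_on_def by blast
  have matchM: "matching H (glued M)" "planar (glued M)" if "M \<in> Out" for M
    using Out_matching[OF that] Out_planar[OF that] by (auto simp: glued_def)
  have uniq: "b = b'" if "M \<in> Out" "(a, b) \<in> M" "(a, b') \<in> M" for M a b b'
  proof -
    have "(a, b) \<in> glued M" "(a, b') \<in> glued M"
      using glued_pair[OF that(2) Out_sym[OF that(1)]] glued_pair[OF that(3) Out_sym[OF that(1)]]
      by (auto simp: pair_def)
    then show ?thesis using matchM(1)[OF that(1)] by (auto simp: matching_def dest: single_valuedD)
  qed
  have cover: "exploring E K A B \<subseteq> resolved E K \<union> (\<Union>x\<in>FA. \<Union>y\<in>FB. Q x y)"
  proof
    fix M assume M: "M \<in> exploring E K A B"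
    then have MO: "M \<in> Out" "K \<subseteq> M" by (auto simp: exploring_def)
    show "M \<in> resolved E K \<union> (\<Union>x\<in>FA. \<Union>y\<in>FB. Q x y)"
    proof (cases "M \<in> resolved E K")
      case False
      then obtain a b where ab: "(a, b) \<in> M - K" "(a, b) \<in> conn E" using MO by (auto simp: resolved_def)
      have ba: "(b, a) \<in> M - K" "(b, a) \<in> conn E"
        using ab conn_sym[OF E(2)] K Out_sym[OF MO(1)] by (auto dest: symD)
      define X where "X x \<longleftrightarrow> (\<exists>y. (x, y) \<in> M - K & (x, y) \<in> conn E)" for x
      have "a \<in> set A & b \<in> set B \<or> a \<in> set B & b \<in> set A" using M ab by (auto simp: exploring_def)
      then have "\<exists>x\<in>set A. X x" using ab ba unfolding X_def by blast
      then obtain ys x zs where x: "A = ys @ x # zs" "X x" "\<forall>z\<in>set zs. \<not> X z"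
        using split_list_last_prop[of A X] by blast
      then obtain y where y: "(x, y) \<in> M - K" "(x, y) \<in> conn E" by (auto simp: X_def)
      have "x ~: set ys" using x(1) dist by auto
      then have A2x: "A2 x = zs" unfolding A2_def x(1) by (induction ys) auto
      have "x \<in> set A" "x ~: set B" using x(1) dist by auto
      then have yB: "y \<in> set B" using M y by (auto simp: exploring_def)
      have yx: "(y, x) \<in> M - K" using y K Out_sym[OF MO(1)] by (auto dest: symD)
      have "x \<in> L" "y \<in> L" using Out_sub[OF MO(1)] y by auto
      moreover have "x ~: Domain K" using uniq[OF MO(1), of x y] y MO(2) by blast
      moreover have "y ~: Domain K" using uniq[OF MO(1), of y x] yx MO(2) by blast
      ultimately have "x \<in> FA" "y \<in> FB" using \<open>x \<in> set A\<close> yB by (auto simp: FA_def FB_def free_def)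
      moreover have "M \<in> Q x y" using M y x(3) by (auto simp: Q_def A2x X_def)
      ultimately show ?thesis by blast
    qed simp
  qed
  have bound: "real (card (Q x y)) <= phi (fcard K (set (A2 x)) + fcard K (set (B1 y))) *
      arc_weight (fcard K (set (A1 x))) (fcard K (set (B2 y))) * rest E K ?c"
    if x: "x \<in> FA" and y: "y \<in> FB" for x y
  proof (cases "Q x y = {}")
    case True
    have "0 <= phi (fcard K (set (A2 x)) + fcard K (set (B1 y))) *
      arc_weight (fcard K (set (A1 x))) (fcard K (set (B2 y))) * rest E K ?c"
      using rest_ge_1[of E K ?c] by (intro mult_nonneg_nonneg arc_weight_nonneg less_imp_le[OF phi_pos]) linarith
    then show ?thesis using True by simp
  next
    case False
    then obtain M where M: "M \<in> Out" "K \<subseteq> M" "(x, y) \<in> M" "(x, y) ~: K" by (auto simp: Q_def exploring_def)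
    let ?E = "E \<union> pair x y" and ?K = "K \<union> pair x y"
    have xA: "x \<in> set A" and yB: "y \<in> set B" and fr: "free K x" "free K y" using x y by (auto simp: FA_def FB_def)
    have Aeq: "A = A1 x @ x # A2 x" unfolding A1_def A2_def by (rule split[OF xA])
    have Beq: "B = B1 y @ y # B2 y" unfolding B1_def B2_def by (rule split[OF yB])
    define a1 a2 b1 b2 where "a1 = A1 x" "a2 = A2 x" "b1 = B1 y" "b2 = B2 y"
    have Ae: "A = a1 @ x # a2" and Be: "B = b1 @ y # b2" using Aeq Beq by (simp_all add: a1_a2_b1_b2_def)
    have d: "distinct (a1 @ x # a2 @ b1 @ y # b2)" using dist unfolding Ae Be by simp
    have K': "sym ?K" "K \<subseteq> ?K" using sym_Un[OF K sym_pair] by auto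
    have gK: "glued K \<subseteq> glued M" using glued_mono[OF M(2)] .
    have xyM: "(x, y) \<in> glued M" using glued_pair[OF M(3) Out_sym[OF M(1)]] by (auto simp: pair_def)
    have xyE: "(x, y) ~: E" using Out_fresh[OF M(1,2) K, of x y] M E(1) unfolding glued_def[symmetric] by auto
    have EM: "E \<subseteq> glued M" using E(1) gK by blast
    note new = matching_new[OF matchM(1)[OF M(1)] EM E(2) xyM xyE]
    have mE: "matching H E" using matchM(1)[OF M(1)] EM E(2) by (rule matching_subset)
    have E': "E \<subset> ?E" "?E \<subseteq> glued ?K" "sym ?E" "?E \<subseteq> H \<times> H"
    proof -
      show "?E \<subseteq> H \<times> H" using new(6) by (simp add: matching_def)
      show "E \<subset> ?E" using xyE by (auto simp: pair_def)
      have "pair x y \<subseteq> glued ?K" by (rule glued_pair) (use K' in \<open>auto simp: pair_def\<close>)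
      then show "?E \<subseteq> glued ?K" using E(1) glued_mono[OF K'(2)] by blast
      show "sym ?E" by (rule new(8))
    qed
    have conn_xy: "(x, y) \<in> conn E" by (rule cycle_conn[OF mE cin]) (use xA yB in auto)
    have ce: "conn ?E = conn E" by (rule conn_insert_conn[OF E(2) conn_xy])
    have rot: "rotate (length p) (p @ q) = q @ p" for p q :: "'h list" by (simp add: rotate_append)
    have "cyc (perm E) (x # a2 @ b1 @ y # (b2 @ a1))"
      using cyc_rotate[OF cy, of "length a1"] rot[of a1 "x # a2 @ b1 @ y # b2"] unfolding Ae Be by simp
    then have cy1: "cyc (perm E) (x # (a2 @ b1) @ y # (b2 @ a1))" by simp
    have pE: "perm ?E = (perm E)(x := perm E y, y := perm E x)" by (rule perm_insert[OF new(6,1,2,3)])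
    note sp = cyc_split[OF cy1, folded pE]
    \<comment> \<open>Glued edges stay listed in the cycles, so \<open>x\<close> is carried along at
      the end of the first arc; being in the domain of the new \<open>K\<close>, it no longer counts
      as free.\<close>
    have cyE': "cyc (perm ?E) ((a1 @ [x]) @ b2)"
      using cyc_rotate[OF sp(1), of "length (x # b2)"] rot[of "x # b2" a1] by simp
    define c1 c2 where "c1 = set ((a1 @ [x]) @ b2)" and "c2 = set (y # (a2 @ b1))"
    have c_eq: "set (x # (a2 @ b1) @ y # (b2 @ a1)) = ?c" unfolding Ae Be by auto
    have c1_eq: "set (x # (b2 @ a1)) = c1" unfolding c1_def by auto
    have cycE': "cycles ?E = {c1, c2} \<union> (cycles E - {?c})"
    proof -
      have "set (x # (a2 @ b1) @ y # (b2 @ a1)) \<subseteq> H" unfolding c_eq by (rule sub)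
      from cycles_on_split[OF finite_H bij_perm[OF mE] cy1 this, folded pE]
      show ?thesis unfolding cycles_def c2_def c_eq c1_eq .
    qed
    have c1in: "c1 \<in> cycles ?E" using cycE' by simp
    have subH: "set ((a1 @ [x]) @ b2) \<subseteq> H" using sub unfolding Ae Be by auto
    have "Q x y \<subseteq> exploring ?E ?K (a1 @ [x]) b2"
    proof
      fix N assume N: "N \<in> Q x y"
      then have NO: "N \<in> Out" "K \<subseteq> N" "(x, y) \<in> N" by (auto simp: Q_def exploring_def)
      have KN: "?K \<subseteq> N" using NO Out_sym[OF NO(1)] by (auto simp: pair_def dest: symD)
      have one: "a \<in> set (a1 @ [x]) & b \<in> set b2"
        if ab: "(a, b) \<in> N - ?K" "(a, b) \<in> conn ?E" "a \<in> set A" "b \<in> set B" for a b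
      proof -
        have abK: "(a, b) \<in> N - K" using ab by auto
        have "a ~: set a2" using N abK ab(2) unfolding ce Q_def a1_a2_b1_b2_def by blast
        moreover have "a ~= x" using uniq[OF NO(1,3), of b] ab(1) by (auto simp: pair_def)
        ultimately have a: "a \<in> set a1" using ab(3) unfolding Ae by auto
        have "(a, b) ~: ?E" using Out_fresh[OF NO(1) KN K'(1) ab(1)] E'(2) unfolding glued_def[symmetric] by auto
        moreover have "(a, b) \<in> glued N" using glued_pair[of a b N] ab(1) Out_sym[OF NO(1)] by (auto simp: pair_def)
        moreover have "?E \<subseteq> glued N" using E'(2) glued_mono[OF KN] by blast
        ultimately have "same_cycle ?E a b"
          using planar_same_cycle[OF matchM[OF NO(1)] _ E'(3)] ab(2) by blast
        then obtain c where c: "c \<in> cycles ?E" "a \<in> c" "b \<in> c" by (auto simp: same_cycle_def)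
        have "a \<in> c1" using a by (auto simp: c1_def)
        then have "c = c1" using cycles_on_disjoint[of c H "perm ?E" c1 a] c(1,2) c1in unfolding cycles_def by simp
        then have "b \<in> set a1 \<union> {x} \<union> set b2" using c(3) by (auto simp: c1_def)
        then have "b \<in> set b2" using ab(4) d unfolding Be by auto
        then show ?thesis using a by auto
      qed
      have "a \<in> set (a1 @ [x]) & b \<in> set b2 \<or> a \<in> set b2 & b \<in> set (a1 @ [x])"
        if ab: "(a, b) \<in> N - ?K" "(a, b) \<in> conn ?E" for a b
      proof -
        have "a \<in> set A & b \<in> set B \<or> a \<in> set B & b \<in> set A"
          using N ab unfolding ce Q_def exploring_def by blast
        moreover have "(b, a) \<in> N - ?K" "(b, a) \<in> conn ?E"
          using ab conn_sym[OF E'(3)] Out_sym[OF NO(1)] K'(1) by (auto dest: symD)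
        ultimately show ?thesis using one ab by blast
      qed
      then show "N \<in> exploring ?E ?K (a1 @ [x]) b2" using NO(1) KN by (auto simp: exploring_def)
    qed
    then have "card (Q x y) <= card (exploring ?E ?K (a1 @ [x]) b2)"
      by (intro card_mono) (use finite_Out in \<open>auto simp: exploring_def\<close>)
    also have "real \<dots> <= arc_weight (fcard ?K (set (a1 @ [x]))) (fcard ?K (set b2)) * rest ?E ?K (set ((a1 @ [x]) @ b2))"
      by (rule IHx[OF E' K'(1) cyE' subH])
    also have "\<dots> = phi (fcard K (set a2) + fcard K (set b1)) * arc_weight (fcard K (set a1)) (fcard K (set b2)) * rest E K ?c"
    proof -
      have fr': "free ?K h \<longleftrightarrow> free K h & h ~= x & h ~= y" for h by (auto simp: free_def pair_def)
      have same: "fcard ?K s = fcard K s" if "x ~: s" "y ~: s" for s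
        unfolding fcard_def fr' using that by (intro arg_cong[where f = card]) auto
      have f1: "fcard ?K (set (a1 @ [x])) = fcard K (set a1)"
        unfolding fcard_def fr' using d by (intro arg_cong[where f = card]) auto
      have f2: "fcard ?K (set b2) = fcard K (set b2)" by (rule same) (use d in auto)
      have f3: "fcard ?K c2 = fcard K (set a2) + fcard K (set b1)"
      proof -
        have "fcard ?K c2 = fcard K (set a2 \<union> set b1)"
          unfolding fcard_def fr' c2_def using d by (intro arg_cong[where f = card]) auto
        then show ?thesis using d by (subst fcard_Un[symmetric]) auto
      qed
      have oth: "x ~: c & y ~: c" if "c \<in> cycles E - {?c}" for c
        using cycles_on_disjoint[of c H "perm E" ?c] cin that xA yB unfolding cycles_def by auto
      have "c1 ~= c2" "c2 ~: cycles E - {?c}" "c1 ~: cycles E - {?c}"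
        using oth[of c2] oth[of c1] d by (auto simp: c1_def c2_def)
      then have "cycles ?E - {c1} = insert c2 (cycles E - {?c})" unfolding cycE' by auto
      then have "(\<Prod>c\<in>cycles ?E - {c1}. phi (fcard ?K c)) = phi (fcard ?K c2) * (\<Prod>c\<in>cycles E - {?c}. phi (fcard ?K c))"
        using finite_cycles[of E] \<open>c2 ~: cycles E - {?c}\<close> by (simp only:) (subst prod.insert; simp)
      also have "(\<Prod>c\<in>cycles E - {?c}. phi (fcard ?K c)) = (\<Prod>c\<in>cycles E - {?c}. phi (fcard K c))"
        by (intro prod.cong refl) (use oth same in auto)
      finally have "rest ?E ?K c1 = phi (fcard K (set a2) + fcard K (set b1)) * rest E K ?c"
        unfolding rest_def f3 by (simp add: comp_weight_def comps_def ce)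
      then show ?thesis unfolding f1 f2 c1_def[symmetric] by simp
    qed
    finally show ?thesis by (simp add: a1_a2_b1_b2_def)
  qed
  have fin: "finite FA" "finite FB" by (auto simp: FA_def FB_def)
  have finQ: "finite (Q x y)" for x y
    by (rule finite_subset[OF _ finite_Out]) (auto simp: Q_def exploring_def)
  have finr: "finite (resolved E K)"
    by (rule finite_subset[OF _ finite_Out]) (auto simp: resolved_def)
  let ?T = "%x y. phi (fcard K (set (A2 x)) + fcard K (set (B1 y))) *
      arc_weight (fcard K (set (A1 x))) (fcard K (set (B2 y)))"
  have "card (exploring E K A B) <= card (resolved E K \<union> (\<Union>x\<in>FA. \<Union>y\<in>FB. Q x y))"
    using cover fin finQ finr by (intro card_mono) auto
  also have "\<dots> <= card (resolved E K) + (\<Sum>x\<in>FA. \<Sum>y\<in>FB. card (Q x y))"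
  proof -
    have "card (\<Union>x\<in>FA. \<Union>y\<in>FB. Q x y) <= (\<Sum>x\<in>FA. card (\<Union>y\<in>FB. Q x y))"
      by (rule card_UN_le[OF fin(1)])
    also have "\<dots> <= (\<Sum>x\<in>FA. \<Sum>y\<in>FB. card (Q x y))"
      by (intro sum_mono card_UN_le fin)
    finally show ?thesis by (intro order_trans[OF card_Un_le] add_left_mono)
  qed
  finally have "real (card (exploring E K A B)) <= real (card (resolved E K)) + (\<Sum>x\<in>FA. \<Sum>y\<in>FB. real (card (Q x y)))"
    by (simp flip: of_nat_sum of_nat_add)
  also have "\<dots> <= wt E K + (\<Sum>x\<in>FA. \<Sum>y\<in>FB. ?T x y * rest E K ?c)"
    by (intro add_mono res sum_mono bound)
  also have "\<dots> = (phi (fcard K ?c) + (\<Sum>x\<in>FA. \<Sum>y\<in>FB. ?T x y)) * rest E K ?c"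
    using wt_rest[OF cin] by (simp add: distrib_right sum_distrib_right)
  also have "phi (fcard K ?c) + (\<Sum>x\<in>FA. \<Sum>y\<in>FB. ?T x y) = arc_weight (fcard K (set A)) (fcard K (set B))"
  proof -
    have "fcard K ?c = fcard K (set A) + fcard K (set B)"
      using dist by (subst fcard_Un[symmetric]) auto
    moreover have "(\<Sum>y\<in>FB. phi (q + fcard K (set (B1 y))) * arc_weight p (fcard K (set (B2 y))))
        = (\<Sum>h<fcard K (set B). phi (q + h) * arc_weight p (fcard K (set B) - 1 - h))" for p q
    proof -
      have "(\<Sum>y\<in>FB. phi (q + fcard K (set (B1 y))) * arc_weight p (fcard K (set (B2 y))))
        = (\<Sum>g<fcard K (set B). phi (q + (fcard K (set B) - 1 - g)) * arc_weight p g)"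
        unfolding FB_def fcard_def B1_def B2_def
        using sum_over_letters[of B "%a b. phi (q + a) * arc_weight p b" "free K"] dist by simp
      also have "\<dots> = (\<Sum>h<fcard K (set B). phi (q + h) * arc_weight p (fcard K (set B) - 1 - h))"
        by (rule sum.reindex_bij_witness[of _ "%g. fcard K (set B) - 1 - g" "%g. fcard K (set B) - 1 - g"]) auto
      finally show ?thesis .
    qed
    moreover have "(\<Sum>x\<in>FA. \<Sum>h<fcard K (set B). phi (fcard K (set (A2 x)) + h) *
          arc_weight (fcard K (set (A1 x))) (fcard K (set B) - 1 - h))
        = (\<Sum>g<fcard K (set A). \<Sum>h<fcard K (set B). phi (g + h) *
          arc_weight (fcard K (set A) - 1 - g) (fcard K (set B) - 1 - h))"
    proof -
      define n where "n = fcard K (set B)"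
      show ?thesis
        unfolding n_def[symmetric] unfolding FA_def fcard_def A1_def A2_def
        using sum_over_letters[of A "%a b. \<Sum>h<n. phi (b + h) * arc_weight a (n - 1 - h)" "free K"] dist by simp
    qed
    ultimately show ?thesis by (subst arc_weight.simps) simp
  qed
  finally show ?thesis .
qed

text \<open>Every transition enlarges \<open>E\<close>, except the one from \<open>exploring\<close>
  to \<open>resolved\<close>, which keeps it; hence at each level the bound for
  \<open>resolved\<close> is established first.\<close>

lemma card_resolved_exploring_le:
  assumes "E \<subseteq> glued K" "sym E" "E \<subseteq> H \<times> H" "sym K"
  shows "real (card (resolved E K)) <= wt E K &
    (\<forall>A B. cyc (perm E) (A @ B) --> set (A @ B) \<subseteq> H -->
      real (card (exploring E K A B)) <= arc_weight (fcard K (set A)) (fcard K (set B)) * rest E K (set (A @ B)))"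
  using assms
proof (induction "card (H \<times> H - E)" arbitrary: E K rule: less_induct)
  case less
  have IH: "real (card (resolved E' K')) <= wt E' K' &
    (\<forall>A B. cyc (perm E') (A @ B) --> set (A @ B) \<subseteq> H -->
      real (card (exploring E' K' A B)) <= arc_weight (fcard K' (set A)) (fcard K' (set B)) * rest E' K' (set (A @ B)))"
    if "E \<subset> E'" "E' \<subseteq> glued K'" "sym E'" "E' \<subseteq> H \<times> H" "sym K'" for E' K'
  proof -
    have "card (H \<times> H - E') < card (H \<times> H - E)"
      using that finite_H by (intro psubset_card_mono) auto
    then show ?thesis using less.hyps that(2-5) by blast
  qed
  have res: "real (card (resolved E K)) <= wt E K"
    by (rule resolved_step) (use IH less.prems in blast)+
  have "real (card (exploring E K A B)) <= arc_weight (fcard K (set A)) (fcard K (set B)) * rest E K (set (A @ B))"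
    if "cyc (perm E) (A @ B)" "set (A @ B) \<subseteq> H" for A B
    by (rule exploring_step[OF res _ less.prems(1,2,4) that]) (use IH in blast)
  with res show ?case by blast
qed

text \<open>Before any pairing a component is a single polygon, so the two products in the initial
  weight run over the same index set.\<close>

lemma comps_empty: "comps {} = cycles {}"
proof -
  have p: "perm {} = nxt" by (auto simp: perm_def mate_def)
  have m: "matching H {}" by (auto simp: matching_def sym_def single_valued_def)
  have cl: "conn {} `` {h} = c" if c: "c \<in> cycles {}" "h \<in> c" for c h
  proof
    show "c \<subseteq> conn {} `` {h}" using cycle_conn[OF m c(1,2)] by auto
    obtain l where l: "c = set l" "cyc nxt l" "set l \<subseteq> H" using c(1) by (auto simp: cycles_def cycles_on_def p)
    have "b \<in> c" if "(h, b) \<in> conn {}" for b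
      using that unfolding conn_def
    proof (induction rule: rtrancl_induct)
      case (step y z)
      then consider "y \<in> H" "z = nxt y" | "z \<in> H" "y = nxt z" by (auto simp: nx_def)
      then show ?case
      proof cases
        case 1
        then show ?thesis using cyc_image[OF l(2)] l(1) step.IH by blast
      next
        case 2
        obtain c' where c': "c' \<in> cycles {}" "z \<in> c'"
          using cycles_on_cover[OF finite_H bij_perm[OF m] 2(1)] by (auto simp: cycles_def)
        then obtain l' where l': "c' = set l'" "cyc nxt l'" by (auto simp: cycles_def cycles_on_def p)
        then have "y \<in> c'" using cyc_image[OF l'(2)] c'(2) 2(2) by blast
        then have "c' = c" using cycles_on_disjoint[of c' H "perm {}" c y] c'(1) c(1) step.IH unfolding cycles_def by simp
        then show ?thesis using c'(2) by simp
      qed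
    qed (use c in simp)
    then show "conn {} `` {h} \<subseteq> c" by auto
  qed
  have ex: "\<exists>c\<in>cycles {}. h \<in> c" if "h \<in> H" for h
    using cycles_on_cover[OF finite_H bij_perm[OF m] that] by (auto simp: cycles_def)
  show ?thesis
  proof
    show "comps {} \<subseteq> cycles {}" using cl ex by (fastforce simp: comps_def)
    show "cycles {} \<subseteq> comps {}"
    proof
      fix c assume c: "c \<in> cycles {}"
      then have "c ~= {}" "c \<subseteq> H"
        using cycles_on_nonempty[of c H "perm {}"] by (auto simp: cycles_def) (auto simp: cycles_on_def)
      then obtain h where h: "h \<in> c" "h \<in> H" by auto
      then show "c \<in> comps {}" using cl[OF c h(1)] by (auto simp: comps_def)
    qed
  qed
qed

lemma card_Out_le: "real (card Out) <= 12 ^ card L"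
proof -
  have "Out = resolved {} {}" using Out_start by (auto simp: resolved_def)
  then have "real (card Out) <= wt {} {}"
    using card_resolved_exploring_le[of "{}" "{}"] by (simp add: sym_def)
  also have "\<dots> = (\<Prod>c\<in>cycles {}. phi (card (c \<inter> L)) * theta (card (c \<inter> L)))"
  proof -
    have "fcard {} c = card (c \<inter> L)" for c
      unfolding fcard_def free_def by (intro arg_cong[where f = card]) auto
    then show ?thesis by (simp add: wt_def comp_weight_def comps_empty prod.distrib)
  qed
  also have "\<dots> <= (\<Prod>c\<in>cycles {}. 12 ^ card (c \<inter> L))"
    using phi_pos theta_ge_1 phi_theta_le
    by (intro prod_mono conjI mult_nonneg_nonneg) (auto intro: less_imp_le order_trans[of 0 1])
  also have "\<dots> = 12 ^ (\<Sum>c\<in>cycles {}. card (c \<inter> L))" by (simp add: power_sum)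
  also have "(\<Sum>c\<in>cycles {}. card (c \<inter> L)) = card (\<Union>c\<in>cycles {}. c \<inter> L)"
  proof (rule card_UN_disjoint[symmetric])
    show "\<forall>c\<in>cycles {}. finite (c \<inter> L)" using finite_subset[OF L_sub finite_H] by auto
    have "c = c'" if "c \<in> cycles {}" "c' \<in> cycles {}" "h \<in> c" "h \<in> c'" for c c' h
      using cycles_on_disjoint[of c H "perm {}" c' h] that unfolding cycles_def by simp
    then show "\<forall>c\<in>cycles {}. \<forall>c'\<in>cycles {}. c ~= c' --> c \<inter> L \<inter> (c' \<inter> L) = {}"
      by blast
  qed (rule finite_cycles)
  also have "(\<Union>c\<in>cycles {}. c \<inter> L) = L"
  proof -
    have "matching H {}" by (auto simp: matching_def sym_def single_valued_def)
    then show ?thesis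
      using cycles_on_Union[OF finite_H bij_perm] L_sub unfolding cycles_def by blast
  qed
  finally show ?thesis .
qed

end

section \<open>Topology of disks and regular cells\<close>

text \<open>Euclidean spaces and disks are recast as subsets of the type \<open>nat => real\<close>,
  whose type-class topology is the product topology; this makes \<open>continuous_on\<close> and
  \<open>open\<close> available.\<close>

definition EE :: "nat => (nat => real) set" where "EE n = {x. \<forall>i\<ge>n. x i = 0}"

definition qq :: "nat => (nat => real) => real" where "qq n x = (\<Sum>i<n. (x i)\<^sup>2)"

definition DD :: "nat => (nat => real) set" where "DD n = {x \<in> EE n. qq n x <= 1}"

definition SS :: "nat => (nat => real) set" where "SS n = {x \<in> EE n. qq n x = 1}"

lemma Euclidean_space_EE: "Euclidean_space n = top_of_set (EE n)"
  by (simp add: Euclidean_space_def euclidean_product_topology EE_def)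

lemma disk_DD: "disk n = top_of_set (DD n)"
proof -
  have "DD n = EE n \<inter> {x. (\<Sum>i<n. (x i)\<^sup>2) <= 1}" by (auto simp: DD_def qq_def)
  then show ?thesis by (simp only: disk_def Euclidean_space_EE subtopology_subtopology)
qed

lemma topspace_disk [simp]: "topspace (disk n) = DD n" by (simp add: disk_DD)

lemma disk_boundary_SS: "disk_boundary n = SS n"
  by (auto simp: disk_boundary_def SS_def DD_def qq_def)

lemma SS_sub_DD: "SS n \<subseteq> DD n" by (auto simp: SS_def DD_def)

lemma DD_sub_EE: "DD n \<subseteq> EE n" by (auto simp: DD_def)

lemma continuous_on_coord [continuous_intros]:
  "continuous_on S (%x :: nat => real. x i)"
  by (rule continuous_on_subset[OF continuous_on_product_coordinates]) simp

lemma continuous_on_funI: "(!!i. continuous_on S (%x. f x i)) ==> continuous_on S (f :: 'b::topological_space => nat => real)"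
  by (rule continuous_on_coordinatewise_then_product)

lemma continuous_on_funD: "continuous_on S (f :: 'b::topological_space => nat => real) ==> continuous_on S (%x. f x i)"
  by (rule continuous_on_product_then_coordinatewise)

lemma continuous_on_qq [continuous_intros]: "continuous_on S (qq n)"
  unfolding qq_def by (intro continuous_intros)

lemma qq_nonneg: "qq n x \<ge> 0" by (simp add: qq_def sum_nonneg)

lemma qq_scale: "qq n (%i. t * x i) = t\<^sup>2 * qq n x"
  by (simp add: qq_def power_mult_distrib sum_distrib_left)

lemma qq_upd: "k \<ge> n ==> qq n (x(k := t)) = qq n x"
  by (simp add: qq_def)

lemma zero_in_DD: "(%i. 0) \<in> DD n" by (simp add: DD_def EE_def qq_def)

lemma zero_notin_SS: "(%i. 0) ~: SS n" by (simp add: SS_def qq_def)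

text \<open>If m < n, invariance of domain makes the image open in \<open>EE n\<close>. But the
  image lies where coordinate \<open>m\<close> vanishes, and a small change of that coordinate
  leaves it.\<close>

lemma injective_dim_le:
  assumes U: "openin (top_of_set (EE n)) U" "U ~= {}"
    and f: "continuous_on U f" "inj_on f U" "f ` U \<subseteq> EE m"
  shows "n <= m"
proof (rule ccontr)
  assume "\<not> n <= m"
  then have mn: "m < n" by simp
  have sub: "EE m \<subseteq> EE n" using mn by (auto simp: EE_def)
  have UE: "U \<subseteq> EE n" using U(1) openin_imp_subset by blast
  have "openin (top_of_set (EE n)) (f ` U)"
  proof (rule invariance_of_domain_Euclidean_space[unfolded Euclidean_space_EE, OF U(1) _ f(2)])
    show "continuous_map (subtopology (top_of_set (EE n)) U) (top_of_set (EE n)) f"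
      using f UE sub by (simp add: subtopology_subtopology inf.absorb2 image_subset_iff_funcset[symmetric])
  qed
  then obtain T where T: "open T" "f ` U = EE n \<inter> T" by (auto simp: openin_open)
  obtain y where y: "y \<in> f ` U" using U(2) by auto
  then have yT: "y \<in> T" "y \<in> EE m" using T f(3) by auto
  have c: "continuous_on UNIV (%t. y(m := t))"
  proof (rule continuous_on_funI)
    fix i show "continuous_on UNIV (%t. (y(m := t)) i)"
      by (cases "i = m") (auto intro: continuous_intros)
  qed
  have "open ((%t. y(m := t)) -` T)" using c T(1) by (simp add: open_vimage)
  moreover have "0 \<in> (%t. y(m := t)) -` T"
  proof -
    have "y(m := 0) = y" using yT(2) by (auto simp: EE_def)
    then show ?thesis using yT by simp
  qed
  ultimately obtain e where e: "e > 0" "ball 0 e \<subseteq> (%t. y(m := t)) -` T" by (meson openE)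
  have "e / 2 \<in> ball 0 e" using e(1) by (simp add: dist_real_def)
  then have "e / 2 \<in> (%t. y(m := t)) -` T" using e(2) by (rule rev_subsetD)
  moreover have "y(m := e / 2) \<in> EE n" using yT(2) mn by (auto simp: EE_def)
  ultimately have "y(m := e / 2) \<in> EE m" using T(2) f(3) by auto
  then show False using e(1) by (auto simp: EE_def)
qed

text \<open>Scaling the sphere-valued map by an extra positive coordinate embeds an open set of
  dimension k + 1 into the ambient space of the sphere.\<close>

lemma disk_into_sphere_dim_le:
  assumes p: "continuous_on (DD k - SS k) p" "inj_on p (DD k - SS k)" "p ` (DD k - SS k) \<subseteq> SS n"
  shows "Suc k <= n"
proof -
  define W where "W = EE (Suc k) \<inter> ({x. qq k x < 1} \<inter> {x. 0 < x k})"
  have odisk: "x(k := 0) \<in> DD k - SS k" if "x \<in> W" for x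
  proof -
    have "x(k := 0) \<in> EE k" using that by (auto simp: W_def EE_def)
    then show ?thesis using that by (auto simp: W_def DD_def SS_def qq_upd)
  qed
  have "open ({x. qq k x < 1} \<inter> {x :: nat => real. 0 < x k})"
    by (intro open_Int open_Collect_less continuous_intros)
  then have opW: "openin (top_of_set (EE (Suc k))) W" unfolding W_def by (rule openin_open_Int)
  have ne: "W ~= {}"
  proof -
    have "(%i. 0)(k := 1) \<in> W" by (auto simp: W_def EE_def qq_upd) (simp add: qq_def)
    then show ?thesis by auto
  qed
  have cu: "continuous_on W (%x. x(k := 0))"
  proof (rule continuous_on_funI)
    fix i show "continuous_on W (%x. (x(k := 0)) i)" by (cases "i = k") (auto intro: continuous_intros)
  qed
  have cp: "continuous_on W (%x. p (x(k := 0)))"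
    using continuous_on_compose2[OF p(1) cu] odisk by blast
  define f where "f x = (%i. x k * p (x(k := 0)) i)" for x
  have "continuous_on W f" unfolding f_def
    by (intro continuous_on_funI continuous_on_mult continuous_on_coord continuous_on_funD[OF cp])
  moreover have "inj_on f W"
  proof (rule inj_onI)
    fix x y assume xy: "x \<in> W" "y \<in> W" "f x = f y"
    have q: "qq n (f x) = (x k)\<^sup>2" if "x \<in> W" for x
      using p(3) odisk[OF that] unfolding f_def qq_scale by (auto simp: SS_def)
    have "(x k)\<^sup>2 = (y k)\<^sup>2" using q xy by metis
    then have k: "x k = y k" using xy by (auto simp: W_def power2_eq_iff)
    have "p (x(k := 0)) i = p (y(k := 0)) i" for i
      using fun_cong[OF xy(3), of i] k xy(1) by (auto simp: f_def W_def)
    then have "p (x(k := 0)) = p (y(k := 0))" by auto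
    then have "x(k := 0) = y(k := 0)" using p(2) odisk[OF xy(1)] odisk[OF xy(2)] by (auto dest: inj_onD)
    then show "x = y" using k by (metis fun_upd_triv fun_upd_upd)
  qed
  moreover have "f ` W \<subseteq> EE n"
  proof
    fix z assume "z \<in> f ` W"
    then obtain x where x: "x \<in> W" "z = f x" by auto
    have "p (x(k := 0)) \<in> EE n" using p(3) odisk[OF x(1)] by (auto simp: SS_def)
    then show "z \<in> EE n" using x by (auto simp: f_def EE_def)
  qed
  ultimately show ?thesis by (rule injective_dim_le[OF opW ne])
qed

text \<open>An open part of the sphere is thickened radially to an open set of dimension
  \<open>n\<close>; the norm is recorded as an additional coordinate at position
  \<open>k\<close>.\<close>

lemma sphere_into_space_dim_le:
  assumes U: "openin (top_of_set (SS n)) U" "U ~= {}"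
    and p: "continuous_on U p" "inj_on p U" "p ` U \<subseteq> EE k"
  shows "n <= Suc k"
proof -
  obtain T where T: "open T" "U = SS n \<inter> T" using U(1) by (auto simp: openin_open)
  define nm where "nm x = (%i. inverse (sqrt (qq n x)) * x i)" for x
  define S where "S = EE n \<inter> {x. 0 < qq n x}"
  define W where "W = S \<inter> nm -` T"
  have nmS: "nm x \<in> SS n" if "x \<in> S" for x
  proof -
    have "qq n (nm x) = 1" using that unfolding nm_def qq_scale by (simp add: S_def power_inverse)
    then show ?thesis using that by (auto simp: SS_def S_def EE_def nm_def)
  qed
  have opS: "openin (top_of_set (EE n)) S" unfolding S_def
    by (intro openin_open_Int open_Collect_less continuous_intros)
  have cn: "continuous_on S nm" unfolding nm_def
    by (intro continuous_on_funI continuous_on_mult continuous_on_inverse continuous_on_real_sqrt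
        continuous_on_qq continuous_on_coord) (auto simp: S_def)
  have "openin (top_of_set S) W" unfolding W_def
    by (rule continuous_openin_preimage_gen[OF cn T(1)])
  then have opW: "openin (top_of_set (EE n)) W" using opS openin_trans by blast
  have fix_: "nm u = u" "u \<in> S" if "u \<in> SS n" for u
    using that by (auto simp: nm_def S_def SS_def)
  have "U \<subseteq> W" using fix_ unfolding T(2) W_def by auto
  then have ne: "W ~= {}" using U(2) by auto
  have nmU: "nm x \<in> U" if "x \<in> W" for x using that nmS unfolding T(2) W_def by auto
  have cp: "continuous_on W (%x. p (nm x))"
  proof (rule continuous_on_compose2[OF p(1)])
    show "continuous_on W nm" by (rule continuous_on_subset[OF cn]) (auto simp: W_def)
    show "nm ` W \<subseteq> U" using nmU by auto
  qed
  define f where "f x = (p (nm x))(k := sqrt (qq n x))" for x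
  have "continuous_on W f"
  proof (rule continuous_on_funI)
    fix i show "continuous_on W (%x. f x i)"
      by (cases "i = k") (auto simp: f_def intro: continuous_on_funD[OF cp] continuous_intros)
  qed
  moreover have "inj_on f W"
  proof (rule inj_onI)
    fix x y assume xy: "x \<in> W" "y \<in> W" "f x = f y"
    have r: "sqrt (qq n x) = sqrt (qq n y)" using fun_cong[OF xy(3), of k] by (simp add: f_def)
    have z: "p (nm z) k = 0" if "z \<in> W" for z
      using subsetD[OF p(3) imageI[OF nmU[OF that]]] by (simp add: EE_def)
    have "p (nm x) = p (nm y)"
    proof
      fix i show "p (nm x) i = p (nm y) i"
        using fun_cong[OF xy(3), of i] z[OF xy(1)] z[OF xy(2)]
        by (cases "i = k") (auto simp: f_def)
    qed
    then have "nm x = nm y" using p(2) nmU xy(1,2) by (auto dest: inj_onD)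
    moreover have "sqrt (qq n y) > 0" using xy(2) by (auto simp: W_def S_def)
    ultimately show "x = y" using r by (auto simp: nm_def fun_eq_iff)
  qed
  moreover have "f ` W \<subseteq> EE (Suc k)"
  proof
    fix z assume "z \<in> f ` W"
    then obtain x where x: "x \<in> W" "z = f x" by auto
    have "p (nm x) \<in> EE k" using p(3) nmU[OF x(1)] by auto
    then show "z \<in> EE (Suc k)" using x by (auto simp: f_def EE_def)
  qed
  ultimately show ?thesis by (rule injective_dim_le[OF opW ne])
qed

lemma compact_DD: "compact (DD n)"
proof -
  have "compactin (product_topology (%_. euclideanreal) UNIV) (PiE UNIV (%_. {-1..1}))"
    by (subst compactin_PiE) auto
  then have "compact (PiE UNIV (%_ :: nat. {-1..1 :: real}))" by (simp add: euclidean_product_topology)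
  moreover have "closed (DD n)"
  proof -
    have "DD n = (\<Inter>i\<in>{n..}. {x. x i = 0}) \<inter> {x. qq n x <= 1}" by (auto simp: DD_def EE_def)
    moreover have "closed \<dots>"
      by (intro closed_Int closed_INT ballI closed_Collect_eq closed_Collect_le continuous_intros)
    ultimately show ?thesis by simp
  qed
  moreover have "DD n \<subseteq> PiE UNIV (%_ :: nat. {-1..1 :: real})"
  proof
    fix x assume x: "x \<in> DD n"
    have "\<bar>x i\<bar> <= 1" for i
    proof (cases "i < n")
      case True
      then have "(x i)\<^sup>2 <= qq n x" unfolding qq_def by (intro member_le_sum) auto
      then have "(x i)\<^sup>2 <= 1" using x by (simp add: DD_def)
      then show ?thesis by (simp add: abs_square_le_1)
    qed (use x in \<open>auto simp: DD_def EE_def\<close>)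
    then show "x \<in> PiE UNIV (%_. {-1..1})" by (auto simp: abs_le_iff minus_le_iff)
  qed
  ultimately show ?thesis by (metis compact_Int_closed inf.absorb_iff2)
qed

lemma compact_space_disk: "compact_space (disk n)"
  using compact_DD by (simp add: disk_DD compact_space_subtopology)

section \<open>Face posets and cells of regular CW-complexes\<close>

lemma poset_iso_card:
  assumes "poset_iso A B" shows "card A = card B"
  using assms by (auto simp: poset_iso_def dest: bij_betw_same_card)

lemma poset_iso_sym:
  assumes "poset_iso A B" shows "poset_iso B A"
proof -
  obtain f where f: "bij_betw f A B" "!!x y. x \<in> A ==> y \<in> A ==> x \<subseteq> y \<longleftrightarrow> f x \<subseteq> f y"
    using assms by (auto simp: poset_iso_def)
  have g: "bij_betw (inv_into A f) B A" using f(1) by (rule bij_betw_inv_into)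
  have "inv_into A f x \<in> A" "f (inv_into A f x) = x" if "x \<in> B" for x
    using f(1) that by (auto simp: bij_betw_def inv_into_into f_inv_into_f)
  then have "\<forall>x\<in>B. \<forall>y\<in>B. x \<subseteq> y \<longleftrightarrow> inv_into A f x \<subseteq> inv_into A f y" using f(2) by metis
  with g show ?thesis by (auto simp: poset_iso_def)
qed

lemma poset_iso_trans:
  assumes "poset_iso A B" "poset_iso B C" shows "poset_iso A C"
proof -
  obtain f where f: "bij_betw f A B" "!!x y. x \<in> A ==> y \<in> A ==> x \<subseteq> y \<longleftrightarrow> f x \<subseteq> f y"
    using assms(1) by (auto simp: poset_iso_def)
  obtain g where g: "bij_betw g B C" "!!x y. x \<in> B ==> y \<in> B ==> x \<subseteq> y \<longleftrightarrow> g x \<subseteq> g y"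
    using assms(2) by (auto simp: poset_iso_def)
  have "\<forall>x\<in>A. \<forall>y\<in>A. x \<subseteq> y \<longleftrightarrow> (g \<circ> f) x \<subseteq> (g \<circ> f) y"
  proof (intro ballI)
    fix x y assume xy: "x \<in> A" "y \<in> A"
    then have "f x \<in> B" "f y \<in> B" using f(1) by (auto simp: bij_betw_def)
    then show "x \<subseteq> y \<longleftrightarrow> (g \<circ> f) x \<subseteq> (g \<circ> f) y" using f(2)[OF xy] g(2) by simp
  qed
  then show ?thesis unfolding poset_iso_def using bij_betw_trans[OF f(1) g(1)] by blast
qed

locale rcw =
  fixes K :: "'a cell_complex"
  assumes reg: "regular_cw K"
begin

definition cint :: "'a set => 'a set" where "cint \<sigma> = \<sigma> - cell_boundary K \<sigma>"

lemma finite_cells: "finite (cells K)" using reg by (simp add: regular_cw_def)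

lemma Hausdorff: "Hausdorff_space (cspace K)" using reg by (simp add: regular_cw_def)

lemma topspace_cells: "topspace (cspace K) = \<Union>(cells K)" using reg by (simp add: regular_cw_def)

lemma cell_sub: "\<sigma> \<in> cells K ==> \<sigma> \<subseteq> topspace (cspace K)" by (auto simp: topspace_cells)

lemma topspace_cell [simp]: "\<sigma> \<in> cells K ==> topspace (subtopology (cspace K) \<sigma>) = \<sigma>"
  by (simp add: topspace_subtopology inf.absorb2 cell_sub)

lemma cell_homeo:
  assumes "\<sigma> \<in> cells K"
  obtains n h g where "homeomorphic_maps (disk n) (subtopology (cspace K) \<sigma>) h g"
    "h ` SS n = cell_boundary K \<sigma>"
proof -
  have "\<forall>\<sigma>\<in>cells K. \<exists>n h. homeomorphic_map (disk n) (subtopology (cspace K) \<sigma>) h &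
                         h ` disk_boundary n = cell_boundary K \<sigma>"
    using reg unfolding regular_cw_def by (elim conjE)
  from bspec[OF this assms] obtain n h where h: "homeomorphic_map (disk n) (subtopology (cspace K) \<sigma>) h"
    "h ` disk_boundary n = cell_boundary K \<sigma>"
    by (elim exE conjE)
  then obtain g where "homeomorphic_maps (disk n) (subtopology (cspace K) \<sigma>) h g"
    by (auto simp: homeomorphic_map_maps)
  with h(2) that show ?thesis by (simp add: disk_boundary_SS)
qed

lemma cell_closed: "\<sigma> \<in> cells K ==> closedin (cspace K) \<sigma>"
proof -
  assume s: "\<sigma> \<in> cells K"
  obtain n h g where "homeomorphic_maps (disk n) (subtopology (cspace K) \<sigma>) h g" "h ` SS n = cell_boundary K \<sigma>"
    using cell_homeo[OF s] .
  then have "disk n homeomorphic_space subtopology (cspace K) \<sigma>" by (auto simp: homeomorphic_space_def)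
  then have "compact_space (subtopology (cspace K) \<sigma>)"
    using compact_space_disk homeomorphic_compact_space by blast
  then have "compactin (cspace K) \<sigma>" using cell_sub[OF s] by (simp add: compactin_subspace)
  then show ?thesis using Hausdorff compactin_imp_closedin by blast
qed

lemma homeo_facts:
  assumes "homeomorphic_maps (disk n) (subtopology (cspace K) \<sigma>) h g" "\<sigma> \<in> cells K"
  shows "h ` DD n = \<sigma>" "g ` \<sigma> = DD n" "!!x. x \<in> DD n ==> g (h x) = x" "!!y. y \<in> \<sigma> ==> h (g y) = y"
    "continuous_map (disk n) (subtopology (cspace K) \<sigma>) h"
    "continuous_map (subtopology (cspace K) \<sigma>) (disk n) g" "inj_on h (DD n)" "inj_on g \<sigma>"
proof -
  have *: "continuous_map (disk n) (subtopology (cspace K) \<sigma>) h"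
      "continuous_map (subtopology (cspace K) \<sigma>) (disk n) g"
      "!!x. x \<in> DD n ==> g (h x) = x" "!!y. y \<in> \<sigma> ==> h (g y) = y"
    using assms cell_sub[OF assms(2)] by (auto simp: homeomorphic_maps_def inf.absorb2)
  show "continuous_map (disk n) (subtopology (cspace K) \<sigma>) h"
    "continuous_map (subtopology (cspace K) \<sigma>) (disk n) g" by fact+
  show 3: "!!x. x \<in> DD n ==> g (h x) = x" and 4: "!!y. y \<in> \<sigma> ==> h (g y) = y" by fact+
  have h: "h ` DD n \<subseteq> \<sigma>" and g: "g ` \<sigma> \<subseteq> DD n"
    using continuous_map_image_subset_topspace[OF *(1)] continuous_map_image_subset_topspace[OF *(2)]
    unfolding topspace_cell[OF assms(2)] topspace_disk by blast+
  show "h ` DD n = \<sigma>" using h g 4 by (force simp: image_iff)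
  show "g ` \<sigma> = DD n" using h g 3 by (force simp: image_iff)
  show "inj_on h (DD n)" by (rule inj_on_inverseI[where g = g]) (rule 3)
  show "inj_on g \<sigma>" by (rule inj_on_inverseI[where g = h]) (rule 4)
qed

lemma cint_homeo:
  assumes "homeomorphic_maps (disk n) (subtopology (cspace K) \<sigma>) h g" "\<sigma> \<in> cells K"
    "h ` SS n = cell_boundary K \<sigma>"
  shows "h ` (DD n - SS n) = cint \<sigma>" "g ` cint \<sigma> = DD n - SS n"
proof -
  note f = homeo_facts[OF assms(1,2)]
  show 1: "h ` (DD n - SS n) = cint \<sigma>"
  proof -
    have "cint \<sigma> = h ` DD n - h ` SS n" using f(1) assms(3) by (simp add: cint_def)
    then show ?thesis using inj_on_image_set_diff[OF f(7), of "DD n" "SS n"] SS_sub_DD[of n] by auto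
  qed
  show "g ` cint \<sigma> = DD n - SS n"
    unfolding 1[symmetric] image_image using f(3) by (auto simp: image_iff)
qed

lemma cint_nonempty: "\<sigma> \<in> cells K ==> cint \<sigma> ~= {}"
proof -
  assume s: "\<sigma> \<in> cells K"
  obtain n h g where h: "homeomorphic_maps (disk n) (subtopology (cspace K) \<sigma>) h g" "h ` SS n = cell_boundary K \<sigma>"
    using cell_homeo[OF s] .
  have "DD n - SS n ~= {}" using zero_in_DD zero_notin_SS by blast
  then show ?thesis using cint_homeo(1)[OF h(1) s h(2)] by blast
qed

lemma cell_nonempty: "\<sigma> \<in> cells K ==> \<sigma> ~= {}"
  using cint_nonempty by (auto simp: cint_def)

lemma cint_sub: "cint \<sigma> \<subseteq> \<sigma>" by (auto simp: cint_def)

lemma cint_disjoint: "\<sigma> \<in> cells K ==> \<tau> \<in> cells K ==> x \<in> cint \<sigma> ==> x \<in> cint \<tau> ==> \<sigma> = \<tau>"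
proof (rule ccontr)
  assume *: "\<sigma> \<in> cells K" "\<tau> \<in> cells K" "x \<in> cint \<sigma>" "x \<in> cint \<tau>" "\<sigma> ~= \<tau>"
  have "\<forall>\<sigma>\<in>cells K. \<forall>\<tau>\<in>cells K. \<sigma> ~= \<tau> -->
         (\<sigma> - cell_boundary K \<sigma>) \<inter> (\<tau> - cell_boundary K \<tau>) = {}"
    using reg unfolding regular_cw_def by (elim conjE)
  with *(1,2,5) have "cint \<sigma> \<inter> cint \<tau> = {}" unfolding cint_def by simp
  then show False using *(3,4) by auto
qed

lemma carrier:
  assumes "\<sigma> \<in> cells K" "x \<in> \<sigma>"
  shows "\<exists>\<tau>\<in>cells K. \<tau> \<subseteq> \<sigma> & x \<in> cint \<tau>"
  using assms
proof (induction "card {\<tau> \<in> cells K. \<tau> \<subset> \<sigma>}" arbitrary: \<sigma> rule: less_induct)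
  case less
  show ?case
  proof (cases "x \<in> cint \<sigma>")
    case False
    then obtain \<tau> where t: "\<tau> \<in> cells K" "\<tau> \<subset> \<sigma>" "x \<in> \<tau>"
      using less.prems by (auto simp: cint_def cell_boundary_def)
    have "card {\<rho> \<in> cells K. \<rho> \<subset> \<tau>} < card {\<rho> \<in> cells K. \<rho> \<subset> \<sigma>}"
      using t finite_cells by (intro psubset_card_mono) auto
    then show ?thesis using less.hyps[of \<tau>] t by blast
  qed (use less.prems in auto)
qed

text \<open>A single interior point decides containment of cells. This is how statements about
  points and quotient maps become statements about the face poset.\<close>

lemma carrier_sub: "\<tau> \<in> cells K ==> x \<in> cint \<tau> ==> \<sigma> \<in> cells K ==> x \<in> \<sigma> ==> \<tau> \<subseteq> \<sigma>"
  using carrier[of \<sigma> x] cint_disjoint[of _ \<tau> x] by blast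

text \<open>
  The boundary sphere of an \<open>n\<close>-cell is the union of its maximal proper faces, whose interiors are
  open in it; invariance of domain compares the dimensions.
\<close>

lemma rank_eq_Suc_dim:
  assumes s: "\<sigma> \<in> cells K"
    and sub: "!!\<tau>. \<tau> \<in> cells K ==> \<exists>V :: nat set. finite V & poset_iso {\<rho> \<in> face_poset K. \<rho> \<subseteq> \<tau>} (Pow V)"
    and V: "finite (V :: nat set)" "poset_iso {\<rho> \<in> face_poset K. \<rho> \<subseteq> \<sigma>} (Pow V)"
    and h: "homeomorphic_maps (disk n) (subtopology (cspace K) \<sigma>) h g" "h ` SS n = cell_boundary K \<sigma>"
  shows "card V = Suc n"
  using s V h
proof (induction "card V" arbitrary: \<sigma> V n h g rule: less_induct)
  case less
  let ?I = "{\<rho> \<in> face_poset K. \<rho> \<subseteq> \<sigma>}"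
  from poset_iso_sym[OF less.prems(3)] obtain f where f0: "bij_betw f (Pow V) ?I"
      "\<forall>x\<in>Pow V. \<forall>y\<in>Pow V. x \<subseteq> y \<longleftrightarrow> f x \<subseteq> f y"
    unfolding poset_iso_def by (elim exE conjE)
  have f: "bij_betw f (Pow V) ?I" "!!x y. x \<in> Pow V ==> y \<in> Pow V ==> x \<subseteq> y \<longleftrightarrow> f x \<subseteq> f y"
    using f0 by simp_all
  have fI: "f S \<in> ?I" if "S \<subseteq> V" for S using f(1) that by (auto simp: bij_betw_def)
  have surj: "\<exists>S\<subseteq>V. f S = \<rho>" if "\<rho> \<in> ?I" for \<rho>
  proof -
    have "\<rho> \<in> f ` Pow V" using that f(1) by (simp add: bij_betw_def)
    then show ?thesis by auto
  qed
  have s: "\<sigma> \<in> cells K" by fact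
  have "{} \<in> ?I" "\<sigma> \<in> ?I" using s by (auto simp: face_poset_def)
  then have fV: "f V = \<sigma>" and fe: "f {} = {}"
  proof -
    obtain S where S: "S \<subseteq> V" "f S = \<sigma>" using surj[OF \<open>\<sigma> \<in> ?I\<close>] by blast
    then have "\<sigma> \<subseteq> f V" using f(2)[of S V] by auto
    then show "f V = \<sigma>" using fI[of V] by auto
    obtain S where S: "S \<subseteq> V" "f S = {}" using surj[OF \<open>{} \<in> ?I\<close>] by blast
    then have "f {} \<subseteq> {}" using f(2)[of "{}" S] by auto
    then show "f {} = {}" by simp
  qed
  have cellI: "f S \<in> cells K" if "S \<subseteq> V" "S ~= {}" for S
  proof -
    have "f S ~= {}" using inj_on_eq_iff[OF bij_betw_imp_inj_on[OF f(1)], of S "{}"] fe that by auto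
    then show ?thesis using fI[OF that(1)] by (auto simp: face_poset_def)
  qed
  have "V ~= {}" using fV fe cell_nonempty[OF s] by auto
  then obtain v where v: "v \<in> V" by auto
  note hf = homeo_facts[OF less.prems(4) s]
  show ?case
  proof (cases "V = {v}")
    case True
    have "cell_boundary K \<sigma> = {}"
    proof (rule ccontr)
      assume "cell_boundary K \<sigma> ~= {}"
      then obtain \<tau> where t: "\<tau> \<in> cells K" "\<tau> \<subset> \<sigma>" by (auto simp: cell_boundary_def)
      then obtain S where "S \<subseteq> V" "f S = \<tau>" using surj[of \<tau>] by (auto simp: face_poset_def)
      then have "\<tau> = {} \<or> \<tau> = \<sigma>" using fe fV True by (metis subset_singletonD)
      then show False using t cell_nonempty by auto
    qed
    then have "SS n = {}" using less.prems(5) by simp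
    moreover have "(%i. if i = 0 then 1 else 0) \<in> SS n" if "n > 0"
      using that by (auto simp: SS_def EE_def qq_def if_distrib[of "%x. x\<^sup>2"] sum.delta cong: if_cong)
    ultimately show ?thesis using True by auto
  next
    case False
    define k where "k = card V - 2"
    define \<tau> where "\<tau> = f (V - {v})"
    have ne: "V - {v} ~= {}" using v False by auto
    have t: "\<tau> \<in> cells K" unfolding \<tau>_def using cellI[OF _ ne] by auto
    have "card {v} < card V" using v False less.prems(2) by (intro psubset_card_mono) auto
    then have kV: "card V = Suc (Suc k)" unfolding k_def by simp
    then have kV': "card (V - {v}) = Suc k" using v less.prems(2) by simp
    have ts: "\<tau> \<subset> \<sigma>"
    proof -
      have "V - {v} ~= V" using v by auto
      then have "\<tau> ~= \<sigma>" unfolding \<tau>_def fV[symmetric] using f(1) by (auto simp: bij_betw_def dest: inj_onD)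
      then show ?thesis using fI[of "V - {v}"] by (auto simp: \<tau>_def)
    qed
    have "poset_iso {\<rho> \<in> face_poset K. \<rho> \<subseteq> \<tau>} (Pow (V - {v}))"
    proof (rule poset_iso_sym, unfold poset_iso_def, intro exI conjI)
      show "bij_betw f (Pow (V - {v})) {\<rho> \<in> face_poset K. \<rho> \<subseteq> \<tau>}"
      proof (rule bij_betw_imageI)
        show "inj_on f (Pow (V - {v}))" using f(1) by (auto simp: bij_betw_def intro: inj_on_subset)
        show "f ` Pow (V - {v}) = {\<rho> \<in> face_poset K. \<rho> \<subseteq> \<tau>}"
        proof (intro equalityI subsetI)
          fix \<rho> assume "\<rho> \<in> f ` Pow (V - {v})"
          then obtain S where S: "S \<subseteq> V - {v}" "\<rho> = f S" by auto
          then show "\<rho> \<in> {\<rho> \<in> face_poset K. \<rho> \<subseteq> \<tau>}"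
            using f(2)[of S "V - {v}"] fI[of S] by (auto simp: \<tau>_def)
        next
          fix \<rho> assume r: "\<rho> \<in> {\<rho> \<in> face_poset K. \<rho> \<subseteq> \<tau>}"
          then obtain S where S: "S \<subseteq> V" "f S = \<rho>" using surj[of \<rho>] ts by auto
          then have "S \<subseteq> V - {v}" using f(2)[of S "V - {v}"] r by (auto simp: \<tau>_def)
          then show "\<rho> \<in> f ` Pow (V - {v})" using S by auto
        qed
      qed
      show "\<forall>x\<in>Pow (V - {v}). \<forall>y\<in>Pow (V - {v}). x \<subseteq> y \<longleftrightarrow> f x \<subseteq> f y" using f(2) by auto
    qed
    moreover obtain n' h' g' where h': "homeomorphic_maps (disk n') (subtopology (cspace K) \<tau>) h' g'"
      "h' ` SS n' = cell_boundary K \<tau>" using cell_homeo[OF t] .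
    ultimately have "Suc k = Suc n'"
      using less.hyps[of "V - {v}" \<tau> n' h' g'] t less.prems(2) kV kV' by auto
    then have n': "n' = k" by simp
    note hf' = homeo_facts[OF h'(1) t, unfolded n'] and ci = cint_homeo[OF h'(1) t h'(2), unfolded n']
    have tbd: "\<tau> \<subseteq> h ` SS n" using ts t less.prems(5) by (auto simp: cell_boundary_def)
    have g_SS: "g y \<in> SS n" if "y \<in> \<tau>" for y
    proof -
      obtain x where "x \<in> SS n" "y = h x" using tbd \<open>y \<in> \<tau>\<close> by auto
      moreover have "x \<in> DD n" using \<open>x \<in> SS n\<close> SS_sub_DD[of n] by blast
      ultimately show ?thesis using hf(3)[of x] by simp
    qed
    have "Suc k <= n"
    proof (rule disk_into_sphere_dim_le[of k "g \<circ> h'"])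
      have "continuous_map (disk k) (subtopology (cspace K) \<sigma>) h'"
        using hf'(5) ts by (auto simp: continuous_map_in_subtopology)
      then have "continuous_map (disk k) (disk n) (g \<circ> h')" using hf(6) by (rule continuous_map_compose)
      then have "continuous_on (DD k) (g \<circ> h')" by (simp add: disk_DD)
      then show "continuous_on (DD k - SS k) (g \<circ> h')" by (rule continuous_on_subset) auto
      show "inj_on (g \<circ> h') (DD k - SS k)"
      proof (rule comp_inj_on)
        show "inj_on h' (DD k - SS k)" using hf'(7) by (rule inj_on_subset) auto
        show "inj_on g (h' ` (DD k - SS k))"
          using hf(8) by (rule inj_on_subset) (use hf'(1) ts in auto)
      qed
      show "(g \<circ> h') ` (DD k - SS k) \<subseteq> SS n" using g_SS hf'(1) by auto
    qed
    moreover have "n <= Suc k"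
    proof (rule sphere_into_space_dim_le[of n "g ` cint \<tau>" "g' \<circ> h"])
      \<comment> \<open>\<open>C\<close> is the union of the proper faces that do not contain
        \<open>\<tau>\<close>. As \<open>\<tau>\<close> is a maximal proper face, the part of the
        boundary sphere outside this closed set is the interior of \<open>\<tau>\<close>.\<close>
      define C where "C = \<Union>{\<rho> \<in> cells K. \<rho> \<subset> \<sigma> & \<not> \<tau> \<subseteq> \<rho>}"
      have "closedin (cspace K) C" unfolding C_def
        by (rule closedin_Union) (use finite_cells cell_closed in auto)
      then have "closedin (subtopology (cspace K) \<sigma>) (C \<inter> \<sigma>)" by (auto simp: closedin_subtopology)
      then have "closedin (disk n) {x \<in> topspace (disk n). h x \<in> C \<inter> \<sigma>}"
        by (rule closedin_continuous_map_preimage[OF hf(5)])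
      then have "openin (disk n) (DD n - {x \<in> DD n. h x \<in> C \<inter> \<sigma>})"
        by (metis openin_diff openin_topspace topspace_disk)
      then have op: "openin (top_of_set (DD n)) {x \<in> DD n. h x ~: C}"
      proof -
        have "DD n - {x \<in> DD n. h x \<in> C \<inter> \<sigma>} = {x \<in> DD n. h x ~: C}" using hf(1) by auto
        then show ?thesis using \<open>openin (disk n) (DD n - _)\<close> by (simp add: disk_DD)
      qed
      have U: "g ` cint \<tau> = SS n \<inter> {x \<in> DD n. h x ~: C}"
      proof (intro equalityI subsetI)
        fix x assume "x \<in> g ` cint \<tau>"
        then obtain y where y: "y \<in> cint \<tau>" "x = g y" by auto
        have yt: "y \<in> \<tau>" using y(1) by (rule subsetD[OF cint_sub])
        then have "h x = y" using hf(4)[of y] ts y(2) by auto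
        moreover have "y ~: C" unfolding C_def using carrier_sub[OF t y(1)] by auto
        ultimately show "x \<in> SS n \<inter> {x \<in> DD n. h x ~: C}" using g_SS[OF yt] y SS_sub_DD[of n] by auto
      next
        fix x assume x: "x \<in> SS n \<inter> {x \<in> DD n. h x ~: C}"
        then have "h x \<in> cell_boundary K \<sigma>" using less.prems(5) by auto
        then obtain \<rho>0 where r0: "\<rho>0 \<in> cells K" "\<rho>0 \<subset> \<sigma>" "h x \<in> \<rho>0" by (auto simp: cell_boundary_def)
        obtain \<rho> where r: "\<rho> \<in> cells K" "\<rho> \<subseteq> \<rho>0" "h x \<in> cint \<rho>" using carrier[OF r0(1,3)] by auto
        have rs: "\<rho> \<subset> \<sigma>" using r(2) r0(2) by (rule subset_psubset_trans)
        have "h x \<in> \<rho>" using r(3) cint_sub[of \<rho>] by blast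
        have tr: "\<tau> \<subseteq> \<rho>"
        proof (rule ccontr)
          assume "\<not> \<tau> \<subseteq> \<rho>"
          then have "h x \<in> C" unfolding C_def using r(1) rs \<open>h x \<in> \<rho>\<close> by blast
          then show False using x by simp
        qed
        obtain S where S: "S \<subseteq> V" "f S = \<rho>" using surj[of \<rho>] r rs by (auto simp: face_poset_def)
        have "V - {v} \<subseteq> S" using f(2)[of "V - {v}" S] S tr by (auto simp: \<tau>_def)
        moreover have "S ~= V" using S fV rs by auto
        ultimately have "S = V - {v}" using S(1) by auto
        then have "\<rho> = \<tau>" using S by (simp add: \<tau>_def)
        then have "h x \<in> cint \<tau>" using r by simp
        moreover have "g (h x) = x" using x hf(3) by auto
        ultimately show "x \<in> g ` cint \<tau>" by (metis imageI)
      qed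
      then show "openin (top_of_set (SS n)) (g ` cint \<tau>)"
      proof -
        obtain T where "open T" "{x \<in> DD n. h x ~: C} = DD n \<inter> T" using op by (auto simp: openin_open)
        then have "g ` cint \<tau> = SS n \<inter> T" using U SS_sub_DD[of n] by auto
        then show ?thesis using \<open>open T\<close> by (simp add: openin_open_Int)
      qed
      show "g ` cint \<tau> ~= {}" using cint_nonempty[OF t] by auto
      have hg: "h (g y) = y" if "y \<in> cint \<tau>" for y
      proof -
        have "y \<in> \<tau>" using that by (rule subsetD[OF cint_sub])
        then show ?thesis using hf(4)[of y] ts by auto
      qed
      then have gt: "h ` (g ` cint \<tau>) = cint \<tau>" by (simp add: image_image)
      have gD: "g ` cint \<tau> \<subseteq> DD n" using U by auto
      have "continuous_map (subtopology (disk n) (g ` cint \<tau>)) (subtopology (cspace K) \<tau>) h"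
      proof -
        have "h x \<in> \<tau>" if "x \<in> g ` cint \<tau>" for x
          using imageI[OF that, of h] unfolding gt by (rule subsetD[OF cint_sub])
        then show ?thesis
          using continuous_map_from_subtopology[OF hf(5), of "g ` cint \<tau>"]
          by (simp add: continuous_map_in_subtopology Pi_iff)
      qed
      then have "continuous_map (subtopology (disk n) (g ` cint \<tau>)) (disk k) (g' \<circ> h)"
        using hf'(6) by (rule continuous_map_compose)
      then show "continuous_on (g ` cint \<tau>) (g' \<circ> h)"
        using gD by (simp add: disk_DD subtopology_subtopology inf.absorb2)
      show "inj_on (g' \<circ> h) (g ` cint \<tau>)"
      proof (rule comp_inj_on)
        show "inj_on h (g ` cint \<tau>)" using hf(7) gD by (rule inj_on_subset)
        show "inj_on g' (h ` (g ` cint \<tau>))" unfolding gt using hf'(8) cint_sub by (rule inj_on_subset)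
      qed
      show "(g' \<circ> h) ` (g ` cint \<tau>) \<subseteq> EE k"
        unfolding image_comp[symmetric] gt using ci(2) DD_sub_EE by auto
    qed
    ultimately show ?thesis using kV by simp
  qed
qed

end

lemma disk_homeo_imp_eq:
  assumes "disk m homeomorphic_space disk n" shows "m = n"
proof -
  have le: "m <= n" if mn: "disk m homeomorphic_space disk n" for m n
  proof -
    obtain f g where fg: "homeomorphic_maps (disk m) (disk n) f g" using mn by (auto simp: homeomorphic_space_def)
    define U where "U = EE m \<inter> {x. qq m x < 1}"
    have op: "openin (top_of_set (EE m)) U" unfolding U_def
      by (intro openin_open_Int open_Collect_less continuous_intros)
    have "(%i. 0) \<in> U" by (simp add: U_def EE_def qq_def)
    then have ne: "U ~= {}" by auto
    have UD: "U \<subseteq> DD m" by (auto simp: U_def DD_def)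
    have "continuous_on (DD m) f" "inj_on f (DD m)" "f ` DD m \<subseteq> DD n"
      using fg by (auto simp: homeomorphic_maps_def disk_DD intro: inj_on_inverseI)
    then show ?thesis
      using injective_dim_le[OF op ne, of f n] UD DD_sub_EE[of n]
      by (meson continuous_on_subset image_mono inj_on_subset order_trans)
  qed
  show ?thesis by (rule antisym[OF le[OF assms] le[OF iffD1[OF homeomorphic_space_sym assms]]])
qed

text \<open>The bridge between the two notions of dimension: \<open>dim_cells\<close> refers to a
  homeomorphism type, all later arguments to the rank of a Boolean interval.\<close>

lemma dim_cells_iff_rank:
  assumes K: "simplicial_cw K" and s: "\<sigma> \<in> cells K"
    and V: "finite (V :: nat set)" "poset_iso {\<rho> \<in> face_poset K. \<rho> \<subseteq> \<sigma>} (Pow V)"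
  shows "\<sigma> \<in> dim_cells K n \<longleftrightarrow> card V = Suc n"
proof -
  interpret rcw K using K by unfold_locales (simp add: simplicial_cw_def)
  obtain m h g where h: "homeomorphic_maps (disk m) (subtopology (cspace K) \<sigma>) h g" "h ` SS m = cell_boundary K \<sigma>"
    using cell_homeo[OF s] .
  have "card V = Suc m"
    by (rule rank_eq_Suc_dim[OF s _ V h]) (use K in \<open>auto simp: simplicial_cw_def\<close>)
  moreover have hs: "subtopology (cspace K) \<sigma> homeomorphic_space disk m"
    by (subst homeomorphic_space_sym) (use h(1) in \<open>auto simp: homeomorphic_space_def\<close>)
  moreover have "subtopology (cspace K) \<sigma> homeomorphic_space disk n \<longleftrightarrow> m = n"
  proof
    assume "subtopology (cspace K) \<sigma> homeomorphic_space disk n"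
    with iffD1[OF homeomorphic_space_sym hs] have "disk m homeomorphic_space disk n"
      by (rule homeomorphic_space_trans)
    then show "m = n" by (rule disk_homeo_imp_eq)
  qed (use hs in simp)
  ultimately show ?thesis using s by (auto simp: dim_cells_def)
qed

section \<open>Sets of codimension two do not locally separate a ball\<close>

lemma in_EE_qq_0: "x \<in> EE n ==> qq n x = 0 ==> x = (%i. 0)"
  by (auto simp: EE_def qq_def sum_nonneg_eq_0_iff fun_eq_iff) (metis lessThan_iff not_le_imp_less)

lemma continuous_on_qq_diff: "continuous_on S (%y. qq n (%i. y i - x i))"
  unfolding qq_def by (intro continuous_intros)

text \<open>Open sets refer to the product topology, so Euclidean balls have to be compared with it:
  the part of the unit ball about \<open>x\<close> outside \<open>T\<close> is compact and thus has
  positive distance from \<open>x\<close>.\<close>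

lemma EE_nbhd:
  assumes T: "open T" "x \<in> T" and x: "x \<in> EE n"
  obtains \<delta> where "\<delta> > 0" "!!y. y \<in> EE n ==> qq n (%i. y i - x i) < \<delta>\<^sup>2 ==> y \<in> T"
proof -
  define C where "C = (%y. (%i. x i + y i)) ` DD n - T"
  have "continuous_on (DD n) (%y i. x i + y i)" by (intro continuous_on_funI continuous_intros)
  then have cC: "compact C" unfolding C_def
    by (intro compact_diff compact_continuous_image compact_DD T)
  show ?thesis
  proof (cases "C = {}")
    case True
    have "y \<in> T" if "y \<in> EE n" "qq n (%i. y i - x i) < 1\<^sup>2" for y
    proof -
      have "(%i. y i - x i) \<in> DD n" using that x by (auto simp: DD_def EE_def)
      then have "y \<in> (%y. (%i. x i + y i)) ` DD n" by (rule rev_image_eqI) auto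
      then show ?thesis using True by (auto simp: C_def)
    qed
    then show ?thesis using that[of 1] by simp
  next
    case False
    obtain y0 where y0: "y0 \<in> C" "!!y. y \<in> C ==> qq n (%i. y0 i - x i) <= qq n (%i. y i - x i)"
      using continuous_attains_inf[OF cC False continuous_on_qq_diff[of C n x]] by auto
    define m where "m = min 1 (qq n (%i. y0 i - x i))"
    have "qq n (%i. y0 i - x i) ~= 0"
    proof
      assume "qq n (%i. y0 i - x i) = 0"
      moreover have "(%i. y0 i - x i) \<in> EE n" using y0(1) by (auto simp: C_def DD_def EE_def)
      ultimately have "(%i. y0 i - x i) = (%i. 0)" by (rule in_EE_qq_0[rotated])
      then have "y0 = x" by (simp add: fun_eq_iff)
      then show False using y0(1) T by (auto simp: C_def)
    qed
    then have m: "m > 0" using qq_nonneg[of n "%i. y0 i - x i"] by (simp add: m_def)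
    have "y \<in> T" if "y \<in> EE n" "qq n (%i. y i - x i) < (sqrt m)\<^sup>2" for y
    proof (rule ccontr)
      assume "y ~: T"
      have lt: "qq n (%i. y i - x i) < m" using that(2) m by simp
      then have "(%i. y i - x i) \<in> DD n" using that x by (auto simp: DD_def EE_def m_def)
      then have "y \<in> (%y. (%i. x i + y i)) ` DD n" by (rule rev_image_eqI) auto
      then have "y \<in> C" using \<open>y ~: T\<close> by (simp add: C_def)
      from y0(2)[OF this] lt show False by (simp add: m_def)
    qed
    then show ?thesis using that[of "sqrt m"] m by simp
  qed
qed

lemma qq_expand:
  "qq n (%i. a * u i - x i) = a\<^sup>2 * qq n u - 2 * a * (\<Sum>i<n. u i * x i) + qq n x"
  by (simp add: qq_def power2_diff sum.distrib sum_subtractf sum_distrib_left power_mult_distrib mult_ac)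

lemma inner_le: "2 * (\<Sum>i<n. u i * x i) <= qq n u + qq n x"
proof -
  have "0 <= qq n (%i. 1 * u i - x i)" by (rule qq_nonneg)
  then show ?thesis unfolding qq_expand by simp
qed

text \<open>
  The set \<open>S\<close> of points near \<open>x\<close> that the radial retraction sends into the \<open>k\<close>-cell \<open>\<tau>\<close> is
  homeomorphic to a closed set \<open>T\<close> of \<open>\<real>\<^sup>k\<^sup>+\<^sup>2\<close> whose complement is visibly connected, and for closed
  subsets of Euclidean space connectedness of the complement is a topological invariant.
\<close>

lemma disk_not_locally_separated:
  assumes k: "k + 2 <= d"
    and P: "homeomorphism \<tau> (DD k) g P" and \<tau>: "\<tau> \<subseteq> DD d" and x: "x \<in> \<tau>"
    and V: "openin (top_of_set (DD d)) V" "x \<in> V" "V - \<tau> \<subseteq> V1 \<union> V2"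
    and V12: "openin (top_of_set (DD d)) V1" "openin (top_of_set (DD d)) V2" "V1 \<inter> V2 = {}"
      "V1 \<inter> \<tau> = {}" "V2 \<inter> \<tau> = {}"
    and cl: "x \<in> closure V1" "x \<in> closure V2"
  shows False
proof -
  have xD: "x \<in> DD d" "x \<in> EE d" "qq d x <= 1" using x \<tau> by (auto simp: DD_def)
  \<comment> \<open>\<open>r\<close> is the radial retraction onto the ball. It allows
    \<open>x\<close> to lie on the boundary sphere, since a full Euclidean neighbourhood of
    \<open>x\<close> is pulled back into the ball.\<close>
  define nr where "nr y = max 1 (sqrt (qq d y))" for y
  define r where "r y = (%i. inverse (nr y) * y i)" for y
  have nr1: "nr y \<ge> 1" for y by (simp add: nr_def)
  have nr0: "nr y ~= 0" for y using nr1[of y] by auto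
  have nr_scale: "y i = nr y * r y i" for y i using nr1[of y] by (simp add: r_def)
  have rD: "r y \<in> DD d" if "y \<in> EE d" for y
  proof -
    have "qq d y <= (nr y)\<^sup>2"
    proof -
      have "sqrt (qq d y) <= nr y" by (simp add: nr_def)
      then have "(sqrt (qq d y))\<^sup>2 <= (nr y)\<^sup>2" by (intro power_mono) (auto simp: qq_nonneg)
      then show ?thesis by (simp add: qq_nonneg)
    qed
    then have "qq d (r y) <= 1" using nr1[of y] unfolding r_def qq_scale
      by (simp add: power_inverse divide_simps)
    then show ?thesis using that by (auto simp: DD_def EE_def r_def)
  qed
  have r_id: "nr y = 1" "r y = y" if "y \<in> DD d" for y
    using that by (auto simp: DD_def nr_def r_def real_sqrt_le_1_iff max_def)
  have r_sphere: "qq d (r y) = 1" if "nr y > 1" for y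
  proof -
    have n: "nr y = sqrt (qq d y)" using that by (auto simp: nr_def max_def split: if_splits)
    then show ?thesis using that unfolding r_def qq_scale n by (simp add: power_inverse qq_nonneg)
  qed
  have cnr: "continuous_on U nr" for U unfolding nr_def
    by (intro continuous_on_max continuous_on_real_sqrt continuous_on_qq continuous_intros)
  have cr: "continuous_on U r" for U unfolding r_def
    by (intro continuous_on_funI continuous_on_mult continuous_on_inverse cnr continuous_on_coord)
      (simp add: nr0)
  obtain TV where TV: "open TV" "V = DD d \<inter> TV" using V(1) by (auto simp: openin_open)
  obtain \<delta> where \<delta>: "\<delta> > 0" "!!y. y \<in> EE d ==> qq d (%i. y i - x i) < \<delta>\<^sup>2 ==> r y \<in> V"
  proof -
    have "open (r -` TV)" using cr[of UNIV] TV(1) by (simp add: open_vimage)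
    moreover have "x \<in> r -` TV" using V(2) TV(2) r_id(2)[OF xD(1)] by auto
    ultimately obtain \<delta> where "\<delta> > 0" "!!y. y \<in> EE d ==> qq d (%i. y i - x i) < \<delta>\<^sup>2 ==> y \<in> r -` TV"
      using EE_nbhd[OF _ _ xD(2)] by metis
    then show ?thesis using that rD TV(2) by auto
  qed
  \<comment> \<open>\<open>\<psi>\<close> maps the whole space onto the open ball of radius
    \<open>\<delta>\<close> about \<open>x\<close>, so local separation at \<open>x\<close> becomes
    separation of Euclidean space.\<close>
  define c where "c z = \<delta> * inverse (sqrt (1 + qq d z))" for z
  define \<psi> where "\<psi> z = (%i. x i + c z * z i)" for z
  have q1: "1 + qq d z > 0" for z using qq_nonneg[of d z] by linarith
  have q0: "sqrt (1 + qq d z) ~= 0" for z using q1[of z] by simp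
  have Q: "qq d (%i. \<psi> z i - x i) = \<delta>\<^sup>2 * (qq d z / (1 + qq d z))" for z
  proof -
    have "qq d (%i. \<psi> z i - x i) = (c z)\<^sup>2 * qq d z" unfolding \<psi>_def by (simp add: qq_scale)
    also have "(c z)\<^sup>2 = \<delta>\<^sup>2 * inverse (1 + qq d z)"
      using q1[of z] by (simp add: c_def power_mult_distrib power_inverse)
    finally show ?thesis by (simp add: divide_inverse)
  qed
  have \<psi>E: "\<psi> z \<in> EE d" if "z \<in> EE d" for z using that xD(2) by (auto simp: \<psi>_def EE_def)
  have \<psi>V: "r (\<psi> z) \<in> V" if "z \<in> EE d" for z
  proof (rule \<delta>(2)[OF \<psi>E[OF that]])
    have "qq d z / (1 + qq d z) < 1" using q1[of z] by (simp add: divide_simps)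
    then show "qq d (%i. \<psi> z i - x i) < \<delta>\<^sup>2"
      unfolding Q using mult_strict_left_mono[of "qq d z / (1 + qq d z)" 1 "\<delta>\<^sup>2"] \<delta>(1) by simp
  qed
  have c\<psi>: "continuous_on U \<psi>" for U unfolding \<psi>_def c_def
    by (intro continuous_on_funI continuous_on_add continuous_on_mult continuous_on_inverse
        continuous_on_real_sqrt continuous_on_qq continuous_on_coord continuous_on_const)
      (use q0 in simp)
  have cr\<psi>: "continuous_on U (%z. r (\<psi> z))" for U
    by (rule continuous_on_compose2[OF cr[of UNIV] c\<psi>]) simp
  have \<psi>_surj: "\<exists>z\<in>EE d. \<psi> z = y" if y: "y \<in> EE d" "qq d (%i. y i - x i) < \<delta>\<^sup>2" for y
  proof -
    define R where "R = qq d (%i. y i - x i)"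
    define e where "e = sqrt (\<delta>\<^sup>2 - R)"
    have e: "e > 0" "e\<^sup>2 = \<delta>\<^sup>2 - R" using y(2) by (simp_all add: e_def R_def)
    define z where "z = (%i. inverse e * (y i - x i))"
    have "qq d z = R / e\<^sup>2" unfolding z_def qq_scale R_def by (simp add: power_inverse divide_inverse)
    moreover have "\<delta>\<^sup>2 = e\<^sup>2 + R" using e(2) by simp
    ultimately have "1 + qq d z = \<delta>\<^sup>2 / e\<^sup>2" using e(1) by (simp only: add_divide_distrib) simp
    then have "sqrt (1 + qq d z) = \<delta> / e" using e(1) \<delta>(1) by (simp add: real_sqrt_divide)
    then have cz: "c z = e" using e(1) \<delta>(1) by (simp add: c_def)
    have "e * z i = y i - x i" for i unfolding z_def using e(1) by simp
    then have "\<psi> z = y" unfolding \<psi>_def cz by simp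
    moreover have "z \<in> EE d" using y(1) xD(2) by (auto simp: z_def EE_def)
    ultimately show ?thesis by blast
  qed
  define S where "S = {z \<in> EE d. r (\<psi> z) \<in> \<tau>}"
  have g: "continuous_on \<tau> g" "!!y. y \<in> \<tau> ==> g y \<in> DD k" "!!y. y \<in> \<tau> ==> P (g y) = y" "continuous_on (DD k) P" "P ` DD k = \<tau>"
    using P by (auto simp: homeomorphism_def)
  have cl\<tau>: "closed \<tau>"
  proof -
    have "compact \<tau>" using compact_continuous_image[OF g(4) compact_DD] g(5) by simp
    moreover have "closed (\<tau> :: (nat => real) set)"
      using \<open>compact \<tau>\<close> by (rule compact_imp_closed)
    ultimately show ?thesis by simp
  qed
  have EEcl: "closed (EE n)" for n
  proof -
    have "EE n = (\<Inter>i\<in>{n..}. {x. x i = 0})" by (auto simp: EE_def)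
    moreover have "closed \<dots>" by (intro closed_INT ballI closed_Collect_eq continuous_intros)
    ultimately show ?thesis by simp
  qed
  have Scl: "closed S"
  proof -
    have "S = EE d \<inter> (%z. r (\<psi> z)) -` \<tau>" by (auto simp: S_def)
    moreover have "closed ((%z. r (\<psi> z)) -` \<tau>)" using cr\<psi>[of UNIV] cl\<tau> by (simp add: closed_vimage)
    ultimately show ?thesis using EEcl by auto
  qed
  \<comment> \<open>The coordinates are the position in the model disk of \<open>\<tau>\<close>, the
    height above the unit ball and the squared norm of \<open>z\<close>. The first two recover
    \<open>\<psi> z\<close>; the third makes images of closed sets closed and keeps \<open>T\<close>
    out of a half-space. Two extra coordinates are exactly what k + 2 <= d permits.\<close>
  define F where "F z = (g (r (\<psi> z)))(k := nr (\<psi> z) - 1, Suc k := qq d z)" for z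
  have cF: "continuous_on S F"
  proof (rule continuous_on_funI)
    fix i
    have 1: "continuous_on S (%z. g (r (\<psi> z)))"
      by (rule continuous_on_compose2[OF g(1) cr\<psi>]) (auto simp: S_def)
    have 2: "continuous_on S (%z. nr (\<psi> z))" by (rule continuous_on_compose2[OF cnr[of UNIV] c\<psi>]) simp
    show "continuous_on S (%z. F z i)"
      by (cases "i = Suc k"; cases "i = k")
        (auto simp: F_def intro: continuous_on_funD[OF 1] 2 continuous_intros)
  qed
  define T where "T = F ` S"
  have FT: "F z \<in> EE (k + 2)" "F z k \<ge> 0" "F z (Suc k) = qq d z" "(F z)(k := 0, Suc k := 0) = g (r (\<psi> z))" if "z \<in> S" for z
  proof -
    have "g (r (\<psi> z)) \<in> EE k" using g(2) that DD_sub_EE by (auto simp: S_def)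
    then show "F z \<in> EE (k + 2)" "(F z)(k := 0, Suc k := 0) = g (r (\<psi> z))"
      by (auto simp: F_def EE_def fun_eq_iff)
    show "F z k \<ge> 0" "F z (Suc k) = qq d z" using nr1 by (auto simp: F_def)
  qed
  have Fdet: "\<psi> z i = (1 + F z k) * P ((F z)(k := 0, Suc k := 0)) i" if "z \<in> S" for z i
  proof -
    have "1 + F z k = nr (\<psi> z)" by (simp add: F_def)
    moreover have "P ((F z)(k := 0, Suc k := 0)) = r (\<psi> z)" using FT(4)[OF that] g(3) that by (auto simp: S_def)
    ultimately show ?thesis using nr_scale[of "\<psi> z" i] by simp
  qed
  have injF: "inj_on F S"
  proof (rule inj_onI)
    fix z z' assume z: "z \<in> S" "z' \<in> S" "F z = F z'"
    have "\<psi> z = \<psi> z'" using Fdet[OF z(1)] Fdet[OF z(2)] z(3) by (simp add: fun_eq_iff)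
    moreover have "c z = c z'" using FT(3)[OF z(1)] FT(3)[OF z(2)] z(3) by (simp add: c_def)
    moreover have "c z ~= 0" using \<delta>(1) q1[of z] by (simp add: c_def)
    ultimately show "z = z'" by (auto simp: \<psi>_def fun_eq_iff)
  qed
  have closed_image: "closed (F ` A)" if A: "closed A" "A \<subseteq> S" for A
  proof -
    have "w \<in> F ` A" if w: "w \<in> closure (F ` A)" for w
    proof -
      define m where "m = \<bar>w (Suc k)\<bar> + 1"
      define A' where "A' = A \<inter> {z. qq d z <= m}"
      define N where "N = {u :: nat => real. u (Suc k) < m}"
      have "open N" unfolding N_def by (intro open_Collect_less continuous_intros)
      moreover have "w \<in> N" by (auto simp: N_def m_def)
      ultimately have "w \<in> closure (N \<inter> F ` A)" using w open_Int_closure_subset by blast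
      moreover have "N \<inter> F ` A \<subseteq> F ` A'" using FT(3) A(2) by (fastforce simp: N_def A'_def)
      ultimately have "w \<in> closure (F ` A')" using closure_mono by blast
      moreover have "compact (F ` A')"
      proof (rule compact_continuous_image)
        show "continuous_on A' F" by (rule continuous_on_subset[OF cF]) (use A(2) in \<open>auto simp: A'_def\<close>)
        have m1: "m \<ge> 1" by (simp add: m_def)
        have "compact ((%z i. sqrt m * z i) ` DD d)"
          by (intro compact_continuous_image compact_DD continuous_on_funI continuous_intros)
        moreover have "closed A'" unfolding A'_def
          by (intro closed_Int A(1) closed_Collect_le continuous_intros)
        moreover have "A' \<subseteq> (%z i. sqrt m * z i) ` DD d"
        proof
          fix z assume z: "z \<in> A'"
          have "qq d (%i. inverse (sqrt m) * z i) <= 1"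
            using z m1 unfolding qq_scale by (simp add: A'_def power_inverse divide_simps)
          moreover have "z \<in> EE d" using z A(2) by (auto simp: A'_def S_def)
          ultimately have "(%i. inverse (sqrt m) * z i) \<in> DD d" by (auto simp: DD_def EE_def)
          then show "z \<in> (%z i. sqrt m * z i) ` DD d" by (rule rev_image_eqI) (use m1 in auto)
        qed
        ultimately show "compact A'" by (metis compact_Int_closed inf.absorb_iff2)
      qed
      ultimately have "w \<in> F ` A'" using compact_imp_closed by (metis closure_closed)
      then show ?thesis by (auto simp: A'_def)
    qed
    then show ?thesis using closure_subset_eq by blast
  qed
  have Tcl: "closed T" unfolding T_def by (rule closed_image[OF Scl]) simp
  have TE: "T \<subseteq> EE d" using FT(1) k by (fastforce simp: T_def EE_def)
  have homST: "S homeomorphic T"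
  proof -
    have "\<exists>G. homeomorphism S T F G"
    proof (rule homeomorphism_injective_closed_map[OF cF _ injF, of T])
      show "F ` S = T" by (simp add: T_def)
      fix U assume "closedin (top_of_set S) U"
      then have "closed U" "U \<subseteq> S" using Scl closedin_closed_eq closedin_imp_subset by blast+
      then have "closed (F ` U)" by (rule closed_image)
      moreover have "F ` U \<subseteq> T" using \<open>U \<subseteq> S\<close> by (auto simp: T_def)
      ultimately show "closedin (top_of_set T) (F ` U)" by (simp add: closed_subset)
    qed auto
    then show ?thesis by (auto simp: homeomorphic_def)
  qed
  have SE: "S \<subseteq> EE d" by (auto simp: S_def)
  have iff: "connected (EE d - S) \<longleftrightarrow> connected (EE d - T)"
  proof -
    have "closedin (top_of_set (EE d)) S" "closedin (top_of_set (EE d)) T"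
      using Scl Tcl SE TE by (auto simp: closed_subset)
    moreover have "subtopology (top_of_set (EE d)) S homeomorphic_space subtopology (top_of_set (EE d)) T"
      using homST SE TE by (simp add: subtopology_subtopology inf.absorb2)
    ultimately show ?thesis
      using connected_in_Euclidean_complements[of d S T] unfolding Euclidean_space_EE
      by (simp add: connectedin_subtopology)
  qed
  define Lo where "Lo = {w \<in> EE d. w (Suc k) < 0}"
  have LoT: "Lo \<inter> T = {}"
  proof -
    have "F z ~: Lo" if "z \<in> S" for z
      using FT(3)[OF that] qq_nonneg[of d z] by (simp add: Lo_def)
    then show ?thesis by (auto simp: T_def)
  qed
  have conn_path: "connected ((%t. w(j := t)) ` {a..b})" for w :: "nat => real" and j a b
  proof (rule connected_continuous_image)
    show "continuous_on {a..b} (%t. w(j := t))"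
    proof (rule continuous_on_funI)
      fix i show "continuous_on {a..b} (%t. (w(j := t)) i)" by (cases "i = j") (auto intro: continuous_intros)
    qed
  qed simp
  have LoC: "connected Lo"
  proof -
    have "Lo = (\<Union>w\<in>Lo. (%t i. (1 - t) * w i + t * (if i = Suc k then -1 else 0)) ` {0..1})"
    proof (intro equalityI subsetI)
      fix w assume "w \<in> Lo"
      then show "w \<in> (\<Union>w\<in>Lo. (%t i. (1 - t) * w i + t * (if i = Suc k then -1 else 0)) ` {0..1})"
        by (intro UN_I[of w] image_eqI[of _ _ 0]) auto
    next
      fix u assume "u \<in> (\<Union>w\<in>Lo. (%t i. (1 - t) * w i + t * (if i = Suc k then -1 else 0)) ` {0..1})"
      then obtain w t where wt: "w \<in> Lo" "0 <= t" "t <= 1" "u = (%i. (1 - t) * w i + t * (if i = Suc k then -1 else 0))" by auto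
      have "(1 - t) * w (Suc k) - t < 0"
      proof (cases "t = 1")
        case False
        then have "(1 - t) * w (Suc k) < 0" using wt by (intro mult_pos_neg) (auto simp: Lo_def)
        then show ?thesis using wt by linarith
      qed simp
      then show "u \<in> Lo" using wt k by (auto simp: Lo_def EE_def)
    qed
    moreover have "connected (\<Union>w\<in>Lo. (%t i. (1 - t) * w i + t * (if i = Suc k then -1 else 0)) ` {0..1::real})"
    proof (rule connected_Union)
      fix A assume "A \<in> (%w. (%t i. (1 - t) * w i + t * (if i = Suc k then -1 else 0)) ` {0..1::real}) ` Lo"
      then obtain w where "A = (%t i. (1 - t) * w i + t * (if i = Suc k then -1 else 0)) ` {0..1::real}" by auto
      moreover have "connected ((%t i. (1 - t) * w i + t * (if i = Suc k then -1 else 0)) ` {0..1::real})"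
        by (rule connected_continuous_image) (auto intro!: continuous_on_funI continuous_intros)
      ultimately show "connected A" by simp
    next
      have "(%i. if i = Suc k then -1 else 0) \<in> (%t i. (1 - t) * w i + t * (if i = Suc k then -1 else 0)) ` {0..1::real}" for w :: "nat => real"
        by (rule image_eqI[of _ _ 1]) auto
      then show "\<Inter> ((%w. (%t i. (1 - t) * w i + t * (if i = Suc k then -1 else 0)) ` {0..1::real}) ` Lo) ~= {}"
        by blast
    qed
    ultimately show ?thesis by simp
  qed
  \<comment> \<open>One descends in coordinate \<open>Suc k\<close>. If \<open>T\<close> blocks the
    way, coordinate \<open>k\<close> is first lowered below 0, where \<open>T\<close> has no points,
    and the descent is made there.\<close>
  have reach: "\<exists>C. connected C & w \<in> C & C \<subseteq> EE d - T & C \<inter> Lo ~= {}" if w: "w \<in> EE d - T" for w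
  proof -
    have down: "\<exists>C. connected C & u \<in> C & C \<subseteq> EE d - T & C \<inter> Lo ~= {}"
      if u: "u \<in> EE d" "!!t. t <= u (Suc k) ==> u(Suc k := t) ~: T" for u
    proof (intro exI conjI)
      let ?C = "(%t. u(Suc k := t)) ` {min (-1) (u (Suc k))..u (Suc k)}"
      show "connected ?C" by (rule conn_path)
      show "u \<in> ?C" by (rule image_eqI[of _ _ "u (Suc k)"]) auto
      have E: "u(Suc k := t) \<in> EE d" for t using u(1) k by (auto simp: EE_def)
      show "?C \<subseteq> EE d - T" using E u(2) by auto
      have "u(Suc k := min (-1) (u (Suc k))) \<in> ?C" by (rule image_eqI[of _ _ "min (-1) (u (Suc k))"]) auto
      moreover have "u(Suc k := min (-1) (u (Suc k))) \<in> Lo" using E by (auto simp: Lo_def)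
      ultimately show "?C \<inter> Lo ~= {}" by blast
    qed
    show ?thesis
    proof (cases "\<exists>t\<le>w (Suc k). w(Suc k := t) \<in> T")
      case False
      show ?thesis by (rule down) (use w False in auto)
    next
      case True
      then obtain t z where t: "t <= w (Suc k)" "z \<in> S" "w(Suc k := t) = F z" by (auto simp: T_def)
      have tz: "t = qq d z" using FT(3)[OF t(2)] t(3) by (metis fun_upd_same)
      have "t ~= w (Suc k)"
      proof
        assume "t = w (Suc k)"
        then have "w = F z" using t(3) by simp
        then show False using w t(2) by (auto simp: T_def)
      qed
      then have tlt: "t < w (Suc k)" using t(1) by simp
      have wk: "w k = F z k" using fun_cong[OF t(3), of k] by simp
      \<comment> \<open>Lowering the height moves the point radially towards the ball and therefore
        not away from \<open>x\<close>, so a point of \<open>T\<close> met on the way would have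
        norm coordinate at most \<open>t\<close>, which is less than
        \<open>w (Suc k)\<close>.\<close>
      have side: "w(k := s') ~: T" if s': "s' <= w k" for s'
      proof
        assume "w(k := s') \<in> T"
        then obtain z' where z': "z' \<in> S" "w(k := s') = F z'" by (auto simp: T_def)
        have s'0: "s' \<ge> 0" using FT(2)[OF z'(1)] z'(2) by (metis fun_upd_same)
        have q': "qq d z' = w (Suc k)" using FT(3)[OF z'(1)] fun_cong[OF z'(2), of "Suc k"] by simp
        have same: "(F z')(k := 0, Suc k := 0) = (F z)(k := 0, Suc k := 0)"
          unfolding z'(2)[symmetric] t(3)[symmetric] by auto
        define u where "u = P ((F z)(k := 0, Suc k := 0))"
        have y: "\<psi> z = (%i. (1 + w k) * u i)" using Fdet[OF t(2)] wk by (auto simp: u_def)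
        have y': "\<psi> z' = (%i. (1 + s') * u i)"
          using Fdet[OF z'(1)] fun_cong[OF z'(2), of k] same by (auto simp: u_def)
        have "qq d (%i. \<psi> z' i - x i) <= qq d (%i. \<psi> z i - x i)"
        proof (cases "w k = 0")
          case True
          then show ?thesis using s' s'0 y y' by simp
        next
          case False
          then have "w k > 0" using s' s'0 by simp
          then have "nr (\<psi> z) > 1" using wk by (auto simp: F_def)
          then have "qq d (r (\<psi> z)) = 1" by (rule r_sphere)
          moreover have "u = r (\<psi> z)" using FT(4)[OF t(2)] g(3) t(2) by (auto simp: u_def S_def)
          ultimately have u1: "qq d u = 1" by simp
          have ip: "(\<Sum>i<d. u i * x i) <= 1" using inner_le[where n = d and u = u and x = x] u1 xD(3) by linarith
          have "0 <= (w k - s') * ((w k - s') + 2 * (1 + s') - 2 * (\<Sum>i<d. u i * x i))"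
            using s' s'0 ip by (intro mult_nonneg_nonneg) auto
          then show ?thesis unfolding y y' qq_expand u1 by (simp add: power2_eq_square algebra_simps)
        qed
        then have "qq d z' / (1 + qq d z') <= qq d z / (1 + qq d z)"
          unfolding Q by (rule mult_left_le_imp_le) (use \<delta>(1) in simp)
        then have "qq d z' * (1 + qq d z) <= qq d z * (1 + qq d z')"
          using q1[of z] q1[of z'] by (simp add: divide_simps mult.commute)
        then have "qq d z' <= qq d z" by (simp add: algebra_simps)
        then show False using q' tz tlt by simp
      qed
      define w' where "w' = w(k := min (-1) (w k))"
      have w'E: "w' \<in> EE d" using w k by (auto simp: w'_def EE_def)
      have "u ~: T" if "u k < 0" for u using FT(2) that by (fastforce simp: T_def)
      then have "\<exists>C. connected C & w' \<in> C & C \<subseteq> EE d - T & C \<inter> Lo ~= {}"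
        by (intro down w'E) (auto simp: w'_def)
      then obtain C where C: "connected C" "w' \<in> C" "C \<subseteq> EE d - T" "C \<inter> Lo ~= {}" by blast
      let ?C = "(%t. w(k := t)) ` {min (-1) (w k)..w k}"
      have "w' \<in> ?C" unfolding w'_def by (rule image_eqI[of _ _ "min (-1) (w k)"]) auto
      then have "connected (?C \<union> C)" using C(2) by (intro connected_Un conn_path C(1)) auto
      moreover have "w \<in> ?C" by (rule image_eqI[of _ _ "w k"]) auto
      moreover have "?C \<subseteq> EE d - T" using side w k by (auto simp: EE_def)
      ultimately show ?thesis using C by (intro exI[of _ "?C \<union> C"]) auto
    qed
  qed
  have "connected (EE d - T)"
  proof -
    obtain C where C: "!!w. w \<in> EE d - T ==> connected (C w) & w \<in> C w & C w \<subseteq> EE d - T & C w \<inter> Lo ~= {}"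
      using reach by metis
    have LoE: "Lo \<subseteq> EE d - T" using LoT by (auto simp: Lo_def)
    have ne: "\<exists>w0. w0 \<in> Lo"
    proof -
      have "(%i. if i = Suc k then -1 else 0) \<in> Lo" using k by (auto simp: Lo_def EE_def)
      then show ?thesis by blast
    qed
    have "EE d - T = (\<Union>w\<in>EE d - T. C w \<union> Lo)" using C LoE by blast
    moreover have "connected (\<Union>w\<in>EE d - T. C w \<union> Lo)"
    proof (rule connected_Union)
      fix A assume "A \<in> (%w. C w \<union> Lo) ` (EE d - T)"
      then obtain w where "w \<in> EE d - T" "A = C w \<union> Lo" by auto
      then show "connected A" using C[of w] LoC by (auto intro: connected_Un)
    next
      show "\<Inter> ((%w. C w \<union> Lo) ` (EE d - T)) ~= {}" using ne by blast
    qed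
    ultimately show ?thesis by simp
  qed
  then have con: "connected (EE d - S)" using iff by simp
  \<comment> \<open>The two sides \<open>V1\<close> and \<open>V2\<close> pull back to a separation
    of the connected complement of \<open>S\<close>.\<close>
  define A where "A = (EE d - S) \<inter> (%z. r (\<psi> z)) -` V1"
  define B where "B = (EE d - S) \<inter> (%z. r (\<psi> z)) -` V2"
  have rngD: "(%z. r (\<psi> z)) \<in> EE d - S \<rightarrow> DD d" using rD \<psi>E by auto
  have "openin (top_of_set (EE d - S)) A" "openin (top_of_set (EE d - S)) B"
    unfolding A_def B_def by (rule continuous_openin_preimage[OF cr\<psi> rngD V12(1)], rule continuous_openin_preimage[OF cr\<psi> rngD V12(2)])
  moreover have "EE d - S \<subseteq> A \<union> B" using \<psi>V V(3) by (auto simp: A_def B_def S_def)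
  moreover have "A \<inter> B = {}" using V12(3) by (auto simp: A_def B_def)
  moreover have nonempty: "\<exists>z. z \<in> (EE d - S) \<inter> (%z. r (\<psi> z)) -` U"
    if U: "U \<subseteq> DD d" "U \<inter> \<tau> = {}" "x \<in> closure U" for U
  proof -
    have "open {y. qq d (%i. y i - x i) < \<delta>\<^sup>2}" by (intro open_Collect_less continuous_on_qq_diff continuous_intros)
    moreover have "x \<in> {y. qq d (%i. y i - x i) < \<delta>\<^sup>2}" using \<delta>(1) by (simp add: qq_def)
    ultimately obtain y where y: "y \<in> U" "qq d (%i. y i - x i) < \<delta>\<^sup>2"
      using U(3) by (metis (mono_tags, lifting) closure_iff_nhds_not_empty disjoint_iff mem_Collect_eq subset_refl)
    then have "y \<in> DD d" "y \<in> EE d" using U(1) DD_sub_EE by auto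
    then obtain z where z: "z \<in> EE d" "\<psi> z = y" using \<psi>_surj y(2) by blast
    then have "r (\<psi> z) = y" using r_id(2)[OF \<open>y \<in> DD d\<close>] by simp
    then show ?thesis using y(1) U(2) z(1) by (intro exI[of _ z]) (auto simp: S_def)
  qed
  moreover have "A ~= {}"
    using nonempty[OF openin_imp_subset[OF V12(1)] V12(4) cl(1)] unfolding A_def by auto
  moreover have "B ~= {}"
    using nonempty[OF openin_imp_subset[OF V12(2)] V12(5) cl(2)] unfolding B_def by auto
  ultimately show False using con unfolding connected_openin by blast
qed

section \<open>Flags and gluing sequences\<close>

type_synonym flag = "nat list \<times> (nat => nat)"

text \<open>Precomposition of a flag with \<open>rot3\<close> passes to the next edge of its link
  triangle, precomposition with \<open>tt\<close> reverses the edge. The first is even and the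
  second odd, so signs of flags behave like orientations.\<close>

definition rot3 :: "nat => nat" where "rot3 = Transposition.transpose 0 1 \<circ> Transposition.transpose 1 2"

definition tt :: "nat => nat" where "tt = Transposition.transpose 1 2"

lemma tt_tt [simp]: "tt \<circ> tt = id" "tt (tt n) = n" by (simp_all add: tt_def)

lemma tt_simps [simp]: "tt 0 = 0" "tt 1 = 2" "tt (Suc 0) = 2" "tt 2 = Suc 0" "n \<ge> 3 ==> tt n = n"
  by (auto simp: tt_def Transposition.transpose_def)

lemma rot3_simps [simp]: "rot3 0 = Suc 0" "rot3 1 = 2" "rot3 (Suc 0) = 2" "rot3 2 = 0" "n \<ge> 3 ==> rot3 n = n"
  by (auto simp: rot3_def Transposition.transpose_def)

text \<open>The quotient of the two permutations fixes everything but 1 and 2, so it is the identity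
  or \<open>tt\<close>, and the sign excludes \<open>tt\<close>. Consequently facet, first entry,
  tail and sign determine a flag.\<close>

lemma perm_agree_tail:
  assumes s: "s permutes {1..d}" "s' permutes {1..d}" and d: "(d::nat) \<ge> 2"
    and eq: "!!n. n \<in> {3..d} ==> s n = s' n" and sg: "sign s = sign s'"
  shows "s = s'"
proof -
  define u where "u = inv_into UNIV s' \<circ> s"
  have u: "u permutes {1..d}" unfolding u_def using s by (intro permutes_compose permutes_inv)
  have fin: "finite {1..d}" by simp
  have ps: "permutation s" "permutation s'" using s fin by (auto simp: permutation_permutes)
  have un: "u n = n" if "n ~: {1, 2}" for n
  proof (cases "n \<in> {3..d}")
    case True
    then show ?thesis using eq[OF True] permutes_inverses(2)[OF s(2)] by (simp add: u_def)
  next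
    case False
    then have "n ~: {1..d}" using that by auto
    then show ?thesis using u by (simp add: permutes_not_in)
  qed
  then have u12: "u permutes {1, 2}"
    using u unfolding permutes_def by auto
  have "sign u = 1"
    unfolding u_def using ps sg by (simp add: sign_compose sign_inverse permutation_inverse sign_idempotent)
  moreover have "u = id \<or> u = tt" using u12 unfolding tt_def permutes_doubleton_iff .
  moreover have "sign tt = -1" unfolding tt_def by (simp add: sign_swap_id)
  ultimately have "u = id" by auto
  then have "s' \<circ> u = s'" by simp
  moreover have "s' \<circ> u = s" unfolding u_def using permutes_inverses(1)[OF s(2)] by (auto simp: fun_eq_iff)
  ultimately show ?thesis by simp
qed

text \<open>
  The edge of the link triangle of a flag joins its entries 1 and 2. Glued edges are traversed in
  opposite directions, hence the conjugation with \<open>tt\<close>.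
\<close>

definition Gl :: "nat => flag => flag => (flag \<times> flag) set" where
  "Gl d x y = {((fst x, snd x \<circ> s), (fst y, snd y \<circ> (tt \<circ> s \<circ> tt))) |s. s permutes {1..d}}"

text \<open>Names the ridge of the facet \<open>fst x\<close> opposite to the colour
  \<open>snd x 0\<close>.\<close>

definition face :: "flag => nat list \<times> nat" where "face x = (fst x, snd x 0)"

lemma tt_permutes: "2 <= d ==> tt permutes {1..d}"
  unfolding tt_def by (rule permutes_swap_id) auto

lemma tt_conj_permutes: "2 <= d ==> s permutes {1..d} ==> (tt \<circ> s \<circ> tt) permutes {1..d}"
  using tt_permutes by (intro permutes_compose)

lemma permutes_0: "s permutes {1..d} ==> s 0 = (0::nat)"
  by (simp add: permutes_not_in)

lemma Gl_in: "(x, y) \<in> Gl d x y"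
  unfolding Gl_def by (intro CollectI exI[of _ id]) (simp add: permutes_id)

lemma GlE:
  assumes "(a, b) \<in> Gl d x y"
  obtains s where "s permutes {1..d}" "a = (fst x, snd x \<circ> s)" "b = (fst y, snd y \<circ> (tt \<circ> s \<circ> tt))"
proof -
  have "\<exists>s. (a, b) = ((fst x, snd x \<circ> s), (fst y, snd y \<circ> (tt \<circ> s \<circ> tt))) & s permutes {1..d}"
    using assms unfolding Gl_def by (rule CollectD)
  then show ?thesis using that by (elim exE conjE) simp
qed

lemma Gl_converse:
  assumes "2 <= d" shows "Gl d y x = (Gl d x y)\<inverse>"
proof -
  have fwd: "(a, b) \<in> Gl d y x ==> (b, a) \<in> Gl d x y" for a b x y
  proof -
    assume "(a, b) \<in> Gl d y x"
    then obtain s where s: "s permutes {1..d}" "a = (fst y, snd y \<circ> s)" "b = (fst x, snd x \<circ> (tt \<circ> s \<circ> tt))"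
      by (rule GlE)
    define s' where "s' = tt \<circ> s \<circ> tt"
    have "s = tt \<circ> s' \<circ> tt" by (auto simp: s'_def fun_eq_iff)
    moreover have "s' permutes {1..d}" unfolding s'_def by (rule tt_conj_permutes[OF assms s(1)])
    ultimately show "(b, a) \<in> Gl d x y" unfolding Gl_def s(2,3) s'_def[symmetric] by blast
  qed
  show ?thesis
  proof (intro equalityI subrelI)
    fix a b assume "(a, b) \<in> Gl d y x"
    then show "(a, b) \<in> (Gl d x y)\<inverse>" using fwd[of a b y x] by simp
  next
    fix a b assume "(a, b) \<in> (Gl d x y)\<inverse>"
    then show "(a, b) \<in> Gl d y x" using fwd[of b a x y] by simp
  qed
qed

lemma Gl_face: "(a, b) \<in> Gl d x y ==> face a = face x & face b = face y"
proof (erule GlE)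
  fix s assume s: "s permutes {1..d}" "a = (fst x, snd x \<circ> s)" "b = (fst y, snd y \<circ> (tt \<circ> s \<circ> tt))"
  have "s 0 = 0" by (rule permutes_0[OF s(1)])
  then show "face a = face x & face b = face y" by (simp add: face_def s(2,3))
qed

text \<open>The dual tree is a finite subtree, containing the root, of the (d + 1)-regular tree of
  words without immediate repetition; a repeated letter would lead straight back.\<close>

definition valid_tree :: "nat => nat list set => bool" where
  "valid_tree d T \<longleftrightarrow> finite T & [] \<in> T &
     (\<forall>w c. w @ [c] \<in> T --> w \<in> T & c <= d & (w = [] \<or> last w ~= c))"

section \<open>The polygons of link triangles and the pairs coming from the tree\<close>

locale tree_flags =
  fixes d :: nat and T :: "nat list set"
  assumes d3: "d \<ge> 3" and T: "valid_tree d T"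
begin

definition H :: "flag set" where "H = T \<times> {p. p permutes {..d}}"

definition nxt :: "flag => flag" where "nxt x = (fst x, snd x \<circ> rot3)"

text \<open>A coherent orientation of all link triangles: crossing a tree edge changes the parity of
  the word and, because of \<open>tt\<close>, also the sign of the permutation.\<close>

definition gs :: "flag => int" where "gs x = (-1) ^ length (fst x) * sign (snd x)"

definition Ed :: "nat list => (flag \<times> flag) set" where
  "Ed m = {((butlast m, p), (m, p \<circ> tt)) |p. p permutes {..d} & p 0 = last m}"

definition E0 :: "nat list set => (flag \<times> flag) set" where
  "E0 A = (\<Union>m\<in>A. Ed m \<union> (Ed m)\<inverse>)"

lemma finT: "finite T" and nilT: "[] \<in> T"
  and T_snoc: "w @ [c] \<in> T ==> w \<in> T" "w @ [c] \<in> T ==> c <= d" "w @ [c] \<in> T ==> w ~= [] ==> last w ~= c"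
  using T by (auto simp: valid_tree_def)

lemma T_node: "m \<in> T ==> m ~= [] ==> butlast m \<in> T & last m <= d & (butlast m ~= [] --> last (butlast m) ~= last m)"
  using T_snoc[of "butlast m" "last m"] append_butlast_last_id[of m] by auto

lemma rot3_permutes: "rot3 permutes {..d}"
  unfolding rot3_def by (intro permutes_compose permutes_swap_id) (use d3 in auto)

lemma tt_permutes_d: "tt permutes {..d}"
  unfolding tt_def by (rule permutes_swap_id) (use d3 in auto)

lemma sub_permutes: "s permutes {1..d} ==> s permutes {..d}"
  by (rule permutes_subset) auto

lemma sign_mult: "p permutes {..d} ==> q permutes {..d} ==> sign (p \<circ> q) = sign p * sign q"
  by (intro sign_compose) (auto simp: permutation_permutes)

lemma sign_rot3: "sign rot3 = 1"
  unfolding rot3_def by (subst sign_compose) (auto simp: permutation_swap_id sign_swap_id)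

lemma sign_tt: "sign tt = -1" unfolding tt_def by (simp add: sign_swap_id)

lemma sign_tt_conj: "s permutes {1..d} ==> sign (tt \<circ> s \<circ> tt) = sign s"
  using sign_mult[of "tt \<circ> s" tt] sign_mult[of tt s] permutes_compose[OF sub_permutes tt_permutes_d, of s]
  by (simp add: sign_tt tt_permutes_d sub_permutes)

lemma same_face_perm:
  assumes "p permutes {..d}" "q permutes {..d}" "p 0 = q 0"
  obtains s where "s permutes {1..d}" "q = p \<circ> s"
proof -
  define s where "s = inv_into UNIV p \<circ> q"
  have s: "s permutes {..d}" unfolding s_def using assms by (intro permutes_compose permutes_inv)
  have "s 0 = 0" unfolding s_def using assms permutes_inverses(2)[OF assms(1), of 0] by simp
  then have "s permutes {1..d}"
    using s unfolding permutes_def by (auto simp: Suc_le_eq)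
  moreover have "q = p \<circ> s" unfolding s_def using permutes_inverses(1)[OF assms(1)] by (auto simp: fun_eq_iff)
  ultimately show ?thesis by (rule that)
qed

end

sublocale tree_flags \<subseteq> half_edges H nxt
proof
  show "finite H" unfolding H_def using finT finite_permutations[of "{..d}"] by auto
  show "bij_betw nxt H H"
  proof (rule bij_betw_byWitness[of _ "%x. (fst x, snd x \<circ> inv_into UNIV rot3)"])
    have "rot3 \<circ> inv_into UNIV rot3 = id" "inv_into UNIV rot3 \<circ> rot3 = id"
      using permutes_inv_o[OF rot3_permutes] by auto
    then show "\<forall>a\<in>H. (fst (nxt a), snd (nxt a) \<circ> inv_into UNIV rot3) = a"
      "\<forall>a'\<in>H. nxt (fst a', snd a' \<circ> inv_into UNIV rot3) = a'"
      by (auto simp: nxt_def comp_assoc)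
    show "nxt ` H \<subseteq> H" "(%x. (fst x, snd x \<circ> inv_into UNIV rot3)) ` H \<subseteq> H"
      using rot3_permutes permutes_inv[OF rot3_permutes] by (auto simp: H_def nxt_def intro: permutes_compose)
  qed
qed

context tree_flags
begin

lemma conn_invariant:
  assumes "(x, y) \<in> conn E" and "!!x. f (nxt x) = f x" and "!!x y. (x, y) \<in> E ==> f x = f y"
  shows "f x = f y"
  using assms(1) unfolding conn_def
  by (induction rule: rtrancl_induct) (use assms(2,3) in \<open>auto simp: nx_def\<close>)

lemma gs_nxt: "x \<in> H ==> gs (nxt x) = gs x"
  using rot3_permutes by (auto simp: gs_def nxt_def H_def sign_mult sign_rot3)

lemma conn_gs:
  assumes "(x, y) \<in> conn E" and "!!x y. (x, y) \<in> E ==> gs x = gs y"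
  shows "gs x = gs y"
  using assms(1) unfolding conn_def
  by (induction rule: rtrancl_induct) (use assms(2) gs_nxt in \<open>auto simp: nx_def\<close>)

lemma Gl_sub_H:
  assumes "x \<in> H" "y \<in> H" shows "Gl d x y \<subseteq> H \<times> H"
proof -
  have "snd x \<circ> s permutes {..d} & snd y \<circ> (tt \<circ> s \<circ> tt) permutes {..d}" if "s permutes {1..d}" for s
    using permutes_compose[OF sub_permutes[OF that], of "snd x"]
      permutes_compose[OF sub_permutes[OF tt_conj_permutes[OF _ that]], of "snd y"] assms d3 by (auto simp: H_def)
  then show ?thesis using assms by (auto simp: Gl_def H_def)
qed

lemma Gl_gs:
  assumes "x \<in> H" "y \<in> H" "gs x = gs y" "(u, v) \<in> Gl d x y"
  shows "gs u = gs v" 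
proof -
  obtain s where s: "s permutes {1..d}" "u = (fst x, snd x \<circ> s)" "v = (fst y, snd y \<circ> (tt \<circ> s \<circ> tt))"
    using assms(4) by (rule GlE)
  have "sign (snd x \<circ> s) = sign (snd x) * sign s" "sign (snd y \<circ> (tt \<circ> s \<circ> tt)) = sign (snd y) * sign s"
    using assms s(1) sign_mult[of "snd x" s] sign_mult[of "snd y" "tt \<circ> s \<circ> tt"] sign_tt_conj[OF s(1)]
      sub_permutes tt_conj_permutes[OF _ s(1)] d3 by (auto simp: H_def)
  then show ?thesis using assms(3) unfolding s(2,3) gs_def by (simp add: mult.assoc[symmetric])
qed

lemma Ed_gs: "(x, y) \<in> Ed m ==> m ~= [] ==> gs x = gs y"
  by (cases m rule: rev_cases) (auto simp: Ed_def gs_def sign_mult tt_permutes_d sign_tt)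

lemma Ed_sub_H: "m \<in> T ==> m ~= [] ==> Ed m \<subseteq> H \<times> H"
  using T_node[of m] tt_permutes_d by (auto simp: Ed_def H_def intro: permutes_compose)

lemma E0_gs: "A \<subseteq> T - {[]} ==> (x, y) \<in> E0 A ==> gs x = gs y"
  unfolding E0_def using Ed_gs by fastforce

lemma E0_sym: "sym (E0 A)"
  by (auto simp: E0_def sym_def)

lemma Ed_faces: "(x, y) \<in> Ed m ==> face x = (butlast m, last m) & face y = (m, last m)"
  by (auto simp: Ed_def face_def)

lemma E0_matching:
  assumes A: "A \<subseteq> T - {[]}" shows "matching H (E0 A)"
  unfolding matching_def
proof (intro conjI allI)
  show "E0 A \<subseteq> H \<times> H" using Ed_sub_H A by (fastforce simp: E0_def)
  show "sym (E0 A)" by (rule E0_sym)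
  have len: "length (butlast m) < length m" if "m \<in> A" for m using that A by (cases m) auto
  show "(h, h) ~: E0 A" for h
  proof
    assume "(h, h) \<in> E0 A"
    then obtain m where m: "m \<in> A" "(h, h) \<in> Ed m" by (auto simp: E0_def)
    then have "butlast m = m" by (auto simp: Ed_def)
    then show False using len[OF m(1)] by simp
  qed
  have node: "butlast m \<in> T & (butlast m ~= [] --> last (butlast m) ~= last m)" "m ~= []" "m = butlast m @ [last m]"
    if m: "m \<in> A" for m
  proof -
    have "m \<in> T" "m ~= []" using m A by auto
    then show "butlast m \<in> T & (butlast m ~= [] --> last (butlast m) ~= last m)" "m ~= []" "m = butlast m @ [last m]"
      using T_node[of m] by auto
  qed
  have same: "m = m'" if m: "m \<in> A" "m' \<in> A" and f: "(butlast m, last m) = (butlast m', last m')" for m m'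
    using node(3)[OF m(1)] node(3)[OF m(2)] f by simp
  have diff: "(butlast m, last m) ~= (m', last m')" if m: "m \<in> A" "m' \<in> A" for m m'
    using node[OF m(1)] node[OF m(2)] by auto
  show "single_valued (E0 A)"
  proof (rule single_valuedI)
    fix x y z assume "(x, y) \<in> E0 A" "(x, z) \<in> E0 A"
    then obtain m m' where m: "m \<in> A" "(x, y) \<in> Ed m \<or> (y, x) \<in> Ed m" "m' \<in> A" "(x, z) \<in> Ed m' \<or> (z, x) \<in> Ed m'"
      by (auto simp: E0_def)
    consider "(x, y) \<in> Ed m" "(x, z) \<in> Ed m'" | "(y, x) \<in> Ed m" "(z, x) \<in> Ed m'"
      | "(x, y) \<in> Ed m" "(z, x) \<in> Ed m'" | "(y, x) \<in> Ed m" "(x, z) \<in> Ed m'" using m by blast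
    then show "y = z"
    proof cases
      case 1
      then have "m = m'" using same[OF m(1,3)] Ed_faces[of x y m] Ed_faces[of x z m'] by auto
      then show ?thesis using 1 by (auto simp: Ed_def)
    next
      case 2
      then have "m = m'" by (auto simp: Ed_def)
      moreover have "p = p'" if "p \<circ> tt = p' \<circ> tt" for p p' :: "nat => nat"
        using arg_cong[OF that, of "%f. f \<circ> tt"] by (simp add: comp_assoc)
      ultimately show ?thesis using 2 by (auto simp: Ed_def)
    next
      case 3
      then show ?thesis using diff[OF m(1,3)] Ed_faces[of x y m] Ed_faces[of z x m'] by auto
    next
      case 4
      then show ?thesis using diff[OF m(3,1)] Ed_faces[of y x m] Ed_faces[of x z m'] by auto
    qed
  qed
qed

text \<open>Tree gluings respect colours, and both \<open>rot3\<close> and \<open>tt\<close> fix the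
  entries from 3 on, so even the ordering of the tail is constant on a component.\<close>

lemma E0_tail:
  assumes "(x, y) \<in> conn (E0 A)" "n \<ge> 3" shows "snd x n = snd y n"
  by (rule conn_invariant[OF assms(1), of "%x. snd x n"])
    (use assms(2) in \<open>auto simp: nxt_def E0_def Ed_def\<close>)

text \<open>Tail and orientation are invariants of the component; once the facet and the first
  colour are fixed, only one flag is left. This supplies the hypothesis \<open>indep\<close> of
  \<open>planar_batch\<close> for the tree.\<close>

lemma E0_same:
  assumes A: "A \<subseteq> T - {[]}" and c: "(x, y) \<in> conn (E0 A)" and H: "x \<in> H" "y \<in> H"
    and f: "fst x = fst y" "snd x 0 = snd y 0"
  shows "x = y"
proof -
  have p: "snd x permutes {..d}" "snd y permutes {..d}" using H by (auto simp: H_def)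
  obtain s where s: "s permutes {1..d}" "snd y = snd x \<circ> s" by (rule same_face_perm[OF p f(2)])
  have "gs x = gs y" by (rule conn_gs[OF c]) (use E0_gs[OF A] in auto)
  then have "sign (snd x) = sign (snd y)" using f(1) by (simp add: gs_def)
  then have "sign s = 1" using s p sign_mult[OF p(1) sub_permutes[OF s(1)]]
    by (cases "snd x" rule: sign_cases) auto
  moreover have "s n = n" if "n \<in> {3..d}" for n
  proof -
    have "snd x (s n) = snd x n" using E0_tail[OF c, of n] that s(2) by simp
    then show ?thesis using p(1) by (metis permutes_inj injD)
  qed
  ultimately have "s = id"
    using perm_agree_tail[OF s(1) permutes_id] d3 by (auto simp: sign_id)
  then show ?thesis using s(2) f(1) by (simp add: prod_eq_iff)
qed

text \<open>A longest word is a leaf. Before it is attached its triangles are isolated polygons, so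
  every pair of the batch joins two different components.\<close>

lemma planar_E0: "A \<subseteq> T - {[]} ==> planar (E0 A)"
proof (induction "card A" arbitrary: A rule: less_induct)
  case less
  have finA: "finite A" using less.prems finT finite_subset by blast
  show ?case
  proof (cases "A = {}")
    case True
    then show ?thesis by (simp add: E0_def planar_def)
  next
    case False
    obtain m where m: "m \<in> A" "!!m'. m' \<in> A ==> length m' <= length m"
    proof -
      have "Max (length ` A) \<in> length ` A" using finA False by (intro Max_in) auto
      then obtain m where "m \<in> A" "length m = Max (length ` A)" by auto
      then show ?thesis using that[of m] finA by simp
    qed
    define B where "B = A - {m}"
    have B: "B \<subseteq> T - {[]}" "card B < card A" "A = insert m B" "m ~: B"
      using m less.prems card_Diff1_less[OF finA m(1)] by (auto simp: B_def)
    have mT: "m \<in> T" "m ~= []" using m less.prems by auto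
    have bm: "butlast m ~= m" using mT by (metis append_butlast_last_id not_Cons_self2 append_self_conv)
    let ?P = "Ed m \<union> (Ed m)\<inverse>"
    have EA: "E0 A = E0 B \<union> ?P" unfolding B(3) by (auto simp: E0_def)
    have noB: "fst x ~= m & fst y ~= m" if "(x, y) \<in> E0 B" for x y
    proof -
      obtain m' where m': "m' \<in> B" "(x, y) \<in> Ed m' \<or> (y, x) \<in> Ed m'" using \<open>(x, y) \<in> E0 B\<close> by (auto simp: E0_def)
      have "m' ~= m" "length m' <= length m" "m' ~= []" using m' B m by auto
      moreover have "butlast m' ~= m"
      proof
        assume "butlast m' = m"
        then have "length m = length m' - 1" by auto
        then show False using \<open>length m' <= length m\<close> \<open>m' ~= []\<close> by (cases m') auto
      qed
      ultimately show ?thesis using m'(2) by (auto simp: Ed_def)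
    qed
    have iso: "(fst x = m) = (fst y = m)" if "(x, y) \<in> conn (E0 B)" for x y
      by (rule conn_invariant[OF that, of "%x. fst x = m"]) (use noB in \<open>auto simp: nxt_def\<close>)
    show ?thesis
      unfolding EA
    proof (rule planar_batch)
      show "matching H (E0 B \<union> ?P)" using E0_matching[OF less.prems] EA by simp
      show "planar (E0 B)" by (rule less.hyps[OF B(2,1)])
      show "sym (E0 B)" by (rule E0_sym)
      show "sym ?P" by (auto simp: sym_def)
      show "same_cycle (E0 B) u v" if "(u, v) \<in> ?P" "(u, v) \<in> conn (E0 B)" for u v
        using iso[OF that(2)] that(1) bm by (auto simp: Ed_def)
      show "a = u \<or> a = v" if uv: "(u, v) \<in> ?P" and ab: "(a, b) \<in> ?P" and c: "(u, a) \<in> conn (E0 B)" for u v a b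
      proof -
        have ua: "u \<in> H" "a \<in> H" using uv ab Ed_sub_H[OF mT] by auto
        have 0: "snd u 0 = last m" "snd a 0 = last m" "fst u \<in> {m, butlast m}" "fst a \<in> {m, butlast m}"
          using uv ab by (auto simp: Ed_def)
        then have "fst u = fst a" using iso[OF c] bm by auto
        then show ?thesis using E0_same[OF B(1) c ua] 0 by simp
      qed
    qed
  qed
qed

text \<open>The gluings performed so far, latest first.\<close>

definition symcl :: "(flag \<times> flag) list => (flag \<times> flag) set" where
  "symcl ms = set ms \<union> (set ms)\<inverse>"

definition ET :: "(flag \<times> flag) set" where "ET = E0 (T - {[]})"

definition EM :: "(flag \<times> flag) list => (flag \<times> flag) set" where
  "EM ms = ET \<union> (\<Union>(x, y)\<in>symcl ms. Gl d x y)"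

text \<open>The combinatorial trace of a gluing. Membership in \<open>conn E\<close> expresses that
  the two ridges share a face of codimension three, the conditions on \<open>face\<close> that they
  are not yet glued, and the last two conjuncts are the hypotheses of \<open>planar_batch\<close>
  for the forced pairs. Fixing the sign to 1 halves the number of possible names of a ridge.\<close>

definition good_step :: "(flag \<times> flag) set => flag => flag => bool" where
  "good_step E x y \<longleftrightarrow> x \<in> H & y \<in> H & fst x ~= fst y & gs x = 1 & gs y = 1 &
     face x ~: face ` Domain E & face y ~: face ` Domain E & (x, y) \<in> conn E &
     (\<forall>(u, v)\<in>Gl d x y. (u, v) \<in> conn E --> same_cycle E u v) &
     (\<forall>(u, v)\<in>Gl d x y \<union> Gl d y x. \<forall>(a, b)\<in>Gl d x y \<union> Gl d y x. (u, a) \<in> conn E --> a = u \<or> a = v)"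

inductive good :: "(flag \<times> flag) list => bool" where
  good_Nil: "good []"
| good_Cons: "good ms ==> good_step (EM ms) x y ==> good ((x, y) # ms)"

lemma d2: "2 <= d" using d3 by simp

lemma symcl_Cons: "symcl ((x, y) # ms) = {(x, y), (y, x)} \<union> symcl ms"
  by (auto simp: symcl_def)

lemma sym_symcl: "sym (symcl ms)" by (auto simp: symcl_def sym_def)

lemma EM_Cons: "EM ((x, y) # ms) = EM ms \<union> (Gl d x y \<union> Gl d y x)"
  by (auto simp: EM_def symcl_Cons)

lemma EM_Nil: "EM [] = ET" by (simp add: EM_def symcl_def)

lemma same_cycle_sym: "same_cycle E u v ==> same_cycle E v u" by (auto simp: same_cycle_def)

text \<open>The statements are proved together because the matching property and planarity of the
  old pairs are needed for the new ones. The last statement makes the named flag of a ridge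
  unique.\<close>

lemma good_invariants:
  assumes "good ms"
  shows "matching H (EM ms)" "planar (EM ms)" "!!x y. (x, y) \<in> EM ms ==> gs x = gs y"
    "!!x y. (x, y) \<in> symcl ms ==> x \<in> H & gs x = 1 & fst x ~= fst y & face x ~: face ` Domain ET"
    "!!x y a b. (x, y) \<in> symcl ms ==> (a, b) \<in> symcl ms ==> face a = face x ==> a = x & b = y"
proof -
  have "matching H (EM ms) & planar (EM ms) & (\<forall>(x, y)\<in>EM ms. gs x = gs y) &
    (\<forall>(x, y)\<in>symcl ms. x \<in> H & gs x = 1 & fst x ~= fst y & face x ~: face ` Domain ET) &
    (\<forall>(x, y)\<in>symcl ms. \<forall>(a, b)\<in>symcl ms. face a = face x --> a = x & b = y)"
    using assms
  proof induction
    case good_Nil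
    then show ?case
      using E0_matching[of "T - {[]}"] planar_E0[of "T - {[]}"] E0_gs[of "T - {[]}"]
      unfolding EM_Nil ET_def by (auto simp: symcl_def)
  next
    case (good_Cons ms x y)
    let ?P = "Gl d x y \<union> Gl d y x"
    have st: "x \<in> H" "y \<in> H" "fst x ~= fst y" "gs x = 1" "gs y = 1"
      "face x ~: face ` Domain (EM ms)" "face y ~: face ` Domain (EM ms)"
      "!!u v. (u, v) \<in> Gl d x y ==> (u, v) \<in> conn (EM ms) ==> same_cycle (EM ms) u v"
      "!!u v a b. (u, v) \<in> ?P ==> (a, b) \<in> ?P ==> (u, a) \<in> conn (EM ms) ==> a = u \<or> a = v"
      using good_Cons.hyps(2) unfolding good_step_def by (simp_all, blast+)
    have mm: "matching H (EM ms)" "planar (EM ms)" using good_Cons.IH by auto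
    have symE: "sym (EM ms)" using mm(1) by (simp add: matching_def)
    have cvr: "Gl d y x = (Gl d x y)\<inverse>" by (rule Gl_converse[OF d2])
    have symP: "sym ?P" unfolding cvr by (auto simp: sym_def)
    have dis: "face h ~= face x" "face h ~= face y" if "h \<in> Domain (EM ms)" for h
      using st(6,7) that by (metis imageI)+
    have fxy: "face x ~= face y" using st(3) by (auto simp: face_def)
    have svG: "single_valued (Gl d a b)" if "a \<in> H" for a b
    proof (rule single_valuedI)
      fix u v z assume uvz: "(u, v) \<in> Gl d a b" "(u, z) \<in> Gl d a b"
      obtain s where s1: "u = (fst a, snd a \<circ> s)" "v = (fst b, snd b \<circ> (tt \<circ> s \<circ> tt))"
        using GlE[OF uvz(1)] by blast
      obtain s' where s2: "u = (fst a, snd a \<circ> s')" "z = (fst b, snd b \<circ> (tt \<circ> s' \<circ> tt))"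
        using GlE[OF uvz(2)] by blast
      note s = s1(2) s2(2)
      have s3: "snd a \<circ> s = snd a \<circ> s'" using s1 s2 by simp
      have "inj (snd a)" using that by (auto simp: H_def permutes_inj)
      then have "s = s'" using s3 by (simp add: fun_eq_iff inj_eq)
      then show "v = z" using s by simp
    qed
    have MM: "matching H (EM ms \<union> ?P)"
      unfolding matching_def
    proof (intro conjI allI)
      show "EM ms \<union> ?P \<subseteq> H \<times> H" using mm(1) Gl_sub_H[OF st(1,2)] Gl_sub_H[OF st(2,1)] by (auto simp: matching_def)
      show "sym (EM ms \<union> ?P)" using symE symP by (rule sym_Un)
      show "(h, h) ~: EM ms \<union> ?P" for h
      proof -
        have "(h, h) ~: EM ms" using mm(1) unfolding matching_def by blast
        then show ?thesis using Gl_face[of h h d x y] Gl_face[of h h d y x] fxy by auto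
      qed
      show "single_valued (EM ms \<union> ?P)"
      proof (rule single_valuedI)
        fix u v z assume uv: "(u, v) \<in> EM ms \<union> ?P" "(u, z) \<in> EM ms \<union> ?P"
        have g: "(u, t) \<in> Gl d x y ==> face u = face x" "(u, t) \<in> Gl d y x ==> face u = face y" for t
          using Gl_face by blast+
        have e: "(u, t) \<in> EM ms ==> face u ~= face x & face u ~= face y" for t using dis[of u] by blast
        have sv: "single_valued (EM ms)" using mm(1) by (simp add: matching_def)
        consider "face u ~= face x" "face u ~= face y" | "face u = face x" | "face u = face y" by blast
        then show "v = z"
        proof cases
          case 1
          then have "(u, v) \<in> EM ms" "(u, z) \<in> EM ms" using uv g[of v] g[of z] by auto
          then show ?thesis by (rule single_valuedD[OF sv])
        next
          case 2
          then have "(u, v) \<in> Gl d x y" "(u, z) \<in> Gl d x y" using uv g(2)[of v] g(2)[of z] e[of v] e[of z] fxy by auto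
          then show ?thesis by (rule single_valuedD[OF svG[OF st(1)]])
        next
          case 3
          then have "(u, v) \<in> Gl d y x" "(u, z) \<in> Gl d y x" using uv g(1)[of v] g(1)[of z] e[of v] e[of z] fxy by auto
          then show ?thesis by (rule single_valuedD[OF svG[OF st(2)]])
        qed
      qed
    qed
    have PL: "planar (EM ms \<union> ?P)"
    proof (rule planar_batch[OF \<open>matching H (EM ms \<union> ?P)\<close> mm(2) symE symP _ st(9)])
      fix u v assume uv: "(u, v) \<in> ?P" "(u, v) \<in> conn (EM ms)"
      show "same_cycle (EM ms) u v"
      proof (cases "(u, v) \<in> Gl d x y")
        case False
        then have "(v, u) \<in> Gl d x y" using uv(1) cvr by auto
        then show ?thesis using st(8) conn_sym[OF symE uv(2)] same_cycle_sym by blast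
      qed (use st(8) uv in blast)
    qed
    have GS: "\<forall>(u, v)\<in>EM ms \<union> ?P. gs u = gs v"
      using good_Cons.IH Gl_gs[OF st(1,2)] Gl_gs[OF st(2,1)] st(4,5) by auto
    have "face x ~: face ` Domain ET" "face y ~: face ` Domain ET"
      using st(6,7) by (auto simp: EM_def)
    have fr: "face a ~= face x & face a ~= face y" if "(a, b) \<in> symcl ms" for a b
    proof -
      have "(a, b) \<in> EM ms" unfolding EM_def by (intro UnI2 UN_I[OF that]) (simp add: Gl_in)
      then show ?thesis using dis[of a] by blast
    qed
    let ?S = "{(x, y), (y, x)} \<union> symcl ms"
    have IH4: "a \<in> H & gs a = 1 & fst a ~= fst b & face a ~: face ` Domain ET" if "(a, b) \<in> symcl ms" for a b
      using good_Cons.IH that by blast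
    have IH5: "a' = a & b' = b" if "(a, b) \<in> symcl ms" "(a', b') \<in> symcl ms" "face a' = face a" for a b a' b'
      using good_Cons.IH that by blast
    have P4: "a \<in> H & gs a = 1 & fst a ~= fst b & face a ~: face ` Domain ET" if "(a, b) \<in> ?S" for a b
    proof (cases "(a, b) \<in> symcl ms")
      case False
      then have "a = x & b = y \<or> a = y & b = x" using that by simp
      then show ?thesis using st(1-5) \<open>face x ~: face ` Domain ET\<close> \<open>face y ~: face ` Domain ET\<close> by metis
    qed (use IH4 in blast)
    have P5: "a' = a & b' = b" if ab: "(a, b) \<in> ?S" "(a', b') \<in> ?S" "face a' = face a" for a b a' b'
    proof -
      have cs: "(c, e) \<in> symcl ms \<or> c = x & e = y \<or> c = y & e = x" if "(c, e) \<in> ?S" for c e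
        using that by auto
      show ?thesis
        using cs[OF ab(1)] cs[OF ab(2)]
        by (elim disjE conjE) (use IH5 fr ab(3) fxy in \<open>simp_all, metis+\<close>)
    qed
    have G: "\<forall>z\<in>?S. case z of (a, b) => a \<in> H & gs a = 1 & fst a ~= fst b & face a ~: face ` Domain ET"
    proof
      fix z assume "z \<in> ?S"
      then show "case z of (a, b) => a \<in> H & gs a = 1 & fst a ~= fst b & face a ~: face ` Domain ET"
        using P4[of "fst z" "snd z"] by (simp add: case_prod_beta)
    qed
    have G': "\<forall>z\<in>?S. case z of (a, b) => \<forall>z'\<in>?S. case z' of (a', b') => face a' = face a --> a' = a & b' = b"
    proof
      fix z assume z: "z \<in> ?S"
      have "\<forall>z'\<in>?S. face (fst z') = face (fst z) --> fst z' = fst z & snd z' = snd z"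
      proof (intro ballI impI)
        fix z' assume z': "z' \<in> ?S" "face (fst z') = face (fst z)"
        show "fst z' = fst z & snd z' = snd z"
          by (rule P5) (simp_all only: prod.collapse z z')
      qed
      then show "case z of (a, b) => \<forall>z'\<in>?S. case z' of (a', b') => face a' = face a --> a' = a & b' = b"
        by (simp add: case_prod_beta)
    qed
    show ?case unfolding EM_Cons symcl_Cons by (intro conjI MM PL GS G G')
  qed
  then show "matching H (EM ms)" "planar (EM ms)" "!!x y. (x, y) \<in> EM ms ==> gs x = gs y"
    "!!x y. (x, y) \<in> symcl ms ==> x \<in> H & gs x = 1 & fst x ~= fst y & face x ~: face ` Domain ET"
    "!!x y a b. (x, y) \<in> symcl ms ==> (a, b) \<in> symcl ms ==> face a = face x ==> a = x & b = y"
    by blast+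
qed

definition Outc :: "flag set => (flag \<times> flag) set set" where
  "Outc L = {symcl ms |ms. good ms & Domain (symcl ms) = L}"

lemma card_Outc_le:
  assumes L: "L \<subseteq> H"
  shows "real (card (Outc L)) <= 12 ^ card L"
proof -
  have conn_fst: "fst x = fst y" if "(x, y) \<in> conn {}" for x y
    by (rule conn_invariant[OF that]) (auto simp: nxt_def)
  have E: "ET \<union> (\<Union>(x, y)\<in>symcl ms. Gl d x y) = EM ms" for ms by (simp add: EM_def)
  interpret chord_outcomes H nxt L "Gl d" ET "Outc L"
  proof
    show "L \<subseteq> H" by (rule L)
    show "sym ET" unfolding ET_def by (rule E0_sym)
    show "Gl d y x = (Gl d x y)\<inverse>" for x y by (rule Gl_converse[OF d2])
    show "(x, y) \<in> Gl d x y" for x y by (rule Gl_in)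
    fix M assume "M \<in> Outc L"
    then obtain ms where ms: "M = symcl ms" "good ms" "Domain (symcl ms) = L" by (auto simp: Outc_def)
    note inv = good_invariants[OF ms(2)]
    show "sym M" using ms sym_symcl by simp
    show "M \<subseteq> L \<times> L" unfolding ms(1) ms(3)[symmetric] using sym_symcl[of ms] by (auto dest: symD)
    show "matching H (ET \<union> (\<Union>(x, y)\<in>M. Gl d x y))" "planar (ET \<union> (\<Union>(x, y)\<in>M. Gl d x y))"
      using inv(1,2) unfolding ms(1) E by auto
    show "(x, y) ~: conn {}" if "(x, y) \<in> M" for x y
      using conn_fst[of x y] inv(4)[of x y] that unfolding ms(1) by blast
    fix K :: "(flag \<times> flag) set" assume K: "sym K"
    {
      assume KM: "K \<subset> M"
      have "\<exists>z\<in>set ms. z ~: K"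
      proof (rule ccontr)
        assume "\<not> ?thesis"
        then have "symcl ms \<subseteq> K" using K by (auto simp: symcl_def dest: symD)
        then show False using KM ms(1) by auto
      qed
      \<comment> \<open>Lists grow at the front, so the last element outside \<open>K\<close> is the
        earliest unknown gluing; all gluings made before it are known, and they connect its
        ends.\<close>
      then obtain post z pre where sp: "ms = post @ z # pre" "z ~: K" "\<forall>z'\<in>set pre. \<not> z' ~: K"
        using split_list_last_prop[of ms "%z. z ~: K"] by blast
      obtain x y where z: "z = (x, y)" by (cases z)
      have suf: "good (z # pre)" if "good (post @ z # pre)" for post
        using that by (induction post) (auto elim: good.cases)
      then have "good (z # pre)" using ms(2) sp(1) by simp
      then have "(x, y) \<in> conn (EM pre)" unfolding z by (cases rule: good.cases) (auto simp: good_step_def)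
      moreover have "symcl pre \<subseteq> K" using sp(3) K by (auto simp: symcl_def dest: symD)
      then have "EM pre \<subseteq> ET \<union> (\<Union>(x, y)\<in>K. Gl d x y)" by (auto simp: EM_def)
      then have "conn (EM pre) \<subseteq> conn (ET \<union> (\<Union>(x, y)\<in>K. Gl d x y))" by (rule conn_mono)
      ultimately have "(x, y) \<in> conn (ET \<union> (\<Union>(x, y)\<in>K. Gl d x y))" by blast
      moreover have "(x, y) \<in> M - K" using sp z ms(1) by (auto simp: symcl_def)
      ultimately show "\<exists>(x, y)\<in>M - K. (x, y) \<in> conn (ET \<union> (\<Union>(x, y)\<in>K. Gl d x y))" by blast
    }
    {
      fix x y assume KM: "K \<subseteq> M" "(x, y) \<in> M - K"
      have xM: "(x, y) \<in> symcl ms" using KM ms(1) by auto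
      show "(x, y) ~: ET \<union> (\<Union>(x, y)\<in>K. Gl d x y)"
      proof
        assume "(x, y) \<in> ET \<union> (\<Union>(x, y)\<in>K. Gl d x y)"
        then consider "(x, y) \<in> ET" | a b where "(a, b) \<in> K" "(x, y) \<in> Gl d a b" by auto
        then show False
        proof cases
          case 1
          then have "face x \<in> face ` Domain ET" by blast
          then show ?thesis using inv(4)[OF xM] by blast
        next
          case 2
          then have "face a = face x" using Gl_face by metis
          moreover have "(a, b) \<in> symcl ms" using 2 KM ms(1) by auto
          ultimately have "a = x & b = y" using inv(5)[OF xM] by blast
          then show ?thesis using 2 KM(2) by simp
        qed
      qed
    }
  qed
  show ?thesis by (rule card_Out_le)
qed

end

section \<open>The number of gluing sequences\<close>

text \<open>A set of letters is, for every ridge, a choice of nothing or of one among at most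
  \<open>k\<close> letters, and a chosen letter has weight 12. The sum over all choices is a product
  with factors 1 + 12 k.\<close>

lemma sum_partial_choices:
  fixes X :: "'f => 'x set"
  assumes fin: "finite F" "!!f. f \<in> F ==> finite (X f)" and k: "!!f. f \<in> F ==> card (X f) <= k"
    and LL: "!!L. L \<in> LL ==> L \<subseteq> (\<Union>f\<in>F. X f)"
      "!!L f x y. L \<in> LL ==> f \<in> F ==> x \<in> L \<inter> X f ==> y \<in> L \<inter> X f ==> x = y"
    and dis: "!!f f'. f \<in> F ==> f' \<in> F ==> f ~= f' ==> X f \<inter> X f' = {}"
  shows "(\<Sum>L\<in>LL. 12 ^ card L) <= (1 + 12 * real k) ^ card F"
proof -
  define U where "U f = insert {} ((%x. {x}) ` X f)" for f
  have finO: "finite (U f)" if "f \<in> F" for f using fin(2)[OF that] by (simp add: U_def)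
  define g where "g L = (\<lambda>f\<in>F. L \<inter> X f)" for L
  have gO: "L \<inter> X f \<in> U f" if "L \<in> LL" "f \<in> F" for L f
  proof (cases "L \<inter> X f = {}")
    case False
    then obtain x where x: "x \<in> L \<inter> X f" by blast
    then have "L \<inter> X f = {x}" using LL(2)[OF that] by blast
    then show ?thesis using x by (auto simp: U_def)
  qed (simp add: U_def)
  then have gP: "g ` LL \<subseteq> PiE F U" by (auto simp: g_def)
  have LU: "L = (\<Union>f\<in>F. g L f)" if "L \<in> LL" for L
  proof -
    have "(\<Union>f\<in>F. g L f) = L \<inter> (\<Union>f\<in>F. X f)" by (auto simp: g_def)
    also have "\<dots> = L" using LL(1)[OF that] by (rule Int_absorb2)
    finally show ?thesis by (rule sym)
  qed
  have inj: "inj_on g LL"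
  proof (rule inj_onI)
    fix L L' assume "L \<in> LL" "L' \<in> LL" "g L = g L'"
    then show "L = L'" using LU[of L, OF \<open>L \<in> LL\<close>] LU[of L', OF \<open>L' \<in> LL\<close>] by (metis (no_types))
  qed
  have cardL: "card L = (\<Sum>f\<in>F. card (g L f))" if "L \<in> LL" for L
  proof -
    have "card (\<Union>f\<in>F. g L f) = (\<Sum>f\<in>F. card (g L f))"
    proof (rule card_UN_disjoint[OF fin(1)])
      show "\<forall>f\<in>F. finite (g L f)" using fin(2) by (auto simp: g_def)
      show "\<forall>f\<in>F. \<forall>f'\<in>F. f ~= f' --> g L f \<inter> g L f' = {}" using dis by (auto simp: g_def)
    qed
    then show ?thesis by (simp only: LU[OF that, symmetric])
  qed
  have "(\<Sum>L\<in>LL. (12::real) ^ card L) = (\<Sum>L\<in>LL. \<Prod>f\<in>F. 12 ^ card (g L f))"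
    by (intro sum.cong refl) (simp add: cardL power_sum)
  also have "\<dots> = (\<Sum>h\<in>g ` LL. \<Prod>f\<in>F. 12 ^ card (h f))"
    by (simp add: sum.reindex[OF inj])
  also have "\<dots> <= (\<Sum>h\<in>PiE F U. \<Prod>f\<in>F. 12 ^ card (h f))"
    using gP fin(1) finO by (intro sum_mono2 finite_PiE) (auto intro: prod_nonneg)
  also have "\<dots> = (\<Prod>f\<in>F. \<Sum>u\<in>U f. 12 ^ card u)"
    by (rule prod_sum_PiE[symmetric, of F U "%_ u. 12 ^ card u"]) (use fin finO in auto)
  also have "\<dots> <= (\<Prod>f\<in>F. 1 + 12 * real k)"
  proof (intro prod_mono conjI)
    fix f assume f: "f \<in> F"
    show "0 <= (\<Sum>u\<in>U f. (12::real) ^ card u)" by (intro sum_nonneg) simp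
    have "(\<Sum>u\<in>U f. (12::real) ^ card u) = 1 + (\<Sum>u\<in>(%x. {x}) ` X f. 12 ^ card u)"
      unfolding U_def using fin(2)[OF f] by (subst sum.insert) auto
    also have "(\<Sum>u\<in>(%x. {x}) ` X f. (12::real) ^ card u) = 12 * real (card (X f))"
      by (subst sum.reindex) (auto simp: inj_on_def)
    finally show "(\<Sum>u\<in>U f. (12::real) ^ card u) <= 1 + 12 * real k" using k[OF f] by simp
  qed
  finally show ?thesis by simp
qed

context tree_flags
begin

definition FF :: "(nat list \<times> nat) set" where
  "FF = T \<times> {..d} - ((%m. (butlast m, last m)) ` (T - {[]}) \<union> (%m. (m, last m)) ` (T - {[]}))"

text \<open>A facet has d + 1 ridges, and each of the \<open>card T - 1\<close> tree edges uses up
  two of them.\<close>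

lemma card_FF: "card FF = (d - 1) * card T + 2"
proof -
  let ?A = "(%m. (butlast m, last m)) ` (T - {[]})" and ?B = "(%m. (m, last m)) ` (T - {[]})"
  have n: "card (T - {[]}) = card T - 1" "card T \<ge> 1"
    using nilT finT by (auto simp: Suc_le_eq card_gt_0_iff)
  have inj: "inj_on (%m. (butlast m, last m)) (T - {[]})" "inj_on (%m. (m, last m)) (T - {[]})"
    by (auto simp: inj_on_def) (metis append_butlast_last_id)
  have dis: "?A \<inter> ?B = {}"
  proof (rule ccontr)
    assume "?A \<inter> ?B ~= {}"
    then obtain m m' where "m \<in> T - {[]}" "m' \<in> T - {[]}" "butlast m = m'" "last m = last m'" by auto
    then show False using T_node[of m] by auto
  qed
  have sub: "?A \<union> ?B \<subseteq> T \<times> {..d}" using T_node by auto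
  have "card (?A \<union> ?B) = 2 * (card T - 1)"
    using finT by (subst card_Un_disjoint[OF _ _ dis]) (auto simp: card_image[OF inj(1)] card_image[OF inj(2)] n)
  then have "card FF = card T * Suc d - 2 * (card T - 1)"
    unfolding FF_def using finT sub by (subst card_Diff_subset) (auto intro: finite_subset)
  moreover obtain k where "card T = Suc k" using n(2) by (cases "card T") auto
  moreover obtain e where "d = Suc e" using d3 by (cases d) auto
  ultimately show ?thesis by simp
qed

lemma face_Domain_ET: "face ` Domain ET = (%m. (butlast m, last m)) ` (T - {[]}) \<union> (%m. (m, last m)) ` (T - {[]})"
proof (intro equalityI subsetI)
  fix f assume "f \<in> face ` Domain ET"
  then obtain x y m where m: "m \<in> T - {[]}" "f = face x" "(x, y) \<in> Ed m \<or> (y, x) \<in> Ed m"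
    unfolding ET_def E0_def by blast
  then show "f \<in> (%m. (butlast m, last m)) ` (T - {[]}) \<union> (%m. (m, last m)) ` (T - {[]})"
    using Ed_faces[of x y m] Ed_faces[of y x m] by auto
next
  fix f assume "f \<in> (%m. (butlast m, last m)) ` (T - {[]}) \<union> (%m. (m, last m)) ` (T - {[]})"
  then obtain m where m: "m \<in> T - {[]}" "f = (butlast m, last m) \<or> f = (m, last m)" by auto
  define p where "p = Transposition.transpose 0 (last m)"
  have p: "p permutes {..d}" "p 0 = last m" unfolding p_def using T_node[of m] m(1)
    by (auto intro: permutes_swap_id)
  then have e: "((butlast m, p), (m, p \<circ> tt)) \<in> Ed m" by (auto simp: Ed_def)
  then have "(butlast m, p) \<in> Domain ET" "(m, p \<circ> tt) \<in> Domain ET" using m(1) by (auto simp: ET_def E0_def)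
  then have "face (butlast m, p) \<in> face ` Domain ET" "face (m, p \<circ> tt) \<in> face ` Domain ET" by blast+
  then show "f \<in> face ` Domain ET" using m(2) p(2) by (auto simp: face_def)
qed

definition XX :: "nat list \<times> nat => flag set" where
  "XX f = {x \<in> H. face x = f & gs x = 1}"

text \<open>A ridge has at most d! flags, and composition with \<open>tt\<close> exchanges the two
  signs.\<close>

lemma card_XX: "card (XX f) <= fact d div 2"
proof (cases "fst f \<in> T")
  case False
  then have "XX f = {}" by (auto simp: XX_def H_def face_def)
  then show ?thesis by simp
next
  case True
  define e :: int where "e = (-1) ^ length (fst f)"
  define P where "P s = {p. p permutes {..d} & p 0 = snd f & sign p = (s :: int)}" for s
  have fin: "finite (P s)" for s by (rule finite_subset[OF _ finite_permutations[of "{..d}"]]) (auto simp: P_def)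
  have "XX f = Pair (fst f) ` P e"
  proof -
    have "e * e = 1" unfolding e_def by (simp flip: power_add)
    then have "e * s = 1 \<longleftrightarrow> s = e" for s :: int by (metis mult.left_commute mult.right_neutral mult.commute)
    then show ?thesis using True by (auto simp: XX_def H_def face_def gs_def P_def e_def)
  qed
  then have 1: "card (XX f) = card (P e)" by (simp add: card_image inj_on_def)
  have "card (P e) = card (P (-e))"
  proof (rule bij_betw_same_card[of "%p. p \<circ> tt"], rule bij_betw_byWitness[of _ "%p. p \<circ> tt"])
    show "(%p. p \<circ> tt) ` P e \<subseteq> P (- e)" "(%p. p \<circ> tt) ` P (- e) \<subseteq> P e"
      using tt_permutes_d by (auto simp: P_def sign_mult sign_tt intro: permutes_compose)
  qed (auto simp: comp_assoc)
  moreover have "P e \<inter> P (-e) = {}" by (auto simp: P_def e_def minus_one_power_iff)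
  ultimately have 2: "2 * card (P e) = card (P e \<union> P (-e))" using fin by (simp add: card_Un_disjoint)
  have "card (P e \<union> P (-e)) <= fact d"
  proof (cases "P e \<union> P (-e) = {}")
    case False
    then obtain p0 where p0: "p0 permutes {..d}" "p0 0 = snd f" by (auto simp: P_def)
    have "P e \<union> P (-e) \<subseteq> (%s. p0 \<circ> s) ` {s. s permutes {1..d}}"
    proof
      fix q assume "q \<in> P e \<union> P (-e)"
      then have "q permutes {..d}" "p0 0 = q 0" using p0(2) by (auto simp: P_def)
      then obtain s where "s permutes {1..d}" "q = p0 \<circ> s" using same_face_perm[OF p0(1)] by blast
      then show "q \<in> (%s. p0 \<circ> s) ` {s. s permutes {1..d}}" by blast
    qed
    then have "card (P e \<union> P (-e)) <= card {s. s permutes {1..d}}"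
      by (intro surj_card_le finite_permutations) auto
    then show ?thesis by (simp add: card_permutations)
  qed simp
  with 1 2 show ?thesis by simp
qed

lemma card_outcomes:
  shows "finite {symcl ms |ms. good ms}"
    and "real (card {symcl ms |ms. good ms}) <= (1 + 12 * real (fact d div 2)) ^ ((d - 1) * card T + 2)"
proof -
  define LL where "LL = {Domain (symcl ms) |ms. good ms}"
  have LLp: "L \<subseteq> H & L \<subseteq> (\<Union>f\<in>FF. XX f) & inj_on face L" if LL1: "L \<in> LL" for L
  proof -
    obtain ms where ms: "L = Domain (symcl ms)" "good ms" using LL1 by (auto simp: LL_def)
    note inv = good_invariants[OF ms(2)]
    have "x \<in> H & gs x = 1 & face x ~: face ` Domain ET" if xL: "x \<in> L" for x
    proof -
      obtain y where "(x, y) \<in> symcl ms" using xL ms(1) by blast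
      from inv(4)[OF this] show ?thesis by blast
    qed
    note a = this
    have "x \<in> (\<Union>f\<in>FF. XX f)" if "x \<in> L" for x
    proof -
      have "face x \<in> T \<times> {..d}" using a[OF that] permutes_in_image[of "snd x" "{..d}" 0] by (auto simp: H_def face_def)
      then have "face x \<in> FF" using a[OF that] unfolding FF_def face_Domain_ET by simp
      then show ?thesis using a[OF that] by (auto simp: XX_def)
    qed
    moreover have "inj_on face L"
    proof (rule inj_onI)
      fix x y assume xy: "x \<in> L" "y \<in> L" "face x = face y"
      obtain x' y' where "(x, x') \<in> symcl ms" "(y, y') \<in> symcl ms" using xy(1,2) unfolding ms(1) by blast
      from inv(5)[OF this(2,1) xy(3)] show "x = y" by simp
    qed
    ultimately show ?thesis using a by blast
  qed
  have finLL: "finite LL"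
    by (rule finite_subset[of _ "Pow H"]) (use LLp finite_H in auto)
  have sub: "{symcl ms |ms. good ms} \<subseteq> (\<Union>L\<in>LL. Outc L)" by (auto simp: LL_def Outc_def)
  have finO: "finite (Outc L)" if "L \<in> LL" for L
  proof -
    have "Outc L \<subseteq> Pow (L \<times> L)"
    proof
      fix M assume "M \<in> Outc L"
      then obtain ms where ms: "M = symcl ms" "Domain (symcl ms) = L" by (auto simp: Outc_def)
      have "Range (symcl ms) \<subseteq> L" using sym_symcl[of ms] ms(2) by (auto dest: symD)
      then show "M \<in> Pow (L \<times> L)" using ms by auto
    qed
    moreover have "finite L" using LLp[OF that] finite_H finite_subset by blast
    ultimately show ?thesis by (meson finite_Pow_iff finite_SigmaI finite_subset)
  qed
  show "finite {symcl ms |ms. good ms}" by (rule finite_subset[OF sub]) (use finLL finO in blast)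
  have "card {symcl ms |ms. good ms} <= card (\<Union>L\<in>LL. Outc L)"
    by (rule card_mono[OF _ sub]) (use finLL finO in blast)
  also have "\<dots> <= (\<Sum>L\<in>LL. card (Outc L))" by (rule card_UN_le[OF finLL])
  finally have "real (card {symcl ms |ms. good ms}) <= (\<Sum>L\<in>LL. real (card (Outc L)))"
    by (simp flip: of_nat_sum)
  also have "\<dots> <= (\<Sum>L\<in>LL. 12 ^ card L)" using LLp by (intro sum_mono card_Outc_le) blast
  also have "\<dots> <= (1 + 12 * real (fact d div 2)) ^ card FF"
  proof (rule sum_partial_choices[of FF XX])
    show "finite FF" unfolding FF_def using finT by simp
    show "finite (XX f)" for f unfolding XX_def using finite_H by simp
    show "card (XX f) <= fact d div 2" for f by (rule card_XX)
    show "L \<subseteq> (\<Union>f\<in>FF. XX f)" if "L \<in> LL" for L using LLp[OF that] by blast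
    show "x = y" if "L \<in> LL" "f \<in> FF" "x \<in> L \<inter> XX f" "y \<in> L \<inter> XX f" for L f x y
    proof -
      have "inj_on face L" using LLp[OF that(1)] by blast
      then show ?thesis by (rule inj_onD) (use that in \<open>auto simp: XX_def\<close>)
    qed
    show "XX f \<inter> XX f' = {}" if "f ~= f'" for f f' using that by (auto simp: XX_def)
  qed
  finally show "real (card {symcl ms |ms. good ms}) <= (1 + 12 * real (fact d div 2)) ^ ((d - 1) * card T + 2)"
    unfolding card_FF .
qed

end

section \<open>The number of trees\<close>

definition subtrees :: "nat => nat => nat => nat list set set" where
  "subtrees d e n = {A. finite A & card A <= n &
     (\<forall>w c. w @ [c] \<in> A --> w \<in> A & c <= d & (if w = [] then c ~= e else last w ~= c))}"

definition child :: "nat list set => nat => nat list set" where "child A c = {w. c # w \<in> A}"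

lemma subtrees_nil: "A \<in> subtrees d e n ==> w \<in> A ==> [] \<in> A"
  by (induction w rule: rev_induct) (auto simp: subtrees_def)

lemma subtrees_hd: "A \<in> subtrees d e n ==> c # w \<in> A ==> c <= d & c ~= e"
proof (induction w rule: rev_induct)
  case Nil
  then have "[] @ [c] \<in> A" by simp
  then show ?case using Nil.prems(1) unfolding subtrees_def by fastforce
next
  case (snoc x xs)
  then have "(c # xs) @ [x] \<in> A" by simp
  then have "c # xs \<in> A" using snoc.prems(1) unfolding subtrees_def by blast
  then show ?case using snoc by simp
qed

lemma subtrees_decompose:
  assumes A: "A \<in> subtrees d e (Suc n)" "A ~= {}"
  shows "A = insert [] (\<Union>c\<in>{..d} - {e}. (#) c ` child A c)"
    and "!!c. child A c \<in> subtrees d c n"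
    and "card A = Suc (\<Sum>c\<in>{..d} - {e}. card (child A c))"
proof -
  have nil: "[] \<in> A" using A(2) subtrees_nil[OF A(1)] by blast
  show eq: "A = insert [] (\<Union>c\<in>{..d} - {e}. (#) c ` child A c)"
  proof (intro equalityI subsetI)
    fix w assume "w \<in> A"
    then show "w \<in> insert [] (\<Union>c\<in>{..d} - {e}. (#) c ` child A c)"
      using subtrees_hd[OF A(1)] by (cases w) (auto simp: child_def)
  qed (use nil in \<open>auto simp: child_def\<close>)
  have finA: "finite A" and cA: "card A <= Suc n" using A(1) by (auto simp: subtrees_def)
  have fc: "finite (child A c)" for c
  proof -
    have "(#) c ` child A c \<subseteq> A" by (auto simp: child_def)
    then show ?thesis by (meson finA finite_imageD finite_subset inj_on_def list.inject)
  qed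
  show "child A c \<in> subtrees d c n" for c
  proof -
    have "insert [] ((#) c ` child A c) \<subseteq> A" using nil by (auto simp: child_def)
    then have "card (insert [] ((#) c ` child A c)) <= card A" by (rule card_mono[OF finA])
    moreover have "card (insert [] ((#) c ` child A c)) = Suc (card (child A c))"
      using fc[of c] by (subst card_insert_disjoint) (auto simp: card_image)
    ultimately have "card (child A c) <= n" using cA by simp
    moreover have "w \<in> child A c & x <= d & (if w = [] then x ~= c else last w ~= x)" if "w @ [x] \<in> child A c" for w x
    proof -
      have "(c # w) @ [x] \<in> A" using that by (simp add: child_def)
      moreover have "\<forall>w c. w @ [c] \<in> A --> w \<in> A & c <= d & (if w = [] then c ~= e else last w ~= c)"
        using A(1) unfolding subtrees_def mem_Collect_eq by (elim conjE)
      ultimately have "c # w \<in> A & x <= d & last (c # w) ~= x" by (metis list.distinct(1))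
      then show ?thesis by (auto simp: child_def split: if_splits)
    qed
    ultimately show ?thesis using fc unfolding subtrees_def by (intro CollectI conjI allI impI) blast+
  qed
  have "card A = card (insert [] (\<Union>c\<in>{..d} - {e}. (#) c ` child A c))"
    by (rule arg_cong[OF eq])
  also have "\<dots> = Suc (card (\<Union>c\<in>{..d} - {e}. (#) c ` child A c))"
    by (rule card_insert_disjoint) (use fc in auto)
  also have "card (\<Union>c\<in>{..d} - {e}. (#) c ` child A c) = (\<Sum>c\<in>{..d} - {e}. card ((#) c ` child A c))"
    by (rule card_UN_disjoint) (use fc in auto)
  finally show "card A = Suc (\<Sum>c\<in>{..d} - {e}. card (child A c))" by (simp add: card_image)
qed

text \<open>The generating function of trees is evaluated at 2 ^ (-d), where 2 is a fixed point: a
  node below the root has d possible branches, and 1 + x * 2 ^ d = 2. The root has d + 1 branches,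
  encoded by the forbidden letter \<open>Suc d\<close> that cannot occur, which gives 1 + 2 =
  3.\<close>

lemma subtrees_weight:
  fixes x :: real
  assumes x: "x = 1 / 2 ^ d"
  shows "(\<forall>e. finite (subtrees d e n)) & (\<forall>e\<le>d. (\<Sum>A\<in>subtrees d e n. x ^ card A) <= 2) &
    (\<Sum>A\<in>subtrees d (Suc d) n. x ^ card A) <= 3"
proof (induction n)
  case 0
  have "subtrees d e 0 = {{}}" for e by (auto simp: subtrees_def)
  then show ?case by simp
next
  case (Suc n)
  have x0: "x > 0" using x by simp
  have main: "finite (subtrees d e (Suc n)) &
      (\<Sum>A\<in>subtrees d e (Suc n). x ^ card A) <= 1 + x * 2 ^ card ({..d} - {e})" for e
  proof -
    let ?C = "{..d} - {e}"
    define NE where "NE = subtrees d e (Suc n) - {{}}"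
    define g where "g A = (\<lambda>c\<in>?C. child A c)" for A
    have gP: "g ` NE \<subseteq> PiE ?C (%c. subtrees d c n)"
      using subtrees_decompose(2) by (fastforce simp: g_def NE_def)
    have inj: "inj_on g NE"
    proof (rule inj_onI)
      fix A B assume AB: "A \<in> NE" "B \<in> NE" "g A = g B"
      have ch: "child A c = child B c" if "c \<in> ?C" for c
        using fun_cong[OF AB(3), of c] that by (simp add: g_def)
      have "A = insert [] (\<Union>c\<in>?C. (#) c ` child A c)" using AB(1) by (intro subtrees_decompose(1)) (auto simp: NE_def)
      also have "\<dots> = insert [] (\<Union>c\<in>?C. (#) c ` child B c)" using ch by simp
      also have "\<dots> = B" using AB(2) by (intro subtrees_decompose(1)[symmetric]) (auto simp: NE_def)
      finally show "A = B" .
    qed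
    have finP: "finite (PiE ?C (%c. subtrees d c n))" using Suc.IH by (intro finite_PiE) auto
    have finNE: "finite NE" using finite_subset[OF gP finP] finite_imageD[OF _ inj] by blast
    have "subtrees d e (Suc n) = insert {} NE" unfolding NE_def by (auto simp: subtrees_def)
    moreover have "{} ~: NE" by (simp add: NE_def)
    ultimately have split: "finite (subtrees d e (Suc n))"
      "(\<Sum>A\<in>subtrees d e (Suc n). x ^ card A) = 1 + (\<Sum>A\<in>NE. x ^ card A)"
      using finNE by simp_all
    have "(\<Sum>A\<in>NE. x ^ card A) = (\<Sum>A\<in>NE. x * (\<Prod>c\<in>?C. x ^ card (g A c)))"
    proof (intro sum.cong refl)
      fix A assume "A \<in> NE"
      then have "card A = Suc (\<Sum>c\<in>?C. card (child A c))" by (intro subtrees_decompose(3)) (auto simp: NE_def)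
      then show "x ^ card A = x * (\<Prod>c\<in>?C. x ^ card (g A c))" by (simp add: power_sum g_def)
    qed
    also have "\<dots> = x * (\<Sum>h\<in>g ` NE. \<Prod>c\<in>?C. x ^ card (h c))"
      by (simp add: sum.reindex[OF inj] sum_distrib_left)
    also have "\<dots> <= x * (\<Sum>h\<in>PiE ?C (%c. subtrees d c n). \<Prod>c\<in>?C. x ^ card (h c))"
      using gP finP x0 by (intro mult_left_mono sum_mono2) (auto intro!: prod_nonneg)
    also have "\<dots> = x * (\<Prod>c\<in>?C. \<Sum>A\<in>subtrees d c n. x ^ card A)"
      using Suc.IH by (subst prod_sum_PiE) auto
    also have "\<dots> <= x * (\<Prod>c\<in>?C. 2)"
      using Suc.IH x0 by (intro mult_left_mono prod_mono) (auto intro: sum_nonneg)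
    finally show ?thesis using split by simp
  qed
  have x1: "x * 2 ^ d = 1" using x by simp
  have "(\<Sum>A\<in>subtrees d e (Suc n). x ^ card A) <= 2" if "e <= d" for e
  proof -
    have "card ({..d} - {e}) = d" using that by simp
    then show ?thesis using main[of e] x1 by simp
  qed
  moreover have "(\<Sum>A\<in>subtrees d (Suc d) (Suc n). x ^ card A) <= 3"
  proof -
    have "card ({..d} - {Suc d}) = Suc d" by simp
    then show ?thesis using main[of "Suc d"] x1 by simp
  qed
  ultimately show ?case using main by blast
qed

lemma card_valid_trees:
  "finite {T. valid_tree d T & card T = N}" "real (card {T. valid_tree d T & card T = N}) <= 3 * 2 ^ (d * N)"
proof -
  let ?V = "{T. valid_tree d T & card T = N}"
  define x :: real where "x = 1 / 2 ^ d"
  note w = subtrees_weight[OF x_def, of N]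
  have sub: "?V \<subseteq> subtrees d (Suc d) N" 
  proof
    fix T assume "T \<in> ?V"
    then have T: "finite T" "card T = N" "!!w c. w @ [c] \<in> T ==> w \<in> T & c <= d & (w = [] \<or> last w ~= c)"
      unfolding valid_tree_def by blast+
    have "w \<in> T & c <= d & (if w = [] then c ~= Suc d else last w ~= c)" if "w @ [c] \<in> T" for w c
      using T(3)[OF that] by auto
    then show "T \<in> subtrees d (Suc d) N" using T(1,2) unfolding subtrees_def by blast
  qed
  show fin: "finite ?V" using finite_subset[OF sub] w by blast
  have x0: "x > 0" by (simp add: x_def)
  have "real (card ?V) * x ^ N = (\<Sum>A\<in>?V. x ^ card A)" by simp
  also have "\<dots> <= (\<Sum>A\<in>subtrees d (Suc d) N. x ^ card A)"
    using w sub x0 by (intro sum_mono2) auto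
  also have "\<dots> <= 3" using w by blast
  finally have "real (card ?V) * x ^ N <= 3" .
  then have "real (card ?V) <= 3 / x ^ N" using x0 by (simp add: pos_le_divide_eq)
  also have "3 / x ^ N = 3 * 2 ^ (d * N)" by (simp add: x_def power_divide power_mult)
  finally show "real (card ?V) <= 3 * 2 ^ (d * N)" .
qed

section \<open>Comparison with the claimed growth rate\<close>

lemma fact_le_power: "d \<ge> 3 ==> (fact d :: nat) ^ 2 <= 2 ^ (d * (d - 1))"
proof (induction d rule: dec_induct)
  case base
  show ?case by (simp add: fact_numeral)
next
  case (step d)
  have "Suc d <= 2 ^ d" using less_exp[of d] by (simp add: Suc_le_eq)
  then have "(Suc d)\<^sup>2 <= (2 ^ d)\<^sup>2" by (rule power_mono) simp
  then have "(Suc d)\<^sup>2 * (fact d)\<^sup>2 <= (2 ^ d)\<^sup>2 * 2 ^ (d * (d - 1))" using step.IH by (intro mult_mono) auto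
  also have "\<dots> = 2 ^ (Suc d * (Suc d - 1))"
  proof -
    obtain e where "d = Suc e" using step.hyps by (cases d) auto
    then show ?thesis by (simp flip: power_add power_mult add: algebra_simps)
  qed
  finally show ?case by (simp only: fact_Suc power_mult_distrib of_nat_id)
qed

text \<open>The comparison of rates, 2 ^ d * (1 + 6 d!) ^ (d - 1) against 2 to the power d ^ 3 / 2,
  squared to stay within the natural numbers. At d = 3 it reads 119946304 < 134217728; afterwards
  the exponent d ^ 3 grows quickly enough for an induction.\<close>

lemma base_less: "d \<ge> 3 ==> (1 + 6 * fact d) ^ (2 * (d - 1)) * 2 ^ (2 * d) < (2 :: nat) ^ (d ^ 3)"
proof (induction d rule: dec_induct)
  case base
  show ?case by (simp add: fact_numeral)
next
  case (step d)
  obtain e where e: "d = Suc e" using step.hyps by (cases d) auto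
  let ?a = "1 + 6 * fact d :: nat"
  have a1: "1 + 6 * fact (Suc d) <= Suc d * ?a" by simp
  have "?a <= 8 * fact d" using fact_ge_1[of d, where 'a = nat] by linarith
  then have "?a\<^sup>2 <= (8 * fact d)\<^sup>2" by (rule power_mono) simp
  also have "\<dots> <= 64 * 2 ^ (d * (d - 1))" using fact_le_power[OF step.hyps(1)] by (simp add: power_mult_distrib)
  finally have a2: "?a\<^sup>2 <= 2 ^ (6 + d * (d - 1))" by (simp add: power_add)
  have "Suc d <= 2 ^ d" using less_exp[of d] by (simp add: Suc_le_eq)
  then have "(Suc d) ^ (2 * d) <= (2 ^ d) ^ (2 * d)" by (rule power_mono) simp
  then have d1: "(Suc d) ^ (2 * d) <= 2 ^ (2 * d * d)" by (simp flip: power_mult add: mult_ac)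
  have "(1 + 6 * fact (Suc d)) ^ (2 * (Suc d - 1)) * 2 ^ (2 * Suc d) <= (Suc d * ?a) ^ (2 * d) * 2 ^ (2 * Suc d)"
    using a1 by (intro mult_right_mono) (simp_all only: diff_Suc_1 power_mono le0 zero_le)
  also have "\<dots> = (Suc d) ^ (2 * d) * ?a\<^sup>2 * 4 * (?a ^ (2 * (d - 1)) * 2 ^ (2 * d))"
  proof -
    have "?a ^ (2 * d) = ?a\<^sup>2 * ?a ^ (2 * (d - 1))" unfolding e by (simp flip: power_add)
    moreover have "(2::nat) ^ (2 * Suc d) = 4 * 2 ^ (2 * d)" by simp
    ultimately show ?thesis unfolding power_mult_distrib by (simp only: mult_ac)
  qed
  also have "\<dots> < (Suc d) ^ (2 * d) * ?a\<^sup>2 * 4 * 2 ^ (d ^ 3)"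
    using step.IH by (intro mult_strict_left_mono) auto
  also have "\<dots> <= 2 ^ (2 * d * d) * 2 ^ (6 + d * (d - 1)) * 2 ^ 2 * 2 ^ (d ^ 3)"
    using d1 a2 by (intro mult_mono) auto
  also have "\<dots> = 2 ^ (2 * d * d + (6 + d * (d - 1)) + 2 + d ^ 3)" by (simp only: power_add)
  also have "\<dots> <= 2 ^ (Suc d ^ 3)"
  proof (rule power_increasing)
    show "2 * d * d + (6 + d * (d - 1)) + 2 + d ^ 3 <= Suc d ^ 3"
      using step.hyps unfolding e by (simp add: power3_eq_cube algebra_simps)
  qed simp
  finally show ?case .
qed

text \<open>The strict gap between the exponential rates \<open>b\<close> and \<open>c\<close>
  eventually outweighs the constant factor 3 a ^ 2, which stems from the root of the tree and the
  two extra boundary ridges.\<close>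

lemma eventually_count_less:
  assumes "d \<ge> 3"
  shows "\<exists>N0. \<forall>N\<ge>N0. 3 * 2 ^ (d * N) * (1 + 12 * real (fact d div 2)) ^ ((d - 1) * N + 2) < 2 powr (real d ^ 3 / 2 * real N)"
proof -
  have ev: "even (fact d :: nat)" using dvd_fact[of 2 d] assms by simp
  define a where "a = 1 + 12 * real (fact d div 2)"
  have a: "a = real (1 + 6 * fact d)" 
  proof -
    have "real (fact d div 2) = real (fact d) / 2" using real_of_nat_div[OF ev] by simp
    then show ?thesis unfolding a_def by simp
  qed
  have a1: "a \<ge> 1" unfolding a_def by simp
  define b where "b = 2 ^ d * a ^ (d - 1)"
  define c where "c = (2 :: real) powr (real d ^ 3 / 2)"
  have b0: "b > 0" unfolding b_def using a1 by simp
  have c0: "c > 0" by (simp add: c_def)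
  have "b\<^sup>2 < c\<^sup>2"
  proof -
    have "b\<^sup>2 = real ((1 + 6 * fact d) ^ (2 * (d - 1)) * 2 ^ (2 * d))"
      unfolding b_def a by (simp add: power_mult_distrib power_mult[symmetric] mult.commute)
    also have "\<dots> < real (2 ^ (d ^ 3))" using base_less[OF assms] by (simp only: of_nat_less_iff)
    also have "\<dots> = c\<^sup>2"
      unfolding c_def power2_eq_square by (simp flip: powr_add add: powr_realpow[symmetric])
    finally show ?thesis .
  qed
  then have "b < c" using b0 c0 by (meson less_imp_le power2_less_imp_less)
  then have "1 < c / b" using b0 by simp
  then obtain N0 where N0: "3 * a\<^sup>2 < (c / b) ^ N0" using real_arch_pow by blast
  show ?thesis
  proof (intro exI allI impI)
    fix N assume "N \<ge> N0"
    then have "(c / b) ^ N0 <= (c / b) ^ N" using \<open>1 < c / b\<close> by (intro power_increasing) auto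
    then have "3 * a\<^sup>2 < c ^ N / b ^ N" using N0 by (simp add: power_divide)
    then have "3 * a\<^sup>2 * b ^ N < c ^ N" using b0 by (simp add: pos_less_divide_eq)
    moreover have "3 * 2 ^ (d * N) * a ^ ((d - 1) * N + 2) = 3 * a\<^sup>2 * b ^ N"
      unfolding b_def by (simp add: power_add power_mult power_mult_distrib power2_eq_square)
    moreover have "c ^ N = 2 powr (real d ^ 3 / 2 * real N)"
      unfolding c_def by (subst powr_realpow[symmetric]) (simp_all add: powr_powr)
    ultimately show "3 * 2 ^ (d * N) * (1 + 12 * real (fact d div 2)) ^ ((d - 1) * N + 2) < 2 powr (real d ^ 3 / 2 * real N)"
      unfolding a_def by simp
  qed
qed

section \<open>Face models\<close>

text \<open>A pair identifies entry n of \<open>u\<close> with entry \<open>tt n\<close> of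
  \<open>v\<close>. Entry 0 is opposite to the glued ridge, hence the restriction of
  \<open>J\<close> to 1..d.\<close>

definition facerel :: "nat => (flag \<times> flag) set => ((nat list \<times> nat set) \<times> (nat list \<times> nat set)) set" where
  "facerel d E = {((fst u, snd u ` J), (fst v, (snd v \<circ> tt) ` J)) |u v J. (u, v) \<in> E & J \<subseteq> {1..d}}"

lemma facerelI: "(u, v) \<in> E ==> J \<subseteq> {1..d} ==> ((fst u, snd u ` J), (fst v, (snd v \<circ> tt) ` J)) \<in> facerel d E"
  unfolding facerel_def by blast

lemma facerelE:
  assumes "(x, y) \<in> facerel d E"
  obtains u v J where "(u, v) \<in> E" "J \<subseteq> {1..d}" "x = (fst u, snd u ` J)" "y = (fst v, (snd v \<circ> tt) ` J)"
proof -
  have "\<exists>u v J. (x, y) = ((fst u, snd u ` J), (fst v, (snd v \<circ> tt) ` J)) & (u, v) \<in> E & J \<subseteq> {1..d}"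
    using assms unfolding facerel_def by (rule CollectD)
  then show ?thesis using that by (elim exE conjE Pair_inject) blast
qed

lemma facerel_mono: "E \<subseteq> E' ==> facerel d E \<subseteq> facerel d E'"
  unfolding facerel_def by blast

text \<open>
  \<open>cm w s\<close> is the face of the facet \<open>w\<close> spanned by its vertices of colours \<open>s\<close>; such faces of
  different facets coincide exactly when this is forced by the glued ridges.
\<close>

definition model ::
  "nat => nat list set => 'a cell_complex => (flag \<times> flag) set => (nat list => nat set => 'a set) => bool" where
  "model d T K E cm \<longleftrightarrow>
     (\<forall>w\<in>T. \<forall>s s'. s \<subseteq> {..d} --> s' \<subseteq> {..d} --> (cm w s \<subseteq> cm w s' \<longleftrightarrow> s \<subseteq> s')) &
     face_poset K = {cm w s |w s. w \<in> T & s \<subseteq> {..d}} &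
     (\<forall>w\<in>T. \<forall>s. s \<subseteq> {..d} --> (\<forall>\<tau>\<in>face_poset K. \<tau> \<subseteq> cm w s --> (\<exists>s'\<subseteq>s. \<tau> = cm w s'))) &
     (\<forall>a\<in>T. \<forall>b\<in>T. \<forall>s r. s \<subseteq> {..d} --> r \<subseteq> {..d} -->
        (cm a s = cm b r \<longleftrightarrow> ((a, s), (b, r)) \<in> (facerel d E)\<^sup>*))"

lemma cyclic_order_three:
  assumes "distinct [a, b, c]" "x ~= y" "y ~= z" "x ~= z" "x \<in> {a, b, c}" "y \<in> {a, b, c}" "z \<in> {a, b, c}"
    and R: "R = {(a, b), (b, c), (c, a)}"
  shows "(y, z) \<in> R \<longleftrightarrow> (x, y) \<in> R" "(z, x) \<in> R \<longleftrightarrow> (x, y) \<in> R" "(x, z) \<in> R \<longleftrightarrow> (x, y) ~: R"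
proof -
  have ne: "a ~= b" "b ~= c" "a ~= c" "b ~= a" "c ~= b" "c ~= a" using assms(1) by auto
  consider "x = a" "y = b" "z = c" | "x = b" "y = c" "z = a" | "x = c" "y = a" "z = b"
    | "x = a" "y = c" "z = b" | "x = b" "y = a" "z = c" | "x = c" "y = b" "z = a"
    using assms(2-7) by (elim insertE emptyE) simp_all
  then have "((y, z) \<in> R \<longleftrightarrow> (x, y) \<in> R) & ((z, x) \<in> R \<longleftrightarrow> (x, y) \<in> R) & ((x, z) \<in> R \<longleftrightarrow> (x, y) ~: R)"
    by cases (simp_all add: R ne)
  then show "(y, z) \<in> R \<longleftrightarrow> (x, y) \<in> R" "(z, x) \<in> R \<longleftrightarrow> (x, y) \<in> R" "(x, z) \<in> R \<longleftrightarrow> (x, y) ~: R"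
    by blast+
qed

locale face_model = tree_flags d T for d T +
  fixes K :: "'a cell_complex" and E :: "(flag \<times> flag) set" and cm :: "nat list => nat set => 'a set"
  assumes mdl: "model d T K E cm" and simp_K: "simplicial_cw K"
    and E_sub: "E \<subseteq> H \<times> H" and E_sym: "sym E" and E_fst: "(u, v) \<in> E ==> fst u ~= fst v"
begin

lemma cm_mono: "w \<in> T ==> s \<subseteq> {..d} ==> s' \<subseteq> {..d} ==> cm w s \<subseteq> cm w s' \<longleftrightarrow> s \<subseteq> s'"
  and face_poset_eq: "face_poset K = {cm w s |w s. w \<in> T & s \<subseteq> {..d}}"
  and cm_sub: "w \<in> T ==> s \<subseteq> {..d} ==> \<tau> \<in> face_poset K ==> \<tau> \<subseteq> cm w s ==> \<exists>s'\<subseteq>s. \<tau> = cm w s'"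
  and cm_eq: "a \<in> T ==> b \<in> T ==> s \<subseteq> {..d} ==> r \<subseteq> {..d} ==>
        cm a s = cm b r \<longleftrightarrow> ((a, s), (b, r)) \<in> (facerel d E)\<^sup>*"
  using mdl unfolding model_def by simp_all

lemma cm_inj: "w \<in> T ==> s \<subseteq> {..d} ==> s' \<subseteq> {..d} ==> cm w s = cm w s' ==> s = s'"
  using cm_mono[of w s s'] cm_mono[of w s' s] by auto

lemma cm_face: "w \<in> T ==> s \<subseteq> {..d} ==> cm w s \<in> face_poset K"
  unfolding face_poset_eq by blast

lemma faceE:
  assumes "\<rho> \<in> face_poset K" obtains w s where "w \<in> T" "s \<subseteq> {..d}" "\<rho> = cm w s"
  using assms unfolding face_poset_eq by blast

lemma regular_K: "regular_cw K" using simp_K by (simp add: simplicial_cw_def)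

lemma cm_empty: "w \<in> T ==> cm w {} = {}"
  using cm_sub[of w "{}" "{}"] by (auto simp: face_poset_def)

lemma cm_cell: "w \<in> T ==> s \<subseteq> {..d} ==> s ~= {} ==> cm w s \<in> cells K"
proof -
  assume a: "w \<in> T" "s \<subseteq> {..d}" "s ~= {}"
  have "cm w s ~= {}"
  proof
    assume "cm w s = {}"
    then have "cm w s \<subseteq> cm w {}" by simp
    then show False using cm_mono[OF a(1,2), of "{}"] a(3) by simp
  qed
  then show ?thesis using cm_face[OF a(1,2)] by (auto simp: face_poset_def)
qed

lemma cell_in_face: "\<rho> \<in> cells K ==> \<rho> \<in> face_poset K" by (simp add: face_poset_def)

lemma cm_dim:
  assumes w: "w \<in> T" and s: "s \<subseteq> {..d}"
  shows "cm w s \<in> dim_cells K n \<longleftrightarrow> card s = Suc n"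
proof (cases "s = {}")
  case True
  have "{} ~: cells K" using rcw.cell_nonempty[of K "{}"] regular_K by (auto simp: rcw_def)
  then show ?thesis using True cm_empty[OF w] by (simp add: dim_cells_def)
next
  case False
  have fin: "finite s" using s finite_subset by blast
  have eq: "{\<rho> \<in> face_poset K. \<rho> \<subseteq> cm w s} = cm w ` Pow s"
  proof (intro equalityI subsetI)
    fix \<rho> assume "\<rho> \<in> {\<rho> \<in> face_poset K. \<rho> \<subseteq> cm w s}"
    then show "\<rho> \<in> cm w ` Pow s" using cm_sub[OF w s, of \<rho>] by blast
  next
    fix \<rho> assume "\<rho> \<in> cm w ` Pow s"
    then obtain t where t: "t \<subseteq> s" "\<rho> = cm w t" by blast
    have td: "t \<subseteq> {..d}" by (rule subset_trans[OF t(1) s])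
    show "\<rho> \<in> {\<rho> \<in> face_poset K. \<rho> \<subseteq> cm w s}"
      using cm_face[OF w td] cm_mono[OF w td s] t by simp
  qed
  have "poset_iso (Pow s) (cm w ` Pow s)"
    unfolding poset_iso_def
  proof (intro exI conjI ballI)
    show "bij_betw (cm w) (Pow s) (cm w ` Pow s)"
    proof (rule inj_on_imp_bij_betw, rule inj_onI)
      fix x y assume "x \<in> Pow s" "y \<in> Pow s" "cm w x = cm w y"
      then show "x = y" using cm_inj[OF w, of x y] s by auto
    qed
    fix x y assume "x \<in> Pow s" "y \<in> Pow s"
    then show "(x \<subseteq> y) = (cm w x \<subseteq> cm w y)" using cm_mono[OF w, of x y] s by auto
  qed
  then have "poset_iso {\<rho> \<in> face_poset K. \<rho> \<subseteq> cm w s} (Pow s)" unfolding eq by (rule poset_iso_sym)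
  from dim_cells_iff_rank[OF simp_K cm_cell[OF w s False] fin this] show ?thesis .
qed

lemma perm_props:
  assumes "u \<in> H"
  shows "fst u \<in> T" "snd u permutes {..d}" "inj (snd u)" "!!J. J \<subseteq> {..d} ==> snd u ` J \<subseteq> {..d}"
    "!!J. card (snd u ` J) = card J" "snd u ` {1..d} = {..d} - {snd u 0}" "snd u 0 <= d"
proof -
  show T: "fst u \<in> T" and p: "snd u permutes {..d}" using assms by (auto simp: H_def)
  show inj: "inj (snd u)" by (rule permutes_inj[OF p])
  show "snd u ` J \<subseteq> {..d}" if "J \<subseteq> {..d}" for J using image_mono[OF that, of "snd u"] permutes_image[OF p] by simp
  show "card (snd u ` J) = card J" for J by (rule card_image[OF inj_on_subset[OF inj]]) simp
  have "{1..d} = {..d} - {0}" by auto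
  then show "snd u ` {1..d} = {..d} - {snd u 0}"
    using image_set_diff[OF inj, of "{..d}" "{0}"] permutes_image[OF p] by simp
  have "snd u 0 \<in> {..d}" using permutes_in_image[OF p, of 0] by simp
  then show "snd u 0 <= d" by simp
qed

lemma E_in: "(u, v) \<in> E ==> u \<in> H" "(u, v) \<in> E ==> v \<in> H"
  using E_sub by auto

text \<open>Gluings identify faces of ridges only, and these have at most \<open>d\<close>
  vertices.\<close>

lemma facet_only:
  assumes "((a, {..d}), z) \<in> (facerel d E)\<^sup>*" shows "z = (a, {..d})"
  using assms
proof (cases rule: converse_rtranclE)
  case (step y)
  then obtain u v J where u: "(u, v) \<in> E" "J \<subseteq> {1..d}" "(a, {..d}) = (fst u, snd u ` J)"
    by (elim facerelE) blast
  have "card {..d} = card J" using perm_props(5)[OF E_in(1)[OF u(1)], of J] u(3) by simp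
  also have "\<dots> <= d" using card_mono[OF _ u(2)] by simp
  finally show ?thesis by simp
qed simp

lemma facet_eq: "a \<in> T ==> b \<in> T ==> cm a {..d} = cm b r ==> r \<subseteq> {..d} ==> a = b & r = {..d}"
  using cm_eq[of a b "{..d}" r] facet_only[of a "(b, r)"] by auto

lemma facets: "dim_cells K d = (%w. cm w {..d}) ` T"
proof (intro equalityI subsetI)
  fix \<rho> assume r: "\<rho> \<in> dim_cells K d"
  then have "\<rho> \<in> face_poset K" by (auto simp: dim_cells_def face_poset_def)
  then obtain w s where w: "w \<in> T" "s \<subseteq> {..d}" "\<rho> = cm w s" by (rule faceE)
  then have "card s = Suc d" using cm_dim r by simp
  then have "s = {..d}" using card_subset_eq[OF _ w(2)] by simp
  then show "\<rho> \<in> (%w. cm w {..d}) ` T" using w by simp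
qed (use cm_dim in auto)

lemma card_facets: "card (dim_cells K d) = card T"
  unfolding facets by (rule card_image, rule inj_onI) (use facet_eq in blast)

lemma ridge_faceE:
  assumes "F \<in> dim_cells K (d - 1)"
  obtains w i where "w \<in> T" "i <= d" "F = cm w ({..d} - {i})"
proof -
  have "F \<in> face_poset K" using assms by (auto simp: dim_cells_def face_poset_def)
  then obtain w s where w: "w \<in> T" "s \<subseteq> {..d}" "F = cm w s" by (rule faceE)
  then have "card s = d" using cm_dim[OF w(1,2), of "d - 1"] assms d3 by simp
  then have "card ({..d} - s) = 1" using card_Diff_subset[of s "{..d}"] w(2) finite_subset[OF w(2)] by simp
  then obtain i where i: "{..d} - s = {i}" by (auto simp: card_1_singleton_iff)
  then have "s = {..d} - {i}" using w(2) by blast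
  moreover have "i <= d" using i by auto
  ultimately show ?thesis using that w by blast
qed

lemma boundary_unique:
  assumes "F \<in> boundary_faces d K" "a \<in> T" "b \<in> T" "F \<subseteq> cm a {..d}" "F \<subseteq> cm b {..d}"
  shows "a = b"
proof -
  obtain D where D: "{D \<in> dim_cells K d. F \<subseteq> D} = {D}"
    using assms(1) by (auto simp: boundary_faces_def card_1_singleton_iff)
  have "cm a {..d} \<in> {D \<in> dim_cells K d. F \<subseteq> D}" "cm b {..d} \<in> {D \<in> dim_cells K d. F \<subseteq> D}"
    using assms(2-5) unfolding facets by auto
  then have "cm a {..d} = cm b {..d}" unfolding D by simp
  then show ?thesis using facet_eq assms(2,3) by blast
qed

text \<open>A pair at \<open>u\<close> would place the ridge in the facet of \<open>v\<close> as
  well, and the facets of a pair are different.\<close>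

lemma boundary_unmatched:
  assumes F: "F \<in> boundary_faces d K" "F = cm w ({..d} - {i})" and uv: "(u, v) \<in> E"
  shows "face u ~= (w, i)"
proof
  assume f: "face u = (w, i)"
  note u = perm_props[OF E_in(1)[OF uv]] and v = perm_props[OF E_in(2)[OF uv]]
  have fu: "fst u = w" "snd u 0 = i" using f by (auto simp: face_def)
  have J: "tt ` {1..d} = {1..d}" by (rule permutes_image[OF tt_permutes[OF d2]])
  have "((fst u, snd u ` {1..d}), (fst v, (snd v \<circ> tt) ` {1..d})) \<in> facerel d E"
    by (rule facerelI[OF uv]) simp
  moreover have "(snd v \<circ> tt) ` {1..d} = snd v ` {1..d}" unfolding image_comp[symmetric] J ..
  ultimately have "cm (fst u) (snd u ` {1..d}) = cm (fst v) (snd v ` {1..d})"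
    using cm_eq[OF u(1) v(1), of "snd u ` {1..d}" "snd v ` {1..d}"] u(4)[of "{1..d}"] v(4)[of "{1..d}"] by auto
  then have Fv: "F = cm (fst v) (snd v ` {1..d})" using F(2) u(6) fu by simp
  have "F \<subseteq> cm (fst v) {..d}" unfolding Fv using cm_mono[OF v(1) v(4)[of "{1..d}"], of "{..d}"] v(4)[of "{1..d}"] by auto
  moreover have "F \<subseteq> cm (fst u) {..d}" using F(2) fu(1) cm_mono[OF u(1), of "{..d} - {i}" "{..d}"] by auto
  ultimately have "fst v = fst u" using boundary_unique[OF F(1) v(1) u(1)] by blast
  then show False using E_fst[OF uv] by simp
qed

lemma tt_image: "tt ` {1..d} = {1..d}" "J \<subseteq> {1..d} ==> tt ` J \<subseteq> {1..d}"
proof -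
  show 1: "tt ` {1..d} = {1..d}" by (rule permutes_image[OF tt_permutes[OF d2]])
  show "J \<subseteq> {1..d} ==> tt ` J \<subseteq> {1..d}" using image_mono[of J "{1..d}" tt] unfolding 1 .
qed

lemma E_face:
  assumes yz: "(y, z) \<in> E" and J: "J \<subseteq> {1..d}"
  shows "cm (fst y) (snd y ` J) = cm (fst z) (snd z ` tt ` J)"
proof -
  have yH: "y \<in> H" and zH: "z \<in> H" using E_in[OF yz] by auto
  have sub: "J \<subseteq> {..d}" "tt ` J \<subseteq> {..d}" using J tt_image(2)[OF J] by auto
  have "((fst y, snd y ` J), (fst z, snd z ` tt ` J)) \<in> facerel d E"
    using facerelI[OF yz J] unfolding image_comp[symmetric] .
  then have "((fst y, snd y ` J), (fst z, snd z ` tt ` J)) \<in> (facerel d E)\<^sup>*" by (rule r_into_rtrancl)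
  then show ?thesis
    using cm_eq[OF perm_props(1)[OF yH] perm_props(1)[OF zH] perm_props(4)[OF yH sub(1)] perm_props(4)[OF zH sub(2)]] by blast
qed

lemma rot3_tail: "J \<subseteq> {3..d} ==> rot3 ` J = J" "J \<subseteq> {3..d} ==> tt ` J = J"
proof -
  assume J: "J \<subseteq> {3..d}"
  have "rot3 j = j" "tt j = j" if "j \<in> J" for j using J that by auto
  then show "rot3 ` J = J" "tt ` J = J" by force+
qed

lemma comp_tail: "J \<subseteq> {3..d} ==> (p \<circ> rot3) ` J = p ` J" "J \<subseteq> {3..d} ==> (p \<circ> tt) ` J = p ` J"
  by (simp_all only: image_comp[symmetric] rot3_tail)

lemma comp_insert: "(p \<circ> rot3) ` insert k {3..d} = p ` insert (rot3 k) {3..d}"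
    "(p \<circ> tt) ` insert k {3..d} = p ` insert (tt k) {3..d}"
  by (simp_all only: image_comp[symmetric] image_insert[of rot3] image_insert[of tt] rot3_tail order_refl)

lemma nxt_H: "x \<in> H ==> nxt x \<in> H"
  using bij_nxt by (auto simp: bij_betw_def)

text \<open>Neither turning a triangle nor crossing a ridge moves the entries from 3 on. Taking
  \<open>J\<close> a singleton shows that connected flags share their tail vertex by vertex, in
  order.\<close>

lemma conn_face:
  assumes "(x, y) \<in> conn E" "x \<in> H" and J: "J \<subseteq> {3..d}"
  shows "y \<in> H & cm (fst x) (snd x ` J) = cm (fst y) (snd y ` J)"
  using assms(1) unfolding conn_def
proof (induction rule: rtrancl_induct)
  case base
  show ?case using assms(2) by simp
next
  case (step y z)
  have nn: "cm (fst (nxt h)) (snd (nxt h) ` J) = cm (fst h) (snd h ` J)" for h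
    unfolding nxt_def fst_conv snd_conv comp_tail(1)[OF J] ..
  consider "(y, z) \<in> nx" | "(z, y) \<in> nx" | "(y, z) \<in> E" using step.hyps by blast
  then show ?case
  proof cases
    case 1
    then have "y \<in> H" "z = nxt y" by (auto simp: nx_def)
    then show ?thesis using step.IH nn[of y] nxt_H by simp
  next
    case 2
    then have "z \<in> H" "y = nxt z" by (auto simp: nx_def)
    then show ?thesis using step.IH nn[of z] by simp
  next
    case 3
    note u = perm_props[OF E_in(1)[OF 3]] and v = perm_props[OF E_in(2)[OF 3]]
    have J1: "J \<subseteq> {1..d}" "J \<subseteq> {..d}" using J by auto
    have "((fst y, snd y ` J), (fst z, snd z ` J)) \<in> facerel d E"
      using facerelI[OF 3 J1(1)] unfolding comp_tail(2)[OF J] .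
    then have "cm (fst y) (snd y ` J) = cm (fst z) (snd z ` J)"
      using cm_eq[OF u(1) v(1) u(4)[OF J1(2)] v(4)[OF J1(2)]] by auto
    then show ?thesis using step.IH E_in(2)[OF 3] by simp
  qed
qed

text \<open>By \<open>conn_face\<close> for singletons the tails agree entrywise; facet, first entry
  and sign then leave no freedom by \<open>perm_agree_tail\<close>.\<close>

lemma conn_same_face:
  assumes c: "(x, y) \<in> conn E" and x: "x \<in> H" and f: "fst x = fst y" "snd x 0 = snd y 0" and g: "gs x = gs y"
  shows "x = y"
proof -
  have y: "y \<in> H" using conn_face[OF c x, of "{}"] by simp
  note u = perm_props[OF x] and v = perm_props[OF y]
  have tl: "snd x n = snd y n" if "n \<in> {3..d}" for n
  proof -
    have "cm (fst x) {snd x n} = cm (fst x) {snd y n}" using conn_face[OF c x, of "{n}"] that f(1) by simp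
    moreover have "{snd x n} \<subseteq> {..d}" "{snd y n} \<subseteq> {..d}" using u(4)[of "{n}"] v(4)[of "{n}"] that by auto
    ultimately have "{snd x n} = {snd y n}" using cm_inj[OF u(1)] by blast
    then show ?thesis by simp
  qed
  obtain s where s: "s permutes {1..d}" "snd y = snd x \<circ> s" by (rule same_face_perm[OF u(2) v(2) f(2)])
  have "sign (snd x) = sign (snd y)" using g f(1) by (simp add: gs_def)
  then have "sign s = sign id" using s u(2) sign_mult[OF u(2) sub_permutes[OF s(1)]]
    by (cases "snd x" rule: sign_cases) auto
  moreover have "s n = id n" if "n \<in> {3..d}" for n
  proof -
    have "snd x (s n) = snd x n" using tl[OF that] s(2) by simp
    then show ?thesis using injD[OF u(3)] by simp
  qed
  ultimately have "s = id" using perm_agree_tail[OF s(1) permutes_id d2] by blast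
  then show ?thesis using s(2) f(1) by (simp add: prod_eq_iff)
qed

text \<open>
  A coherent orientation of the link of a tail face is constant on the connected class of a
  flag, but distinguishes a flag from its mirror image.
\<close>

lemma orientable_no_mirror:
  assumes x: "x \<in> H" and ori: "orientable_link d K (cm (fst x) (snd x ` {3..d}))"
  shows "(x, (fst x, snd x \<circ> tt)) ~: conn E"
proof
  define \<sigma> where "\<sigma> = cm (fst x) (snd x ` {3..d})"
  define V where "V y k = cm (fst y) (snd y ` insert k {3..d})" for y k
  have sub3: "insert k {3..d} \<subseteq> {..d}" "card (insert k {3..d}) = d - 1" if "k < 3" for k
    using that d3 by auto
  obtain f where f0: "(\<forall>D\<in>link_triangles d K \<sigma>. \<exists>a b c.
         distinct [a, b, c] & {\<rho> \<in> link_vertices d K \<sigma>. \<rho> \<subseteq> D} = {a, b, c} &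
         f D = {(a, b), (b, c), (c, a)}) &
     (\<forall>G\<in>link_edges d K \<sigma>. \<forall>D\<in>link_triangles d K \<sigma>. \<forall>D'\<in>link_triangles d K \<sigma>.
         D ~= D' & G \<subseteq> D & G \<subseteq> D' -->
         (\<forall>a\<in>link_vertices d K \<sigma>. \<forall>b\<in>link_vertices d K \<sigma>.
             a ~= b & a \<subseteq> G & b \<subseteq> G --> ((a, b) \<in> f D \<longleftrightarrow> (b, a) \<in> f D')))"
    using ori unfolding orientable_link_def \<sigma>_def[symmetric] by (elim exE)
  note f1 = bspec[OF conjunct1[OF f0]]
  have f2: "((a, b) \<in> f D \<longleftrightarrow> (b, a) \<in> f D')"
    if "G \<in> link_edges d K \<sigma>" "D \<in> link_triangles d K \<sigma>" "D' \<in> link_triangles d K \<sigma>"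
      "D ~= D'" "G \<subseteq> D" "G \<subseteq> D'" "a\<in>link_vertices d K \<sigma>" "b\<in>link_vertices d K \<sigma>" "a ~= b" "a \<subseteq> G" "b \<subseteq> G"
    for G D D' a b
    using bspec[OF bspec[OF bspec[OF conjunct2[OF f0] that(1)] that(2)] that(3)] that(4-11) by simp
  define C where "C y \<longleftrightarrow> y \<in> H & cm (fst y) (snd y ` {3..d}) = \<sigma>" for y
  have mono: "cm (fst y) (snd y ` A) \<subseteq> cm (fst y) (snd y ` B)" if "C y" "A \<subseteq> B" "B \<subseteq> {..d}" for y A B
  proof -
    have yH: "y \<in> H" using that(1) by (simp add: C_def)
    have "A \<subseteq> {..d}" by (rule subset_trans[OF that(2,3)])
    then show ?thesis
      using cm_mono[OF perm_props(1)[OF yH] perm_props(4)[OF yH] perm_props(4)[OF yH], of A B] that(3)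
        image_mono[OF that(2), of "snd y"] by blast
  qed
  have inlink: "cm (fst y) (snd y ` B) \<in> link_poset K \<sigma>" if "C y" "{3..d} \<subseteq> B" "B \<subseteq> {..d}" "B ~= {}" for y B
  proof -
    have "cm (fst y) (snd y ` B) \<in> cells K" using that by (intro cm_cell perm_props) (auto simp: C_def)
    then show ?thesis using mono[OF that(1-3)] that(1) by (auto simp: link_poset_def C_def)
  qed
  have tri: "cm (fst y) {..d} \<in> link_triangles d K \<sigma>" if "C y" for y
  proof -
    have "y \<in> H" using that by (simp add: C_def)
    moreover from permutes_image[OF perm_props(2)[OF this]] have "snd y ` {..d} = {..d}" .
    ultimately show ?thesis using inlink[OF that, of "{..d}"] cm_dim[OF perm_props(1)[of y], of "{..d}" d]
      by (auto simp: link_triangles_def)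
  qed
  have Vv: "V y k \<in> link_vertices d K \<sigma>" if "C y" "k < 3" for y k
  proof -
    have yH: "y \<in> H" using that(1) by (simp add: C_def)
    have "V y k \<in> link_poset K \<sigma>" unfolding V_def
      by (rule inlink[OF that(1) _ sub3(1)[OF that(2)]]) blast+
    moreover have "card (snd y ` insert k {3..d}) = Suc (d - 2)"
      unfolding perm_props(5)[OF yH] sub3(2)[OF that(2)] using d3 by simp
    then have "V y k \<in> dim_cells K (d - 2)"
      unfolding V_def using cm_dim[OF perm_props(1)[OF yH] perm_props(4)[OF yH sub3(1)[OF that(2)]]] by blast
    ultimately show ?thesis by (simp add: link_vertices_def)
  qed
  have Vsub: "V y k \<subseteq> cm (fst y) {..d}" if "C y" "k < 3" for y k
    using mono[OF that(1), of "insert k {3..d}" "{..d}"] sub3[OF that(2)] permutes_image[OF perm_props(2), of y] that(1)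
    by (auto simp: C_def V_def)
  have Vne: "V y k ~= V y l" if "C y" "k < 3" "l < 3" "k ~= l" for y k l
  proof
    have yH: "y \<in> H" using that(1) by (simp add: C_def)
    assume "V y k = V y l"
    then have "snd y ` insert k {3..d} = snd y ` insert l {3..d}"
      unfolding V_def by (rule cm_inj[OF perm_props(1)[OF yH] perm_props(4)[OF yH sub3(1)[OF that(2)]] perm_props(4)[OF yH sub3(1)[OF that(3)]]])
    then have "insert k {3..d} = insert l {3..d}" unfolding inj_image_eq_iff[OF perm_props(3)[OF yH]] .
    then show False using that by auto
  qed
  \<comment> \<open>\<open>P y\<close> records whether the chosen orientation of the triangle runs
    through the entries 0, 1, 2 of the flag in this cyclic order.\<close>
  define P where "P y \<longleftrightarrow> (V y 0, V y 1) \<in> f (cm (fst y) {..d})" for y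
  have cyc: "(V y 1, V y 2) \<in> f (cm (fst y) {..d}) \<longleftrightarrow> P y" "(V y 2, V y 0) \<in> f (cm (fst y) {..d}) \<longleftrightarrow> P y"
    "(V y 0, V y 2) \<in> f (cm (fst y) {..d}) \<longleftrightarrow> \<not> P y" if "C y" for y
  proof -
    note trD = f1[OF tri[OF that]]
    obtain a b c where abc: "distinct [a, b, c]" "{\<rho> \<in> link_vertices d K \<sigma>. \<rho> \<subseteq> cm (fst y) {..d}} = {a, b, c}"
         "f (cm (fst y) {..d}) = {(a, b), (b, c), (c, a)}" using trD by (elim exE conjE)
    have in3: "V y k \<in> {a, b, c}" if "k < 3" for k
      unfolding abc(2)[symmetric] using Vv[OF \<open>C y\<close> that] Vsub[OF \<open>C y\<close> that] by (intro CollectI conjI)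
    have ne: "V y 0 ~= V y 1" "V y 1 ~= V y 2" "V y 0 ~= V y 2" using Vne[OF that] by simp_all
    have "V y 0 \<in> {a, b, c}" "V y 1 \<in> {a, b, c}" "V y 2 \<in> {a, b, c}" using in3 by simp_all
    then show "(V y 1, V y 2) \<in> f (cm (fst y) {..d}) \<longleftrightarrow> P y" "(V y 2, V y 0) \<in> f (cm (fst y) {..d}) \<longleftrightarrow> P y"
      "(V y 0, V y 2) \<in> f (cm (fst y) {..d}) \<longleftrightarrow> \<not> P y"
      unfolding P_def using cyclic_order_three[OF abc(1) ne _ _ _ abc(3)] by blast+
  qed
  have nxtP: "C (nxt y) & P (nxt y) = P y" if "C y" for y
  proof -
    have "C (nxt y)" using that nxt_H unfolding C_def nxt_def fst_conv snd_conv comp_tail(1)[OF order_refl] by blast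
    moreover have "V (nxt y) 0 = V y 1" "V (nxt y) 1 = V y 2"
      unfolding V_def nxt_def fst_conv snd_conv comp_insert rot3_simps by (simp_all only: One_nat_def)
    ultimately show ?thesis using cyc(1)[OF that] by (simp add: P_def nxt_def)
  qed
  have EP: "C z & P z = P y" if yz: "(y, z) \<in> E" "C y" for y z
  proof -
    have zH: "z \<in> H" and yH: "y \<in> H" using E_in[OF yz(1)] by auto
    note fe = E_face[OF yz(1)]
    have Cz: "C z" using fe[of "{3..d}"] rot3_tail(2)[of "{3..d}"] yz(2) zH by (auto simp: C_def)
    have Vz: "V y 1 = V z 2" "V y 2 = V z 1"
      using fe[of "insert 1 {3..d}"] fe[of "insert 2 {3..d}"] rot3_tail(2)[of "{3..d}"] d3 by (auto simp: V_def)
    define G where "G = cm (fst y) (snd y ` {1..d})"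
    have G2: "G = cm (fst z) (snd z ` {1..d})"
      unfolding G_def using fe[of "{1..d}"] permutes_image[OF tt_permutes[OF d2]] by simp
    have 1: "G \<in> link_edges d K \<sigma>"
      using inlink[OF yz(2), of "{1..d}"] cm_dim[OF perm_props(1,4)[OF yH], of "{1..d}" "d - 1"] perm_props(5)[OF yH, of "{1..d}"] d3
      by (auto simp: link_edges_def G_def)
    have 2: "cm (fst y) {..d} ~= cm (fst z) {..d}"
      using facet_eq[OF perm_props(1)[OF yH] perm_props(1)[OF zH]] E_fst[OF yz(1)] by blast
    have 3: "G \<subseteq> cm (fst y) {..d}" "G \<subseteq> cm (fst z) {..d}"
      using mono[OF yz(2), of "{1..d}" "{..d}"] mono[OF Cz, of "{1..d}" "{..d}"] permutes_image[OF perm_props(2)[OF yH]]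
        permutes_image[OF perm_props(2)[OF zH]] unfolding G2[symmetric] G_def[symmetric] by auto
    have 4: "V y 1 \<subseteq> G" "V y 2 \<subseteq> G"
      using mono[OF yz(2), of "insert 1 {3..d}" "{1..d}"] mono[OF yz(2), of "insert 2 {3..d}" "{1..d}"] d3
      by (auto simp: V_def G_def)
    have "P y \<longleftrightarrow> (V y 1, V y 2) \<in> f (cm (fst y) {..d})" using cyc(1)[OF yz(2)] by simp
    also have "\<dots> \<longleftrightarrow> (V y 2, V y 1) \<in> f (cm (fst z) {..d})"
      by (rule f2[OF 1 tri[OF yz(2)] tri[OF Cz] 2 3 Vv[OF yz(2)] Vv[OF yz(2)] Vne[OF yz(2)] 4]) simp_all
    also have "\<dots> \<longleftrightarrow> P z" unfolding Vz using cyc(1)[OF Cz] by simp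
    finally show ?thesis using Cz by simp
  qed
  have Cx: "C x" using x by (simp add: C_def \<sigma>_def)
  assume "(x, (fst x, snd x \<circ> tt)) \<in> conn E"
  then have "C (fst x, snd x \<circ> tt) & P (fst x, snd x \<circ> tt) = P x"
    unfolding conn_def
  proof (induction rule: rtrancl_induct)
    case (step y z)
    consider "(y, z) \<in> nx" | "(z, y) \<in> nx" | "(y, z) \<in> E" using step.hyps by blast
    then show ?case
    proof cases
      case 2
      then have z: "z \<in> H" "y = nxt z" by (auto simp: nx_def)
      have "C z" using step.IH z(1) unfolding z(2) C_def nxt_def fst_conv snd_conv comp_tail(1)[OF order_refl] by blast
      then show ?thesis using nxtP[of z] step.IH z by simp
    qed (use step.IH nxtP EP in \<open>auto simp: nx_def\<close>)
  qed (use Cx in simp)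
  moreover have "V (fst x, snd x \<circ> tt) 0 = V x 0" "V (fst x, snd x \<circ> tt) 1 = V x 2"
    unfolding V_def fst_conv snd_conv comp_insert tt_simps by simp_all
  ultimately show False using cyc(3)[OF Cx] by (simp add: P_def)
qed

end

lemma rot3_cube: "rot3 \<circ> rot3 \<circ> rot3 = id"
proof
  fix n show "(rot3 \<circ> rot3 \<circ> rot3) n = id n"
  proof (cases "n \<ge> 3")
    case False
    then have "n = 0 \<or> n = 1 \<or> n = 2" by arith
    then show ?thesis by (elim disjE) simp_all
  qed simp
qed

section \<open>Boundary cycles and boundary components of links\<close>

locale face_model_closed = face_model d T K E cm
  for d T and K :: "'a cell_complex" and E cm +
  assumes E_match: "matching H E"
    and E_tail: "(u, v) \<in> E ==> s permutes {1..d} ==> ((fst u, snd u \<circ> s), (fst v, snd v \<circ> (tt \<circ> s \<circ> tt))) \<in> E"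
    and E_gs: "(u, v) \<in> E ==> gs u = gs v"
begin

lemma perm_surj: "u \<in> H ==> i <= d ==> \<exists>k\<le>d. snd u k = i"
proof -
  assume "u \<in> H" "i <= d"
  then have "i \<in> snd u ` {..d}" using permutes_image[OF perm_props(2)] by simp
  then show ?thesis by auto
qed

lemma tail_mate:
  assumes g: "(g, g') \<in> E" and y: "y \<in> H" "fst y = fst g" "snd y 0 = snd g 0"
  obtains m where "(y, m) \<in> E" "fst m = fst g'"
    "!!A J. snd y ` A = snd g ` J ==> snd m ` tt ` A = (snd g' \<circ> tt) ` J"
proof -
  have gH: "g \<in> H" using E_in(1)[OF g] .
  obtain s where s: "s permutes {1..d}" "snd y = snd g \<circ> s"
    by (rule same_face_perm[OF perm_props(2)[OF gH] perm_props(2)[OF y(1)] y(3)[symmetric]])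
  define m where "m = (fst g', snd g' \<circ> (tt \<circ> s \<circ> tt))"
  have "(fst g, snd g \<circ> s) = y" using y(2) s(2) by (simp add: prod_eq_iff)
  then have ym: "(y, m) \<in> E" using E_tail[OF g s(1)] by (simp add: m_def)
  have "snd m ` tt ` A = (snd g' \<circ> tt) ` J" if "snd y ` A = snd g ` J" for A J
  proof -
    have "snd g ` s ` A = snd g ` J" using that s(2) by (simp add: image_comp)
    then have "s ` A = J" unfolding inj_image_eq_iff[OF perm_props(3)[OF gH]] .
    moreover have "snd m ` tt ` A = snd g' ` tt ` s ` A" unfolding m_def snd_conv image_comp by (simp add: comp_assoc)
    ultimately show ?thesis by (simp add: image_comp)
  qed
  then show ?thesis using that[OF ym] by (simp add: m_def)
qed

lemma rotate_to:
  assumes x: "x \<in> H" and k: "k < 3"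
  obtains x' where "(x, x') \<in> conn E" "x' \<in> H" "fst x' = fst x" "snd x' 0 = snd x k"
    "!!n. n \<ge> 3 ==> snd x' n = snd x n"
proof -
  have n: "(x, nxt x) \<in> conn E" "(nxt x, nxt (nxt x)) \<in> conn E" using x nxt_H conn_nxt by blast+
  have "k = 0 \<or> k = 1 \<or> k = 2" using k by arith
  then show ?thesis
  proof (elim disjE)
    assume "k = 0"
    then show ?thesis using that[of x] x by simp
  next
    assume "k = 1"
    then show ?thesis using that[of "nxt x", OF n(1) nxt_H[OF x]] by (simp add: nxt_def)
  next
    assume "k = 2"
    then show ?thesis using that[of "nxt (nxt x)", OF conn_trans[OF n] nxt_H[OF nxt_H[OF x]]] by (simp add: nxt_def)
  qed
qed

lemma rotate_missing:
  assumes x: "x \<in> H" and i: "i <= d" "i ~: snd x ` {3..d}"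
  obtains x' where "(x, x') \<in> conn E" "x' \<in> H" "fst x' = fst x" "snd x' 0 = i" "snd x' ` {3..d} = snd x ` {3..d}"
proof -
  obtain k where k: "k <= d" "snd x k = i" using perm_surj[OF x i(1)] by blast
  have "k ~: {3..d}" using k(2) i(2) by blast
  then have "k < 3" using k(1) by simp
  then obtain x' where x': "(x, x') \<in> conn E" "x' \<in> H" "fst x' = fst x" "snd x' 0 = snd x k"
    "!!n. n \<ge> 3 ==> snd x' n = snd x n" by (rule rotate_to[OF x]) blast
  have "snd x' ` {3..d} = snd x ` {3..d}" by (rule image_cong) (use x'(5) in auto)
  then show ?thesis using that x' k(2) by simp
qed

text \<open>Each identification crosses a ridge that contains the face. The colour opposite to that
  ridge is among the first three entries, so turning the triangle brings it to the front and the
  flag can follow across.\<close>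

lemma transport:
  assumes "((a, s), z) \<in> (facerel d E)\<^sup>*" and x: "x \<in> H" "fst x = a" "snd x ` {3..d} = s"
  shows "\<exists>y. (x, y) \<in> conn E & y \<in> H & (fst y, snd y ` {3..d}) = z"
  using assms(1)
proof (induction rule: rtrancl_induct)
  case base
  show ?case using x conn_refl by blast
next
  case (step z z')
  obtain y where y: "(x, y) \<in> conn E" "y \<in> H" "(fst y, snd y ` {3..d}) = z" using step.IH by blast
  obtain g g' J where g: "(g, g') \<in> E" "J \<subseteq> {1..d}" "z = (fst g, snd g ` J)" "z' = (fst g', (snd g' \<circ> tt) ` J)"
    using step.hyps(2) by (rule facerelE)
  have gH: "g \<in> H" by (rule E_in(1)[OF g(1)])
  have e: "fst y = fst g" "snd y ` {3..d} = snd g ` J" using y(3) g(3) by auto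
  have "snd g 0 ~: snd y ` {3..d}"
    unfolding e(2) inj_image_mem_iff[OF perm_props(3)[OF gH]] using g(2) by auto
  then obtain y' where y': "(y, y') \<in> conn E" "y' \<in> H" "fst y' = fst y" "snd y' 0 = snd g 0"
      "snd y' ` {3..d} = snd y ` {3..d}"
    by (rule rotate_missing[OF y(2) perm_props(7)[OF gH]])
  have "fst y' = fst g" using y'(3) e(1) by simp
  then obtain m where m: "(y', m) \<in> E" "fst m = fst g'" "!!A J. snd y' ` A = snd g ` J ==> snd m ` tt ` A = (snd g' \<circ> tt) ` J"
    using tail_mate[OF g(1) y'(2) _ y'(4)] by metis
  have "snd m ` tt ` {3..d} = (snd g' \<circ> tt) ` J" by (rule m(3)) (simp only: y'(5) e(2))
  then have "(fst m, snd m ` {3..d}) = z'" using m(2) g(4) rot3_tail(2)[OF order_refl] by simp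
  moreover have "(x, m) \<in> conn E" by (rule conn_trans[OF y(1) conn_trans[OF y'(1) conn_edge[OF m(1)]]])
  ultimately show ?case using E_in(2)[OF m(1)] by blast
qed

lemma cycle_sub_H: "c \<in> cycles E ==> c \<subseteq> H"
  by (auto simp: cycles_def cycles_on_def)

lemma cycle_perm: "c \<in> cycles E ==> z \<in> c ==> perm E z \<in> c"
  and cycle_perm_iff: "c \<in> cycles E ==> m \<in> H ==> perm E m \<in> c ==> m \<in> c"
proof -
  assume c: "c \<in> cycles E"
  have im: "perm E ` c = c" using c cyc_image by (auto simp: cycles_def cycles_on_def)
  show "z \<in> c ==> perm E z \<in> c" using im by blast
  show "m \<in> c" if "m \<in> H" "perm E m \<in> c"
  proof -
    have "perm E m \<in> perm E ` c" using that(2) im by simp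
    then obtain m' where m': "m' \<in> c" "perm E m = perm E m'" by blast
    have "inj_on (perm E) H" using bij_perm[OF E_match] by (rule bij_betw_imp_inj_on)
    then have "m = m'" using m'(2) that(1) subsetD[OF cycle_sub_H[OF c] m'(1)] by (rule inj_onD)
    then show ?thesis using m'(1) by simp
  qed
qed

lemma perm_mate: "(y, m) \<in> E ==> perm E y = nxt m"
  using E_match unfolding perm_def matching_def by (metis mate_eq)

lemma perm_free: "y ~: Domain E ==> perm E y = nxt y"
  by (simp add: perm_def mate_notin)

definition prv :: "flag => flag" where "prv y = (fst y, snd y \<circ> rot3 \<circ> rot3)"

lemma prv_props:
  assumes "y \<in> H"
  shows "prv y \<in> H" "nxt (prv y) = y" "fst (prv y) = fst y" "snd (prv y) 0 = snd y 2"
    "snd (prv y) ` insert 2 {3..d} = snd y ` insert 1 {3..d}"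
proof -
  have "prv y = nxt (nxt y)" by (simp add: prv_def nxt_def)
  then show "prv y \<in> H" using nxt_H[OF nxt_H[OF assms]] by simp
  have "snd y \<circ> rot3 \<circ> rot3 \<circ> rot3 = snd y" using rot3_cube by (metis comp_assoc comp_id)
  then show "nxt (prv y) = y" by (simp add: prv_def nxt_def)
  show "snd (prv y) ` insert 2 {3..d} = snd y ` insert 1 {3..d}"
    unfolding prv_def snd_conv comp_insert rot3_simps by simp
qed (simp_all add: prv_def)

lemma opposite_pivot:
  assumes "y \<in> H" "i <= d" "i ~: snd y ` insert 1 {3..d}"
  shows "i = snd y 0 \<or> i = snd y 2"
proof -
  obtain k where k: "k <= d" "snd y k = i" using perm_surj[OF assms(1,2)] by blast
  have "k ~: insert 1 {3..d}" using k(2) assms(3) by blast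
  then have "k = 0 \<or> k = 2" using k(1) by auto
  then show ?thesis using k(2) by blast
qed

text \<open>Just two ridges of the facet contain the link vertex given by entry 1 and the tail,
  namely those opposite to entries 0 and 2. Crossing the first is a step of \<open>perm E\<close>
  forwards, crossing the second a step backwards, so a cycle that meets the vertex turns through all
  facets around it.\<close>

lemma visit_step:
  assumes c: "c \<in> cycles E" and y: "y \<in> c" and st: "((fst y, snd y ` insert 1 {3..d}), z) \<in> facerel d E"
  shows "\<exists>y'\<in>c. (fst y', snd y' ` insert 1 {3..d}) = z"
proof -
  have yH: "y \<in> H" by (rule subsetD[OF cycle_sub_H[OF c] y])
  obtain g g' J where g: "(g, g') \<in> E" "J \<subseteq> {1..d}" "(fst y, snd y ` insert 1 {3..d}) = (fst g, snd g ` J)"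
      "z = (fst g', (snd g' \<circ> tt) ` J)"
    using st by (rule facerelE)
  have gH: "g \<in> H" by (rule E_in(1)[OF g(1)])
  have e: "fst y = fst g" "snd y ` insert 1 {3..d} = snd g ` J" using g(3) by auto
  have "snd g 0 ~: snd y ` insert 1 {3..d}"
    unfolding e(2) inj_image_mem_iff[OF perm_props(3)[OF gH]] using g(2) by auto
  then have "snd g 0 = snd y 0 \<or> snd g 0 = snd y 2" by (rule opposite_pivot[OF yH perm_props(7)[OF gH]])
  then show ?thesis
  proof
    assume 0: "snd g 0 = snd y 0"
    obtain m where m: "(y, m) \<in> E" "fst m = fst g'" "!!A J. snd y ` A = snd g ` J ==> snd m ` tt ` A = (snd g' \<circ> tt) ` J"
      using tail_mate[OF g(1) yH e(1) 0[symmetric]] by metis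
    have "snd m ` tt ` insert 1 {3..d} = (snd g' \<circ> tt) ` J" by (rule m(3)[OF e(2)])
    moreover have "tt ` insert 1 {3..d} = insert 2 {3..d}" unfolding image_insert rot3_tail(2)[OF order_refl] by simp
    moreover have "snd (nxt m) ` insert 1 {3..d} = snd m ` insert 2 {3..d}"
      unfolding nxt_def snd_conv comp_insert by simp
    ultimately have "(fst (nxt m), snd (nxt m) ` insert 1 {3..d}) = z" using m(2) g(4) by (simp add: nxt_def)
    moreover have "nxt m \<in> c" using cycle_perm[OF c y] unfolding perm_mate[OF m(1)] .
    ultimately show ?thesis by blast
  next
    assume 2: "snd g 0 = snd y 2"
    note pr = prv_props[OF yH]
    have 3: "fst (prv y) = fst g" "snd (prv y) 0 = snd g 0" using pr(3,4) 2 e(1) by simp_all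
    obtain m where m: "(prv y, m) \<in> E" "fst m = fst g'" "!!A J. snd (prv y) ` A = snd g ` J ==> snd m ` tt ` A = (snd g' \<circ> tt) ` J"
      using tail_mate[OF g(1) pr(1) 3] by metis
    have "snd m ` tt ` insert 2 {3..d} = (snd g' \<circ> tt) ` J" by (rule m(3)) (simp only: pr(5) e(2))
    moreover have "tt ` insert 2 {3..d} = insert 1 {3..d}" unfolding image_insert rot3_tail(2)[OF order_refl] by simp
    ultimately have "(fst m, snd m ` insert 1 {3..d}) = z" using m(2) g(4) by simp
    moreover have "(m, prv y) \<in> E" using E_sym m(1) by (rule symD)
    then have "perm E m = y" using perm_mate pr(2) by simp
    then have "m \<in> c" using cycle_perm_iff[OF c E_in(2)[OF m(1)]] y by simp
    ultimately show ?thesis by blast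
  qed
qed

lemma visit:
  assumes c: "c \<in> cycles E" and y: "y \<in> c" and b: "b \<in> T" "t \<subseteq> {..d}"
    and eq: "cm b t = cm (fst y) (snd y ` insert 1 {3..d})"
  shows "\<exists>y'\<in>c. fst y' = b & snd y' ` insert 1 {3..d} = t"
proof -
  have yH: "y \<in> H" by (rule subsetD[OF cycle_sub_H[OF c] y])
  have "insert 1 {3..d} \<subseteq> {..d}" using d3 by auto
  then have "((fst y, snd y ` insert 1 {3..d}), (b, t)) \<in> (facerel d E)\<^sup>*"
    using cm_eq[OF perm_props(1)[OF yH] b(1) perm_props(4)[OF yH \<open>insert 1 {3..d} \<subseteq> {..d}\<close>] b(2)] eq[symmetric] by blast
  then have "\<exists>y'\<in>c. (fst y', snd y' ` insert 1 {3..d}) = (b, t)"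
  proof (induction rule: rtrancl_induct)
    case (step z z')
    then show ?case using visit_step[OF c] by blast
  qed (use y in blast)
  then show ?thesis by simp
qed

lemma pivot_cases:
  assumes "J \<subseteq> {1..d}" "{3..d} \<subseteq> J" "card J = d - 1"
  shows "J = insert 1 {3..d} \<or> J = insert 2 {3..d}"
proof -
  define X where "X = J \<inter> {1, 2}"
  have J: "J = X \<union> {3..d}"
  proof
    show "J \<subseteq> X \<union> {3..d}"
    proof
      fix n assume n: "n \<in> J"
      then have "1 <= n" "n <= d" using assms(1) by auto
      then have "n = 1 \<or> n = 2 \<or> n \<in> {3..d}" by auto
      then show "n \<in> X \<union> {3..d}" using n by (auto simp: X_def)
    qed
  qed (use assms(2) in \<open>auto simp: X_def\<close>)
  have "card J = card X + card {3..d}"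
    unfolding J by (rule card_Un_disjoint) (auto simp: X_def)
  then have "card X = 1" using assms(3) d3 by simp
  then obtain k where "X = {k}" by (auto simp: card_1_singleton_iff)
  moreover have "k = 1 \<or> k = 2" using \<open>X = {k}\<close> by (auto simp: X_def)
  ultimately show ?thesis using J by auto
qed

lemma dim_sub:
  assumes "\<alpha> \<in> dim_cells K n" "\<beta> \<in> dim_cells K m" "\<alpha> \<subseteq> \<beta>"
  shows "n <= m" "n = m ==> \<alpha> = \<beta>"
proof -
  have fp: "\<alpha> \<in> face_poset K" "\<beta> \<in> face_poset K" using assms by (auto simp: dim_cells_def face_poset_def)
  obtain b r where b: "b \<in> T" "r \<subseteq> {..d}" "\<beta> = cm b r" using fp(2) by (rule faceE)
  obtain s where s: "s \<subseteq> r" "\<alpha> = cm b s" using cm_sub[OF b(1,2) fp(1)] assms(3) b(3) by blast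
  have fin: "finite r" using b(2) finite_subset by blast
  have c: "card s = Suc n" "card r = Suc m"
    using cm_dim[OF b(1) subset_trans[OF s(1) b(2)]] cm_dim[OF b(1,2)] assms(1,2) s(2) b(3) by auto
  show "n <= m" using card_mono[OF fin s(1)] c by simp
  show "\<alpha> = \<beta>" if "n = m" using card_subset_eq[OF fin s(1)] c that s(2) b(3) by simp
qed

lemma flag_dims:
  assumes u: "u \<in> H"
  shows "cm (fst u) (snd u ` {1..d}) \<in> dim_cells K (d - 1)"
    "cm (fst u) (snd u ` insert 1 {3..d}) \<in> dim_cells K (d - 2)"
    "cm (fst u) (snd u ` {3..d}) \<in> dim_cells K (d - 3)"
proof -
  have sub: "{1..d} \<subseteq> {..d}" "insert 1 {3..d} \<subseteq> {..d}" "{3..d} \<subseteq> {..d}" using d3 by auto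
  have c: "card {1..d} = Suc (d - 1)" "card (insert 1 {3..d}) = Suc (d - 2)" "card {3..d} = Suc (d - 3)" using d3 by auto
  have "cm (fst u) (snd u ` J) \<in> dim_cells K n" if "J \<subseteq> {..d}" "card J = Suc n" for J n
    using cm_dim[OF perm_props(1)[OF u] perm_props(4)[OF u that(1)], of n] perm_props(5)[OF u, of J] that(2) by simp
  then show "cm (fst u) (snd u ` {1..d}) \<in> dim_cells K (d - 1)"
    "cm (fst u) (snd u ` insert 1 {3..d}) \<in> dim_cells K (d - 2)"
    "cm (fst u) (snd u ` {3..d}) \<in> dim_cells K (d - 3)" using sub c by blast+
qed

text \<open>At an unpaired edge \<open>perm E\<close> acts as \<open>nxt\<close>, so the two ends of
  the edge are recorded at \<open>z\<close> and at its successor in the cycle.\<close>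

lemma edge_vertex:
  assumes c: "c \<in> cycles E" and z: "z \<in> c" "z ~: Domain E"
    and \<rho>: "\<rho> \<in> dim_cells K (d - 2)" "cm (fst z) (snd z ` {3..d}) \<subseteq> \<rho>" "\<rho> \<subseteq> cm (fst z) (snd z ` {1..d})"
  shows "\<exists>y\<in>c. \<rho> = cm (fst y) (snd y ` insert 1 {3..d})"
proof -
  have zH: "z \<in> H" by (rule subsetD[OF cycle_sub_H[OF c] z(1)])
  note p = perm_props[OF zH]
  have sub: "{1..d} \<subseteq> {..d}" "{3..d} \<subseteq> {..d}" by auto
  have "\<rho> \<in> face_poset K" using \<rho>(1) by (auto simp: dim_cells_def face_poset_def)
  then obtain t where t: "t \<subseteq> snd z ` {1..d}" "\<rho> = cm (fst z) t" using cm_sub[OF p(1) p(4)[OF sub(1)] _ \<rho>(3)] by blast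
  have td: "t \<subseteq> {..d}" by (rule subset_trans[OF t(1) p(4)[OF sub(1)]])
  obtain J where J: "J \<subseteq> {1..d}" "t = snd z ` J" using t(1) by (rule subset_imageE)
  have "card t = d - 1" using cm_dim[OF p(1) td, of "d - 2"] \<rho>(1) t(2) d3 by simp
  then have "card J = d - 1" unfolding J(2) p(5) .
  moreover have "snd z ` {3..d} \<subseteq> snd z ` J"
    using cm_mono[OF p(1) p(4)[OF sub(2)] td] \<rho>(2) t(2) J(2) by simp
  then have "{3..d} \<subseteq> J" unfolding inj_image_subset_iff[OF p(3)] .
  ultimately have "J = insert 1 {3..d} \<or> J = insert 2 {3..d}" using pivot_cases[OF J(1)] by blast
  then show ?thesis
  proof
    assume "J = insert 2 {3..d}"
    then have "\<rho> = cm (fst (nxt z)) (snd (nxt z) ` insert 1 {3..d})"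
      using t(2) J(2) unfolding nxt_def fst_conv snd_conv comp_insert by simp
    moreover have "nxt z \<in> c" using cycle_perm[OF c z(1)] unfolding perm_free[OF z(2)] .
    ultimately show ?thesis by blast
  qed (use z(1) t(2) J(2) in blast)
qed

lemma boundary_free:
  "F \<in> boundary_faces d K ==> F = cm w ({..d} - {i}) ==> face z = (w, i) ==> z ~: Domain E"
  using boundary_unmatched by blast

text \<open>By \<open>visit\<close> the cycle passes a copy of the vertex in the facet of
  \<open>\<beta>\<close>. As that ridge is unpaired, the cycle runs along it, either leaving from
  this flag or arriving at it.\<close>

lemma vertex_edge:
  assumes c: "c \<in> cycles E" and y: "y \<in> c"
    and \<beta>: "\<beta> \<in> boundary_faces d K" "cm (fst y) (snd y ` insert 1 {3..d}) \<subseteq> \<beta>"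
  shows "\<exists>z\<in>c. z ~: Domain E & \<beta> = cm (fst z) (snd z ` {1..d})"
proof -
  have yH: "y \<in> H" by (rule subsetD[OF cycle_sub_H[OF c] y])
  have "\<beta> \<in> dim_cells K (d - 1)" using \<beta>(1) by (simp add: boundary_faces_def)
  then obtain b i where b: "b \<in> T" "i <= d" "\<beta> = cm b ({..d} - {i})" by (rule ridge_faceE)
  have fp: "cm (fst y) (snd y ` insert 1 {3..d}) \<in> face_poset K"
    using flag_dims(2)[OF yH] by (auto simp: dim_cells_def face_poset_def)
  have "cm (fst y) (snd y ` insert 1 {3..d}) \<subseteq> cm b ({..d} - {i})" using \<beta>(2) b(3) by simp
  then obtain t where t: "t \<subseteq> {..d} - {i}" "cm (fst y) (snd y ` insert 1 {3..d}) = cm b t"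
    using cm_sub[OF b(1) Diff_subset fp] by blast
  then have "t \<subseteq> {..d}" by blast
  then obtain y' where y': "y' \<in> c" "fst y' = b" "snd y' ` insert 1 {3..d} = t"
    using visit[OF c y b(1) _ t(2)[symmetric]] by blast
  have y'H: "y' \<in> H" by (rule subsetD[OF cycle_sub_H[OF c] y'(1)])
  have fin: "z ~: Domain E & \<beta> = cm (fst z) (snd z ` {1..d})" if "z \<in> H" "fst z = b" "snd z 0 = i" for z
    using boundary_free[OF \<beta>(1) b(3), of z] that(2,3) perm_props(6)[OF that(1)] b(3) by (simp add: face_def)
  have "i ~: snd y' ` insert 1 {3..d}" using y'(3) t(1) by auto
  then have "i = snd y' 0 \<or> i = snd y' 2" by (rule opposite_pivot[OF y'H b(2)])
  then show ?thesis
  proof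
    assume "i = snd y' 0"
    then show ?thesis using fin[OF y'H y'(2)] y'(1) by blast
  next
    assume 2: "i = snd y' 2"
    note pr = prv_props[OF y'H]
    have f: "prv y' ~: Domain E & \<beta> = cm (fst (prv y')) (snd (prv y') ` {1..d})"
      by (rule fin[OF pr(1)]) (simp_all add: pr(3,4) y'(2) 2)
    have "perm E (prv y') = y'" using perm_free[OF conjunct1[OF f]] pr(2) by simp
    then have "prv y' \<in> c" using cycle_perm_iff[OF c pr(1)] y'(1) by simp
    then show ?thesis using f by blast
  qed
qed

text \<open>A chain of incident boundary edges and vertices is followed by alternating
  \<open>edge_vertex\<close> and \<open>vertex_edge\<close>, so a boundary component of the link
  stays within a single cycle.\<close>

lemma walk:
  assumes c: "c \<in> cycles E" and u: "u \<in> c" "u ~: Domain E"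
    and \<tau>: "\<tau> = cm (fst u) (snd u ` {3..d})"
    and sb: "same_boundary_component d K \<tau> (cm (fst u) (snd u ` {1..d})) F'" and F': "F' \<in> dim_cells K (d - 1)"
  shows "\<exists>z\<in>c. F' = cm (fst z) (snd z ` {1..d})"
proof -
  have inH: "z \<in> H" if "z \<in> c" for z by (rule subsetD[OF cycle_sub_H[OF c] that])
  have tau: "cm (fst z) (snd z ` {3..d}) = \<tau>" if "z \<in> c" for z
    using conn_face[OF cycle_conn[OF E_match c u(1) that] inH[OF u(1)] order_refl] \<tau> by simp
  define I1 where "I1 \<alpha> \<longleftrightarrow> (\<exists>z\<in>c. z ~: Domain E & \<alpha> = cm (fst z) (snd z ` {1..d}))" for \<alpha>
  define I2 where "I2 \<alpha> \<longleftrightarrow> (\<exists>y\<in>c. \<alpha> = cm (fst y) (snd y ` insert 1 {3..d}))" for \<alpha>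
  have I1d: "\<alpha> \<in> dim_cells K (d - 1)" if "I1 \<alpha>" for \<alpha>
    using that flag_dims(1)[OF inH] unfolding I1_def by blast
  have I2d: "\<alpha> \<in> dim_cells K (d - 2)" if "I2 \<alpha>" for \<alpha>
    using that flag_dims(2)[OF inH] unfolding I2_def by blast
  have nle: "\<not> d - 1 <= d - 2" using d3 by simp
  let ?R = "{(\<alpha>, \<beta>). \<alpha> \<in> link_boundary d K \<tau> & \<beta> \<in> link_boundary d K \<tau> & (\<alpha> \<subseteq> \<beta> \<or> \<beta> \<subseteq> \<alpha>)}"
  have "(cm (fst u) (snd u ` {1..d}), F') \<in> ?R\<^sup>*" using sb unfolding same_boundary_component_def .
  then have "I1 F' \<or> I2 F'"
  proof (induction rule: rtrancl_induct)
    case base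
    show ?case using u unfolding I1_def by blast
  next
    case (step \<alpha> \<beta>)
    have \<beta>: "\<beta> \<in> link_boundary d K \<tau>" and ab: "\<alpha> \<subseteq> \<beta> \<or> \<beta> \<subseteq> \<alpha>" using step.hyps(2) by auto
    obtain G where G: "G \<in> boundary_faces d K" "\<beta> \<subseteq> G" using \<beta> by (auto simp: link_boundary_def)
    have t\<beta>: "\<tau> \<subseteq> \<beta>" using \<beta> by (auto simp: link_boundary_def link_vertices_def link_edges_def link_poset_def)
    have Gd: "G \<in> dim_cells K (d - 1)" using G(1) by (simp add: boundary_faces_def)
    consider "\<beta> \<in> dim_cells K (d - 1)" | "\<beta> \<in> dim_cells K (d - 2)"
      using \<beta> by (auto simp: link_boundary_def link_vertices_def link_edges_def)
    note bd = this
    show ?case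
    proof (cases "I1 \<alpha>")
      case True
      note ad = I1d[OF True]
      show ?thesis
      proof (cases rule: bd)
        case 1
        then have "\<alpha> = \<beta>" using ab dim_sub(2)[OF ad 1] dim_sub(2)[OF 1 ad] by auto
        then show ?thesis using True by simp
      next
        case 2
        then have "\<beta> \<subseteq> \<alpha>" using ab dim_sub(1)[OF ad 2] nle by blast
        obtain z where z: "z \<in> c" "z ~: Domain E" "\<alpha> = cm (fst z) (snd z ` {1..d})" using True unfolding I1_def by blast
        have "\<exists>y\<in>c. \<beta> = cm (fst y) (snd y ` insert 1 {3..d})"
          by (rule edge_vertex[OF c z(1,2) 2]) (use t\<beta> tau[OF z(1)] \<open>\<beta> \<subseteq> \<alpha>\<close> z(3) in simp_all)
        then show ?thesis unfolding I2_def by blast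
      qed
    next
      case False
      then have I2: "I2 \<alpha>" using step.IH by blast
      note ad = I2d[OF I2]
      show ?thesis
      proof (cases rule: bd)
        case 1
        then have "\<alpha> \<subseteq> \<beta>" using ab dim_sub(1)[OF 1 ad] nle by blast
        have "\<beta> = G" using dim_sub(2)[OF 1 Gd G(2)] by simp
        then have bb: "\<beta> \<in> boundary_faces d K" using G(1) by simp
        obtain y where y: "y \<in> c" "\<alpha> = cm (fst y) (snd y ` insert 1 {3..d})" using I2 unfolding I2_def by blast
        have "cm (fst y) (snd y ` insert 1 {3..d}) \<subseteq> \<beta>" using \<open>\<alpha> \<subseteq> \<beta>\<close> y(2) by simp
        from vertex_edge[OF c y(1) bb this] show ?thesis unfolding I1_def by blast
      next
        case 2
        then have "\<alpha> = \<beta>" using ab dim_sub(2)[OF ad 2] dim_sub(2)[OF 2 ad] by auto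
        then show ?thesis using I2 by simp
      qed
    qed
  qed
  moreover have "\<not> I2 F'" using dim_sub(1)[OF F' I2d[of F'] order_refl] nle by blast
  ultimately show ?thesis unfolding I1_def by blast
qed

text \<open>The cycle through \<open>u\<close> meets \<open>F'\<close> in some flag, and
  \<open>conn_same_face\<close> identifies that flag with \<open>v\<close>, orientation included.
  This turns the condition on boundary components into the one that keeps pairings planar.\<close>

lemma same_cycle_of_component:
  assumes u: "u \<in> H" "u ~: Domain E" and v: "(u, v) \<in> conn E"
    and sb: "same_boundary_component d K (cm (fst u) (snd u ` {3..d})) (cm (fst u) (snd u ` {1..d})) F'"
    and F': "F' \<in> boundary_faces d K" "F' = cm (fst v) (snd v ` {1..d})"
  shows "same_cycle E u v"
proof -
  obtain c where c: "c \<in> cycles E" "u \<in> c"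
    using cycles_on_cover[OF finite_H bij_perm[OF E_match] u(1)] by (auto simp: cycles_def)
  have "F' \<in> dim_cells K (d - 1)" using F'(1) by (simp add: boundary_faces_def)
  from walk[OF c u(2) refl sb this] obtain z where z: "z \<in> c" "F' = cm (fst z) (snd z ` {1..d})" by blast
  have zH: "z \<in> H" by (rule subsetD[OF cycle_sub_H[OF c(1)] z(1)])
  have vH: "v \<in> H" using conn_face[OF v u(1), of "{}"] by simp
  have s1: "{1..d} \<subseteq> {..d}" by auto
  have sub: "cm (fst x) (snd x ` {1..d}) \<subseteq> cm (fst x) {..d}" if "x \<in> H" for x
    using cm_mono[OF perm_props(1)[OF that] perm_props(4)[OF that s1] order_refl] perm_props(4)[OF that s1] by blast
  have f: "fst z = fst v"
    by (rule boundary_unique[OF F'(1) perm_props(1)[OF zH] perm_props(1)[OF vH]]) (use sub[OF zH] sub[OF vH] z(2) F'(2) in simp_all)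
  have "snd z ` {1..d} = snd v ` {1..d}"
    by (rule cm_inj[OF perm_props(1)[OF vH]]) (use perm_props(4)[OF zH s1] perm_props(4)[OF vH s1] z(2) F'(2) f in simp_all)
  then have "{..d} - {snd z 0} = {..d} - {snd v 0}" unfolding perm_props(6)[OF zH] perm_props(6)[OF vH] .
  then have 0: "snd z 0 = snd v 0" using perm_props(7)[OF zH] perm_props(7)[OF vH] by auto
  have zv: "(z, v) \<in> conn E" by (rule conn_trans[OF cycle_conn[OF E_match c(1) z(1) c(2)] v])
  have "gs z = gs v" by (rule conn_gs[OF zv E_gs])
  then have "z = v" by (rule conn_same_face[OF zv zH f 0])
  then show ?thesis using c z(1) unfolding same_cycle_def by blast
qed

end

section \<open>The effect of a gluing\<close>

text \<open>An order isomorphism of power sets maps singletons to singletons and is determined by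
  them.\<close>

lemma Pow_iso_image:
  assumes bij: "bij_betw \<phi> (Pow A) (Pow B)"
    and mono: "!!s t. s \<subseteq> A ==> t \<subseteq> A ==> \<phi> s \<subseteq> \<phi> t \<longleftrightarrow> s \<subseteq> t"
  shows "\<exists>\<beta>. bij_betw \<beta> A B & (\<forall>s\<subseteq>A. \<phi> s = \<beta> ` s)"
proof -
  have inj: "s = t" if "s \<subseteq> A" "t \<subseteq> A" "\<phi> s = \<phi> t" for s t
    using mono[OF that(1,2)] mono[OF that(2,1)] that(3) by auto
  have ran: "\<phi> s \<subseteq> B" if "s \<subseteq> A" for s using bij that by (auto simp: bij_betw_def)
  have sur: "\<exists>s\<subseteq>A. \<phi> s = r" if "r \<subseteq> B" for r
  proof -
    have "r \<in> \<phi> ` Pow A" using bij that by (simp add: bij_betw_def)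
    then show ?thesis by auto
  qed
  have empty: "\<phi> {} = {}"
  proof -
    obtain s where s: "s \<subseteq> A" "\<phi> s = {}" using sur[of "{}"] by auto
    have "\<phi> {} \<subseteq> \<phi> s" using mono[of "{}" s] s(1) by simp
    then show ?thesis using s(2) by simp
  qed
  have "\<exists>b. \<phi> {j} = {b}" if j: "j \<in> A" for j
  proof -
    have "\<phi> {j} ~= {}" using inj[of "{j}" "{}"] empty j by auto
    then obtain b where b: "b \<in> \<phi> {j}" by blast
    then have "{b} \<subseteq> B" using ran[of "{j}"] j by auto
    from sur[OF this] obtain s where s: "s \<subseteq> A" "\<phi> s = {b}" by (elim exE conjE)
    have "s \<subseteq> {j}" using mono[of s "{j}"] s b j by auto
    moreover have "s ~= {}" using s(2) empty by auto
    ultimately have "s = {j}" by auto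
    then show ?thesis using s(2) by blast
  qed
  then obtain \<beta> where \<beta>: "!!j. j \<in> A ==> \<phi> {j} = {\<beta> j}" by metis
  have im: "\<phi> s = \<beta> ` s" if s: "s \<subseteq> A" for s
  proof (intro equalityI subsetI)
    fix b assume b: "b \<in> \<phi> s"
    then have "{b} \<subseteq> B" using ran[OF s] by auto
    from sur[OF this] obtain t where t: "t \<subseteq> A" "\<phi> t = {b}" by (elim exE conjE)
    have ts: "t \<subseteq> s" using mono[OF t(1) s] t(2) b by simp
    have "t ~= {}" using t(2) empty by auto
    then obtain j where j: "j \<in> t" by blast
    then have "\<phi> {j} \<subseteq> \<phi> t" using mono[of "{j}" t] t(1) by auto
    then have "\<beta> j = b" using \<beta>[of j] j t by auto
    then show "b \<in> \<beta> ` s" using j ts by auto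
  next
    fix b assume "b \<in> \<beta> ` s"
    then obtain j where j: "j \<in> s" "b = \<beta> j" by blast
    then have "\<phi> {j} \<subseteq> \<phi> s" using mono[of "{j}" s] s by auto
    then show "b \<in> \<phi> s" using \<beta>[of j] j s by auto
  qed
  have "inj_on \<beta> A"
  proof (rule inj_onI)
    fix j k assume "j \<in> A" "k \<in> A" "\<beta> j = \<beta> k"
    then show "j = k" using inj[of "{j}" "{k}"] \<beta> by auto
  qed
  moreover have "\<beta> ` A = B"
  proof -
    obtain s where s: "s \<subseteq> A" "\<phi> s = B" using sur[of B] by auto
    then have "B \<subseteq> \<phi> A" using mono[of s A] by simp
    then show ?thesis using im[of A] ran[of A] by auto
  qed
  ultimately have "bij_betw \<beta> A B" by (simp add: bij_betw_def)
  then show ?thesis using im by (intro exI[of _ \<beta>]) simp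
qed

lemma facerel_Un: "facerel d (A \<union> B) = facerel d A \<union> facerel d B"
proof
  show "facerel d (A \<union> B) \<subseteq> facerel d A \<union> facerel d B"
  proof (rule subrelI)
    fix z z' assume "(z, z') \<in> facerel d (A \<union> B)"
    then obtain u v J where uv: "(u, v) \<in> A \<union> B" "J \<subseteq> {1..d}" "z = (fst u, snd u ` J)" "z' = (fst v, (snd v \<circ> tt) ` J)"
      by (rule facerelE)
    from uv(1) show "(z, z') \<in> facerel d A \<union> facerel d B"
      unfolding uv(3,4) using facerelI[of u v A J d] facerelI[of u v B J d] uv(2) by (elim UnE) simp_all
  qed
  show "facerel d A \<union> facerel d B \<subseteq> facerel d (A \<union> B)"
    by (intro Un_least facerel_mono) simp_all
qed

sublocale face_model \<subseteq> rcw K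
  by unfold_locales (rule regular_K)

locale gluing_step = face_model_closed d T K E cm
  for d T and K :: "'a cell_complex" and E cm +
  fixes K' :: "'a cell_complex" and F F' h q
  assumes glu: "gluing K K' F F' h q" and F: "F \<in> boundary_faces d K" and F': "F' \<in> boundary_faces d K"
    and FF': "F ~= F'" and pm: "pseudomanifold d K'"
begin

lemma simp_K': "simplicial_cw K'" and pure_K': "pure_dim d K'"
  using pm by (auto simp: pseudomanifold_def)

lemma F_dim: "F \<in> dim_cells K (d - 1)" "F' \<in> dim_cells K (d - 1)"
  using F F' by (auto simp: boundary_faces_def)

lemma F_cell: "F \<in> cells K" "F' \<in> cells K"
  using F_dim by (auto simp: dim_cells_def)

lemma h_inj: "inj_on h F" and h_image: "h ` F = F'"
proof -
  have "homeomorphic_map (subtopology (cspace K) F) (subtopology (cspace K) F') h"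
    using glu by (simp add: gluing_def simplicial_homeo_def)
  note hm = this
  show "inj_on h F" using homeomorphic_imp_injective_map[OF hm] unfolding topspace_cell[OF F_cell(1)] .
  show "h ` F = F'" using homeomorphic_imp_surjective_map[OF hm]
    unfolding topspace_cell[OF F_cell(1)] topspace_cell[OF F_cell(2)] .
qed

lemma h_cells: "(`) h ` {\<tau> \<in> cells K. \<tau> \<subseteq> F} = {\<tau> \<in> cells K. \<tau> \<subseteq> F'}"
  using glu by (simp add: gluing_def simplicial_homeo_def)

lemma h_cell: "\<tau> \<in> cells K ==> \<tau> \<subseteq> F ==> h ` \<tau> \<in> cells K & h ` \<tau> \<subseteq> F'"
proof -
  assume "\<tau> \<in> cells K" "\<tau> \<subseteq> F"
  then have "h ` \<tau> \<in> (`) h ` {\<tau> \<in> cells K. \<tau> \<subseteq> F}" by (intro imageI CollectI conjI)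
  then show ?thesis unfolding h_cells by simp
qed

lemma h_cell_surj: "\<tau> \<in> cells K ==> \<tau> \<subseteq> F' ==> \<exists>\<rho>\<in>cells K. \<rho> \<subseteq> F & \<tau> = h ` \<rho>"
proof -
  assume "\<tau> \<in> cells K" "\<tau> \<subseteq> F'"
  then have "\<tau> \<in> (`) h ` {\<tau> \<in> cells K. \<tau> \<subseteq> F}" unfolding h_cells by simp
  then show ?thesis by (elim imageE) auto
qed

lemma cells_K': "cells K' = (`) q ` cells K"
  using glu by (simp add: gluing_def)

lemma q_eq: "x \<in> topspace (cspace K) ==> y \<in> topspace (cspace K) ==>
    q x = q y \<longleftrightarrow> (x, y) \<in> ({(x, h x) |x. x \<in> F} \<union> {(h x, x) |x. x \<in> F})\<^sup>*"
  using glu by (simp add: gluing_def)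

lemma q_h: "x \<in> F ==> q (h x) = q x"
proof -
  assume x: "x \<in> F"
  have t: "x \<in> topspace (cspace K)" "h x \<in> topspace (cspace K)"
    using subsetD[OF cell_sub[OF F_cell(1)] x] subsetD[OF cell_sub[OF F_cell(2)], of "h x"] h_image x by auto
  have "(x, h x) \<in> ({(x, h x) |x. x \<in> F} \<union> {(h x, x) |x. x \<in> F})\<^sup>*" using x by (intro r_into_rtrancl) blast
  then show ?thesis using q_eq[OF t] by simp
qed

lemma q_h_image: "\<tau> \<subseteq> F ==> q ` h ` \<tau> = q ` \<tau>"
  unfolding image_image by (rule image_cong) (use q_h in auto)

definition Sg :: "('a set \<times> 'a set) set" where
  "Sg = {(\<tau>, h ` \<tau>) |\<tau>. \<tau> \<in> cells K & \<tau> \<subseteq> F} \<union> {(h ` \<tau>, \<tau>) |\<tau>. \<tau> \<in> cells K & \<tau> \<subseteq> F}"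

lemma SgE:
  assumes "(\<sigma>, \<tau>) \<in> Sg"
  obtains "\<sigma> \<in> cells K" "\<sigma> \<subseteq> F" "\<tau> = h ` \<sigma>" | "\<tau> \<in> cells K" "\<tau> \<subseteq> F" "\<sigma> = h ` \<tau>"
  using assms unfolding Sg_def by (elim UnE CollectE exE conjE Pair_inject) simp_all

lemma Sg_q: "(\<sigma>, \<tau>) \<in> Sg\<^sup>* ==> q ` \<sigma> = q ` \<tau>"
proof (induction rule: rtrancl_induct)
  case (step y z)
  from step.hyps(2) have "q ` y = q ` z" by (rule SgE) (simp_all add: q_h_image)
  then show ?case using step.IH by simp
qed simp

lemma cint_h:
  assumes s: "\<sigma> \<in> cells K" "\<sigma> \<subseteq> F" and x: "x \<in> F"
  shows "x \<in> cint \<sigma> \<longleftrightarrow> h x \<in> cint (h ` \<sigma>)"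
proof -
  have fwd: "h x \<in> cint (h ` \<sigma>)" if s: "\<sigma> \<in> cells K" "\<sigma> \<subseteq> F" "x \<in> cint \<sigma>" for \<sigma>
  proof -
    have hs: "h ` \<sigma> \<in> cells K" "h ` \<sigma> \<subseteq> F'" using h_cell[OF s(1,2)] by auto
    have "h x \<in> h ` \<sigma>" using subsetD[OF cint_sub s(3)] by blast
    then obtain \<kappa> where k: "\<kappa> \<in> cells K" "\<kappa> \<subseteq> h ` \<sigma>" "h x \<in> cint \<kappa>" using carrier[OF hs(1)] by blast
    obtain \<rho> where r: "\<rho> \<in> cells K" "\<rho> \<subseteq> F" "\<kappa> = h ` \<rho>" using h_cell_surj[OF k(1)] k(2) hs(2) by blast
    have "h x \<in> h ` \<rho>" using subsetD[OF cint_sub k(3)] r(3) by simp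
    then have "x \<in> \<rho>" using inj_on_image_mem_iff[OF h_inj x r(2)] by simp
    then have "\<sigma> \<subseteq> \<rho>" by (rule carrier_sub[OF s(1,3) r(1)])
    then have "\<kappa> = h ` \<sigma>" using k(2) r(3) by blast
    then show ?thesis using k(3) by simp
  qed
  show ?thesis
  proof
    assume hx: "h x \<in> cint (h ` \<sigma>)"
    then have "h x \<in> h ` \<sigma>" by (rule subsetD[OF cint_sub])
    then have "x \<in> \<sigma>" using inj_on_image_mem_iff[OF h_inj x s(2)] by simp
    then obtain \<kappa> where k: "\<kappa> \<in> cells K" "\<kappa> \<subseteq> \<sigma>" "x \<in> cint \<kappa>" using carrier[OF s(1)] by blast
    have kF: "\<kappa> \<subseteq> F" by (rule subset_trans[OF k(2) s(2)])
    have "h ` \<kappa> = h ` \<sigma>"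
      using cint_disjoint fwd[OF k(1) kF k(3)] hx h_cell[OF k(1) kF] h_cell[OF s] by blast
    then have "\<kappa> = \<sigma>" using inj_on_image_eq_iff[OF h_inj kF s(2)] by simp
    then show "x \<in> cint \<sigma>" using k(3) by simp
  qed (use fwd[OF s] in blast)
qed

text \<open>As \<open>h\<close> maps cells to cells and interiors to interiors, a chain of
  identifications of points drags along the cell whose interior contains the point.\<close>

lemma Sg_carrier:
  assumes "(x, y) \<in> ({(x, h x) |x. x \<in> F} \<union> {(h x, x) |x. x \<in> F})\<^sup>*" and s: "\<sigma> \<in> cells K" "x \<in> cint \<sigma>"
  shows "\<exists>\<tau>\<in>cells K. (\<sigma>, \<tau>) \<in> Sg\<^sup>* & y \<in> cint \<tau>"
  using assms(1)
proof (induction rule: rtrancl_induct)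
  case base
  show ?case using s by blast
next
  case (step y z)
  obtain \<tau> where t: "\<tau> \<in> cells K" "(\<sigma>, \<tau>) \<in> Sg\<^sup>*" "y \<in> cint \<tau>" using step.IH by blast
  have yt: "y \<in> \<tau>" by (rule subsetD[OF cint_sub t(3)])
  consider "y \<in> F" "z = h y" | "z \<in> F" "y = h z" using step.hyps(2) by blast
  then show ?case
  proof cases
    case 1
    have tF: "\<tau> \<subseteq> F" by (rule carrier_sub[OF t(1,3) F_cell(1) 1(1)])
    have "(\<tau>, h ` \<tau>) \<in> Sg" using t(1) tF unfolding Sg_def by blast
    then have "(\<sigma>, h ` \<tau>) \<in> Sg\<^sup>*" by (rule rtrancl_into_rtrancl[OF t(2)])
    moreover have "z \<in> cint (h ` \<tau>)" using cint_h[OF t(1) tF 1(1)] t(3) 1(2) by simp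
    ultimately show ?thesis using h_cell[OF t(1) tF] by blast
  next
    case 2
    have "y \<in> F'" using 2 h_image by blast
    then have "\<tau> \<subseteq> F'" by (rule carrier_sub[OF t(1,3) F_cell(2)])
    then obtain \<rho> where r: "\<rho> \<in> cells K" "\<rho> \<subseteq> F" "\<tau> = h ` \<rho>" using h_cell_surj[OF t(1)] by blast
    have "(\<tau>, \<rho>) \<in> Sg" using r unfolding Sg_def by blast
    then have "(\<sigma>, \<rho>) \<in> Sg\<^sup>*" by (rule rtrancl_into_rtrancl[OF t(2)])
    moreover have "z \<in> cint \<rho>" using cint_h[OF r(1,2) 2(1)] t(3) 2(2) r(3) by simp
    ultimately show ?thesis using r(1) by blast
  qed
qed

lemma q_sub:
  assumes "\<sigma> \<in> face_poset K" "\<tau> \<in> face_poset K" "q ` \<sigma> \<subseteq> q ` \<tau>"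
  shows "\<exists>\<sigma>'\<in>face_poset K. (\<sigma>, \<sigma>') \<in> Sg\<^sup>* & \<sigma>' \<subseteq> \<tau>"
proof (cases "\<sigma> = {}")
  case True
  then show ?thesis using assms(1) by blast
next
  case False
  then have s: "\<sigma> \<in> cells K" using assms(1) by (simp add: face_poset_def)
  obtain x where x: "x \<in> cint \<sigma>" using cint_nonempty[OF s] by blast
  have xs: "x \<in> \<sigma>" by (rule subsetD[OF cint_sub x])
  then obtain y where y: "y \<in> \<tau>" "q x = q y" using assms(3) by blast
  then have t: "\<tau> \<in> cells K" using assms(2) by (auto simp: face_poset_def)
  have "(x, y) \<in> ({(x, h x) |x. x \<in> F} \<union> {(h x, x) |x. x \<in> F})\<^sup>*"
    using q_eq[of x y] y cell_sub[OF s] cell_sub[OF t] xs by blast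
  from Sg_carrier[OF this s x] obtain \<sigma>' where s': "\<sigma>' \<in> cells K" "(\<sigma>, \<sigma>') \<in> Sg\<^sup>*" "y \<in> cint \<sigma>'" by blast
  have "\<sigma>' \<subseteq> \<tau>" by (rule carrier_sub[OF s'(1,3) t y(1)])
  then show ?thesis using s' by (auto simp: face_poset_def)
qed

lemma facet_not_sub: "a \<in> T ==> G \<in> dim_cells K (d - 1) ==> \<not> cm a {..d} \<subseteq> G"
proof
  assume a: "a \<in> T" "G \<in> dim_cells K (d - 1)" "cm a {..d} \<subseteq> G"
  have "cm a {..d} \<in> dim_cells K d" using cm_dim[OF a(1) order_refl, of d] by simp
  from dim_sub(1)[OF this a(2,3)] show False using d3 by simp
qed

lemma Sg_facet:
  assumes "a \<in> T" "(cm a {..d}, \<tau>) \<in> Sg\<^sup>*" shows "\<tau> = cm a {..d}"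
  using assms(2)
proof (cases rule: converse_rtranclE)
  case (step y)
  have "\<not> cm a {..d} \<subseteq> F" "\<not> cm a {..d} \<subseteq> F'" using facet_not_sub[OF assms(1)] F_dim by auto
  then show ?thesis using step(1) h_image by (elim SgE) blast+
qed simp

lemma face_K': "face_poset K' = (`) q ` face_poset K"
  unfolding face_poset_def cells_K' by simp

text \<open>As the new complex is simplicial, exactly 2 ^ (d + 1) faces lie below the image of the
  facet. All of them are images of faces of this one facet, which has equally many, so no two of its
  faces can be identified.\<close>

lemma q_inj:
  assumes a: "a \<in> T" shows "inj_on (%s. q ` cm a s) (Pow {..d})"
proof -
  have D: "cm a {..d} \<in> cells K" using cm_cell[OF a order_refl] by auto
  then have qD: "q ` cm a {..d} \<in> cells K'" unfolding cells_K' by blast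
  \<comment> \<open>Purity shows that the image of a facet still has dimension \<open>d\<close>: a
    facet of the new complex that contains it is the image of a cell containing the old facet, hence
    of the facet itself.\<close>
  then obtain D' where D': "D' \<in> dim_cells K' d" "q ` cm a {..d} \<subseteq> D'"
    using pure_K' by (auto simp: pure_dim_def)
  have "D' \<in> cells K'" using D'(1) by (simp add: dim_cells_def)
  then obtain \<tau> where t: "\<tau> \<in> cells K" "D' = q ` \<tau>" unfolding cells_K' by blast
  obtain \<sigma> where s: "(cm a {..d}, \<sigma>) \<in> Sg\<^sup>*" "\<sigma> \<subseteq> \<tau>"
    using q_sub[OF cell_in_face[OF D] cell_in_face[OF t(1)]] D'(2) t(2) by blast
  then have sub: "cm a {..d} \<subseteq> \<tau>" using Sg_facet[OF a] by blast
  obtain b r where b: "b \<in> T" "r \<subseteq> {..d}" "\<tau> = cm b r" using cell_in_face[OF t(1)] by (rule faceE)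
  obtain r' where r': "r' \<subseteq> r" "cm a {..d} = cm b r'"
    using cm_sub[OF b(1,2) cell_in_face[OF D]] sub b(3) by blast
  then have "r' = {..d}" using facet_eq[OF a b(1)] b(2) by blast
  then have "r = {..d}" using r'(1) b(2) by blast
  then have tD: "\<tau> = cm a {..d}" using r' b(3) \<open>r' = {..d}\<close> by simp
  have dq: "q ` cm a {..d} \<in> dim_cells K' d" using D'(1) t(2) tD by simp
  obtain V :: "nat set" where V: "finite V" "poset_iso {\<rho> \<in> face_poset K'. \<rho> \<subseteq> q ` cm a {..d}} (Pow V)"
    using simp_K' qD unfolding simplicial_cw_def by blast
  have "card V = Suc d" using dim_cells_iff_rank[OF simp_K' qD V] dq by simp
  then have cV: "card {\<rho> \<in> face_poset K'. \<rho> \<subseteq> q ` cm a {..d}} = 2 ^ Suc d"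
    using poset_iso_card[OF V(2)] V(1) by (simp add: card_Pow)
  have "{\<rho> \<in> face_poset K'. \<rho> \<subseteq> q ` cm a {..d}} \<subseteq> (%s. q ` cm a s) ` Pow {..d}"
  proof
    fix \<rho> assume r: "\<rho> \<in> {\<rho> \<in> face_poset K'. \<rho> \<subseteq> q ` cm a {..d}}"
    then obtain \<tau> where t: "\<tau> \<in> face_poset K" "\<rho> = q ` \<tau>" unfolding face_K' by blast
    obtain \<tau>' where t': "\<tau>' \<in> face_poset K" "(\<tau>, \<tau>') \<in> Sg\<^sup>*" "\<tau>' \<subseteq> cm a {..d}"
      using q_sub[OF t(1) cell_in_face[OF D]] r t(2) by blast
    obtain s where "s \<subseteq> {..d}" "\<tau>' = cm a s" using cm_sub[OF a order_refl t'(1,3)] by blast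
    then show "\<rho> \<in> (%s. q ` cm a s) ` Pow {..d}" using Sg_q[OF t'(2)] t(2) by blast
  qed
  then have "2 ^ Suc d <= card ((%s. q ` cm a s) ` Pow {..d})"
    unfolding cV[symmetric] by (intro card_mono) auto
  moreover have "card ((%s. q ` cm a s) ` Pow {..d}) <= card (Pow {..d})" by (rule card_image_le) simp
  moreover have "card (Pow {..d}) = 2 ^ Suc d" by (simp add: card_Pow)
  ultimately show ?thesis by (intro eq_card_imp_inj_on) auto
qed

lemma q_cm_inj: "a \<in> T ==> s \<subseteq> {..d} ==> s' \<subseteq> {..d} ==> q ` cm a s = q ` cm a s' ==> s = s'"
proof -
  assume a: "a \<in> T" "s \<subseteq> {..d}" "s' \<subseteq> {..d}" "q ` cm a s = q ` cm a s'"
  show "s = s'" by (rule inj_onD[OF q_inj[OF a(1)] a(4)]) (simp_all add: a(2,3))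
qed

lemma q_cm_sub:
  assumes a: "a \<in> T" "s \<subseteq> {..d}" and t: "\<tau> \<in> face_poset K" "q ` \<tau> \<subseteq> q ` cm a s"
  obtains s' where "s' \<subseteq> s" "(\<tau>, cm a s') \<in> Sg\<^sup>*" "q ` \<tau> = q ` cm a s'"
proof -
  obtain \<tau>' where t': "\<tau>' \<in> face_poset K" "(\<tau>, \<tau>') \<in> Sg\<^sup>*" "\<tau>' \<subseteq> cm a s"
    using q_sub[OF t(1) cm_face[OF a] t(2)] by blast
  obtain s' where "s' \<subseteq> s" "\<tau>' = cm a s'" using cm_sub[OF a t'(1,3)] by blast
  then show ?thesis using t'(2) Sg_q[OF t'(2)] by (intro that[of s']) simp_all
qed

text \<open>The homeomorphism \<open>h\<close> induces an isomorphism between the face lattices of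
  two simplices, and by \<open>Pow_iso_image\<close> that is a bijection of colours.\<close>

lemma face_bijection:
  assumes w: "w \<in> T" "i <= d" "F = cm w ({..d} - {i})" and w': "w' \<in> T" "i' <= d" "F' = cm w' ({..d} - {i'})"
  shows "\<exists>\<beta>. bij_betw \<beta> ({..d} - {i}) ({..d} - {i'}) & (\<forall>s\<subseteq>{..d} - {i}. h ` cm w s = cm w' (\<beta> ` s))"
proof -
  let ?A = "{..d} - {i}" and ?B = "{..d} - {i'}"
  have Ad: "s \<subseteq> {..d}" if "s \<subseteq> ?A" for s by (rule subset_trans[OF that Diff_subset])
  have Bd: "s \<subseteq> {..d}" if "s \<subseteq> ?B" for s by (rule subset_trans[OF that Diff_subset])
  have FA: "cm w s \<subseteq> F" if "s \<subseteq> ?A" for s using cm_mono[OF w(1) Ad[OF that], of ?A] that w(3) by auto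
  have FB: "cm w' s \<subseteq> F'" if "s \<subseteq> ?B" for s using cm_mono[OF w'(1) Bd[OF that], of ?B] that w'(3) by auto
  have "\<exists>r. r \<subseteq> ?B & h ` cm w s = cm w' r" if s: "s \<subseteq> ?A" for s
  proof (cases "s = {}")
    case True
    then show ?thesis using cm_empty[OF w(1)] cm_empty[OF w'(1)] by blast
  next
    case False
    have "h ` cm w s \<in> cells K & h ` cm w s \<subseteq> F'" by (rule h_cell[OF cm_cell[OF w(1) Ad[OF s] False] FA[OF s]])
    then show ?thesis using cm_sub[OF w'(1), of ?B "h ` cm w s"] w'(3) cell_in_face by blast
  qed
  then obtain \<phi> where \<phi>: "!!s. s \<subseteq> ?A ==> \<phi> s \<subseteq> ?B & h ` cm w s = cm w' (\<phi> s)" by metis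
  have mono: "\<phi> s \<subseteq> \<phi> t \<longleftrightarrow> s \<subseteq> t" if s: "s \<subseteq> ?A" and t: "t \<subseteq> ?A" for s t
  proof -
    have "\<phi> s \<subseteq> \<phi> t \<longleftrightarrow> h ` cm w s \<subseteq> h ` cm w t"
      using cm_mono[OF w'(1), of "\<phi> s" "\<phi> t"] \<phi>[OF s] \<phi>[OF t] Bd by auto
    also have "\<dots> \<longleftrightarrow> cm w s \<subseteq> cm w t" by (rule inj_on_image_subset_iff[OF h_inj FA[OF s] FA[OF t]])
    also have "\<dots> \<longleftrightarrow> s \<subseteq> t" by (rule cm_mono[OF w(1) Ad[OF s] Ad[OF t]])
    finally show ?thesis .
  qed
  have "bij_betw \<phi> (Pow ?A) (Pow ?B)"
    unfolding bij_betw_def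
  proof
    show "inj_on \<phi> (Pow ?A)"
    proof (rule inj_onI)
      fix s t assume "s \<in> Pow ?A" "t \<in> Pow ?A" "\<phi> s = \<phi> t"
      then show "s = t" using mono[of s t] mono[of t s] by auto
    qed
    show "\<phi> ` Pow ?A = Pow ?B"
    proof
      show "\<phi> ` Pow ?A \<subseteq> Pow ?B" using \<phi> by blast
      show "Pow ?B \<subseteq> \<phi> ` Pow ?A"
      proof
        fix r assume "r \<in> Pow ?B"
        then have r: "r \<subseteq> ?B" by simp
        have "\<exists>s\<subseteq>?A. h ` cm w s = cm w' r"
        proof (cases "r = {}")
          case True
          then show ?thesis using cm_empty[OF w(1)] cm_empty[OF w'(1)] by blast
        next
          case False
          obtain \<rho> where \<rho>: "\<rho> \<in> cells K" "\<rho> \<subseteq> F" "cm w' r = h ` \<rho>"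
            using h_cell_surj[OF cm_cell[OF w'(1) Bd[OF r] False] FB[OF r]] by blast
          obtain s where "s \<subseteq> ?A" "\<rho> = cm w s" using cm_sub[OF w(1), of ?A \<rho>] w(3) \<rho> cell_in_face by blast
          then show ?thesis using \<rho>(3) by auto
        qed
        then obtain s where s: "s \<subseteq> ?A" "h ` cm w s = cm w' r" by blast
        have "cm w' (\<phi> s) = cm w' r" using \<phi>[OF s(1)] s(2) by simp
        then have "\<phi> s = r" using cm_inj[OF w'(1), of "\<phi> s" r] \<phi>[OF s(1)] Bd r by blast
        then show "r \<in> \<phi> ` Pow ?A" using s(1) by blast
      qed
    qed
  qed
  then have "\<exists>\<beta>. bij_betw \<beta> ?A ?B & (\<forall>s\<subseteq>?A. \<phi> s = \<beta> ` s)" using mono by (rule Pow_iso_image)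
  then obtain \<beta> where \<beta>: "bij_betw \<beta> ?A ?B" "\<forall>s\<subseteq>?A. \<phi> s = \<beta> ` s" by (elim exE conjE)
  have "\<forall>s\<subseteq>?A. h ` cm w s = cm w' (\<beta> ` s)" using \<phi> \<beta>(2) by simp
  then show ?thesis using \<beta>(1) by blast
qed

definition E' :: "flag => flag => (flag \<times> flag) set" where "E' x y = E \<union> (Gl d x y \<union> Gl d y x)"

text \<open>If \<open>\<beta>\<close> sends entry n of \<open>x\<close> to entry \<open>tt n\<close>
  of \<open>y\<close>, the pairs of \<open>Gl\<close> generate the same identifications of faces as
  \<open>h\<close>. Nothing is assumed about the signs of the flags, so \<open>step_exists\<close>
  can also use the lemma for the wrong orientation and refute it.\<close>

lemma face_model_glued:
  assumes x: "x \<in> H" "fst x = w" "snd x 0 = i" and y: "y \<in> H" "fst y = w'" "snd y 0 = i'"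
    and Fw: "F = cm w ({..d} - {i})" and \<beta>: "!!s. s \<subseteq> {..d} - {i} ==> h ` cm w s = cm w' (\<beta> ` s)"
    and bt: "!!n. n \<in> {1..d} ==> \<beta> (snd x n) = snd y (tt n)" and ne: "w ~= w'"
  shows "face_model d T K' (E' x y) (%a s. q ` cm a s)"
proof -
  let ?A = "{..d} - {i}"
  have A: "snd x ` {1..d} = ?A" using perm_props(6)[OF x(1)] x(3) by simp
  have wT: "w \<in> T" "w' \<in> T" using perm_props(1)[OF x(1)] perm_props(1)[OF y(1)] x(2) y(2) by simp_all
  have bi: "\<beta> ` snd x ` J = snd y ` tt ` J" if "J \<subseteq> {1..d}" for J
    unfolding image_image by (rule image_cong) (use bt that in auto)
  have tt2: "tt ` tt ` J = J" for J by (simp add: image_image)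
  have xr: "snd x ` J \<subseteq> ?A" if "J \<subseteq> {1..d}" for J using image_mono[OF that, of "snd x"] A by simp
  have x0: "snd x ` J \<subseteq> {..d}" "snd y ` J \<subseteq> {..d}" if "J \<subseteq> {1..d}" for J
  proof -
    have "J \<subseteq> {..d}" using that by auto
    then show "snd x ` J \<subseteq> {..d}" "snd y ` J \<subseteq> {..d}"
      using perm_props(4)[OF x(1)] perm_props(4)[OF y(1)] by simp_all
  qed
  have xy: "((w, t), (w', \<beta> ` t)) \<in> facerel d (Gl d x y)" "((w', \<beta> ` t), (w, t)) \<in> facerel d (Gl d y x)"
    if t: "t \<subseteq> ?A" for t
  proof -
    obtain J where J: "J \<subseteq> {1..d}" "t = snd x ` J" using t unfolding A[symmetric] by (rule subset_imageE)
    show "((w, t), (w', \<beta> ` t)) \<in> facerel d (Gl d x y)"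
      using facerelI[OF Gl_in[of x y d] J(1)] J(2) bi[OF J(1)] x(2) y(2) by (simp add: image_comp)
    have "((fst y, snd y ` tt ` J), (fst x, (snd x \<circ> tt) ` tt ` J)) \<in> facerel d (Gl d y x)"
      by (rule facerelI[OF Gl_in[of y x d] tt_image(2)[OF J(1)]])
    note rel = this
    have e: "(snd x \<circ> tt) ` tt ` J = t" unfolding image_comp[symmetric] tt2 J(2) ..
    show "((w', \<beta> ` t), (w, t)) \<in> facerel d (Gl d y x)"
      using rel unfolding e bi[OF J(1), symmetric] J(2)[symmetric] x(2) y(2) .
  qed
  have qb: "q ` cm w' (\<beta> ` t) = q ` cm w t" if "t \<subseteq> ?A" for t
  proof -
    have "cm w t \<subseteq> F" using cm_mono[OF wT(1), of t ?A] that Fw by auto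
    from q_h_image[OF this] show ?thesis using \<beta>[OF that] by simp
  qed
  have gx: "\<exists>t\<subseteq>?A. z = (w, t) & z' = (w', \<beta> ` t)" if zz: "(z, z') \<in> facerel d (Gl d x y)" for z z'
  proof -
    obtain u v J where uv: "(u, v) \<in> Gl d x y" "J \<subseteq> {1..d}" "z = (fst u, snd u ` J)" "z' = (fst v, (snd v \<circ> tt) ` J)"
      using zz by (rule facerelE)
    obtain s where s: "s permutes {1..d}" "u = (fst x, snd x \<circ> s)" "v = (fst y, snd y \<circ> (tt \<circ> s \<circ> tt))"
      using uv(1) by (rule GlE)
    have sJ: "s ` J \<subseteq> {1..d}" using image_mono[OF uv(2), of s] permutes_image[OF s(1)] by simp
    have "snd u ` J = snd x ` s ` J" unfolding s(2) by (simp add: image_comp)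
    moreover have "(snd v \<circ> tt) ` J = snd y ` tt ` s ` J" unfolding s(3) by (simp add: image_comp comp_assoc)
    then have "(snd v \<circ> tt) ` J = \<beta> ` snd x ` s ` J" using bi[OF sJ] by simp
    ultimately show ?thesis using uv(3,4) s(2,3) x(2) y(2) xr[OF sJ] by auto
  qed
  have gy: "\<exists>t\<subseteq>?A. z' = (w, t) & z = (w', \<beta> ` t)" if zz: "(z, z') \<in> facerel d (Gl d y x)" for z z'
  proof -
    obtain u v J where uv: "(u, v) \<in> Gl d y x" "J \<subseteq> {1..d}" "z = (fst u, snd u ` J)" "z' = (fst v, (snd v \<circ> tt) ` J)"
      using zz by (rule facerelE)
    obtain s where s: "s permutes {1..d}" "u = (fst y, snd y \<circ> s)" "v = (fst x, snd x \<circ> (tt \<circ> s \<circ> tt))"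
      using uv(1) by (rule GlE)
    have sJ: "s ` J \<subseteq> {1..d}" using image_mono[OF uv(2), of s] permutes_image[OF s(1)] by simp
    have sJ': "tt ` s ` J \<subseteq> {1..d}" by (rule tt_image(2)[OF sJ])
    have "snd u ` J = snd y ` s ` J" unfolding s(2) by (simp add: image_comp)
    then have "snd u ` J = \<beta> ` snd x ` tt ` s ` J" using bi[OF sJ'] unfolding tt2 by simp
    moreover have "(snd v \<circ> tt) ` J = snd x ` tt ` s ` J" unfolding s(3) by (simp add: image_comp comp_assoc)
    ultimately show ?thesis using uv(3,4) s(2,3) x(2) y(2) xr[OF sJ'] by auto
  qed
  have bd: "\<beta> ` t \<subseteq> {..d}" if tA: "t \<subseteq> ?A" for t
  proof -
    obtain J where J: "J \<subseteq> {1..d}" "t = snd x ` J" using tA unfolding A[symmetric] by (rule subset_imageE)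
    show ?thesis unfolding J(2) bi[OF J(1)] by (rule x0(2)[OF tt_image(2)[OF J(1)]])
  qed
  have fr: "facerel d (E' x y) = facerel d E \<union> facerel d (Gl d x y) \<union> facerel d (Gl d y x)"
    unfolding E'_def facerel_Un by (simp only: Un_assoc)
  have bk: "q ` cm a s = q ` cm (fst z) (snd z) & fst z \<in> T & snd z \<subseteq> {..d}"
    if a: "a \<in> T" "s \<subseteq> {..d}" and "((a, s), z) \<in> (facerel d (E' x y))\<^sup>*" for a s z
    using that(3)
  proof (induction rule: rtrancl_induct)
    case base
    show ?case using a by simp
  next
    case (step z z')
    consider "(z, z') \<in> facerel d E" | "(z, z') \<in> facerel d (Gl d x y)" | "(z, z') \<in> facerel d (Gl d y x)"
      using step.hyps(2) unfolding fr by blast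
    then show ?case
    proof cases
      case 1
      obtain u v J where uv: "(u, v) \<in> E" "J \<subseteq> {1..d}" "z = (fst u, snd u ` J)" "z' = (fst v, (snd v \<circ> tt) ` J)"
        using 1 by (rule facerelE)
      have "cm (fst z) (snd z) = cm (fst z') (snd z')"
        using E_face[OF uv(1,2)] uv(3,4) by (simp add: image_comp)
      moreover have tJ: "tt ` J \<subseteq> {..d}" using tt_image(2)[OF uv(2)] by auto
      then have "fst v \<in> T" "snd v ` tt ` J \<subseteq> {..d}"
        using perm_props(1)[OF E_in(2)[OF uv(1)]] perm_props(4)[OF E_in(2)[OF uv(1)] tJ] by simp_all
      ultimately show ?thesis using step.IH uv(4) by (simp add: image_comp)
    next
      case 2
      obtain t where t: "t \<subseteq> ?A" "z = (w, t)" "z' = (w', \<beta> ` t)" using gx[OF 2] by blast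
      then show ?thesis using step.IH qb[OF t(1)] bd[OF t(1)] wT by simp
    next
      case 3
      obtain t where t: "t \<subseteq> ?A" "z' = (w, t)" "z = (w', \<beta> ` t)" using gy[OF 3] by blast
      moreover have "t \<subseteq> {..d}" using t(1) by blast
      ultimately show ?thesis using step.IH qb[OF t(1)] wT by simp
    qed
  qed
  have Sgs: "\<exists>b\<in>T. \<exists>r\<subseteq>{..d}. \<tau> = cm b r & ((a, s), (b, r)) \<in> (facerel d (E' x y))\<^sup>*"
    if a: "a \<in> T" "s \<subseteq> {..d}" and "(cm a s, \<tau>) \<in> Sg\<^sup>*" for a s \<tau>
    using that(3)
  proof (induction rule: rtrancl_induct)
    case base
    show ?case using a by blast
  next
    case (step \<tau> \<tau>')
    obtain b r where b: "b \<in> T" "r \<subseteq> {..d}" "\<tau> = cm b r" "((a, s), (b, r)) \<in> (facerel d (E' x y))\<^sup>*"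
      using step.IH by blast
    have E1: "((b1, r1), (b2, r2)) \<in> (facerel d (E' x y))\<^sup>*"
      if "b1 \<in> T" "b2 \<in> T" "r1 \<subseteq> {..d}" "r2 \<subseteq> {..d}" "cm b1 r1 = cm b2 r2" for b1 r1 b2 r2
    proof -
      have "((b1, r1), (b2, r2)) \<in> (facerel d E)\<^sup>*" using cm_eq[OF that(1-4)] that(5) by blast
      moreover have "(facerel d E)\<^sup>* \<subseteq> (facerel d (E' x y))\<^sup>*" by (rule rtrancl_mono) (use fr in blast)
      ultimately show ?thesis by blast
    qed
    have At: "\<exists>t\<subseteq>?A. \<rho> = cm w t" if "\<rho> \<in> cells K" "\<rho> \<subseteq> F" for \<rho>
      using cm_sub[OF wT(1), of ?A \<rho>] cell_in_face[OF that(1)] that(2) Fw by blast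
    from step.hyps(2) show ?case
    proof (cases rule: SgE)
      case 1
      obtain t where t: "t \<subseteq> ?A" "\<tau> = cm w t" using At[OF 1(1,2)] by blast
      have td: "t \<subseteq> {..d}" using t(1) by blast
      have "((b, r), (w, t)) \<in> (facerel d (E' x y))\<^sup>*" by (rule E1[OF b(1) wT(1) b(2) td]) (use b(3) t(2) in simp)
      moreover have "((w, t), (w', \<beta> ` t)) \<in> facerel d (E' x y)" using xy(1)[OF t(1)] fr by blast
      ultimately have "((a, s), (w', \<beta> ` t)) \<in> (facerel d (E' x y))\<^sup>*"
        using rtrancl_into_rtrancl rtrancl_trans b(4) by metis
      moreover have "\<tau>' = cm w' (\<beta> ` t)" using 1(3) t(2) \<beta>[OF t(1)] by simp
      ultimately show ?thesis using wT(2) bd[OF t(1)] by blast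
    next
      case 2
      obtain t where t: "t \<subseteq> ?A" "\<tau>' = cm w t" using At[OF 2(1,2)] by blast
      have td: "t \<subseteq> {..d}" using t(1) by blast
      have "cm b r = cm w' (\<beta> ` t)" using 2(3) b(3) t(2) \<beta>[OF t(1)] by simp
      then have "((b, r), (w', \<beta> ` t)) \<in> (facerel d (E' x y))\<^sup>*" by (rule E1[OF b(1) wT(2) b(2) bd[OF t(1)]])
      moreover have "((w', \<beta> ` t), (w, t)) \<in> facerel d (E' x y)" using xy(2)[OF t(1)] fr by blast
      ultimately have "((a, s), (w, t)) \<in> (facerel d (E' x y))\<^sup>*"
        using rtrancl_into_rtrancl rtrancl_trans b(4) by metis
      then show ?thesis using wT(1) td t(2) by blast
    qed
  qed
  have mono': "q ` cm a s \<subseteq> q ` cm a s' \<longleftrightarrow> s \<subseteq> s'" if a: "a \<in> T" "s \<subseteq> {..d}" "s' \<subseteq> {..d}" for a s s'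
  proof
    assume "q ` cm a s \<subseteq> q ` cm a s'"
    then obtain t where t: "t \<subseteq> s'" "q ` cm a s = q ` cm a t" using q_cm_sub[OF a(1,3) cm_face[OF a(1,2)]] by metis
    then have "s = t" using q_cm_inj[OF a(1,2)] a(3) by blast
    then show "s \<subseteq> s'" using t(1) by simp
  next
    assume "s \<subseteq> s'"
    then show "q ` cm a s \<subseteq> q ` cm a s'" using cm_mono[OF a] by (intro image_mono) blast
  qed
  have eq': "q ` cm a s = q ` cm b r \<longleftrightarrow> ((a, s), (b, r)) \<in> (facerel d (E' x y))\<^sup>*"
    if a: "a \<in> T" "b \<in> T" "s \<subseteq> {..d}" "r \<subseteq> {..d}" for a s b r
  proof
    assume eq: "q ` cm a s = q ` cm b r"
    then obtain t where t: "t \<subseteq> r" "(cm a s, cm b t) \<in> Sg\<^sup>*" "q ` cm a s = q ` cm b t"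
      using q_cm_sub[OF a(2,4) cm_face[OF a(1,3)]] by (metis order_refl)
    then have "t = r" using q_cm_inj[OF a(2)] a(4) eq by (metis subset_trans)
    then obtain b' r' where b': "b' \<in> T" "r' \<subseteq> {..d}" "cm b r = cm b' r'" "((a, s), (b', r')) \<in> (facerel d (E' x y))\<^sup>*"
      using Sgs[OF a(1,3) t(2)] by blast
    have "((b', r'), (b, r)) \<in> (facerel d E)\<^sup>*" using cm_eq[OF b'(1) a(2) b'(2) a(4)] b'(3) by simp
    moreover have "(facerel d E)\<^sup>* \<subseteq> (facerel d (E' x y))\<^sup>*" by (rule rtrancl_mono) (use fr in blast)
    ultimately show "((a, s), (b, r)) \<in> (facerel d (E' x y))\<^sup>*" using rtrancl_trans[OF b'(4)] by blast
  next
    assume "((a, s), (b, r)) \<in> (facerel d (E' x y))\<^sup>*"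
    from bk[OF a(1,3) this] show "q ` cm a s = q ` cm b r" by simp
  qed
  have m: "model d T K' (E' x y) (%a s. q ` cm a s)"
    unfolding model_def
  proof (intro conjI ballI allI impI)
    show "face_poset K' = {q ` cm w s |w s. w \<in> T & s \<subseteq> {..d}}" unfolding face_K' face_poset_eq by blast
    fix a s \<tau> assume a: "a \<in> T" "s \<subseteq> {..d}" "\<tau> \<in> face_poset K'" "\<tau> \<subseteq> q ` cm a s"
    then obtain \<rho> where "\<rho> \<in> face_poset K" "\<tau> = q ` \<rho>" unfolding face_K' by blast
    then show "\<exists>s'\<subseteq>s. \<tau> = q ` cm a s'" using q_cm_sub[OF a(1,2), of \<rho>] a(4) by metis
  qed (rule mono' eq'; assumption)+
  have Gf: "fst u = w & fst v = w'" if "(u, v) \<in> Gl d x y" for u v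
    using that by (rule GlE) (simp add: x(2) y(2))
  have cv: "Gl d y x = (Gl d x y)\<inverse>" by (rule Gl_converse[OF d2])
  show ?thesis
  proof
    show "model d T K' (E' x y) (%a s. q ` cm a s)" by (rule m)
    show "simplicial_cw K'" by (rule simp_K')
    show "E' x y \<subseteq> H \<times> H" unfolding E'_def using E_sub Gl_sub_H[OF x(1) y(1)] Gl_sub_H[OF y(1) x(1)] by (intro Un_least)
    show "sym (E' x y)" unfolding E'_def cv by (intro sym_Un E_sym sym_Un_converse)
    show "fst u ~= fst v" if uvE: "(u, v) \<in> E' x y" for u v
    proof -
      consider "(u, v) \<in> E" | "(u, v) \<in> Gl d x y" | "(v, u) \<in> Gl d x y" using uvE unfolding E'_def cv by blast
      then show ?thesis by cases (use E_fst Gf ne in auto)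
    qed
  qed
qed

end

context tree_flags
begin

lemma Ed_tail:
  assumes "(u, v) \<in> Ed m" "s permutes {1..d}"
  shows "((fst u, snd u \<circ> s), (fst v, snd v \<circ> (tt \<circ> s \<circ> tt))) \<in> Ed m"
proof -
  obtain p where p: "u = (butlast m, p)" "v = (m, p \<circ> tt)" "p permutes {..d}" "p 0 = last m"
    using assms(1) unfolding Ed_def by auto
  have "p \<circ> tt \<circ> (tt \<circ> s \<circ> tt) = (p \<circ> s) \<circ> tt" by (auto simp: fun_eq_iff)
  moreover have "p \<circ> s permutes {..d}" by (rule permutes_compose[OF sub_permutes[OF assms(2)] p(3)])
  moreover have "(p \<circ> s) 0 = last m" using permutes_0[OF assms(2)] p(4) by simp
  ultimately show ?thesis unfolding Ed_def p(1,2) fst_conv snd_conv by blast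
qed

lemma tt_conj_conj: "tt \<circ> (tt \<circ> s \<circ> tt) \<circ> tt = s" by (auto simp: fun_eq_iff)

lemma EM_tail:
  assumes "(u, v) \<in> EM ms" and s: "s permutes {1..d}"
  shows "((fst u, snd u \<circ> s), (fst v, snd v \<circ> (tt \<circ> s \<circ> tt))) \<in> EM ms"
proof -
  consider m where "m \<in> T - {[]}" "(u, v) \<in> Ed m" | m where "m \<in> T - {[]}" "(v, u) \<in> Ed m"
    | x y where "(x, y) \<in> symcl ms" "(u, v) \<in> Gl d x y"
    using assms(1) unfolding EM_def ET_def E0_def by blast
  then show ?thesis
  proof cases
    case 1
    from Ed_tail[OF 1(2) s] show ?thesis using 1(1) unfolding EM_def ET_def E0_def by blast
  next
    case 2
    from Ed_tail[OF 2(2) tt_conj_permutes[OF d2 s]]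
    have "((fst v, snd v \<circ> (tt \<circ> s \<circ> tt)), (fst u, snd u \<circ> s)) \<in> Ed m" unfolding tt_conj_conj .
    then show ?thesis using 2(1) unfolding EM_def ET_def E0_def by blast
  next
    case 3
    obtain r where r: "r permutes {1..d}" "u = (fst x, snd x \<circ> r)" "v = (fst y, snd y \<circ> (tt \<circ> r \<circ> tt))"
      using 3(2) by (rule GlE)
    have "r \<circ> s permutes {1..d}" by (rule permutes_compose[OF s r(1)])
    moreover have "snd v \<circ> (tt \<circ> s \<circ> tt) = snd y \<circ> (tt \<circ> (r \<circ> s) \<circ> tt)" unfolding r(3) by (auto simp: fun_eq_iff)
    moreover have "snd u \<circ> s = snd x \<circ> (r \<circ> s)" unfolding r(2) by (simp add: comp_assoc)
    ultimately have "((fst u, snd u \<circ> s), (fst v, snd v \<circ> (tt \<circ> s \<circ> tt))) \<in> Gl d x y"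
      unfolding Gl_def using r(2,3) by auto
    then show ?thesis using 3(1) unfolding EM_def by blast
  qed
qed

lemma EM_fst:
  assumes g: "good ms" and "(u, v) \<in> EM ms" shows "fst u ~= fst v"
proof -
  consider m where "m \<in> T - {[]}" "(u, v) \<in> Ed m \<or> (v, u) \<in> Ed m"
    | x y where "(x, y) \<in> symcl ms" "(u, v) \<in> Gl d x y"
    using assms(2) unfolding EM_def ET_def E0_def by blast
  then show ?thesis
  proof cases
    case 1
    then have "length (butlast m) ~= length m" by (cases m) auto
    then have "butlast m ~= m" by metis
    then show ?thesis using 1(2) by (auto simp: Ed_def)
  next
    case 2
    have "fst x ~= fst y" using good_invariants(4)[OF g 2(1)] by blast
    then show ?thesis using 2(2) by (elim GlE) simp
  qed
qed

lemma face_model_closedI: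
  assumes g: "good ms" and m: "model d T K (EM ms) cm" and K: "simplicial_cw K"
  shows "face_model_closed d T K (EM ms) cm"
proof
  note inv = good_invariants[OF g]
  show "model d T K (EM ms) cm" "simplicial_cw K" "matching H (EM ms)" by (rule m K inv(1))+
  show "EM ms \<subseteq> H \<times> H" "sym (EM ms)" using inv(1) by (simp_all add: matching_def)
  show "fst u ~= fst v" if "(u, v) \<in> EM ms" for u v by (rule EM_fst[OF g that])
  show "((fst u, snd u \<circ> s), (fst v, snd v \<circ> (tt \<circ> s \<circ> tt))) \<in> EM ms" if "(u, v) \<in> EM ms" "s permutes {1..d}" for u v s
    by (rule EM_tail[OF that])
  show "gs u = gs v" if "(u, v) \<in> EM ms" for u v by (rule inv(3)[OF that])
qed

lemma gs_cases: "gs x = 1 \<or> gs x = -1"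
  by (cases "snd x" rule: sign_cases) (auto simp: gs_def minus_one_power_iff)

text \<open>Any enumeration with the given tail will do; if its sign is wrong, composing with
  \<open>tt\<close> corrects it without touching entry 0 or the tail.\<close>

lemma flag_exists:
  assumes w: "w \<in> T" and i: "i <= d" and s: "s \<subseteq> {..d} - {i}" "card s = d - 2"
  obtains x where "x \<in> H" "fst x = w" "snd x 0 = i" "snd x ` {3..d} = s" "gs x = 1"
proof -
  have fins: "finite s" using s(1) finite_subset by blast
  have "\<exists>f. bij_betw f {3..d} s" by (rule finite_same_card_bij) (use fins s(2) in auto)
  then obtain f where f: "bij_betw f {3..d} s" by blast
  have "card ({..d} - {i} - s) = card ({..d} - {i}) - card s" by (rule card_Diff_subset[OF fins s(1)])
  then have "card ({..d} - {i} - s) = 2" using i s(2) d3 by simp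
  then have "\<exists>g. bij_betw g {1, 2::nat} ({..d} - {i} - s)" by (intro finite_same_card_bij) auto
  then obtain g where g: "bij_betw g {1, 2::nat} ({..d} - {i} - s)" by blast
  define p where "p n = (if n = 0 then i else if n \<in> {3..d} then f n else if n \<in> {1, 2} then g n else n)" for n
  have 1: "bij_betw p {0} {i}" by (simp add: bij_betw_def p_def)
  have 2: "bij_betw p {3..d} s" using f by (rule bij_betw_cong[THEN iffD1, rotated]) (simp add: p_def)
  have 3: "bij_betw p {1, 2} ({..d} - {i} - s)" using g by (rule bij_betw_cong[THEN iffD1, rotated]) (auto simp: p_def)
  have 4: "bij_betw p ({1, 2} \<union> {3..d}) (({..d} - {i} - s) \<union> s)" by (rule bij_betw_combine[OF 3 2]) blast
  have "bij_betw p ({0} \<union> ({1, 2} \<union> {3..d})) ({i} \<union> (({..d} - {i} - s) \<union> s))"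
    by (rule bij_betw_combine[OF 1 4]) (use s(1) in blast)
  moreover have "{0} \<union> ({1, 2} \<union> {3..d}) = {..d}" using d3 by auto
  moreover have "{i} \<union> (({..d} - {i} - s) \<union> s) = {..d}" using s(1) i by auto
  ultimately have "bij_betw p {..d} {..d}" by simp
  then have pp: "p permutes {..d}" by (rule bij_imp_permutes) (use d3 in \<open>auto simp: p_def\<close>)
  have p0: "p 0 = i" by (simp add: p_def)
  have pt: "p ` {3..d} = s" using 2 by (simp add: bij_betw_def)
  have pH: "(w, p) \<in> H" using w pp by (simp add: H_def)
  show ?thesis
  proof (cases "gs (w, p) = 1")
    case True
    show ?thesis by (rule that[OF pH]) (simp_all add: p0 pt True)
  next
    case False
    then have g1: "gs (w, p) = -1" using gs_cases[of "(w, p)"] by blast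
    have pH': "(w, p \<circ> tt) \<in> H" using w permutes_compose[OF tt_permutes_d pp] by (simp add: H_def)
    have "(p \<circ> tt) ` {3..d} = p ` {3..d}" by (rule image_cong) simp_all
    moreover have "gs (w, p \<circ> tt) = 1" using g1 by (simp add: gs_def sign_mult[OF pp tt_permutes_d] sign_tt)
    ultimately show ?thesis by (intro that[OF pH']) (simp_all only: fst_conv snd_conv pt comp_apply tt_simps p0)
  qed
qed

end

context face_model_closed
begin

lemma in_link_boundary:
  assumes z: "z \<in> H" and G: "cm (fst z) (snd z ` {1..d}) \<in> boundary_faces d K"
  shows "cm (fst z) (snd z ` {1..d}) \<in> link_boundary d K (cm (fst z) (snd z ` {3..d}))"
proof -
  have s: "{1..d} \<subseteq> {..d}" "{3..d} \<subseteq> {..d}" "{3..d} \<subseteq> {1..d}" by auto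
  have "cm (fst z) (snd z ` {3..d}) \<subseteq> cm (fst z) (snd z ` {1..d})"
    by (rule iffD2[OF cm_mono[OF perm_props(1)[OF z] perm_props(4)[OF z s(2)] perm_props(4)[OF z s(1)]] image_mono[OF s(3)]])
  then show ?thesis using G flag_dims(1)[OF z]
    by (auto simp: link_boundary_def link_edges_def link_poset_def dim_cells_def)
qed

end

context gluing_step
begin

text \<open>A common face of codimension three provides the tail of \<open>x\<close>; transporting
  \<open>x\<close> to the facet of \<open>F'\<close> provides \<open>y\<close>; orientability
  decides how the two remaining vertices of the edges are matched.\<close>

lemma step_exists:
  assumes \<sigma>: "d - 3 <= k" "\<sigma> \<in> dim_cells K k" "\<sigma> \<subseteq> F \<inter> F'"
    and ori: "orientable_gluing d K'" and resp: "respects_boundary_components d K q"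
  shows "\<exists>x y. good_step E x y & model d T K' (E' x y) (%a s. q ` cm a s)"
proof -
  obtain w i where w: "w \<in> T" "i <= d" "F = cm w ({..d} - {i})" by (rule ridge_faceE[OF F_dim(1)])
  obtain w' i' where w': "w' \<in> T" "i' <= d" "F' = cm w' ({..d} - {i'})" by (rule ridge_faceE[OF F_dim(2)])
  obtain \<beta> where \<beta>: "bij_betw \<beta> ({..d} - {i}) ({..d} - {i'})" "!!s. s \<subseteq> {..d} - {i} ==> h ` cm w s = cm w' (\<beta> ` s)"
    using face_bijection[OF w w'] by (elim exE conjE) simp
  let ?A = "{..d} - {i}" and ?B = "{..d} - {i'}"
  have AB: "?A \<subseteq> {..d}" "?B \<subseteq> {..d}" by auto
  have qF: "q ` F = q ` F'" using q_h_image[OF order_refl] h_image by simp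
  \<comment> \<open>Otherwise two ridges of a single facet would get the same image, contrary to
    \<open>q_inj\<close>.\<close>
  have ne: "w ~= w'"
  proof
    assume e: "w = w'"
    then have "q ` cm w ?A = q ` cm w ?B" using qF w(3) w'(3) by simp
    then have "?A = ?B" by (rule q_cm_inj[OF w(1) AB])
    then show False using FF' w(3) w'(3) e by simp
  qed
  have sf: "\<sigma> \<in> face_poset K" using \<sigma>(2) by (simp add: dim_cells_def face_poset_def)
  have "\<sigma> \<subseteq> cm w ?A" using \<sigma>(3) w(3) by blast
  from cm_sub[OF w(1) AB(1) sf this] obtain s1 where s1: "s1 \<subseteq> ?A" "\<sigma> = cm w s1" by (elim exE conjE)
  have s1d: "s1 \<subseteq> {..d}" by (rule subset_trans[OF s1(1) AB(1)])
  have "card s1 = Suc k" using cm_dim[OF w(1) s1d] \<sigma>(2) s1(2) by simp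
  then have "d - 2 <= card s1" using \<sigma>(1) d3 by simp
  \<comment> \<open>A common face of larger dimension is cut down to one with d - 2 vertices, that
    is of codimension three.\<close>
  then obtain s0 where s0: "s0 \<subseteq> s1" "card s0 = d - 2" by (rule obtain_subset_with_card_n)
  have s0A: "s0 \<subseteq> ?A" by (rule subset_trans[OF s0(1) s1(1)])
  have s0d: "s0 \<subseteq> {..d}" by (rule subset_trans[OF s0A AB(1)])
  obtain x where x: "x \<in> H" "fst x = w" "snd x 0 = i" "snd x ` {3..d} = s0" "gs x = 1"
    by (rule flag_exists[OF w(1,2) s0A s0(2)])
  have "cm w s0 \<subseteq> cm w s1" using cm_mono[OF w(1) s0d s1d] s0(1) by simp
  then have "cm w s0 \<subseteq> cm w' ?B" using s1(2) \<sigma>(3) w'(3) by blast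
  from cm_sub[OF w'(1) AB(2) cm_face[OF w(1) s0d] this] obtain r0 where r0: "r0 \<subseteq> ?B" "cm w s0 = cm w' r0" by (elim exE conjE)
  have r0d: "r0 \<subseteq> {..d}" by (rule subset_trans[OF r0(1) AB(2)])
  have "((w, s0), (w', r0)) \<in> (facerel d E)\<^sup>*" using cm_eq[OF w(1) w'(1) s0d r0d] r0(2) by blast
  from transport[OF this x(1,2,4)] obtain y1 where y1: "(x, y1) \<in> conn E" "y1 \<in> H" "(fst y1, snd y1 ` {3..d}) = (w', r0)"
    by (elim exE conjE)
  have "i' ~: snd y1 ` {3..d}" using y1(3) r0(1) by auto
  then obtain y where y0: "(y1, y) \<in> conn E" "y \<in> H" "fst y = fst y1" "snd y 0 = i'" "snd y ` {3..d} = snd y1 ` {3..d}"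
    by (rule rotate_missing[OF y1(2) w'(2)]) blast
  have y: "y \<in> H" "fst y = w'" "snd y 0 = i'" "snd y ` {3..d} = r0" using y0 y1(3) by auto
  have xy: "(x, y) \<in> conn E" by (rule conn_trans[OF y1(1) y0(1)])
  have gsE: "gs u = gs v" if "(u, v) \<in> conn E" for u v by (rule conn_gs[OF that E_gs])
  have gy: "gs y = 1" using gsE[OF xy] x(5) by simp
  have xA: "snd x ` {1..d} = ?A" "snd y ` {1..d} = ?B" using perm_props(6)[OF x(1)] perm_props(6)[OF y(1)] x(3) y(3) by simp_all
  have xn: "snd x n \<in> ?A" if "n \<in> {1..d}" for n using xA(1) that by blast
  have bn: "\<beta> (snd x n) \<in> ?B" if "n \<in> {1..d}" for n using bij_betwE[OF \<beta>(1)] xn[OF that] by blast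
  have b3: "\<beta> (snd x n) = snd y n" if n: "n \<in> {3..d}" for n
  proof -
    have n1: "n \<in> {1..d}" using n by auto
    have xs: "{snd x n} \<subseteq> ?A" using xn[OF n1] by simp
    have "cm w {snd x n} \<subseteq> F" using cm_mono[OF w(1) subset_trans[OF xs AB(1)] AB(1)] xs w(3) by blast
    from q_h_image[OF this] have 1: "q ` cm w' {\<beta> (snd x n)} = q ` cm w {snd x n}" using \<beta>(2)[OF xs] by simp
    have "cm w {snd x n} = cm w' {snd y n}" using conn_face[OF xy x(1), of "{n}"] n x(2) y(2) by simp
    with 1 have "q ` cm w' {\<beta> (snd x n)} = q ` cm w' {snd y n}" by simp
    moreover have "{\<beta> (snd x n)} \<subseteq> {..d}" using bn[OF n1] by auto
    moreover have "{snd y n} \<subseteq> {..d}" using perm_props(4)[OF y(1), of "{n}"] n by simp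
    ultimately have "{\<beta> (snd x n)} = {snd y n}" by (intro q_cm_inj[OF w'(1)])
    then show ?thesis by simp
  qed
  have b_inj: "m = n" if mn: "m \<in> {1..d}" "n \<in> {1..d}" "\<beta> (snd x m) = \<beta> (snd x n)" for m n
  proof -
    have "snd x m = snd x n" by (rule inj_onD[OF bij_betw_imp_inj_on[OF \<beta>(1)] mn(3) xn[OF mn(1)] xn[OF mn(2)]])
    then show ?thesis by (rule injD[OF perm_props(3)[OF x(1)]])
  qed
  have b12: "\<beta> (snd x j) = snd y 1 \<or> \<beta> (snd x j) = snd y 2" if j: "j \<in> {1, 2}" for j
  proof -
    have j1: "j \<in> {1..d}" "j ~: {3..d}" using j d3 by auto
    have "\<beta> (snd x j) \<in> snd y ` {1..d}" using bn[OF j1(1)] unfolding xA(2) .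
    then obtain m where m: "m \<in> {1..d}" "\<beta> (snd x j) = snd y m" by blast
    have "m ~: {3..d}"
    proof
      assume m3: "m \<in> {3..d}"
      then have "j = m" using b_inj[OF j1(1) m(1)] m(2) b3[OF m3] by simp
      then show False using m3 j1(2) by simp
    qed
    then have "m = 1 \<or> m = 2" using m(1) by auto
    then show ?thesis using m(2) by blast
  qed
  have n12: "1 \<in> {1..d}" "2 \<in> {1..d}" using d3 by auto
  have nb: "\<beta> (snd x 1) ~= \<beta> (snd x 2)" using b_inj[OF n12] by auto
  have split: "n = 1 \<or> n = 2 \<or> n \<in> {3..d}" if "n \<in> {1..d}" for n using that by auto
  \<comment> \<open>If the ends of the edges were matched without crossing, the gluing would be
    described by the mirror image \<open>y2\<close> of \<open>y\<close>. Then \<open>y\<close> and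
    \<open>y2\<close> would be connected in the new complex, which an orientable link
    forbids.\<close>
  have crossed: "\<beta> (snd x 1) = snd y 2 & \<beta> (snd x 2) = snd y 1"
  proof (rule ccontr)
    assume "\<not> ?thesis"
    then have c: "\<beta> (snd x 1) = snd y 1" "\<beta> (snd x 2) = snd y 2" using b12[of 1] b12[of 2] nb by auto
    define y2 where "y2 = (w', snd y \<circ> tt)"
    have y2: "y2 \<in> H" "fst y2 = w'" "snd y2 0 = i'"
      using y(1,3) permutes_compose[OF tt_permutes_d perm_props(2)[OF y(1)]] w'(1) by (simp_all add: y2_def H_def)
    have bt: "\<beta> (snd x n) = snd y2 (tt n)" if "n \<in> {1..d}" for n
      using split[OF that] c b3[of n] by (auto simp: y2_def)
    interpret fm: face_model d T K' "E' x y2" "%a s. q ` cm a s"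
      by (rule face_model_glued[OF x(1-3) y2 w(3) \<beta>(2) bt ne])
    have s3: "{3..d} \<subseteq> {..d}" by auto
    have "card (snd y ` {3..d}) = Suc (d - 3)" unfolding perm_props(5)[OF y(1)] using d3 by simp
    then have "q ` cm (fst y) (snd y ` {3..d}) \<in> dim_cells K' (d - 3)"
      using fm.cm_dim[OF perm_props(1)[OF y(1)] perm_props(4)[OF y(1) s3], of "d - 3"] by blast
    then have "orientable_link d K' (q ` cm (fst y) (snd y ` {3..d}))" using ori by (simp add: orientable_gluing_def)
    then have no: "(y, (fst y, snd y \<circ> tt)) ~: conn (E' x y2)" by (rule fm.orientable_no_mirror[OF y(1)])
    have EE: "E \<subseteq> E' x y2" unfolding E'_def by blast
    have "(y, x) \<in> conn (E' x y2)" using conn_sym[OF E_sym xy] conn_mono[OF EE] by blast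
    moreover have "(x, y2) \<in> E' x y2" unfolding E'_def using Gl_in by blast
    ultimately have "(y, y2) \<in> conn (E' x y2)" using conn_trans conn_edge by metis
    then show False using no y(2) by (simp add: y2_def)
  qed
  have bt: "\<beta> (snd x n) = snd y (tt n)" if "n \<in> {1..d}" for n
    using split[OF that] crossed b3[of n] by auto
  interpret fm: face_model d T K' "E' x y" "%a s. q ` cm a s"
    by (rule face_model_glued[OF x(1-3) y(1-3) w(3) \<beta>(2) bt ne])
  have faces: "face x = (w, i)" "face y = (w', i')" using x(2,3) y(2,3) by (simp_all add: face_def)
  have GlH: "Gl d x y \<subseteq> H \<times> H" "Gl d y x \<subseteq> H \<times> H" using Gl_sub_H x(1) y(1) by blast+
  have cv: "Gl d y x = (Gl d x y)\<inverse>" by (rule Gl_converse[OF d2])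
  have free: "face x ~: face ` Domain E" "face y ~: face ` Domain E"
    using boundary_free[OF F w(3)] boundary_free[OF F' w'(3)] faces by (metis imageE)+
  \<comment> \<open>The condition on boundary components is applied in the link of the tail of
    \<open>u\<close>, thus in every link where both edges occur and not merely in that of
    \<open>x\<close>.\<close>
  have same: "same_cycle E u v" if uv: "(u, v) \<in> Gl d x y" "(u, v) \<in> conn E" for u v
  proof -
    have uH: "u \<in> H" and vH: "v \<in> H" using GlH(1) uv(1) by auto
    have fu: "face u = (w, i)" and fv: "face v = (w', i')" using Gl_face[OF uv(1)] faces by simp_all
    have uF: "cm (fst u) (snd u ` {1..d}) = F" "cm (fst v) (snd v ` {1..d}) = F'"
      using fu fv w(3) w'(3) perm_props(6)[OF uH] perm_props(6)[OF vH] by (auto simp: face_def)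
    define \<tau> where "\<tau> = cm (fst u) (snd u ` {3..d})"
    have tv: "\<tau> = cm (fst v) (snd v ` {3..d})" using conn_face[OF uv(2) uH order_refl] by (simp add: \<tau>_def)
    have "\<tau> \<in> dim_cells K (d - 3)" unfolding \<tau>_def by (rule flag_dims(3)[OF uH])
    moreover have "F \<in> link_boundary d K \<tau>" using in_link_boundary[OF uH] F uF(1) by (simp add: \<tau>_def)
    moreover have "F' \<in> link_boundary d K \<tau>" using in_link_boundary[OF vH] F' uF(2) by (simp add: tv)
    moreover have "link_identified K q \<tau> F F'" using FF' qF by (simp add: link_identified_def)
    ultimately have "same_boundary_component d K \<tau> F F'" using resp unfolding respects_boundary_components_def by blast
    then have "same_boundary_component d K (cm (fst u) (snd u ` {3..d})) (cm (fst u) (snd u ` {1..d})) F'"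
      unfolding uF(1) \<tau>_def .
    then show ?thesis
      by (rule same_cycle_of_component[OF uH boundary_free[OF F w(3) fu] uv(2) _ F' uF(2)[symmetric]])
  qed
  \<comment> \<open>In the new complex \<open>u\<close> and \<open>v\<close> are connected. A
    connected flag on the same ridge as one of them has the same sign, so
    \<open>conn_same_face\<close> of the new model identifies it with that one.\<close>
  have indep: "a = u \<or> a = v" if uv: "(u, v) \<in> Gl d x y \<union> Gl d y x" and ab: "(a, b) \<in> Gl d x y \<union> Gl d y x"
    and c: "(u, a) \<in> conn E" for u v a b
  proof -
    have H4: "u \<in> H" "v \<in> H" "a \<in> H" using GlH uv ab by auto
    have EE: "E \<subseteq> E' x y" unfolding E'_def by blast
    have uvE: "(u, v) \<in> E' x y" unfolding E'_def using uv by blast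
    have ua: "(u, a) \<in> conn (E' x y)" using conn_mono[OF EE] c by blast
    have gua: "gs u = gs a" by (rule gsE[OF c])
    have guv: "gs u = gs v"
    proof -
      have gxy: "gs x = gs y" using x(5) gy by simp
      from uv show ?thesis
      proof
        assume "(u, v) \<in> Gl d x y"
        then show ?thesis by (rule Gl_gs[OF x(1) y(1) gxy])
      next
        assume "(u, v) \<in> Gl d y x"
        then show ?thesis by (rule Gl_gs[OF y(1) x(1) gxy[symmetric]])
      qed
    qed
    have "(face u = face x & face v = face y) \<or> (face u = face y & face v = face x)" using uv Gl_face by blast
    moreover have "face a = face x \<or> face a = face y" using ab Gl_face by blast
    ultimately have "face a = face u \<or> face a = face v" by auto
    then show ?thesis
    proof
      assume f: "face a = face u"
      have "u = a" by (rule fm.conn_same_face[OF ua H4(1) _ _ gua]) (use f in \<open>auto simp: face_def\<close>)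
      then show ?thesis by simp
    next
      assume f: "face a = face v"
      have va: "(v, a) \<in> conn (E' x y)"
        by (rule conn_trans[OF conn_sym[OF fm.E_sym conn_edge[OF uvE]] ua])
      have "v = a" by (rule fm.conn_same_face[OF va H4(2)]) (use f gua guv in \<open>auto simp: face_def\<close>)
      then show ?thesis by simp
    qed
  qed
  have "good_step E x y"
    unfolding good_step_def
  proof (intro conjI)
    show "x \<in> H" "y \<in> H" "fst x ~= fst y" "gs x = 1" "gs y = 1" "(x, y) \<in> conn E"
      using x y ne gy xy by simp_all
    show "face x ~: face ` Domain E" "face y ~: face ` Domain E" by (rule free)+
    show "\<forall>(u, v)\<in>Gl d x y. (u, v) \<in> conn E --> same_cycle E u v" using same by blast
    show "\<forall>(u, v)\<in>Gl d x y \<union> Gl d y x. \<forall>(a, b)\<in>Gl d x y \<union> Gl d y x. (u, a) \<in> conn E --> a = u \<or> a = v"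
      using indep by blast
  qed
  then show ?thesis using fm.mdl by blast
qed

end

section \<open>Codes of quasimanifolds\<close>

definition encoded :: "nat => 'a cell_complex => nat list set => (flag \<times> flag) list => bool" where
  "encoded d K T ms \<longleftrightarrow> valid_tree d T & tree_flags.good d T ms &
     (\<exists>cm. model d T K (tree_flags.EM d T ms) cm)"

lemma encoded_glue:
  assumes d: "d \<ge> 3" and enc: "encoded d K T ms" and pmK: "pseudomanifold d K"
    and glue: "two_LC_gluing d K K' q" and pmK': "pseudomanifold d K'"
    and ori: "orientable_gluing d K'" and resp: "respects_boundary_components d K q"
  shows "\<exists>z. encoded d K' T (z # ms)"
proof -
  interpret tree_flags d T using enc d by unfold_locales (simp_all add: encoded_def)
  obtain cm where g: "good ms" and cm: "model d T K (EM ms) cm" using enc by (auto simp: encoded_def)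
  have "simplicial_cw K" using pmK by (simp add: pseudomanifold_def)
  then interpret fmc: face_model_closed d T K "EM ms" cm by (rule face_model_closedI[OF g cm])
  obtain F F' h k \<sigma> where gl: "F \<in> boundary_faces d K" "F' \<in> boundary_faces d K" "F ~= F'"
    "k \<ge> d - 3" "\<sigma> \<in> dim_cells K k" "\<sigma> \<subseteq> F \<inter> F'" "gluing K K' F F' h q"
    using glue unfolding two_LC_gluing_def by blast
  interpret st: gluing_step d T K "EM ms" cm K' F F' h q
    by unfold_locales (rule gl pmK')+
  obtain x y where xy: "good_step (EM ms) x y" "model d T K' (st.E' x y) (%a s. q ` cm a s)"
    using st.step_exists[OF gl(4-6) ori resp] by blast
  have "st.E' x y = EM ((x, y) # ms)" unfolding st.E'_def EM_Cons ..
  then have "model d T K' (EM ((x, y) # ms)) (%a s. q ` cm a s)" using xy(2) by simp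
  moreover have "good ((x, y) # ms)" by (rule good_Cons[OF g xy(1)])
  moreover have "valid_tree d T" using enc by (simp add: encoded_def)
  ultimately show ?thesis unfolding encoded_def by blast
qed

lemma obtainable_encoded:
  assumes d: "d \<ge> 3" and "obtainable d K" "pseudomanifold d K"
    and base: "!!K :: 'a cell_complex. tree_of_simplices d K ==> pseudomanifold d K ==> \<exists>T. encoded d K T []"
  shows "\<exists>T ms. encoded d (K :: 'a cell_complex) T ms"
  using assms(2,3)
proof (induction rule: obtainable.induct)
  case (tree K)
  then show ?case using base by blast
next
  case (glue K K' q)
  obtain T ms where "encoded d K T ms" using glue.IH glue.hyps by blast
  from encoded_glue[OF d this glue.hyps(2-5) glue.hyps(8)] show ?case by blast
qed

lemma encoded_card:
  assumes "d \<ge> 3" "encoded d K T ms" "simplicial_cw K" shows "card T = card (dim_cells K d)"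
proof -
  interpret tree_flags d T using assms by unfold_locales (simp_all add: encoded_def)
  obtain cm where "good ms" "model d T K (EM ms) cm" using assms(2) by (auto simp: encoded_def)
  from face_model_closedI[OF this assms(3)] interpret face_model_closed d T K "EM ms" cm .
  show ?thesis by (rule card_facets[symmetric])
qed

text \<open>Identifications of faces depend on \<open>EM\<close>, and \<open>EM\<close> depends on
  the gluings only through \<open>symcl\<close>. Hence tree and unordered set of gluings determine
  the face poset.\<close>

lemma encoded_iso:
  assumes d: "d \<ge> 3" and K: "encoded d K T ms" "simplicial_cw K" and L: "encoded d L T ns" "simplicial_cw L"
    and eq: "tree_flags.symcl ms = tree_flags.symcl ns"
  shows "poset_iso (face_poset K) (face_poset L)"
proof -
  interpret tree_flags d T using d K(1) by unfold_locales (simp_all add: encoded_def)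
  obtain cm where cm: "good ms" "model d T K (EM ms) cm" using K(1) by (auto simp: encoded_def)
  obtain cn where cn: "good ns" "model d T L (EM ns) cn" using L(1) by (auto simp: encoded_def)
  have EE: "EM ns = EM ms" using eq by (simp add: EM_def)
  interpret k: face_model_closed d T K "EM ms" cm by (rule face_model_closedI[OF cm K(2)])
  interpret l: face_model_closed d T L "EM ms" cn using face_model_closedI[OF cn L(2)] unfolding EE .
  have same: "cm a s = cm b r \<longleftrightarrow> cn a s = cn b r" if "a \<in> T" "b \<in> T" "s \<subseteq> {..d}" "r \<subseteq> {..d}" for a b s r
    using k.cm_eq[OF that] l.cm_eq[OF that] by simp
  have ord: "cm a s \<subseteq> cm b r \<longleftrightarrow> cn a s \<subseteq> cn b r" if "a \<in> T" "b \<in> T" "s \<subseteq> {..d}" "r \<subseteq> {..d}" for a b s r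
  proof
    assume "cm a s \<subseteq> cm b r"
    from k.cm_sub[OF that(2,4) k.cm_face[OF that(1,3)] this] obtain s' where s': "s' \<subseteq> r" "cm a s = cm b s'" by (elim exE conjE)
    have sd: "s' \<subseteq> {..d}" by (rule subset_trans[OF s'(1) that(4)])
    then show "cn a s \<subseteq> cn b r" using same[OF that(1,2,3) sd] s' l.cm_mono[OF that(2) sd that(4)] by simp
  next
    assume "cn a s \<subseteq> cn b r"
    from l.cm_sub[OF that(2,4) l.cm_face[OF that(1,3)] this] obtain s' where s': "s' \<subseteq> r" "cn a s = cn b s'" by (elim exE conjE)
    have sd: "s' \<subseteq> {..d}" by (rule subset_trans[OF s'(1) that(4)])
    then show "cm a s \<subseteq> cm b r" using same[OF that(1,2,3) sd] s' k.cm_mono[OF that(2) sd that(4)] by simp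
  qed
  define f where "f \<rho> = (SOME \<tau>. \<exists>a\<in>T. \<exists>s\<subseteq>{..d}. \<rho> = cm a s & \<tau> = cn a s)" for \<rho>
  have f: "f (cm a s) = cn a s" if a: "a \<in> T" "s \<subseteq> {..d}" for a s
  proof -
    have "\<exists>b\<in>T. \<exists>r\<subseteq>{..d}. cm a s = cm b r & f (cm a s) = cn b r"
      unfolding f_def by (rule someI_ex) (use a in blast)
    then show ?thesis using same a by metis
  qed
  show ?thesis
    unfolding poset_iso_def
  proof (intro exI conjI ballI)
    show "(\<rho> \<subseteq> \<tau>) = (f \<rho> \<subseteq> f \<tau>)" if rt: "\<rho> \<in> face_poset K" "\<tau> \<in> face_poset K" for \<rho> \<tau>
    proof -
      obtain a s where a: "a \<in> T" "s \<subseteq> {..d}" "\<rho> = cm a s" using rt(1) by (rule k.faceE)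
      obtain b r where b: "b \<in> T" "r \<subseteq> {..d}" "\<tau> = cm b r" using rt(2) by (rule k.faceE)
      show ?thesis using ord[OF a(1) b(1) a(2) b(2)] f[OF a(1,2)] f[OF b(1,2)] a(3) b(3) by simp
    qed
    note fo = this
    have "inj_on f (face_poset K)"
    proof (rule inj_onI)
      fix \<rho> \<tau> assume rt: "\<rho> \<in> face_poset K" "\<tau> \<in> face_poset K" "f \<rho> = f \<tau>"
      then show "\<rho> = \<tau>" using fo[OF rt(1,2)] fo[OF rt(2,1)] by auto
    qed
    moreover have "f ` face_poset K = face_poset L"
    proof
      show "f ` face_poset K \<subseteq> face_poset L"
      proof
        fix \<tau> assume "\<tau> \<in> f ` face_poset K"
        then obtain \<rho> where r: "\<rho> \<in> face_poset K" "\<tau> = f \<rho>" by blast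
        obtain a s where a: "a \<in> T" "s \<subseteq> {..d}" "\<rho> = cm a s" using r(1) by (rule k.faceE)
        show "\<tau> \<in> face_poset L" using l.cm_face[OF a(1,2)] f[OF a(1,2)] r(2) a(3) by simp
      qed
      show "face_poset L \<subseteq> f ` face_poset K"
      proof
        fix \<tau> assume "\<tau> \<in> face_poset L"
        then obtain a s where a: "a \<in> T" "s \<subseteq> {..d}" "\<tau> = cn a s" by (rule l.faceE)
        then show "\<tau> \<in> f ` face_poset K" using k.cm_face[OF a(1,2)] f[OF a(1,2)] by (intro image_eqI[of _ _ "cm a s"]) simp_all
      qed
    qed
    ultimately show "bij_betw f (face_poset K) (face_poset L)" by (simp add: bij_betw_def)
  qed
qed

section \<open>Trees of simplices\<close>

text \<open>A repetition at the smallest possible distance encloses a closed walk with distinct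
  vertices. Distance 1 would be a loop and distance 2 a step back, so it would be a cycle of length
  at least three.\<close>

lemma nonbacktracking_distinct:
  assumes irr: "!!u. (u, u) ~: E"
    and E: "!!i. Suc i < length vs ==> (vs ! i, vs ! Suc i) \<in> E"
    and nb: "!!i. i + 2 < length vs ==> vs ! i ~= vs ! (i + 2)"
    and nocyc: "\<not> (\<exists>us. 3 <= length us & distinct us & set us \<subseteq> set vs &
             (\<forall>i<length us. (us ! i, us ! (Suc i mod length us)) \<in> E))"
  shows "distinct vs"
proof (rule ccontr)
  assume "\<not> distinct vs"
  then have "\<exists>n i. 0 < n & i + n < length vs & vs ! i = vs ! (i + n)"
  proof -
    obtain i j where ij: "i < length vs" "j < length vs" "i ~= j" "vs ! i = vs ! j"
      using \<open>\<not> distinct vs\<close> by (auto simp: distinct_conv_nth)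
    show ?thesis
    proof (cases "i < j")
      case True
      then show ?thesis using ij by (intro exI[of _ "j - i"] exI[of _ i]) simp
    next
      case False
      then show ?thesis using ij by (intro exI[of _ "i - j"] exI[of _ j]) simp
    qed
  qed
  then obtain n where n: "\<exists>i. 0 < n & i + n < length vs & vs ! i = vs ! (i + n)"
    "!!m. m < n ==> \<not> (\<exists>i. 0 < m & i + m < length vs & vs ! i = vs ! (i + m))"
    using exists_least_iff[of "%n. \<exists>i. 0 < n & i + n < length vs & vs ! i = vs ! (i + n)"] by blast
  obtain i where i: "0 < n" "i + n < length vs" "vs ! i = vs ! (i + n)" using n(1) by blast
  have "n ~= 1" using E[of i] i irr by auto
  moreover have "n ~= 2" using nb[of i] i by auto
  ultimately have n3: "3 <= n" using i(1) by simp
  define us where "us = take n (drop i vs)"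
  have len: "length us = n" using i(2) by (simp add: us_def)
  have nth: "us ! k = vs ! (i + k)" if "k < n" for k using that i(2) by (simp add: us_def)
  have "distinct us"
  proof (rule ccontr)
    assume "\<not> distinct us"
    then obtain a b where ab: "a < n" "b < n" "a ~= b" "us ! a = us ! b" using len by (auto simp: distinct_conv_nth)
    define lo hi where "lo = min a b" and "hi = max a b"
    have lh: "lo < hi" "hi < n" "us ! lo = us ! hi" using ab by (auto simp: lo_def hi_def min_def max_def)
    have "vs ! (i + lo) = vs ! (i + lo + (hi - lo))" using lh nth[of lo] nth[of hi] by simp
    moreover have "i + lo + (hi - lo) < length vs" "0 < hi - lo" "hi - lo < n" using lh i(2) by auto
    ultimately show False using n(2)[of "hi - lo"] by blast
  qed
  moreover have "set us \<subseteq> set vs" unfolding us_def using set_take_subset set_drop_subset by (metis subset_trans)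
  moreover have "(us ! k, us ! (Suc k mod length us)) \<in> E" if "k < length us" for k
  proof (cases "Suc k < n")
    case True
    then show ?thesis using E[of "i + k"] i(2) nth[of k] nth[of "Suc k"] len by simp
  next
    case False
    then have "Suc k = n" using that len by simp
    then have "(vs ! (i + k), vs ! (i + n)) \<in> E" using E[of "i + k"] i(2) by auto
    then show ?thesis using i(3) nth[of k] nth[of 0] \<open>Suc k = n\<close> len n3 by simp
  qed
  ultimately show False using nocyc n3 len by blast
qed

locale tree_complex =
  fixes d :: nat and K :: "'a cell_complex"
  assumes d3: "3 <= d" and tr: "tree_of_simplices d K" and pm: "pseudomanifold d K"
begin

lemma simp_K: "simplicial_cw K" and pure_K: "pure_dim d K"
  and two_K: "F \<in> dim_cells K (d - 1) ==> card {D \<in> dim_cells K d. F \<subseteq> D} <= 2"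
  using pm by (simp_all add: pseudomanifold_def)

lemma inter_face: "\<sigma> \<in> cells K ==> \<tau> \<in> cells K ==> \<sigma> \<inter> \<tau> \<in> face_poset K"
  and disk_K: "cspace K homeomorphic_space disk d"
  and tree_K: "tree_graph (dim_cells K d) (dual_edges d K)"
  using tr by (simp_all add: tree_of_simplices_def simplicial_complex_def)

end

sublocale tree_complex \<subseteq> rcw K
  by unfold_locales (use simp_K in \<open>simp add: simplicial_cw_def\<close>)

context tree_complex
begin

lemma cell_face: "\<rho> \<in> cells K ==> \<rho> \<in> face_poset K" by (simp add: face_poset_def)

lemma dim_cell: "\<rho> \<in> dim_cells K n ==> \<rho> \<in> cells K" by (simp add: dim_cells_def)

lemma in_facet: "\<rho> \<in> cells K ==> \<exists>D\<in>dim_cells K d. \<rho> \<subseteq> D"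
  using pure_K by (simp add: pure_dim_def)

text \<open>A colouring of the vertices of \<open>D\<close> by 0..d, expressed through the faces
  spanned by sets of colours.\<close>

definition faceiso :: "'a set => (nat set => 'a set) => bool" where
  "faceiso D f \<longleftrightarrow> (\<forall>s s'. s \<subseteq> {..d} --> s' \<subseteq> {..d} --> (f s \<subseteq> f s' \<longleftrightarrow> s \<subseteq> s')) &
     f ` Pow {..d} = {\<rho> \<in> face_poset K. \<rho> \<subseteq> D}"

lemma faceiso_mono: "faceiso D f ==> s \<subseteq> {..d} ==> s' \<subseteq> {..d} ==> f s \<subseteq> f s' \<longleftrightarrow> s \<subseteq> s'"
  by (simp add: faceiso_def)

lemma faceiso_inj: "faceiso D f ==> s \<subseteq> {..d} ==> s' \<subseteq> {..d} ==> f s = f s' ==> s = s'"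
  using faceiso_mono[of D f s s'] faceiso_mono[of D f s' s] by auto

lemma faceiso_mem:
  assumes "faceiso D f" "s \<subseteq> {..d}" shows "f s \<in> face_poset K" "f s \<subseteq> D"
proof -
  have "f s \<in> f ` Pow {..d}" using assms(2) by blast
  then have "f s \<in> {\<rho> \<in> face_poset K. \<rho> \<subseteq> D}" using assms(1) by (simp add: faceiso_def)
  then show "f s \<in> face_poset K" "f s \<subseteq> D" by simp_all
qed

lemma faceiso_sur:
  assumes "faceiso D f" "\<rho> \<in> face_poset K" "\<rho> \<subseteq> D" shows "\<exists>s\<subseteq>{..d}. \<rho> = f s"
proof -
  have "\<rho> \<in> {\<rho> \<in> face_poset K. \<rho> \<subseteq> D}" using assms(2,3) by simp
  then have "\<rho> \<in> f ` Pow {..d}" using assms(1) by (simp add: faceiso_def)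
  then show ?thesis by auto
qed

lemma faceiso_sub:
  assumes "faceiso D f" "s \<subseteq> {..d}" "\<rho> \<in> face_poset K" "\<rho> \<subseteq> f s" shows "\<exists>s'\<subseteq>s. \<rho> = f s'"
proof -
  have "\<rho> \<subseteq> D" using assms(4) faceiso_mem(2)[OF assms(1,2)] by (rule subset_trans)
  from faceiso_sur[OF assms(1,3) this] obtain s' where s': "s' \<subseteq> {..d}" "\<rho> = f s'" by (elim exE conjE)
  then have "s' \<subseteq> s" using faceiso_mono[OF assms(1) s'(1) assms(2)] assms(4) by simp
  then show ?thesis using s'(2) by blast
qed

lemma faceiso_empty: "faceiso D f ==> f {} = {}"
proof -
  assume f: "faceiso D f"
  have "{} \<in> face_poset K" by (simp add: face_poset_def)
  from faceiso_sur[OF f this] obtain s where s: "s \<subseteq> {..d}" "{} = f s" by auto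
  have "f {} \<subseteq> f s" using faceiso_mono[OF f _ s(1), of "{}"] by simp
  then show ?thesis using s(2) by simp
qed

lemma faceiso_top: "faceiso D f ==> D \<in> cells K ==> f {..d} = D"
proof -
  assume f: "faceiso D f" and D: "D \<in> cells K"
  from faceiso_sur[OF f cell_face[OF D]] obtain s where s: "s \<subseteq> {..d}" "D = f s" by auto
  have "f s \<subseteq> f {..d}" using faceiso_mono[OF f s(1) order_refl] s(1) by simp
  then show ?thesis using s(2) faceiso_mem(2)[OF f order_refl] by blast
qed

lemma faceiso_dim:
  assumes f: "faceiso D f" and s: "s \<subseteq> {..d}"
  shows "f s \<in> dim_cells K n \<longleftrightarrow> card s = Suc n"
proof (cases "s = {}")
  case True
  have "{} ~: cells K" using cell_nonempty by blast
  then show ?thesis using True faceiso_empty[OF f] by (simp add: dim_cells_def)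
next
  case False
  have fin: "finite s" using s finite_subset by blast
  have "f s ~= {}"
  proof
    assume "f s = {}"
    then have "f s \<subseteq> f {}" by simp
    then show False using faceiso_mono[OF f s, of "{}"] False by simp
  qed
  then have cell: "f s \<in> cells K" using faceiso_mem(1)[OF f s] by (simp add: face_poset_def)
  have eq: "{\<rho> \<in> face_poset K. \<rho> \<subseteq> f s} = f ` Pow s"
  proof (intro equalityI subsetI)
    fix \<rho> assume "\<rho> \<in> {\<rho> \<in> face_poset K. \<rho> \<subseteq> f s}"
    then show "\<rho> \<in> f ` Pow s" using faceiso_sub[OF f s, of \<rho>] by blast
  next
    fix \<rho> assume "\<rho> \<in> f ` Pow s"
    then obtain t where t: "t \<subseteq> s" "\<rho> = f t" by blast
    have td: "t \<subseteq> {..d}" by (rule subset_trans[OF t(1) s])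
    show "\<rho> \<in> {\<rho> \<in> face_poset K. \<rho> \<subseteq> f s}"
      using faceiso_mem(1)[OF f td] faceiso_mono[OF f td s] t by simp
  qed
  have "poset_iso (Pow s) (f ` Pow s)"
    unfolding poset_iso_def
  proof (intro exI conjI ballI)
    show "bij_betw f (Pow s) (f ` Pow s)"
    proof (rule inj_on_imp_bij_betw, rule inj_onI)
      fix x y assume "x \<in> Pow s" "y \<in> Pow s" "f x = f y"
      then show "x = y" using faceiso_inj[OF f, of x y] s by auto
    qed
    fix x y assume "x \<in> Pow s" "y \<in> Pow s"
    then show "(x \<subseteq> y) = (f x \<subseteq> f y)" using faceiso_mono[OF f, of x y] s by auto
  qed
  then have "poset_iso {\<rho> \<in> face_poset K. \<rho> \<subseteq> f s} (Pow s)" unfolding eq by (rule poset_iso_sym)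
  from dim_cells_iff_rank[OF simp_K cell fin this] show ?thesis .
qed

lemma faceiso_exists:
  assumes D: "D \<in> dim_cells K d" shows "\<exists>f. faceiso D f"
proof -
  have Dc: "D \<in> cells K" by (rule dim_cell[OF D])
  obtain V :: "nat set" where V: "finite V" "poset_iso {\<rho> \<in> face_poset K. \<rho> \<subseteq> D} (Pow V)"
    using simp_K Dc unfolding simplicial_cw_def by blast
  have "card V = Suc d" using dim_cells_iff_rank[OF simp_K Dc V] D by simp
  then have "\<exists>b. bij_betw b {..d} V" by (intro finite_same_card_bij) (simp_all add: V(1))
  then obtain b where b: "bij_betw b {..d} V" by blast
  obtain g where g: "bij_betw g (Pow V) {\<rho> \<in> face_poset K. \<rho> \<subseteq> D}"
    "!!x y. x \<in> Pow V ==> y \<in> Pow V ==> x \<subseteq> y \<longleftrightarrow> g x \<subseteq> g y"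
    using poset_iso_sym[OF V(2)] unfolding poset_iso_def by (elim exE conjE) simp
  have bV: "b ` s \<in> Pow V" if "s \<subseteq> {..d}" for s using b that by (auto simp: bij_betw_def)
  have "faceiso D (%s. g (b ` s))"
    unfolding faceiso_def
  proof (intro conjI allI impI)
    fix s s' assume s: "s \<subseteq> {..d}" "s' \<subseteq> {..d}"
    have "g (b ` s) \<subseteq> g (b ` s') \<longleftrightarrow> b ` s \<subseteq> b ` s'" using g(2)[OF bV[OF s(1)] bV[OF s(2)]] by simp
    also have "\<dots> \<longleftrightarrow> s \<subseteq> s'" by (rule inj_on_image_subset_iff[OF bij_betw_imp_inj_on[OF b] s])
    finally show "g (b ` s) \<subseteq> g (b ` s') \<longleftrightarrow> s \<subseteq> s'" .
  next
    have "(%s. g (b ` s)) ` Pow {..d} = g ` (`) b ` Pow {..d}" by (simp add: image_image)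
    also have "(`) b ` Pow {..d} = Pow V" by (rule image_Pow_surj) (use b in \<open>simp add: bij_betw_def\<close>)
    also have "g ` Pow V = {\<rho> \<in> face_poset K. \<rho> \<subseteq> D}" using g(1) by (simp add: bij_betw_def)
    finally show "(%s. g (b ` s)) ` Pow {..d} = {\<rho> \<in> face_poset K. \<rho> \<subseteq> D}" .
  qed
  then show ?thesis by blast
qed

lemma dim_sub:
  assumes "\<alpha> \<in> dim_cells K n" "\<beta> \<in> dim_cells K m" "\<alpha> \<subseteq> \<beta>"
  shows "n <= m" "n = m ==> \<alpha> = \<beta>"
proof -
  obtain D where D: "D \<in> dim_cells K d" "\<beta> \<subseteq> D" using in_facet[OF dim_cell[OF assms(2)]] by blast
  obtain f where f: "faceiso D f" using faceiso_exists[OF D(1)] by blast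
  from faceiso_sur[OF f cell_face[OF dim_cell[OF assms(2)]] D(2)]
  obtain r where r: "r \<subseteq> {..d}" "\<beta> = f r" by (elim exE conjE)
  have "\<alpha> \<subseteq> f r" using assms(3) r(2) by simp
  from faceiso_sub[OF f r(1) cell_face[OF dim_cell[OF assms(1)]] this]
  obtain s where s: "s \<subseteq> r" "\<alpha> = f s" by (elim exE conjE)
  have fin: "finite r" using r(1) finite_subset by blast
  have c: "card s = Suc n" "card r = Suc m"
    using faceiso_dim[OF f subset_trans[OF s(1) r(1)]] faceiso_dim[OF f r(1)] assms(1,2) s(2) r(2) by auto
  show "n <= m" using card_mono[OF fin s(1)] c by simp
  show "\<alpha> = \<beta>" if "n = m" using card_subset_eq[OF fin s(1)] c that s(2) r(2) by simp
qed

lemma facet_sub: "D \<in> dim_cells K d ==> D' \<in> dim_cells K d ==> D \<subseteq> D' ==> D = D'"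
  by (rule dim_sub(2)) simp_all

lemma ridge_in:
  assumes f: "faceiso D f" and G: "G \<in> dim_cells K (d - 1)" "G \<subseteq> D"
  shows "\<exists>c\<le>d. G = f ({..d} - {c})"
proof -
  from faceiso_sur[OF f cell_face[OF dim_cell[OF G(1)]] G(2)] obtain s where s: "s \<subseteq> {..d}" "G = f s" by (elim exE conjE)
  have "card s = d" using faceiso_dim[OF f s(1), of "d - 1"] G(1) s(2) d3 by simp
  then have "card ({..d} - s) = 1" using card_Diff_subset[of s "{..d}"] s(1) finite_subset[OF s(1)] by simp
  then obtain c where c: "{..d} - s = {c}" by (auto simp: card_1_singleton_iff)
  then have "s = {..d} - {c}" using s(1) by blast
  moreover have "c <= d" using c by auto
  ultimately show ?thesis using s(2) by blast
qed

lemma ridge_dim: "faceiso D f ==> c <= d ==> f ({..d} - {c}) \<in> dim_cells K (d - 1)"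
  using faceiso_dim[of D f "{..d} - {c}" "d - 1"] d3 by simp

lemma third_facet:
  assumes G: "G \<in> dim_cells K (d - 1)" and D: "D1 \<in> dim_cells K d" "D2 \<in> dim_cells K d" "D3 \<in> dim_cells K d"
    and sub: "G \<subseteq> D1" "G \<subseteq> D2" "G \<subseteq> D3" and ne: "D2 ~= D1" "D3 ~= D1"
  shows "D2 = D3"
proof (rule ccontr)
  assume "D2 ~= D3"
  then have "card {D1, D2, D3} = 3" using ne by auto
  moreover have "finite {D \<in> dim_cells K d. G \<subseteq> D}"
    by (rule finite_subset[OF _ finite_cells]) (auto simp: dim_cells_def)
  then have "card {D1, D2, D3} <= card {D \<in> dim_cells K d. G \<subseteq> D}"
    by (rule card_mono) (use D sub in auto)
  ultimately show False using two_K[OF G] by simp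
qed

text \<open>In a simplicial complex the intersection of two facets is a single face. Being proper,
  it has at most \<open>d\<close> vertices, so it coincides with any ridge inside it.\<close>

lemma shared_ridge_unique:
  assumes D: "D \<in> dim_cells K d" "D' \<in> dim_cells K d" "D ~= D'"
    and G: "G \<in> dim_cells K (d - 1)" "G \<subseteq> D" "G \<subseteq> D'" and G': "G' \<in> dim_cells K (d - 1)" "G' \<subseteq> D" "G' \<subseteq> D'"
  shows "G = G'"
proof -
  obtain f where f: "faceiso D f" using faceiso_exists[OF D(1)] by blast
  from faceiso_sur[OF f inter_face[OF dim_cell[OF D(1)] dim_cell[OF D(2)]] Int_lower1]
  obtain r where r: "r \<subseteq> {..d}" "D \<inter> D' = f r" by (elim exE conjE)
  have "r ~= {..d}"
  proof
    assume "r = {..d}"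
    then have "D \<subseteq> D'" using r(2) faceiso_top[OF f dim_cell[OF D(1)]] by blast
    then show False using facet_sub[OF D(1,2)] D(3) by simp
  qed
  then have "card r < card {..d}" using r(1) by (intro psubset_card_mono) auto
  then have cr: "card r <= d" by simp
  have fin: "finite r" using r(1) finite_subset by blast
  have "X = f r" if X: "X \<in> dim_cells K (d - 1)" "X \<subseteq> D" "X \<subseteq> D'" for X
  proof -
    have "X \<subseteq> f r" using X(2,3) r(2) by blast
    from faceiso_sub[OF f r(1) cell_face[OF dim_cell[OF X(1)]] this] obtain s where s: "s \<subseteq> r" "X = f s" by (elim exE conjE)
    have "card s = d" using faceiso_dim[OF f subset_trans[OF s(1) r(1)], of "d - 1"] X(1) s(2) d3 by simp
    then have "s = r" using card_subset_eq[OF fin s(1)] card_mono[OF fin s(1)] cr by simp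
    then show ?thesis using s(2) by simp
  qed
  then show ?thesis using G G' by metis
qed

text \<open>In disk coordinates, shrinking a point slightly towards the centre makes it
  interior.\<close>

lemma cint_dense:
  assumes D: "D \<in> cells K" and x: "x \<in> D" and U: "openin (cspace K) U" "x \<in> U"
  shows "U \<inter> cint D ~= {}"
proof -
  obtain n h g where hm: "homeomorphic_maps (disk n) (subtopology (cspace K) D) h g" "h ` SS n = cell_boundary K D"
    by (rule cell_homeo[OF D])
  note f = homeo_facts[OF hm(1) D]
  define z where "z = g x"
  have z: "z \<in> DD n" "h z = x" using f(2,4) x by (auto simp: z_def)
  have "openin (subtopology (cspace K) D) (U \<inter> D)" by (rule openin_subtopology_Int[OF U(1)])
  then have "openin (disk n) {z \<in> topspace (disk n). h z \<in> U \<inter> D}" by (rule openin_continuous_map_preimage[OF f(5)])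
  then obtain S where S: "open S" "{z \<in> DD n. h z \<in> U \<inter> D} = DD n \<inter> S"
    unfolding topspace_disk unfolding disk_DD openin_open by blast
  have zS: "z \<in> S" using z x U(2) S(2) by blast
  define \<gamma> where "\<gamma> t = (%i. t * z i)" for t :: real
  have "continuous_on UNIV \<gamma>" unfolding \<gamma>_def by (rule continuous_on_funI) (intro continuous_intros)
  then have "open (\<gamma> -` S)" by (rule open_vimage[OF S(1)])
  moreover have "1 \<in> \<gamma> -` S" using zS by (simp add: \<gamma>_def)
  ultimately obtain e where e: "e > 0" "ball 1 e \<subseteq> \<gamma> -` S" using open_contains_ball by blast
  define t where "t = 1 - min e 1 / 2"
  have t: "0 < t" "t < 1" "t \<in> ball 1 e" using e(1) by (auto simp: t_def dist_real_def min_def)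
  have gS: "\<gamma> t \<in> S" using e(2) t(3) by blast
  have q1: "qq n (\<gamma> t) = t\<^sup>2 * qq n z" unfolding \<gamma>_def by (rule qq_scale)
  have "qq n z <= 1" using z(1) by (simp add: DD_def)
  then have "t\<^sup>2 * qq n z <= t\<^sup>2 * 1" by (intro mult_left_mono) simp_all
  moreover have "t\<^sup>2 < 1" using t by (simp add: power_less_one_iff)
  ultimately have q2: "qq n (\<gamma> t) < 1" using q1 by simp
  have gD: "\<gamma> t \<in> DD n - SS n" using z(1) q2 by (auto simp: DD_def SS_def EE_def \<gamma>_def)
  then have "h (\<gamma> t) \<in> cint D" using cint_homeo(1)[OF hm(1) D hm(2)] by blast
  moreover have "h (\<gamma> t) \<in> U" using gS gD S(2) by blast
  ultimately show ?thesis by blast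
qed

text \<open>The dual graph of the star of \<open>\<tau>\<close>.\<close>

definition Adj :: "'a set => ('a set \<times> 'a set) set" where
  "Adj \<tau> = {(D, D'). D \<in> dim_cells K d & D' \<in> dim_cells K d &
     (\<exists>G\<in>dim_cells K (d - 1). \<tau> \<subseteq> G & G \<subseteq> D & G \<subseteq> D')}"

lemma Adj_mono: "\<tau> \<subseteq> \<kappa> ==> Adj \<kappa> \<subseteq> Adj \<tau>"
proof (rule subrelI)
  fix A B assume sub: "\<tau> \<subseteq> \<kappa>" and "(A, B) \<in> Adj \<kappa>"
  then obtain G where G: "A \<in> dim_cells K d" "B \<in> dim_cells K d" "G \<in> dim_cells K (d - 1)" "\<kappa> \<subseteq> G" "G \<subseteq> A" "G \<subseteq> B"
    unfolding Adj_def by auto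
  then show "(A, B) \<in> Adj \<tau>" unfolding Adj_def using subset_trans[OF sub G(4)] by auto
qed

text \<open>
  A ball is not locally separated by a subset of codimension at least two, so the facets around a
  face form a single class.
\<close>

lemma facets_connected:
  assumes "\<tau> \<in> cells K" "D \<in> dim_cells K d" "\<tau> \<subseteq> D" "D' \<in> dim_cells K d" "\<tau> \<subseteq> D'"
  shows "(D, D') \<in> (Adj \<tau>)\<^sup>*"
  using assms
proof (induction "card {\<rho> \<in> cells K. \<tau> \<subset> \<rho>}" arbitrary: \<tau> D D' rule: less_induct)
  case less
  note \<tau> = less.prems(1) and D = less.prems(2,3) and D' = less.prems(4,5)
  obtain f where f: "faceiso D f" using faceiso_exists[OF D(1)] by blast
  from faceiso_sur[OF f cell_face[OF \<tau>] D(2)] obtain s where s: "s \<subseteq> {..d}" "\<tau> = f s" by (elim exE conjE)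
  have "s ~= {}" using s(2) faceiso_empty[OF f] cell_nonempty[OF \<tau>] by auto
  then have "card s ~= 0" using s(1) finite_subset by fastforce
  then obtain k where k: "card s = Suc k" by (cases "card s") auto
  then have kd: "\<tau> \<in> dim_cells K k" using faceiso_dim[OF f s(1)] s(2) by simp
  have "k <= d" using dim_sub(1)[OF kd D(1) D(2)] .
  then consider "k = d" | "k = d - 1" | "k + 2 <= d" by arith
  then show ?case
  proof cases
    case 1
    then have "\<tau> = D" "\<tau> = D'" using dim_sub(2)[OF kd D(1) D(2)] dim_sub(2)[OF kd D'(1) D'(2)] by simp_all
    then show ?thesis by simp
  next
    case 2
    then have "(D, D') \<in> Adj \<tau>" using kd D D' unfolding Adj_def by blast
    then show ?thesis by (rule r_into_rtrancl)
  next
    case 3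
    show ?thesis
    proof (rule ccontr)
      assume nc: "(D, D') ~: (Adj \<tau>)\<^sup>*"
      \<comment> \<open>If the facets around \<open>\<tau>\<close> fell into several classes,
        removing one class or the others would give disjoint open sets \<open>U1\<close> and
        \<open>U2\<close>. They cover the neighbourhood \<open>U\<close> off \<open>\<tau>\<close>:
        a point there is interior to a strictly larger face, whose facets form one class by
        induction.\<close>
      define C1 where "C1 = {E \<in> dim_cells K d. \<tau> \<subseteq> E & (D, E) \<in> (Adj \<tau>)\<^sup>*}"
      define C2 where "C2 = {E \<in> dim_cells K d. \<tau> \<subseteq> E & (D, E) ~: (Adj \<tau>)\<^sup>*}"
      define N where "N = \<Union>{\<rho> \<in> cells K. \<not> \<tau> \<subseteq> \<rho>}"
      have DC: "D \<in> C1" "D' \<in> C2" using D D' nc by (auto simp: C1_def C2_def)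
      have Cc: "C1 \<subseteq> cells K" "C2 \<subseteq> cells K" by (auto simp: C1_def C2_def dim_cells_def)
      have clU: "closedin (cspace K) (\<Union>C)" if "C \<subseteq> cells K" for C
        using that finite_subset[OF that finite_cells] cell_closed by (intro closedin_Union) auto
      define U where "U = topspace (cspace K) - N"
      define U1 where "U1 = topspace (cspace K) - (N \<union> \<Union>C2)"
      define U2 where "U2 = topspace (cspace K) - (N \<union> \<Union>C1)"
      have "closedin (cspace K) N" unfolding N_def by (rule clU) blast
      note cN = this
      have op: "openin (cspace K) U" "openin (cspace K) U1" "openin (cspace K) U2"
        unfolding U_def U1_def U2_def
        by (rule openin_diff[OF openin_topspace cN] openin_diff[OF openin_topspace closedin_Un[OF cN clU[OF Cc(2)]]]
            openin_diff[OF openin_topspace closedin_Un[OF cN clU[OF Cc(1)]]])+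
      obtain x where x: "x \<in> cint \<tau>" using cint_nonempty[OF \<tau>] by blast
      have xt: "x \<in> \<tau>" by (rule subsetD[OF cint_sub x])
      have xU: "x \<in> U"
        using carrier_sub[OF \<tau> x] subsetD[OF cell_sub[OF \<tau>] xt] by (auto simp: U_def N_def)
      have carr: "\<exists>\<kappa>\<in>cells K. y \<in> cint \<kappa> & \<tau> \<subseteq> \<kappa>" if "y \<in> U" for y
      proof -
        have "y \<in> \<Union>(cells K)" using that topspace_cells by (simp add: U_def)
        then obtain \<sigma> where \<sigma>: "\<sigma> \<in> cells K" "y \<in> \<sigma>" by blast
        from carrier[OF this] obtain \<kappa> where \<kappa>: "\<kappa> \<in> cells K" "y \<in> cint \<kappa>" by blast
        have "y \<in> \<kappa>" by (rule subsetD[OF cint_sub \<kappa>(2)])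
        then have "\<tau> \<subseteq> \<kappa>" using that \<kappa>(1) unfolding U_def N_def by blast
        then show ?thesis using \<kappa> by blast
      qed
      have cover: "U - \<tau> \<subseteq> U1 \<union> U2"
      proof
        fix y assume y: "y \<in> U - \<tau>"
        show "y \<in> U1 \<union> U2"
        proof (rule ccontr)
          assume "y ~: U1 \<union> U2"
          then obtain E1 E2 where E: "E1 \<in> C1" "y \<in> E1" "E2 \<in> C2" "y \<in> E2"
            using y by (auto simp: U_def U1_def U2_def)
          obtain \<kappa> where \<kappa>: "\<kappa> \<in> cells K" "y \<in> cint \<kappa>" "\<tau> \<subseteq> \<kappa>" using carr y by blast
          have "y \<in> \<kappa>" by (rule subsetD[OF cint_sub \<kappa>(2)])
          then have ps: "\<tau> \<subset> \<kappa>" using \<kappa>(3) y by blast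
          have "{\<rho> \<in> cells K. \<kappa> \<subset> \<rho>} \<subset> {\<rho> \<in> cells K. \<tau> \<subset> \<rho>}"
            using ps \<kappa>(1) by (intro psubsetI) auto
          then have "card {\<rho> \<in> cells K. \<kappa> \<subset> \<rho>} < card {\<rho> \<in> cells K. \<tau> \<subset> \<rho>}"
            by (rule psubset_card_mono[rotated]) (simp add: finite_cells)
          moreover have "\<kappa> \<subseteq> E1" "\<kappa> \<subseteq> E2"
            using carrier_sub[OF \<kappa>(1,2)] E Cc by blast+
          moreover have "E1 \<in> dim_cells K d" "E2 \<in> dim_cells K d" using E by (auto simp: C1_def C2_def)
          ultimately have "(E1, E2) \<in> (Adj \<kappa>)\<^sup>*" using less.hyps[OF _ \<kappa>(1)] by blast
          then have "(E1, E2) \<in> (Adj \<tau>)\<^sup>*" by (rule subsetD[OF rtrancl_mono[OF Adj_mono[OF \<kappa>(3)]]])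
          moreover have "(D, E1) \<in> (Adj \<tau>)\<^sup>*" using E(1) by (simp add: C1_def)
          ultimately have "(D, E2) \<in> (Adj \<tau>)\<^sup>*" by (rule rtrancl_trans[rotated])
          then show False using E(3) by (simp add: C2_def)
        qed
      qed
      have disj: "U1 \<inter> U2 = {}"
      proof (rule ccontr)
        assume "U1 \<inter> U2 ~= {}"
        then obtain y where y: "y \<in> U1" "y \<in> U2" by blast
        then have "y \<in> U" by (simp add: U_def U1_def)
        then obtain \<kappa> where \<kappa>: "\<kappa> \<in> cells K" "y \<in> cint \<kappa>" "\<tau> \<subseteq> \<kappa>" using carr by blast
        obtain E where E: "E \<in> dim_cells K d" "\<kappa> \<subseteq> E" using in_facet[OF \<kappa>(1)] by blast
        have "E \<in> C1 \<or> E \<in> C2" using E \<kappa>(3) by (auto simp: C1_def C2_def)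
        moreover have "y \<in> E" using E(2) subsetD[OF cint_sub \<kappa>(2)] by blast
        ultimately show False using y by (auto simp: U1_def U2_def)
      qed
      have away: "U1 \<inter> \<tau> = {}" "U2 \<inter> \<tau> = {}"
        using DC D D' by (auto simp: U1_def U2_def)
      have ci: "cint D \<subseteq> U1" "cint D' \<subseteq> U2"
      proof -
        have *: "y \<in> topspace (cspace K) - (N \<union> \<Union>C)"
          if y: "y \<in> cint B" and B: "B \<in> dim_cells K d" "\<tau> \<subseteq> B" and C: "C \<subseteq> dim_cells K d" "B ~: C" for y B C
        proof -
          note Bc = dim_cell[OF B(1)]
          have "y \<in> B" by (rule subsetD[OF cint_sub y])
          then have "y \<in> topspace (cspace K)" using cell_sub[OF Bc] by blast
          moreover have "y ~: N" using carrier_sub[OF Bc y] B(2) unfolding N_def by blast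
          moreover have "y ~: \<Union>C"
          proof
            assume "y \<in> \<Union>C"
            then obtain E where E: "E \<in> C" "y \<in> E" by blast
            then have Ed: "E \<in> dim_cells K d" using C(1) by blast
            then have "B \<subseteq> E" using carrier_sub[OF Bc y dim_cell E(2)] by blast
            then have "B = E" by (rule facet_sub[OF B(1) Ed])
            then show False using E(1) C(2) by simp
          qed
          ultimately show ?thesis by blast
        qed
        have "C2 \<subseteq> dim_cells K d" "D ~: C2" "C1 \<subseteq> dim_cells K d" "D' ~: C1"
          using DC by (auto simp: C1_def C2_def)
        then show "cint D \<subseteq> U1" "cint D' \<subseteq> U2" using * D D' unfolding U1_def U2_def by blast+
      qed
      obtain F G where FG: "homeomorphic_maps (cspace K) (disk d) F G"
        using disk_K by (auto simp: homeomorphic_space_def)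
      then have Fm: "homeomorphic_map (cspace K) (disk d) F" using homeomorphic_map_maps by blast
      have Fi: "inj_on F (topspace (cspace K))" by (rule homeomorphic_imp_injective_map[OF Fm])
      have Fs: "F ` topspace (cspace K) = DD d" using homeomorphic_imp_surjective_map[OF Fm] by simp
      have Fo: "openin (top_of_set (DD d)) (F ` S)" if "openin (cspace K) S" for S
        using homeomorphic_imp_open_map[OF Fm] that unfolding open_map_def disk_DD by blast
      have tt: "\<tau> \<subseteq> topspace (cspace K)" by (rule cell_sub[OF \<tau>])
      have sub: "U \<subseteq> topspace (cspace K)" "U1 \<subseteq> topspace (cspace K)" "U2 \<subseteq> topspace (cspace K)"
        by (auto simp: U_def U1_def U2_def)
      have F\<tau>: "F ` \<tau> \<subseteq> DD d" using image_mono[OF tt, of F] Fs by simp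
      have "homeomorphic_map (subtopology (cspace K) \<tau>) (subtopology (disk d) (F ` \<tau>)) F"
        by (rule homeomorphic_map_subtopologies[OF Fm]) (use tt F\<tau> in \<open>simp add: inf.absorb2\<close>)
      moreover have "subtopology (disk d) (F ` \<tau>) = top_of_set (F ` \<tau>)"
        using F\<tau> by (simp add: disk_DD subtopology_subtopology inf.absorb2)
      ultimately have "subtopology (cspace K) \<tau> homeomorphic_space top_of_set (F ` \<tau>)"
        using homeomorphic_map_imp_homeomorphic_space by fastforce
      moreover have "subtopology (cspace K) \<tau> homeomorphic_space disk k" using kd by (simp add: dim_cells_def)
      ultimately have "top_of_set (F ` \<tau>) homeomorphic_space top_of_set (DD k)"
        unfolding disk_DD by (meson homeomorphic_space_sym homeomorphic_space_trans)
      then obtain P Q where PQ: "homeomorphic_maps (top_of_set (F ` \<tau>)) (top_of_set (DD k)) P Q"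
        by (auto simp: homeomorphic_space_def)
      have "homeomorphism (F ` \<tau>) (DD k) P Q"
        using PQ unfolding homeomorphic_maps_def homeomorphism_def continuous_map_iff_continuous2
        by (auto simp: image_iff Pi_iff) (metis image_eqI)+
      moreover have "F x \<in> closure (F ` W)"
        if W: "W \<in> {U1, U2}" and B: "cint B \<subseteq> W" "B \<in> cells K" "\<tau> \<subseteq> B" for W B
        unfolding closure_iff_nhds_not_empty
      proof (intro allI impI)
        fix A S assume S: "S \<subseteq> A" "open S" "F x \<in> S"
        have "openin (disk d) (DD d \<inter> S)" unfolding disk_DD using S(2) by (simp add: openin_open_Int)
        moreover have "continuous_map (cspace K) (disk d) F" using homeomorphic_imp_continuous_map[OF Fm] .
        ultimately have "openin (cspace K) {y \<in> topspace (cspace K). F y \<in> DD d \<inter> S}"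
          by (intro openin_continuous_map_preimage)
        moreover have "x \<in> {y \<in> topspace (cspace K). F y \<in> DD d \<inter> S}" using xt tt S(3) F\<tau> by auto
        ultimately have "{y \<in> topspace (cspace K). F y \<in> DD d \<inter> S} \<inter> cint B ~= {}"
          using cint_dense[OF B(2)] xt B(3) by blast
        then obtain y where "F y \<in> S" "y \<in> cint B" by blast
        then show "F ` W \<inter> A ~= {}" using B(1) S(1) by blast
      qed
      then have "F x \<in> closure (F ` U1)" "F x \<in> closure (F ` U2)"
        using ci dim_cell[OF D(1)] dim_cell[OF D'(1)] D(2) D'(2) by blast+
      moreover have "F ` U - F ` \<tau> \<subseteq> F ` U1 \<union> F ` U2" using cover by blast
      moreover have "F ` U1 \<inter> F ` U2 = {}" "F ` U1 \<inter> F ` \<tau> = {}" "F ` U2 \<inter> F ` \<tau> = {}"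
        using inj_on_image_Int[OF Fi sub(2,3)] inj_on_image_Int[OF Fi sub(2) tt] inj_on_image_Int[OF Fi sub(3) tt]
          disj away by simp_all
      ultimately show False
        using disk_not_locally_separated[OF 3 _ F\<tau> _ Fo[OF op(1)] _ _ Fo[OF op(2)] Fo[OF op(3)], of P Q "F x"] xt xU by blast
    qed
  qed
qed

end

context tree_complex
begin

section \<open>Developing a tree of simplices from a root facet\<close>

lemma extend_labelling:
  assumes f: "faceiso D f" and D: "D \<in> dim_cells K d" "D' \<in> dim_cells K d" and c: "c <= d"
    and sub: "f ({..d} - {c}) \<subseteq> D'"
  shows "\<exists>g. faceiso D' g & (\<forall>s\<subseteq>{..d} - {c}. g s = f s)"
proof -
  let ?A = "{..d} - {c}"
  have G: "f ?A \<in> dim_cells K (d - 1)" by (rule ridge_dim[OF f c])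
  obtain p where p: "faceiso D' p" using faceiso_exists[OF D(2)] by blast
  obtain c' where c': "c' <= d" "f ?A = p ({..d} - {c'})" using ridge_in[OF p G sub] by blast
  let ?B = "{..d} - {c'}"
  have Ad: "s \<subseteq> {..d}" if "s \<subseteq> ?A" for s by (rule subset_trans[OF that Diff_subset])
  have Bd: "s \<subseteq> {..d}" if "s \<subseteq> ?B" for s by (rule subset_trans[OF that Diff_subset])
  have "\<exists>r. r \<subseteq> ?B & p r = f s" if s: "s \<subseteq> ?A" for s
  proof -
    have "f s \<subseteq> f ?A" by (rule iffD2[OF faceiso_mono[OF f Ad[OF s] Diff_subset] s])
    then have "f s \<subseteq> p ?B" unfolding c'(2) .
    from faceiso_sub[OF p Diff_subset faceiso_mem(1)[OF f Ad[OF s]] this] show ?thesis by metis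
  qed
  then obtain \<phi> where \<phi>: "!!s. s \<subseteq> ?A ==> \<phi> s \<subseteq> ?B & p (\<phi> s) = f s" by metis
  have mono: "\<phi> s \<subseteq> \<phi> t \<longleftrightarrow> s \<subseteq> t" if s: "s \<subseteq> ?A" and t: "t \<subseteq> ?A" for s t
  proof -
    have "\<phi> s \<subseteq> \<phi> t \<longleftrightarrow> p (\<phi> s) \<subseteq> p (\<phi> t)"
      by (rule faceiso_mono[OF p Bd[OF conjunct1[OF \<phi>[OF s]]] Bd[OF conjunct1[OF \<phi>[OF t]]], symmetric])
    also have "\<dots> \<longleftrightarrow> f s \<subseteq> f t" using \<phi>[OF s] \<phi>[OF t] by simp
    also have "\<dots> \<longleftrightarrow> s \<subseteq> t" by (rule faceiso_mono[OF f Ad[OF s] Ad[OF t]])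
    finally show ?thesis .
  qed
  have "bij_betw \<phi> (Pow ?A) (Pow ?B)"
    unfolding bij_betw_def
  proof
    show "inj_on \<phi> (Pow ?A)"
    proof (rule inj_onI)
      fix s t assume "s \<in> Pow ?A" "t \<in> Pow ?A" "\<phi> s = \<phi> t"
      then show "s = t" using mono[of s t] mono[of t s] by auto
    qed
    show "\<phi> ` Pow ?A = Pow ?B"
    proof
      show "\<phi> ` Pow ?A \<subseteq> Pow ?B" using \<phi> by blast
      show "Pow ?B \<subseteq> \<phi> ` Pow ?A"
      proof
        fix r assume "r \<in> Pow ?B"
        then have r: "r \<subseteq> ?B" by simp
        have "p r \<subseteq> p ?B" by (rule iffD2[OF faceiso_mono[OF p Bd[OF r] Diff_subset] r])
        then have "p r \<subseteq> f ?A" unfolding c'(2) .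
        from faceiso_sub[OF f Diff_subset faceiso_mem(1)[OF p Bd[OF r]] this]
        obtain s where s: "s \<subseteq> ?A" "p r = f s" by (elim exE conjE)
        have "p (\<phi> s) = p r" using \<phi>[OF s(1)] s(2) by simp
        then have "\<phi> s = r" using faceiso_inj[OF p Bd Bd[OF r]] \<phi>[OF s(1)] by blast
        then show "r \<in> \<phi> ` Pow ?A" using s(1) by blast
      qed
    qed
  qed
  then have "\<exists>\<beta>. bij_betw \<beta> ?A ?B & (\<forall>s\<subseteq>?A. \<phi> s = \<beta> ` s)" using mono by (rule Pow_iso_image)
  then obtain \<beta> where \<beta>: "bij_betw \<beta> ?A ?B" "\<forall>s\<subseteq>?A. \<phi> s = \<beta> ` s" by (elim exE conjE)
  \<comment> \<open>The vertex of \<open>D'\<close> off the common ridge receives the colour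
    \<open>c\<close>, the only one left over.\<close>
  define \<gamma> where "\<gamma> j = (if j = c then c' else \<beta> j)" for j
  have g1: "bij_betw \<gamma> ?A ?B" using \<beta>(1) by (rule bij_betw_cong[THEN iffD1, rotated]) (simp add: \<gamma>_def)
  have g2: "bij_betw \<gamma> {c} {c'}" by (simp add: bij_betw_def \<gamma>_def)
  have "bij_betw \<gamma> (?A \<union> {c}) (?B \<union> {c'})" by (rule bij_betw_combine[OF g1 g2]) blast
  moreover have "?A \<union> {c} = {..d}" "?B \<union> {c'} = {..d}" using c c'(1) by auto
  ultimately have g: "bij_betw \<gamma> {..d} {..d}" by simp
  have gd: "\<gamma> ` s \<subseteq> {..d}" if "s \<subseteq> {..d}" for s using image_mono[OF that, of \<gamma>] g by (simp add: bij_betw_def)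
  have "faceiso D' (%s. p (\<gamma> ` s))"
    unfolding faceiso_def
  proof (intro conjI allI impI)
    fix s s' assume s: "s \<subseteq> {..d}" "s' \<subseteq> {..d}"
    have "p (\<gamma> ` s) \<subseteq> p (\<gamma> ` s') \<longleftrightarrow> \<gamma> ` s \<subseteq> \<gamma> ` s'" by (rule faceiso_mono[OF p gd[OF s(1)] gd[OF s(2)]])
    also have "\<dots> \<longleftrightarrow> s \<subseteq> s'" by (rule inj_on_image_subset_iff[OF bij_betw_imp_inj_on[OF g] s])
    finally show "p (\<gamma> ` s) \<subseteq> p (\<gamma> ` s') \<longleftrightarrow> s \<subseteq> s'" .
  next
    have "(%s. p (\<gamma> ` s)) ` Pow {..d} = p ` (`) \<gamma> ` Pow {..d}" by (simp add: image_image)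
    also have "(`) \<gamma> ` Pow {..d} = Pow {..d}" by (rule image_Pow_surj) (use g in \<open>simp add: bij_betw_def\<close>)
    also have "p ` Pow {..d} = {\<rho> \<in> face_poset K. \<rho> \<subseteq> D'}" using p by (simp add: faceiso_def)
    finally show "(%s. p (\<gamma> ` s)) ` Pow {..d} = {\<rho> \<in> face_poset K. \<rho> \<subseteq> D'}" .
  qed
  moreover have "p (\<gamma> ` s) = f s" if s: "s \<subseteq> ?A" for s
  proof -
    have "\<gamma> ` s = \<beta> ` s" by (rule image_cong) (use s in \<open>auto simp: \<gamma>_def\<close>)
    then show ?thesis using \<beta>(2) \<phi>[OF s] s by simp
  qed
  ultimately show ?thesis by (intro exI[of _ "%s. p (\<gamma> ` s)"]) simp
qed

definition okx :: "'a set \<times> (nat set => 'a set) => bool" where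
  "okx x \<longleftrightarrow> fst x \<in> dim_cells K d & faceiso (fst x) (snd x)"

definition can :: "'a set \<times> (nat set => 'a set) => nat => bool" where
  "can x c \<longleftrightarrow> (\<exists>D'\<in>dim_cells K d. D' ~= fst x & snd x ({..d} - {c}) \<subseteq> D')"

definition crs :: "'a set \<times> (nat set => 'a set) => nat => 'a set \<times> (nat set => 'a set)" where
  "crs x c = (SOME y. okx y & fst y ~= fst x & (\<forall>s\<subseteq>{..d} - {c}. snd y s = snd x s))"

text \<open>
  Developing the complex from a labelled root facet: the letter \<open>c\<close> crosses the ridge opposite
  to the vertex labelled \<open>c\<close>, and the other labels are kept. Words without immediate repetition
  are the paths without backtracking in the dual tree, so each facet is reached exactly once.
\<close>

definition st :: "nat list => 'a set \<times> (nat set => 'a set)" where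
  "st w = foldl crs (SOME x. okx x) w"

abbreviation "fac w \<equiv> fst (st w)"
abbreviation "cm w \<equiv> snd (st w)"

inductive_set TT :: "nat list set" where
  TT_Nil: "[] \<in> TT"
| TT_snoc: "w \<in> TT ==> c <= d ==> w = [] \<or> last w ~= c ==> can (st w) c ==> w @ [c] \<in> TT"

lemma TT_snocD: "w @ [c] \<in> TT ==> w \<in> TT & c <= d & (w = [] \<or> last w ~= c) & can (st w) c"
  by (erule TT.cases) simp_all

lemma crs_props:
  assumes x: "okx x" and c: "c <= d" "can x c"
  shows "okx (crs x c) & fst (crs x c) ~= fst x & (\<forall>s\<subseteq>{..d} - {c}. snd (crs x c) s = snd x s)"
  unfolding crs_def
proof (rule someI_ex)
  obtain D' where D': "D' \<in> dim_cells K d" "D' ~= fst x" "snd x ({..d} - {c}) \<subseteq> D'" using c(2) unfolding can_def by blast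
  have x': "faceiso (fst x) (snd x)" "fst x \<in> dim_cells K d" using x by (simp_all add: okx_def)
  obtain g where g: "faceiso D' g" "\<forall>s\<subseteq>{..d} - {c}. g s = snd x s"
    using extend_labelling[OF x' D'(1) c(1) D'(3)] by blast
  show "\<exists>y. okx y & fst y ~= fst x & (\<forall>s\<subseteq>{..d} - {c}. snd y s = snd x s)"
    by (intro exI[of _ "(D', g)"]) (use g D' in \<open>simp add: okx_def\<close>)
qed

lemma st_snoc: "st (w @ [c]) = crs (st w) c" by (simp add: st_def)

lemma st_ok: "w \<in> TT ==> okx (st w)"
proof (induction rule: TT.induct)
  case TT_Nil
  have "dim_cells K d ~= {}" using tree_K by (simp add: tree_graph_def)
  then obtain D f where "D \<in> dim_cells K d" "faceiso D f" using faceiso_exists by blast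
  then have "okx (D, f)" by (simp add: okx_def)
  then show ?case unfolding st_def foldl_Nil by (rule someI)
next
  case (TT_snoc w c)
  then show ?case using crs_props[of "st w" c] by (simp add: st_snoc)
qed

lemma st_props:
  assumes "w \<in> TT" shows "fac w \<in> dim_cells K d" "faceiso (fac w) (cm w)" "cm w {..d} = fac w"
proof -
  show D: "fac w \<in> dim_cells K d" and f: "faceiso (fac w) (cm w)" using st_ok[OF assms] by (simp_all add: okx_def)
  show "cm w {..d} = fac w" by (rule faceiso_top[OF f dim_cell[OF D]])
qed

lemma snoc_props:
  assumes "w @ [c] \<in> TT"
  shows "fac (w @ [c]) ~= fac w" "!!s. s \<subseteq> {..d} - {c} ==> cm (w @ [c]) s = cm w s"
    "cm w ({..d} - {c}) \<in> dim_cells K (d - 1)" "cm w ({..d} - {c}) \<subseteq> fac w" "cm w ({..d} - {c}) \<subseteq> fac (w @ [c])"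
    "(fac w, fac (w @ [c])) \<in> dual_edges d K" "(fac (w @ [c]), fac w) \<in> dual_edges d K"
proof -
  have w: "w \<in> TT" "c <= d" "can (st w) c" using TT_snocD[OF assms] by auto
  note p = crs_props[OF st_ok[OF w(1)] w(2,3)]
  show 1: "fac (w @ [c]) ~= fac w" and 2: "!!s. s \<subseteq> {..d} - {c} ==> cm (w @ [c]) s = cm w s"
    using p by (simp_all add: st_snoc)
  show 3: "cm w ({..d} - {c}) \<in> dim_cells K (d - 1)" by (rule ridge_dim[OF st_props(2)[OF w(1)] w(2)])
  show 4: "cm w ({..d} - {c}) \<subseteq> fac w" by (rule faceiso_mem(2)[OF st_props(2)[OF w(1)] Diff_subset])
  have "cm (w @ [c]) ({..d} - {c}) \<subseteq> fac (w @ [c])" by (rule faceiso_mem(2)[OF st_props(2)[OF assms] Diff_subset])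
  then show 5: "cm w ({..d} - {c}) \<subseteq> fac (w @ [c])" using 2[OF order_refl] by simp
  show "(fac w, fac (w @ [c])) \<in> dual_edges d K" "(fac (w @ [c]), fac w) \<in> dual_edges d K"
    using st_props(1)[OF w(1)] st_props(1)[OF assms] 1 3 4 5 unfolding dual_edges_def by auto
qed

text \<open>A ridge lies in at most two facets, so the facet across it is unique. It is reached by
  appending \<open>c\<close>, or by deleting \<open>c\<close> if the word ends in it.\<close>

lemma step:
  assumes w: "w \<in> TT" and c: "c <= d" and D': "D' \<in> dim_cells K d" "D' ~= fac w" "cm w ({..d} - {c}) \<subseteq> D'"
  shows "\<exists>v\<in>TT. fac v = D' & (\<forall>s\<subseteq>{..d} - {c}. cm v s = cm w s) & (v = w @ [c] \<or> w = v @ [c])"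
proof (cases "w ~= [] & last w = c")
  case True
  then have e: "w = butlast w @ [c]" using append_butlast_last_id[of w] by simp
  define v where "v = butlast w"
  have wv: "w = v @ [c]" using e by (simp add: v_def)
  have vw: "v @ [c] \<in> TT" using w unfolding wv .
  note sp = snoc_props[OF vw]
  have v: "v \<in> TT" using TT_snocD[OF vw] by blast
  have "cm w ({..d} - {c}) = cm v ({..d} - {c})" unfolding wv by (rule sp(2)[OF order_refl])
  then have "cm v ({..d} - {c}) \<subseteq> D'" using D'(3) by simp
  then have "fac v = D'"
    by (rule third_facet[OF sp(3) st_props(1)[OF vw] st_props(1)[OF v] D'(1) sp(5,4)])
      (use sp(1) D'(2) wv in auto)
  then show ?thesis using v sp(2) unfolding wv by (intro bexI[of _ v]) simp_all
next
  case False
  then have l: "w = [] \<or> last w ~= c" by blast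
  have "can (st w) c" unfolding can_def using D' by blast
  then have wc: "w @ [c] \<in> TT" by (rule TT_snoc[OF w c l])
  note sp = snoc_props[OF wc]
  have "fac (w @ [c]) = D'"
    by (rule third_facet[OF sp(3) st_props(1)[OF w] st_props(1)[OF wc] D'(1) sp(4,5) D'(3) sp(1) D'(2)])
  then show ?thesis using wc sp(2) by (intro bexI[of _ "w @ [c]"]) simp_all
qed

text \<open>Two facets share only one ridge, so returning at once means crossing the same ridge
  again; consecutive letters, however, name different ridges of the middle facet.\<close>

lemma no_back:
  assumes ab: "u @ [a, b] \<in> TT" shows "fac (u @ [a, b]) ~= fac u"
proof
  assume eq: "fac (u @ [a, b]) = fac u"
  have ab': "(u @ [a]) @ [b] \<in> TT" using ab by simp
  have ua: "u @ [a] \<in> TT" and ne: "a ~= b" and b: "b <= d" using TT_snocD[OF ab'] by auto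
  have u: "u \<in> TT" and a: "a <= d" using TT_snocD[OF ua] by auto
  note p1 = snoc_props[OF ua] and p2 = snoc_props[OF ab']
  have "cm u ({..d} - {a}) = cm (u @ [a]) ({..d} - {b})"
    by (rule shared_ridge_unique[OF st_props(1)[OF u] st_props(1)[OF ua] p1(1)[symmetric] p1(3,4,5) p2(3)])
      (use p2(4,5) eq in simp_all)
  then have "cm (u @ [a]) ({..d} - {a}) = cm (u @ [a]) ({..d} - {b})" using p1(2)[OF order_refl] by simp
  then have "{..d} - {a} = {..d} - {b}" by (rule faceiso_inj[OF st_props(2)[OF ua] Diff_subset Diff_subset])
  then show False using ne a b by auto
qed

lemma TT_take: "w \<in> TT ==> take k w \<in> TT"
proof (induction arbitrary: k rule: TT.induct)
  case (TT_snoc w c)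
  show ?case
  proof (cases "k <= length w")
    case False
    then have "take k (w @ [c]) = w @ [c]" by simp
    then show ?thesis using TT.TT_snoc[OF TT_snoc.hyps] by simp
  qed (use TT_snoc.IH in simp)
qed (simp add: TT.TT_Nil)

text \<open>By \<open>no_back\<close> the facets along a word form a walk without backtracking in
  the dual graph, which is a tree.\<close>

lemma walk_distinct:
  assumes w: "w \<in> TT" shows "distinct (map (%k. fac (take k w)) [0..<Suc (length w)])"
proof (rule nonbacktracking_distinct[of "dual_edges d K"])
  let ?vs = "map (%k. fac (take k w)) [0..<Suc (length w)]"
  show "(u, u) ~: dual_edges d K" for u by (simp add: dual_edges_def)
  have nth: "?vs ! k = fac (take k w)" if "k <= length w" for k using that by (simp del: upt_Suc)
  show "(?vs ! i, ?vs ! Suc i) \<in> dual_edges d K" if i: "Suc i < length ?vs" for i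
  proof -
    have il: "i < length w" using i by simp
    have e: "take (Suc i) w = take i w @ [w ! i]" by (rule take_Suc_conv_app_nth[OF il])
    have "take i w @ [w ! i] \<in> TT" using TT_take[OF w, of "Suc i"] unfolding e .
    from snoc_props(6)[OF this] show ?thesis using nth[of i] nth[of "Suc i"] il e by simp
  qed
  show "?vs ! i ~= ?vs ! (i + 2)" if i: "i + 2 < length ?vs" for i
  proof -
    have il: "i < length w" "Suc i < length w" using i by simp_all
    have e: "take (i + 2) w = take i w @ [w ! i, w ! Suc i]"
      using take_Suc_conv_app_nth[OF il(1)] take_Suc_conv_app_nth[OF il(2)] by simp
    have "take i w @ [w ! i, w ! Suc i] \<in> TT" using TT_take[OF w, of "i + 2"] unfolding e .
    from no_back[OF this] have "fac (take (i + 2) w) ~= fac (take i w)" unfolding e .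
    then show ?thesis using nth[of i] nth[of "i + 2"] il by simp
  qed
  have vs: "set ?vs \<subseteq> dim_cells K d" using st_props(1)[OF TT_take[OF w]] by (auto simp del: upt_Suc)
  show "\<not> (\<exists>us. 3 <= length us & distinct us & set us \<subseteq> set ?vs &
             (\<forall>i<length us. (us ! i, us ! (Suc i mod length us)) \<in> dual_edges d K))"
  proof
    assume "\<exists>us. 3 <= length us & distinct us & set us \<subseteq> set ?vs &
             (\<forall>i<length us. (us ! i, us ! (Suc i mod length us)) \<in> dual_edges d K)"
    then obtain us where us: "3 <= length us" "distinct us" "set us \<subseteq> set ?vs"
      "\<forall>i<length us. (us ! i, us ! (Suc i mod length us)) \<in> dual_edges d K" by (elim exE conjE)
    have "set us \<subseteq> dim_cells K d" by (rule subset_trans[OF us(3) vs])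
    then show False using tree_K us(1,2,4) unfolding tree_graph_def by blast
  qed
qed

lemma no_return:
  assumes "w @ [c, b] \<in> TT" "fac (w @ [c, b]) = fac w" shows False
  using no_back[OF assms(1)] assms(2) by simp

text \<open>For the root, a second word would close up a walk with distinct facets. Otherwise
  \<open>step\<close> relates \<open>w\<close> to a word of the preceding facet, which is
  \<open>u\<close> by induction. The case u = w @ [c] would be backtracking, and for w = u @ [c] the
  common ridge forces the last letters to agree.\<close>

lemma fac_inj: "w' \<in> TT ==> w \<in> TT ==> fac w = fac w' ==> w = w'"
proof (induction arbitrary: w rule: TT.induct)
  case TT_Nil
  show ?case
  proof (rule ccontr)
    assume "w ~= []"
    then have l: "0 < length w" by simp
    let ?vs = "map (%k. fac (take k w)) [0..<Suc (length w)]"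
    have "?vs ! 0 = ?vs ! length w" using TT_Nil.prems(2) by (simp add: nth_append del: upt_Suc)
    then have "0 = length w"
      using nth_eq_iff_index_eq[OF walk_distinct[OF TT_Nil.prems(1)], of 0 "length w"] by (simp del: upt_Suc)
    then show False using l by simp
  qed
next
  case (TT_snoc u b)
  have ub: "u @ [b] \<in> TT" by (rule TT.TT_snoc[OF TT_snoc.hyps])
  note sp = snoc_props[OF ub] and w = TT_snoc.prems(1)
  have Gw: "cm u ({..d} - {b}) \<subseteq> fac w" using sp(5) TT_snoc.prems(2) by simp
  obtain c where c: "c <= d" "cm u ({..d} - {b}) = cm w ({..d} - {c})"
    using ridge_in[OF st_props(2)[OF w] sp(3) Gw] by blast
  have "fac u ~= fac w" using sp(1) TT_snoc.prems(2) by simp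
  moreover have "cm w ({..d} - {c}) \<subseteq> fac u" using sp(4) c(2) by simp
  ultimately obtain v where v: "v \<in> TT" "fac v = fac u" "v = w @ [c] \<or> w = v @ [c]"
    using step[OF w c(1) st_props(1)[OF TT_snoc.hyps(1)]] by blast
  have vu: "v = u" by (rule TT_snoc.IH[OF v(1,2)])
  from v(3) show ?case
  proof
    assume "v = w @ [c]"
    then have u: "u = w @ [c]" using vu by simp
    have "w @ [c, b] \<in> TT" using ub u by simp
    moreover have "fac (w @ [c, b]) = fac w" using TT_snoc.prems(2) u by simp
    ultimately show ?case by (rule no_return[THEN FalseE])
  next
    assume "w = v @ [c]"
    then have wu: "w = u @ [c]" using vu by simp
    have "u @ [c] \<in> TT" using w wu by simp
    from snoc_props(2)[OF this order_refl] have "cm w ({..d} - {c}) = cm u ({..d} - {c})" using wu by simp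
    then have "cm u ({..d} - {b}) = cm u ({..d} - {c})" using c(2) by simp
    then have "{..d} - {b} = {..d} - {c}" by (rule faceiso_inj[OF st_props(2)[OF TT_snoc.hyps(1)] Diff_subset Diff_subset])
    then have "b = c" using TT_snoc.hyps(2) c(1) by auto
    then show ?case using wu by simp
  qed
qed

lemma fac_sur: "D \<in> dim_cells K d ==> \<exists>w\<in>TT. fac w = D"
proof -
  assume D: "D \<in> dim_cells K d"
  have "(fac [], D) \<in> (Restr (dual_edges d K) (dim_cells K d))\<^sup>*"
    using tree_K st_props(1)[OF TT_Nil] D unfolding tree_graph_def by blast
  then show ?thesis
  proof (induction rule: rtrancl_induct)
    case base
    show ?case using TT_Nil by blast
  next
    case (step D1 D2)
    obtain w where w: "w \<in> TT" "fac w = D1" using step.IH by blast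
    obtain G where G: "G \<in> dim_cells K (d - 1)" "G \<subseteq> D1" "G \<subseteq> D2" and D2: "D2 \<in> dim_cells K d" "D1 ~= D2"
      using step.hyps(2) unfolding dual_edges_def by auto
    obtain c where c: "c <= d" "G = cm w ({..d} - {c})" using ridge_in[OF st_props(2)[OF w(1)] G(1)] G(2) w(2) by blast
    then show ?case using tree_complex.step[OF tree_complex_axioms w(1) c(1) D2(1)] D2(2) w(2) G(3) by blast
  qed
qed

lemma valid_TT: "valid_tree d TT"
proof -
  have "inj_on fac TT" by (rule inj_onI) (use fac_inj in blast)
  moreover have "fac ` TT \<subseteq> cells K" using st_props(1) dim_cell by blast
  ultimately have "finite TT" using finite_cells by (rule inj_on_finite)
  moreover have "w \<in> TT & c <= d & (w = [] \<or> last w ~= c)" if "w @ [c] \<in> TT" for w c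
    using TT_snocD[OF that] by blast
  ultimately show ?thesis unfolding valid_tree_def using TT_Nil by blast
qed

text \<open>The essential direction is that two names of one face are related by tree edges.
  \<open>facets_connected\<close> yields a chain of facets joined by ridges that contain the face,
  the colour set is carried along unchanged, and \<open>fac_inj\<close> identifies the word at the
  end of the chain.\<close>

lemma encoded_tree: "tree_flags d TT & model d TT K (tree_flags.ET d TT) (%w. cm w)"
proof -
  interpret tf: tree_flags d TT by unfold_locales (rule d3 valid_TT)+
  have ETi: "((w, s), (w @ [c], s)) \<in> facerel d tf.ET" "((w @ [c], s), (w, s)) \<in> facerel d tf.ET"
    if wc: "w @ [c] \<in> TT" and s: "s \<subseteq> {..d} - {c}" for w c s
  proof -
    have c: "c <= d" using TT_snocD[OF wc] by blast
    define p where "p = Transposition.transpose 0 c"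
    have p: "p permutes {..d}" unfolding p_def by (rule permutes_swap_id) (use c in auto)
    have p0: "p 0 = c" by (simp add: p_def)
    have pp: "p ` p ` s = s" by (simp add: image_image p_def)
    have sub: "p ` s \<subseteq> {1..d}"
    proof
      fix n assume "n \<in> p ` s"
      then obtain j where j: "j \<in> s" "n = p j" by blast
      have "n <= d" using permutes_in_image[OF p, of j] j s by auto
      moreover have "n ~= 0"
      proof
        assume "n = 0"
        then have "p j = p c" using j(2) by (simp add: p_def)
        then have "j = c" by (rule injD[OF permutes_inj[OF p]])
        then show False using j(1) s by blast
      qed
      ultimately show "n \<in> {1..d}" by simp
    qed
    have e: "((w, p), (w @ [c], p \<circ> tt)) \<in> tf.Ed (w @ [c])" unfolding tf.Ed_def using p p0 by auto
    then have e1: "((w, p), (w @ [c], p \<circ> tt)) \<in> tf.ET" "((w @ [c], p \<circ> tt), (w, p)) \<in> tf.ET"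
      unfolding tf.ET_def tf.E0_def using wc by blast+
    have ct: "(p \<circ> tt) \<circ> tt = p" by (auto simp: fun_eq_iff)
    from facerelI[OF e1(1) sub] show "((w, s), (w @ [c], s)) \<in> facerel d tf.ET"
      unfolding fst_conv snd_conv ct pp .
    have "tt ` p ` s \<subseteq> {1..d}"
      using image_mono[OF sub, of tt] permutes_image[OF tt_permutes[OF tf.d2]] by simp
    moreover have "(p \<circ> tt) ` tt ` p ` s = s"
    proof -
      have "(p \<circ> tt) ` tt ` p ` s = ((p \<circ> tt) \<circ> tt) ` p ` s" by (rule image_comp)
      then show ?thesis unfolding ct pp .
    qed
    ultimately show "((w @ [c], s), (w, s)) \<in> facerel d tf.ET"
      using facerelI[OF e1(2), of "tt ` p ` s" d] by (simp only: fst_conv snd_conv)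
  qed
  have fwd: "cm (fst z) (snd z) = cm (fst z') (snd z') & (fst z' \<in> TT)" if "(z, z') \<in> facerel d tf.ET" for z z'
  proof -
    have zz: "(z, z') \<in> facerel d tf.ET" by (rule that)
    obtain u v J where uv: "(u, v) \<in> tf.ET" "J \<subseteq> {1..d}" "z = (fst u, snd u ` J)" "z' = (fst v, (snd v \<circ> tt) ` J)"
      using zz by (rule facerelE)
    obtain m where m: "m \<in> TT" "m ~= []" "(u, v) \<in> tf.Ed m \<or> (v, u) \<in> tf.Ed m"
      using uv(1) unfolding tf.ET_def tf.E0_def by blast
    have mm: "butlast m @ [last m] \<in> TT" using m(1,2) by simp
    have bm: "butlast m \<in> TT" using TT_snocD[OF mm] by blast
    have key: "cm (butlast m) (p ` J) = cm m (p ` J)"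
      if p: "p permutes {..d}" "p 0 = last m" and J: "J \<subseteq> {1..d}" for p J
    proof -
      have "p ` J \<subseteq> {..d}" using image_mono[of J "{..d}" p] permutes_image[OF p(1)] J by force
      moreover have "last m ~: p ` J"
        unfolding p(2)[symmetric] inj_image_mem_iff[OF permutes_inj[OF p(1)]] using J by auto
      ultimately have "p ` J \<subseteq> {..d} - {last m}" by blast
      from snoc_props(2)[OF mm this] show ?thesis using m(2) by simp
    qed
    from m(3) show ?thesis
    proof
      assume "(u, v) \<in> tf.Ed m"
      then obtain p where p: "u = (butlast m, p)" "v = (m, p \<circ> tt)" "p permutes {..d}" "p 0 = last m"
        unfolding tf.Ed_def by auto
      have ct: "(p \<circ> tt) \<circ> tt = p" by (auto simp: fun_eq_iff)
      show ?thesis unfolding uv(3,4) p(1,2) fst_conv snd_conv ct using key[OF p(3,4) uv(2)] m(1) by simp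
    next
      assume "(v, u) \<in> tf.Ed m"
      then obtain p where p: "v = (butlast m, p)" "u = (m, p \<circ> tt)" "p permutes {..d}" "p 0 = last m"
        unfolding tf.Ed_def by auto
      have J': "tt ` J \<subseteq> {1..d}"
        using image_mono[OF uv(2), of tt] permutes_image[OF tt_permutes[OF tf.d2]] by simp
      have "(p \<circ> tt) ` J = p ` tt ` J" by (rule image_comp[symmetric])
      then show ?thesis unfolding uv(3,4) p(1,2) fst_conv snd_conv using key[OF p(3,4) J'] bm by simp
    qed
  qed
  have fwds: "cm (fst z) (snd z) = cm (fst z') (snd z')" if "(z, z') \<in> (facerel d tf.ET)\<^sup>*" for z z'
    using that by (induction rule: rtrancl_induct) (use fwd in auto)
  \<comment> \<open>The empty face is not a cell, so \<open>facets_connected\<close> does not apply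
    to it; its names are related through the root.\<close>
  have to_root: "((w, {}), ([], {})) \<in> (facerel d tf.ET)\<^sup>* & (([], {}), (w, {})) \<in> (facerel d tf.ET)\<^sup>*" if "w \<in> TT" for w
    using that
  proof (induction rule: TT.induct)
    case (TT_snoc w c)
    have wc: "w @ [c] \<in> TT" by (rule TT.TT_snoc[OF TT_snoc.hyps])
    from ETi[OF wc, of "{}"] show ?case
      using converse_rtrancl_into_rtrancl rtrancl_into_rtrancl TT_snoc.IH by (metis empty_subsetI)
  qed simp
  have bwd: "((a, s), (b, r)) \<in> (facerel d tf.ET)\<^sup>*"
    if a: "a \<in> TT" "s \<subseteq> {..d}" and b: "b \<in> TT" "r \<subseteq> {..d}" and eq: "cm a s = cm b r" for a s b r
  proof (cases "s = {}")
    case True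
    have "cm b r = cm b {}" using eq True faceiso_empty[OF st_props(2)[OF a(1)]] faceiso_empty[OF st_props(2)[OF b(1)]] by simp
    then have "r = {}" by (rule faceiso_inj[OF st_props(2)[OF b(1)] b(2) empty_subsetI])
    moreover have "((a, {}), (b, {})) \<in> (facerel d tf.ET)\<^sup>*"
      by (rule rtrancl_trans[OF conjunct1[OF to_root[OF a(1)]] conjunct2[OF to_root[OF b(1)]]])
    ultimately show ?thesis using True by simp
  next
    case False
    define \<tau> where "\<tau> = cm a s"
    have "\<tau> ~= {}"
    proof
      assume "\<tau> = {}"
      then have "cm a s = cm a {}" using faceiso_empty[OF st_props(2)[OF a(1)]] by (simp add: \<tau>_def)
      then show False using faceiso_inj[OF st_props(2)[OF a(1)] a(2) empty_subsetI] False by simp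
    qed
    then have \<tau>c: "\<tau> \<in> cells K" using faceiso_mem(1)[OF st_props(2)[OF a(1)] a(2)] by (simp add: \<tau>_def face_poset_def)
    have "\<tau> \<subseteq> fac a" "\<tau> \<subseteq> fac b"
      using faceiso_mem(2)[OF st_props(2)[OF a(1)] a(2)] faceiso_mem(2)[OF st_props(2)[OF b(1)] b(2)] eq by (simp_all add: \<tau>_def)
    then have "(fac a, fac b) \<in> (Adj \<tau>)\<^sup>*"
      by (intro facets_connected[OF \<tau>c] st_props(1) a(1) b(1))
    then have "\<exists>v\<in>TT. fac v = fac b & cm v s = \<tau> & ((a, s), (v, s)) \<in> (facerel d tf.ET)\<^sup>*"
    proof (induction rule: rtrancl_induct)
      case base
      show ?case using a(1) \<tau>_def by blast
    next
      case (step D1 D2)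
      obtain v where v: "v \<in> TT" "fac v = D1" "cm v s = \<tau>" "((a, s), (v, s)) \<in> (facerel d tf.ET)\<^sup>*" using step.IH by blast
      obtain G where G: "G \<in> dim_cells K (d - 1)" "\<tau> \<subseteq> G" "G \<subseteq> D1" "G \<subseteq> D2" and D2: "D2 \<in> dim_cells K d"
        using step.hyps(2) unfolding Adj_def by auto
      show ?case
      proof (cases "D2 = D1")
        case True
        then show ?thesis using v by blast
      next
        case False
        obtain c where c: "c <= d" "G = cm v ({..d} - {c})" using ridge_in[OF st_props(2)[OF v(1)] G(1)] G(3) v(2) by blast
        have sc: "s \<subseteq> {..d} - {c}" using faceiso_mono[OF st_props(2)[OF v(1)] a(2) Diff_subset] G(2) c(2) v(3) by blast
        have "D2 ~= fac v" "cm v ({..d} - {c}) \<subseteq> D2" using False v(2) G(4) c(2) by simp_all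
        from tree_complex.step[OF tree_complex_axioms v(1) c(1) D2 this]
        obtain x where x: "x \<in> TT" "fac x = D2" "\<forall>s\<subseteq>{..d} - {c}. cm x s = cm v s" "x = v @ [c] \<or> v = x @ [c]" by blast
        have "((v, s), (x, s)) \<in> facerel d tf.ET"
          using x(4) ETi(1)[of v c s] ETi(2)[of x c s] x(1) v(1) sc by blast
        then have "((a, s), (x, s)) \<in> (facerel d tf.ET)\<^sup>*" by (rule rtrancl_into_rtrancl[OF v(4)])
        then show ?thesis using x(1-3) sc v(3) by blast
      qed
    qed
    then obtain v where v: "v \<in> TT" "fac v = fac b" "cm v s = \<tau>" "((a, s), (v, s)) \<in> (facerel d tf.ET)\<^sup>*" by blast
    have vb: "v = b" by (rule fac_inj[OF b(1) v(1,2)])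
    then have "cm b s = cm b r" using v(3) eq by (simp add: \<tau>_def)
    then have "s = r" by (rule faceiso_inj[OF st_props(2)[OF b(1)] a(2) b(2)])
    then show ?thesis using v(4) vb by simp
  qed
  have "model d TT K tf.ET (%w. cm w)"
    unfolding model_def
  proof (intro conjI ballI allI impI)
    fix w s s' assume "w \<in> TT" "s \<subseteq> {..d}" "s' \<subseteq> {..d}"
    then show "cm w s \<subseteq> cm w s' \<longleftrightarrow> s \<subseteq> s'" by (intro faceiso_mono[OF st_props(2)])
  next
    show "face_poset K = {cm w s |w s. w \<in> TT & s \<subseteq> {..d}}"
    proof (intro equalityI subsetI)
      fix \<rho> assume \<rho>: "\<rho> \<in> face_poset K"
      have "\<exists>D\<in>dim_cells K d. \<rho> \<subseteq> D"
        using \<rho> in_facet st_props(1)[OF TT_Nil] unfolding face_poset_def by blast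
      then obtain w where w: "w \<in> TT" "\<rho> \<subseteq> fac w" using fac_sur by blast
      from faceiso_sur[OF st_props(2)[OF w(1)] \<rho> w(2)] show "\<rho> \<in> {cm w s |w s. w \<in> TT & s \<subseteq> {..d}}" using w(1) by blast
    next
      fix \<rho> assume "\<rho> \<in> {cm w s |w s. w \<in> TT & s \<subseteq> {..d}}"
      then obtain w s where "w \<in> TT" "s \<subseteq> {..d}" "\<rho> = cm w s" by blast
      then show "\<rho> \<in> face_poset K" using faceiso_mem(1)[OF st_props(2)] by simp
    qed
  next
    fix w s \<tau> assume "w \<in> TT" "s \<subseteq> {..d}" "\<tau> \<in> face_poset K" "\<tau> \<subseteq> cm w s"
    then show "\<exists>s'\<subseteq>s. \<tau> = cm w s'" by (intro faceiso_sub[OF st_props(2)])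
  next
    fix a b s r assume ab: "a \<in> TT" "b \<in> TT" "s \<subseteq> {..d}" "r \<subseteq> {..d}"
    show "cm a s = cm b r \<longleftrightarrow> ((a, s), (b, r)) \<in> (facerel d tf.ET)\<^sup>*"
      using bwd[OF ab(1,3,2,4)] fwds[of "(a, s)" "(b, r)"] by auto
  qed
  then show ?thesis using tf.tree_flags_axioms by blast
qed

end

section \<open>The upper bound\<close>

lemma tree_encoded:
  assumes "3 <= d" "tree_of_simplices d K" "pseudomanifold d K"
  shows "\<exists>T. encoded d K T []"
proof -
  interpret tree_complex d K by unfold_locales (rule assms)+
  have "tree_flags d TT" and m: "model d TT K (tree_flags.ET d TT) (%w. cm w)" using encoded_tree by blast+
  then interpret tf: tree_flags d TT by blast
  have "model d TT K (tf.EM []) (%w. cm w)" using m unfolding tf.EM_Nil .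
  then show ?thesis unfolding encoded_def using valid_TT tf.good_Nil by blast
qed

theorem theorem3p9:
  fixes d :: nat
  assumes "d \<ge> 3"
  shows "\<exists>N\<^sub>0. \<forall>N\<ge>N\<^sub>0.
           finite (quasimanifold_classes d N :: 'a cell_complex set set) \<and>
           real (card (quasimanifold_classes d N :: 'a cell_complex set set))
             < 2 powr (real d ^ 3 / 2 * real N)"
proof -
  obtain N0 where N0: "!!N. N \<ge> N0 ==>
      3 * 2 ^ (d * N) * (1 + 12 * real (fact d div 2)) ^ ((d - 1) * N + 2) < 2 powr (real d ^ 3 / 2 * real N)"
    using eventually_count_less[OF assms] by blast
  have "finite (quasimanifold_classes d N :: 'a cell_complex set set) &
      real (card (quasimanifold_classes d N :: 'a cell_complex set set))
        <= 3 * 2 ^ (d * N) * (1 + 12 * real (fact d div 2)) ^ ((d - 1) * N + 2)" for N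
  proof -
    define Q where "Q = {K :: 'a cell_complex. two_LC_quasimanifold d K & card (dim_cells K d) = N}"
    define V where "V = {T. valid_tree d T & card T = N}"
    define O' where "O' T = {tree_flags.symcl ms |ms. tree_flags.good d T ms}" for T
    have tf: "tree_flags d T" if "T \<in> V" for T using that assms by (simp add: V_def tree_flags_def)
    have simp_Q: "simplicial_cw K" if "K \<in> Q" for K
      using that by (simp add: Q_def two_LC_quasimanifold_def pseudomanifold_def)
    have enc: "\<exists>T ms. encoded d K T ms" if "K \<in> Q" for K
    proof (rule obtainable_encoded[OF assms])
      show "obtainable d K" "pseudomanifold d K" using that by (simp_all add: Q_def two_LC_quasimanifold_def)
      show "\<exists>T. encoded d K T []" if "tree_of_simplices d K" "pseudomanifold d K" for K :: "'a cell_complex"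
        by (rule tree_encoded[OF assms that])
    qed
    \<comment> \<open>Each code receives a representative. By \<open>encoded_iso\<close> any two
      complexes with the same code have isomorphic face posets, so codes map onto the
      classes.\<close>
    define r where "r z = (SOME K. K \<in> Q & (\<exists>ms. encoded d K (fst z) ms & tree_flags.symcl ms = snd z))" for z
    have sub: "quasimanifold_classes d N \<subseteq> (%z. comb_equiv `` {r z}) ` (SIGMA T:V. O' T)"
    proof
      fix c :: "'a cell_complex set" assume "c \<in> quasimanifold_classes d N"
      then obtain K where K: "K \<in> Q" "c = comb_equiv `` {K}"
        unfolding quasimanifold_classes_def Q_def[symmetric] by (elim quotientE) simp
      obtain T ms where ms: "encoded d K T ms" using enc[OF K(1)] by blast
      have "card T = N" using encoded_card[OF assms ms simp_Q[OF K(1)]] K(1) by (simp add: Q_def)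
      then have z: "(T, tree_flags.symcl ms) \<in> (SIGMA T:V. O' T)"
        using ms by (auto simp: V_def O'_def encoded_def)
      define L where "L = r (T, tree_flags.symcl ms)"
      have "L \<in> Q & (\<exists>ns. encoded d L T ns & tree_flags.symcl ns = tree_flags.symcl ms)"
        unfolding L_def r_def fst_conv snd_conv by (rule someI[of _ K]) (use K(1) ms in blast)
      then obtain ns where L: "L \<in> Q" "encoded d L T ns" "tree_flags.symcl ns = tree_flags.symcl ms" by blast
      have KL: "poset_iso (face_poset K) (face_poset L)"
        by (rule encoded_iso[OF assms ms simp_Q[OF K(1)] L(2) simp_Q[OF L(1)] L(3)[symmetric]])
      have "c = comb_equiv `` {L}"
        unfolding K(2) comb_equiv_def
        using poset_iso_trans[OF KL] poset_iso_trans[OF poset_iso_sym[OF KL]] by auto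
      then show "c \<in> (%z. comb_equiv `` {r z}) ` (SIGMA T:V. O' T)" using z unfolding L_def by blast
    qed
    have finV: "finite V" and cV: "real (card V) <= 3 * 2 ^ (d * N)"
      unfolding V_def by (rule card_valid_trees)+
    have O': "finite (O' T)" "real (card (O' T)) <= (1 + 12 * real (fact d div 2)) ^ ((d - 1) * N + 2)" if "T \<in> V" for T
      using tree_flags.card_outcomes[OF tf[OF that]] that by (simp_all add: O'_def V_def)
    have fin: "finite (SIGMA T:V. O' T)" using finV O'(1) by (rule finite_SigmaI)
    have "real (card (quasimanifold_classes d N :: 'a cell_complex set set)) <= real (card (SIGMA T:V. O' T))"
      using card_mono[OF finite_imageI[OF fin] sub] card_image_le[OF fin] by (meson le_trans of_nat_le_iff)
    also have "\<dots> = (\<Sum>T\<in>V. real (card (O' T)))" using finV O'(1) by (subst card_SigmaI) simp_all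
    also have "\<dots> <= (\<Sum>T\<in>V. (1 + 12 * real (fact d div 2)) ^ ((d - 1) * N + 2))" by (rule sum_mono) (rule O'(2))
    also have "\<dots> = real (card V) * (1 + 12 * real (fact d div 2)) ^ ((d - 1) * N + 2)" by simp
    also have "\<dots> <= 3 * 2 ^ (d * N) * (1 + 12 * real (fact d div 2)) ^ ((d - 1) * N + 2)"
      by (rule mult_right_mono[OF cV]) simp
    finally show ?thesis using finite_subset[OF sub finite_imageI[OF fin]] by blast
  qed
  then show ?thesis using N0 by (meson le_less_trans)
qed

end
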